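(* Let $U\in\mathcal C(\mathbb{R}^d)$ and let $\varphi$ be a positive Jacobi field on $U$. For every $\rho>0$ there is a constant $C$ depending only on $d$ and $\rho$ such that $$\sup_{\partial B_1\cap\mathcal R_U(\rho)}\varphi\le C\inf_{\partial B_1\cap\mathcal R_U(\rho)}\varphi.$$
   Context: Alt–Caffarelli energy $\mathcal{E}(u;\Omega)=\int_\Omega|\nabla u|^2+\chi_{\{u>0\}}$; a global minimizer is a nonnegative $U$ minimizing $\mathcal E(\cdot;B_R)$ among functions with the same boundary values on $\partial B_R$, for every $R>0$. $\mathcal C(\mathbb{R}^d)$ is the set of global minimizers $U$ with $U(tx)=tU(x)$ for all $t>0$. $\Gamma(U)=\partial\{U>0\}$; $\mathrm{Reg}(U)$ is the set of $p\in\Gamma(U)$ for which there are $r>0$, a unit vector $e$ with $|U(x)-((x-p)\cdot e)_+|<\varepsilon_d r$ on $B_r(p)$ ($\varepsilon_d$ a fixed small dimensional flatness threshold guaranteeing $C^{2,\alpha}$ free boundary near $p$), and $\mathrm{Sing}(U)=\Gamma(U)\setminus\mathrm{Reg}(U)$. On $\mathrm{Reg}(U)$, $\nu=\nabla U$ is the inner unit normal and $H=-U_{\nu\nu}$ the mean curvature. A positive Jacobi field on $U$ is $\varphi\in C^{2,\alpha}_{loc}(\overline{\{U>0\}}\setminus\mathrm{Sing}(U))$ with $\varphi>0$ on $\overline{\{U>0\}}\setminus\mathrm{Sing}(U)$, $\Delta\varphi=0$ in $\{U>0\}$ and $\varphi_\nu+H\varphi=0$ on $\mathrm{Reg}(U)$.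 Regularity scale (with $\Omega=\mathbb{R}^d$): $\rho_U(p)=\sup\{r>0:\ |D^2U|<r^{-1}\text{ in }B_r(p)\cap\{U>0\}\}$ ($0$ if empty) for $p\in\overline{\{U>0\}}$, and $\mathcal R_U(\rho)=\{p\in\overline{\{U>0\}}:\rho_U(p)>\rho\}$. *)

theory Defs
  imports "HOL-Analysis.Analysis"
begin

definition test_fun :: "('a::euclidean_space \<Rightarrow> real) \<Rightarrow> bool" where
  "test_fun \<psi> \<longleftrightarrow> (\<forall>x. \<psi> differentiable at x)
     \<and> (\<forall>b\<in>Basis. continuous_on UNIV (\<lambda>x. frechet_derivative \<psi> (at x) b))
     \<and> compact (closure {x. \<psi> x \<noteq> 0})"

definition weak_gradient :: "('a::euclidean_space \<Rightarrow> real) \<Rightarrow> ('a \<Rightarrow> 'a) \<Rightarrow> bool" where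
  "weak_gradient v g \<longleftrightarrow> (\<forall>b\<in>Basis. \<forall>\<psi>. test_fun \<psi> \<longrightarrow>
      integral\<^sup>L lebesgue (\<lambda>x. v x * frechet_derivative \<psi> (at x) b)
        = - integral\<^sup>L lebesgue (\<lambda>x. (g x \<bullet> b) * \<psi> x))"

definition H1_loc :: "('a::euclidean_space \<Rightarrow> real) \<Rightarrow> ('a \<Rightarrow> 'a) \<Rightarrow> bool" where
  "H1_loc v g \<longleftrightarrow> v \<in> borel_measurable lebesgue \<and> g \<in> borel_measurable lebesgue
     \<and> (\<forall>K. compact K \<longrightarrow> set_integrable lebesgue K (\<lambda>x. (v x)\<^sup>2)
                          \<and> set_integrable lebesgue K (\<lambda>x. (norm (g x))\<^sup>2))
     \<and> weak_gradient v g"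

definition AC_energy :: "('a::euclidean_space \<Rightarrow> real) \<Rightarrow> ('a \<Rightarrow> 'a) \<Rightarrow> real \<Rightarrow> real" where
  "AC_energy v g R = (LINT x:ball 0 R|lebesgue. (norm (g x))\<^sup>2)
                     + measure lebesgue {x \<in> ball 0 R. v x > 0}"

definition global_minimizer :: "('a::euclidean_space \<Rightarrow> real) \<Rightarrow> bool" where
  "global_minimizer U \<longleftrightarrow> (\<forall>x. U x \<ge> 0) \<and> continuous_on UNIV U \<and> (\<exists>gU. H1_loc U gU)
     \<and> (\<forall>R>0. \<forall>gU v gv. H1_loc U gU \<longrightarrow> H1_loc v gv \<longrightarrow> (\<forall>x. x \<notin> ball 0 R \<longrightarrow> v x = U x)
           \<longrightarrow> AC_energy U gU R \<le> AC_energy v gv R)"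

definition cone_minimizers :: "('a::euclidean_space \<Rightarrow> real) set" where
  "cone_minimizers = {U. global_minimizer U \<and> (\<forall>t>0. \<forall>x. U (t *\<^sub>R x) = t * U x)}"

definition free_bdry :: "('a::euclidean_space \<Rightarrow> real) \<Rightarrow> 'a set" where
  "free_bdry U = frontier {x. U x > 0}"

text \<open>eps plays the role of the fixed dimensional flatness threshold.\<close>
definition Reg :: "real \<Rightarrow> ('a::euclidean_space \<Rightarrow> real) \<Rightarrow> 'a set" where
  "Reg eps U = {p \<in> free_bdry U. \<exists>r>0. \<exists>e. norm e = 1 \<and>
       (\<forall>x\<in>ball p r. \<bar>U x - max 0 ((x - p) \<bullet> e)\<bar> < eps * r)}"

definition Sing :: "real \<Rightarrow> ('a::euclidean_space \<Rightarrow> real) \<Rightarrow> 'a set" where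
  "Sing eps U = free_bdry U - Reg eps U"

definition grad :: "('a::euclidean_space \<Rightarrow> real) \<Rightarrow> 'a \<Rightarrow> 'a" where
  "grad f x = (\<Sum>b\<in>Basis. frechet_derivative f (at x) b *\<^sub>R b)"

definition hess :: "('a::euclidean_space \<Rightarrow> real) \<Rightarrow> 'a \<Rightarrow> 'a \<Rightarrow> 'a" where
  "hess f x = frechet_derivative (grad f) (at x)"

text \<open>Inner unit normal and mean curvature on the regular part (boundary values of
  the derivatives of U taken from inside the positivity set).\<close>
definition normal :: "('a::euclidean_space \<Rightarrow> real) \<Rightarrow> 'a \<Rightarrow> 'a" where
  "normal U p = Lim (at p within {x. U x > 0}) (grad U)"

definition mean_curv :: "('a::euclidean_space \<Rightarrow> real) \<Rightarrow> 'a \<Rightarrow> real" where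
  "mean_curv U p = - Lim (at p within {x. U x > 0}) (\<lambda>x. hess U x (normal U p) \<bullet> normal U p)"

text \<open>phi in C^{2,alpha}_loc(X), X = closure{U>0} minus Sing: phi is twice differentiable
  in {U>0}, and phi, its gradient g and Hessian Hs extend continuously to X with Hs
  locally alpha-Hoelder on X.\<close>
definition pos_jacobi :: "real \<Rightarrow> ('a::euclidean_space \<Rightarrow> real) \<Rightarrow> ('a \<Rightarrow> real) \<Rightarrow> bool" where
  "pos_jacobi eps U \<phi> \<longleftrightarrow>
    (let \<Omega> = {x. U x > 0}; X = closure \<Omega> - Sing eps U in
      (\<forall>x\<in>X. \<phi> x > 0) \<and>
      (\<exists>\<alpha> g Hs. 0 < \<alpha> \<and> \<alpha> < 1 \<and>
         continuous_on X \<phi> \<and> continuous_on X g \<and>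
         (\<forall>b\<in>Basis. continuous_on X (\<lambda>x. Hs x b)) \<and>
         (\<forall>x\<in>\<Omega>. (\<phi> has_derivative (\<lambda>h. g x \<bullet> h)) (at x) \<and> (g has_derivative Hs x) (at x)) \<and>
         (\<forall>K. compact K \<and> K \<subseteq> X \<longrightarrow>
             (\<exists>M. \<forall>x\<in>K. \<forall>y\<in>K. \<forall>b\<in>Basis. norm (Hs x b - Hs y b) \<le> M * dist x y powr \<alpha>)) \<and>
         (\<forall>x\<in>\<Omega>. (\<Sum>b\<in>Basis. Hs x b \<bullet> b) = 0) \<and>
         (\<forall>p\<in>Reg eps U. g p \<bullet> normal U p + mean_curv U p * \<phi> p = 0)))"

definition reg_scale :: "('a::euclidean_space \<Rightarrow> real) \<Rightarrow> 'a \<Rightarrow> ereal" where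
  "reg_scale U p = (let S = {r. r > 0 \<and> (\<forall>x\<in>ball p r \<inter> {x. U x > 0}. onorm (hess U x) < 1 / r)}
                    in if S = {} then 0 else Sup (ereal ` S))"

definition R_set :: "('a::euclidean_space \<Rightarrow> real) \<Rightarrow> real \<Rightarrow> 'a set" where
  "R_set U \<rho> = {p \<in> closure {x. U x > 0}. reg_scale U p > ereal \<rho>}"

end

(* A Jacobi field is a positive harmonic function on the positivity set, with a Robin condition on the
regular free boundary whose coefficient is bounded where the Hessian of U is. Hence it can be compared
on each point of the regularity set with its value at a nearby point at definite distance from the
free boundary: a barrier gives the lower bound, and maximizing phi(x) (t - |x - z|)^N the upper one.
Two such interior points are joined by a Harnack chain of controlled length, provided they lie in one
component of {U > delta |x|} for a delta depending only on the data. If they did not, suitable multiples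
of the truncations of U to two pieces would have a difference with zero Gaussian mean that almost
minimizes the Rayleigh quotient in the Gaussian Poincare inequality. By 1-homogeneity it would be almost
linear, so the zero set of U would lie in a thin strip, against the density estimate for minimizers. *)

theory Submission
  imports Defs
begin

text \<open>Minimality is used only against smooth compactly supported perturbations
  (\<open>ac_min\<close>), with the cross term integrated by parts onto the perturbation, so the
  gradient of \<open>U\<close> across the free boundary never enters. No free boundary regularity
  theorem is invoked. A Hessian bound controls \<open>U\<close> only along segments inside {U > 0},
  whose shape is unknown at the outset; \<open>capture\<close> resolves this: a segment stays in {U
  > 0} as long as the first-order prediction beats the quadratic error. Together with the density of
  the zero set, which excludes nearly opposite gradients, this yields a normal, slope 1 and a
  Lipschitz graph; such points lie in \<open>Reg eps\<close> for every \<open>eps > 0\<close>. The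
  constants must be uniform over all cones, and no compactness of families of minimizers is used.
  Connectedness is quantified through the Gaussian spectral gap: its value 1 is attained by linear
  functions, and 1-homogeneous harmonic functions on a cone piece also have Rayleigh quotient 1, so
  two separate pieces would produce a near-extremal with zero mean. The truncations are made at
  height \<open>de * |x|\<close>, and every error is an explicit power of \<open>de\<close>.\<close>

abbreviation (input) "LI f == integral\<^sup>L lborel f"
abbreviation (input) scaleR_infix (infixr "*R" 75) where "t *R x == scaleR t x"
abbreviation (input) inner_infix (infix "*." 70) where "x *. y == inner x y"

lemmas bi_add = Bochner_Integration.integrable_add and bi_diff = Bochner_Integration.integrable_diff
  and bi_iadd = Bochner_Integration.integral_add and bi_idiff = Bochner_Integration.integral_diff
  and bi_nonneg = Bochner_Integration.integral_nonneg

section \<open>Smooth cutoffs and integration by parts\<close>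

text \<open>Of class C^(n-1), and differentiation lowers \<open>n\<close> by one:
  \<open>bump 3\<close> is a twice differentiable averaging kernel, and \<open>bump 4\<close> is the
  test function whose gradient is radial with weight \<open>bump 3\<close>.\<close>

definition bump :: "nat => 'a::euclidean_space => real" where
 "bump n y = (max 0 (1 - y *. y)) ^ n"

lemma pos_power_has_derivative:
 fixes t :: real
 assumes "n >= 2"
 shows "((%t. (max 0 t) ^ n) has_real_derivative real n * (max 0 t) ^ (n - 1)) (at t)"
proof -
 consider "t > 0" | "t < 0" | "t = 0" by linarith
 then show ?thesis
 proof cases
  case 1
  have "((%t. t ^ n) has_real_derivative real n * (max 0 t) ^ (n - 1)) (at t)"
   using 1 by (auto intro!: derivative_eq_intros)
  then show ?thesis
   by (rule has_field_derivative_transform_within_open[where S = "{0<..}"]) (use 1 in auto)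
 next
  case 2
  have "((%t. 0) has_real_derivative real n * (max 0 t) ^ (n - 1)) (at t)"
   using 2 assms by (auto intro!: derivative_eq_intros)
  then show ?thesis
   by (rule has_field_derivative_transform_within_open[where S = "{..<0}"]) (use 2 assms in auto)
 next
  case 3
  have "((%h::real. (max 0 h) ^ n / h) \<longlongrightarrow> 0) (at 0)"
  proof (rule Lim_null_comparison)
   show "\<forall>\<^sub>F h in at 0. norm ((max 0 h) ^ n / h) <= abs (h::real) ^ (n - 1)"
   proof (rule always_eventually, rule allI)
    fix h :: real
    show "norm ((max 0 h) ^ n / h) <= abs (h) ^ (n - 1)"
    proof (cases "h > 0")
     case True
     then show ?thesis using assms by (cases n) (auto simp: field_simps)
    next
     case False
     then have "max 0 h = 0" by simp
     then show ?thesis using assms by (simp add: power_0_left)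
    qed
   qed
   have "((%h::real. abs (h) ^ (n - 1)) \<longlongrightarrow> \<bar>0\<bar> ^ (n - 1)) (at 0)"
    by (intro tendsto_intros)
   then show "((%h::real. abs (h) ^ (n - 1)) \<longlongrightarrow> 0) (at 0)" using assms by (simp add: power_0_left)
  qed
  then show ?thesis using 3 assms by (simp add: has_field_derivative_iff power_0_left)
 qed
qed

lemma bump_nonneg: "0 <= bump n y" by (simp add: bump_def)
lemma bump_le_one: "bump n y <= 1" by (simp add: bump_def power_le_one)

lemma bump_zero: "norm y >= 1 ==> n > 0 ==> bump n y = 0"
 by (simp add: bump_def max_def norm_ge_square power_0_left)

lemma bump_pos: "norm y < 1 ==> bump n y > 0"
 by (simp add: bump_def norm_lt_square)

lemma bump_ge:
 assumes "norm y <= r" "r <= 1" shows "bump n y >= (1 - r\<^sup>2) ^ n"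
proof -
 have "y *. y <= r\<^sup>2" using assms by (metis norm_ge_zero power_mono power2_norm_eq_inner)
 moreover have "r\<^sup>2 <= 1" using assms by (smt (verit) norm_ge_zero power2_le_iff_abs_le one_power2 abs_square_le_1)
 ultimately show ?thesis unfolding bump_def by (intro power_mono) auto
qed

lemma bump_has_derivative:
 assumes "n >= 2"
 shows "(bump n has_derivative (%h. - (2 * real n * bump (n - 1) y) * (y *. h))) (at y)"
proof -
 have 1: "((%y::'a. 1 - y *. y) has_derivative (%h. - (2 * (y *. h)))) (at y)"
  by (auto intro!: derivative_eq_intros simp: inner_commute)
 have 2: "((%t. (max 0 t) ^ n) has_derivative (%h. real n * (max 0 (1 - y *. y)) ^ (n - 1) * h)) (at (1 - y *. y))"
  using pos_power_has_derivative[OF assms, of "1 - y *. y"] by (simp add: has_field_derivative_def)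
 have "((%y. (max 0 (1 - y *. y)) ^ n) has_derivative
  (%h. real n * (max 0 (1 - y *. y)) ^ (n - 1) * (- (2 * (y *. h))))) (at y)"
  by (rule has_derivative_compose[OF 1 2, unfolded o_def])
 then show ?thesis unfolding bump_def[abs_def] by (simp add: mult_ac)
qed

lemma bump_continuous [continuous_intros]:
 "continuous_on S f ==> continuous_on S (%x. bump n (f x))"
 unfolding bump_def by (intro continuous_intros)

section \<open>Differentiation under the integral sign and integrals of derivatives\<close>

lemma integrable_cts_supp:
 fixes f :: "'a::euclidean_space => 'b::euclidean_space"
 assumes "continuous_on UNIV f" "!!x. norm x > R ==> f x = 0"
 shows "integrable lborel f"
proof -
 have "integrable lborel (%x. indicator (cball 0 R) x *R f x)"
  by (rule borel_integrable_compact) (use assms(1) continuous_on_subset in auto)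
 moreover have "(%x. indicator (cball 0 R) x *R f x) = f"
  using assms(2) by (auto simp: indicator_def fun_eq_iff not_le)
 ultimately show ?thesis by simp
qed

lemma integral_lborel_eq_cbox:
 fixes f :: "'a::euclidean_space => 'b::euclidean_space"
 assumes "continuous_on UNIV f" "!!x. x ~: cbox a b ==> f x = 0"
 shows "integral (cbox a b) f = LI f" "integrable lborel f"
proof -
 obtain R where R: "cbox a b \<subseteq> cball 0 R"
  using bounded_subset_ballD[OF bounded_cbox, of a b 0] ball_subset_cball by blast
 show I: "integrable lborel f"
  by (rule integrable_cts_supp[OF assms(1), of R]) (use R assms(2) in "metis mem_cball_0 not_le subset_iff")
 have "(f has_integral (LI f)) UNIV"
  by (rule has_integral_integral_lborel[OF I])
 moreover have "(%x. if x : cbox a b then f x else 0) = f" using assms(2) by auto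
 ultimately have "(f has_integral (LI f)) (cbox a b)"
  by (metis has_integral_restrict_UNIV)
 then show "integral (cbox a b) f = LI f" by (rule integral_unique)
qed

text \<open>A support bound uniform in the parameter turns the integral into one over a fixed box,
  where the Leibniz rule for continuous integrands applies.\<close>

lemma leibniz_lborel:
 fixes k :: "'b::euclidean_space => 'a::euclidean_space => real"
 assumes d: "!!s x. s : S ==> ((%s. k s x) has_derivative (%h. K s x *. h)) (at s)"
  and c: "continuous_on (S \<times> UNIV) (%(s, x). K s x)"
  and ck: "!!s. s : S ==> continuous_on UNIV (k s)"
  and z: "!!s x. s : S ==> norm x > R ==> k s x = 0" "!!s x. s : S ==> norm x > R ==> K s x = 0"
  and S: "open S" "convex S" "s0 : S"
 shows "((%s. LI (k s)) has_derivative (%h. LI (K s0) *. h)) (at s0)"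
proof -
 obtain a b :: 'a where ab: "cball 0 R \<subseteq> cbox a b"
  using bounded_subset_cbox_symmetric[OF bounded_cball] by metis
 have out: "x ~: cbox a b ==> norm x > R" for x using ab by (auto simp: subset_iff not_le)
 have eq: "integral (cbox a b) (k s) = LI (k s)" if "s : S" for s
  by (rule integral_lborel_eq_cbox) (use that ck z out in auto)
 have cK: "continuous_on T (K s)" if "s : S" for s T
 proof -
  have "continuous_on T ((%(s, x). K s x) \<circ> (%x. (s, x)))"
   by (rule continuous_on_compose) (auto intro!: continuous_intros continuous_on_subset[OF c] that)
  then show ?thesis by (simp add: o_def)
 qed
 have "((%s. integral (cbox a b) (k s)) has_derivative
     integral (cbox a b) (%x. blinfun_inner_left (K s0 x))) (at s0 within S)"
 proof (rule leibniz_rule)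
  have "continuous_on (S \<times> cbox a b) (%p. K (fst p) (snd p))"
   using continuous_on_subset[OF c, of "S \<times> cbox a b"] by (auto simp: split_beta)
  then show "continuous_on (S \<times> cbox a b) (%(s, x). blinfun_inner_left (K s x))"
   unfolding split_beta by (rule bounded_linear.continuous_on[OF bounded_linear_blinfun_inner_left])
  show "k s integrable_on cbox a b" if "s : S" for s
   by (rule integrable_continuous) (use ck[OF that] continuous_on_subset in blast)
  show "((%s. k s x) has_derivative blinfun_apply (blinfun_inner_left (K s x))) (at s within S)"
   if "s : S" for s x
  proof -
   have "blinfun_apply (blinfun_inner_left (K s x)) = (%h. K s x *. h)"
    by (simp add: blinfun_inner_left.rep_eq fun_eq_iff inner_commute)
   then show ?thesis using has_derivative_at_withinI[OF d[OF that]] by simp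
  qed
 qed (use S in auto)
 moreover have "blinfun_apply (integral (cbox a b) (%x. blinfun_inner_left (K s0 x))) = (%h. LI (K s0) *. h)"
 proof -
  have "(%x. blinfun_inner_left (K s0 x)) integrable_on cbox a b"
   by (intro integrable_continuous bounded_linear.continuous_on[OF bounded_linear_blinfun_inner_left] cK S)
  then have "blinfun_apply (integral (cbox a b) (%x. blinfun_inner_left (K s0 x))) h
   = integral (cbox a b) (%x. blinfun_apply (blinfun_inner_left (K s0 x)) h)" for h
   by (subst blinfun_apply_integral) auto
  moreover have "integral (cbox a b) (%x. K s0 x *. h) = integral (cbox a b) (K s0) *. h" for h
   using integral_linear[OF integrable_continuous[OF cK[OF S(3)]] bounded_linear_inner_left, of a b h]
   by (simp add: o_def)
  moreover have "integral (cbox a b) (K s0) = LI (K s0)"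
   by (rule integral_lborel_eq_cbox) (use cK[OF S(3)] z(2)[OF S(3)] out in auto)
  ultimately show ?thesis by (auto simp: blinfun_inner_left.rep_eq inner_commute)
 qed
 ultimately have 1: "((%s. integral (cbox a b) (k s)) has_derivative (%h. LI (K s0) *. h)) (at s0)"
  by (simp only: at_within_open[OF S(3) S(1)])
 show ?thesis
  by (rule has_derivative_transform_within_open[OF 1 S(1) S(3)]) (use eq in auto)
qed

lemma lborel_shift_integral:
 fixes f :: "'a::euclidean_space => 'b::{banach,second_countable_topology}"
 shows "LI (%x. f (x + t)) = LI f"
proof -
 have "LI f = integral\<^sup>L (distr lborel borel ((+) t)) f"
  by (simp add: lborel_distr_plus)
 show ?thesis
 proof (cases "f : borel_measurable borel")
  case True
  then have "integral\<^sup>L (distr lborel borel ((+) t)) f = LI (%x. f (t + x))"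
   by (intro integral_distr) auto
  then show ?thesis by (simp add: lborel_distr_plus add.commute)
 next
  case False
  have "(%x. f (x + t)) ~: borel_measurable borel"
  proof
   assume "(%x. f (x + t)) : borel_measurable borel"
   then have "(%x. f (x + t)) \<circ> (%x. x - t) : borel_measurable borel"
    by (intro measurable_comp[where N = borel]) auto
   then show False using False by (simp add: o_def)
  qed
  then have "~ integrable lborel (%x. f (x + t))" "~ integrable lborel f"
   using False borel_measurable_integrable[of lborel] by auto
  then show ?thesis by (simp add: not_integrable_integral_eq)
 qed
qed

lemma lborel_scale_integral:
 fixes f :: "'a::euclidean_space => real"
 assumes "s > 0"
 shows "LI (%x. f (z + s *R x)) = LI f / s ^ DIM('a)"
proof (cases "f : borel_measurable borel")
 case True
 have "LI f = integral\<^sup>L (density (distr lborel borel (%x. z + s *R x)) (%_. ennreal (abs (s) ^ DIM('a)))) f"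
  using lborel_affine[of s z] assms by simp
 also have "... = integral\<^sup>L (distr lborel borel (%x. z + s *R x)) (%x. (s ^ DIM('a)) *R f x)"
  using assms True by (subst integral_density) auto
 also have "... = LI (%x. (s ^ DIM('a)) *R f (z + s *R x))"
  using True by (subst integral_distr) auto
 finally show ?thesis using assms by (simp add: field_simps)
next
 case False
 have "(%x. f (z + s *R x)) ~: borel_measurable borel"
 proof
  assume "(%x. f (z + s *R x)) : borel_measurable borel"
  then have "(%x. f (z + s *R x)) \<circ> (%x. (1/s) *R (x - z)) : borel_measurable borel"
   by (intro measurable_comp[where N = borel]) auto
  then show False using False assms by (simp add: o_def)
 qed
 then have "~ integrable lborel (%x. f (z + s *R x))" "~ integrable lborel f"
  using False borel_measurable_integrable[of lborel] by auto
 then show ?thesis by (simp add: not_integrable_integral_eq)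
qed

text \<open>By translation invariance the integral of \<open>f (x + t *R b)\<close> is constant in
  \<open>t\<close>; its derivative at \<open>t = 0\<close> is the claim. Differentiability is asked
  only on a neighbourhood \<open>S\<close> of the support, which later is often the positivity
  set.\<close>

lemma integral_directional_derivative_zero:
 fixes f :: "'a::euclidean_space => real"
 assumes S: "open S" and K: "compact K" "K \<subseteq> S"
  and d: "!!x. x : S ==> (f has_derivative D x) (at x)"
  and c: "continuous_on S (%x. D x b)"
  and z: "!!x. x ~: K ==> f x = 0"
  and z': "!!x. x ~: K ==> D' x = 0" and e: "!!x. x : K ==> D' x = D x b"
 shows "LI D' = 0"
proof -
 have oK: "open (- K)" using compact_imp_closed[OF K(1)] by (simp add: open_Compl)
 have dz: "D x = (%h. 0)" if "x : S" "x ~: K" for x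
 proof -
  have "(f has_derivative (%h. 0)) (at x)"
   by (rule has_derivative_transform_within_open[of "%x. 0" _ x UNIV "- K"]) (use oK that z in auto)
  then show ?thesis using d[OF that(1)] has_derivative_unique by blast
 qed
 define E where "E = (%x. if x : S then D x else (%h. 0))"
 have dE: "(f has_derivative E x) (at x)" for x
 proof (cases "x : S")
  case False
  then have "x : - K" using K by auto
  have "(f has_derivative (%h. 0)) (at x)"
   by (rule has_derivative_transform_within_open[of "%x. 0" _ x UNIV "- K"]) (use oK \<open>x : - K\<close> z in auto)
  then show ?thesis using False by (simp add: E_def)
 qed (simp add: E_def d)
 have E': "E x b = D' x" for x
  using e z' dz K(2) by (cases "x : K") (auto simp: E_def)
 have cE: "continuous_on UNIV D'"
 proof -
  have "continuous_on S D'"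
   using c
  proof (rule continuous_on_eq)
   show "D x b = D' x" if "x : S" for x using E'[of x] that by (simp add: E_def)
  qed
  moreover have "continuous_on (- K) D'"
   by (rule continuous_on_eq[of _ "%x. 0"]) (use z' in auto)
  ultimately have "continuous_on (S Un - K) D'"
   using S oK by (simp add: continuous_on_open_Un)
  moreover have "S Un - K = UNIV" using K by auto
  ultimately show ?thesis by simp
 qed
 obtain R0 where R0: "K \<subseteq> cball 0 R0"
  using bounded_subset_ballD[OF compact_imp_bounded[OF K(1)], of 0] ball_subset_cball by blast
 define R where "R = R0 + norm b"
 have far: "x + t *R b ~: K" if "norm x > R" "t : {-1<..<1}" for x t
 proof
  assume "x + t *R b : K"
  then have "norm (x + t *R b) <= R0" using R0 by auto
  moreover have "norm (t *R b) <= norm b" using that mult_right_mono[of "abs (t)" 1 "norm b"] by auto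
  ultimately show False using that norm_triangle_ineq4[of "x + t *R b" "t *R b"] by (auto simp: R_def)
 qed
 have cf: "continuous_on UNIV f" using dE has_derivative_continuous continuous_at_imp_continuous_on by blast
 have "((%t::real. LI (%x. f (x + t *R b))) has_derivative
    (%h. LI (%x. D' (x + 0 *R b)) *. h)) (at 0)"
 proof (rule leibniz_lborel[where S = "{-1<..<1}" and R = R and K = "%t x. D' (x + t *R b)"])
  fix t :: real and x assume "t : {-1<..<1}"
  have 1: "((%t. x + t *R b) has_derivative (%h. h *R b)) (at t)"
   by (auto intro!: derivative_eq_intros)
  have "((%t. f (x + t *R b)) has_derivative (%h. E (x + t *R b) (h *R b))) (at t)"
   by (rule has_derivative_compose[OF 1 dE])
  moreover have "E (x + t *R b) (h *R b) = D' (x + t *R b) *. h" for h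
   using E' linear_cmul[OF has_derivative_linear[OF dE]] by (simp add: mult.commute)
  ultimately show "((%t. f (x + t *R b)) has_derivative (%h. D' (x + t *R b) *. h)) (at t)" by simp
  show "continuous_on UNIV (%x. f (x + t *R b))"
   by (rule continuous_on_compose2[OF cf]) (auto intro!: continuous_intros)
  show "norm x > R ==> f (x + t *R b) = 0" "norm x > R ==> D' (x + t *R b) = 0"
   using far[of x t] \<open>t : _\<close> z z' by blast+
 next
  show "continuous_on ({-1<..<1} \<times> UNIV) (%(t, x). D' (x + t *R b))"
   unfolding split_beta by (rule continuous_on_compose2[OF cE]) (auto intro!: continuous_intros)
 qed auto
 then have "((%t::real. LI f) has_derivative (%h. LI D' *. h)) (at 0)"
  by (simp add: lborel_shift_integral)
 moreover have "((%t::real. LI f) has_derivative (%h. 0)) (at 0)" by simp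
 ultimately have "(%h::real. LI D' *. h) = (%h. 0)" by (rule has_derivative_unique)
 then show ?thesis by (metis inner_real_def mult.right_neutral)
qed

text \<open>Packing: \<open>n\<close> disjoint translates of \<open>S\<close>, moved by at most
  \<open>R\<close> in total, fit into the ball of doubled radius.\<close>

lemma measure_translates_le:
 fixes S :: "'a::euclidean_space set"
 assumes S: "S : sets lebesgue" "S \<subseteq> cball z R"
  and disj: "!!x j. x : S ==> 1 <= j ==> j < n ==> x + real j *R v ~: S"
  and v: "real n * norm v <= R"
 shows "real n * measure lebesgue S <= measure lebesgue (cball z (2 * R))"
proof -
 define T where "T j = (+) (real j *R v) ` S" for j :: nat
 have Sm: "S : lmeasurable"
  using S bounded_set_imp_lmeasurable bounded_subset[OF bounded_cball] by blast
 have Tm: "T j : lmeasurable" for j unfolding T_def using Sm by (rule measurable_translation)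
 have Tj: "measure lebesgue (T j) = measure lebesgue S" for j unfolding T_def by (rule measure_translation)
 have dj: "T i Int T j = {}" if "i < j" "j < n" for i j
 proof -
  { fix x y assume "x : S" "y : S" "real i *R v + x = real j *R v + y"
   then have "x = y + real (j - i) *R v" using that by (simp add: of_nat_diff algebra_simps)
   moreover have "y + real (j - i) *R v ~: S" using disj[OF \<open>y : S\<close>, of "j - i"] that by auto
   ultimately have False using \<open>x : S\<close> by simp }
  then show ?thesis by (auto simp: T_def)
 qed
 have "disjoint_family_on T {..<n}" unfolding disjoint_family_on_def
  using dj by (metis lessThan_iff nat_neq_iff inf_commute)
 moreover have "emeasure lebesgue (T j) ~= top" for j using fmeasurableD2[OF Tm] by simp
 ultimately have "measure lebesgue (\<Union>j<n. T j) = (\<Sum>j<n. measure lebesgue (T j))"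
  by (intro measure_finite_Union) (use Tm fmeasurableD in auto)
 moreover have "(\<Union>j<n. T j) \<subseteq> cball z (2 * R)"
 proof
  fix x assume "x : (\<Union>j<n. T j)"
  then obtain j y where j: "j < n" "y : S" "x = real j *R v + y" by (auto simp: T_def)
  have "dist z y <= R" using j S by auto
  moreover have "norm (real j *R v) <= R"
   using v j by (smt (verit) mult_right_mono norm_ge_zero norm_scaleR of_nat_0_le_iff abs_of_nat of_nat_less_iff)
  ultimately have "dist z x <= 2 * R" using j(3) norm_triangle_ineq4[of "z - y" "real j *R v"]
   by (simp add: dist_norm algebra_simps)
  then show "x : cball z (2 * R)" by simp
 qed
 moreover have "(\<Union>j<n. T j) : lmeasurable" using Tm by (intro fmeasurable.finite_UN) auto
 ultimately show ?thesis using Tj measure_mono_fmeasurable[of "\<Union>j<n. T j" "cball z (2 * R)" lebesgue]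
  by (simp add: fmeasurableD)
qed

lemma measure_strip_le:
 fixes a :: "'a::euclidean_space"
 assumes a: "norm a = 1" and e: "e > 0" and r: "r > 0"
 shows "measure lebesgue {x : cball z r. abs (a *. x - c) <= e} <= 6 * (e / r) * measure lebesgue (cball z (2 * r))"
proof -
 define S where "S = {x : cball z r. abs (a *. x - c) <= e}"
 have "closed S"
 proof -
  have "S = cball z r Int {x. abs (a *. x - c) <= e}" by (auto simp: S_def)
  moreover have "closed {x. abs (a *. x - c) <= e}" by (intro closed_Collect_le continuous_intros)
  ultimately show ?thesis by (auto intro: closed_Int)
 qed
 then have Sm: "S : sets lebesgue" by (simp add: lmeasurable_compact fmeasurableD borel_closed sets_completionI_sets)
 have sub: "S \<subseteq> cball z r" by (auto simp: S_def)
 show ?thesis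
 proof (cases "r <= 6 * e")
  case True
  have "measure lebesgue S <= measure lebesgue (cball z (2 * r))"
   by (intro measure_mono_fmeasurable) (use sub r Sm in auto)
  also have "... <= 6 * (e / r) * measure lebesgue (cball z (2 * r))"
   using True r mult_right_mono[of 1 "6 * (e/r)" "measure lebesgue (cball z (2 * r))"] by (simp add: field_simps)
  finally show ?thesis unfolding S_def .
 next
  case False
  \<comment> \<open>The strip has width \<open>2 * e\<close>, so translates by multiples of
    \<open>3 * e\<close> along \<open>a\<close> are disjoint. The quotient
    \<open>r / (3 * e)\<close> exceeds 2 here, so rounding down loses at most half of it.\<close>
  define n where "n = nat \<lfloor>r / (3 * e)\<rfloor>"
  have n1: "real n <= r / (3 * e)" using r e by (simp add: n_def)
  have "r / (3 * e) > 2" using False r e by (simp add: field_simps)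
  moreover have "real n > r / (3 * e) - 1" using r e by (simp add: n_def)
  moreover have "r / (6 * e) = r / (3 * e) / 2" by simp
  ultimately have n2: "real n >= r / (6 * e)" by linarith
  have "real n * measure lebesgue S <= measure lebesgue (cball z (2 * r))"
  proof (rule measure_translates_le[OF Sm sub, of n "(3 * e) *R a"])
   show "real n * norm ((3 * e) *R a) <= r" using n1 a e by (simp add: field_simps)
   fix x j assume x: "x : S" and j: "1 <= j" "j < n"
   have "a *. (x + real j *R (3 * e) *R a) = a *. x + real j * (3 * e)"
    using a by (simp add: inner_add_right norm_eq_1)
   moreover have "real j * (3 * e) >= 3 * e" using j e by simp
   moreover have "abs (a *. x - c) <= e" using x by (simp add: S_def)
   ultimately have "~ abs (a *. (x + real j *R (3 * e) *R a) - c) <= e" using e by linarith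
   then show "x + real j *R (3 * e) *R a ~: S" by (simp only: S_def mem_Collect_eq) blast
  qed
  then have "r / (6 * e) * measure lebesgue S <= measure lebesgue (cball z (2 * r))"
   using mult_right_mono[OF n2, of "measure lebesgue S"] by simp
  then show ?thesis using e r unfolding S_def by (simp add: field_simps)
 qed
qed

lemma integrable_cts_compact:
 fixes f :: "'a::euclidean_space => 'b::euclidean_space"
 assumes "compact K" "continuous_on K f" "!!x. x ~: K ==> f x = 0"
 shows "integrable lborel f"
proof -
 have "integrable lborel (%x. indicator K x *R f x)"
  by (rule borel_integrable_compact[OF assms(1,2)])
 moreover have "(%x. indicator K x *R f x) = f"
  using assms(3) by (auto simp: indicator_def fun_eq_iff)
 ultimately show ?thesis by simp
qed

lemma integral_divergence_zero:
 fixes F :: "'a::euclidean_space => 'a"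
 assumes S: "open S" and K: "compact K" "K \<subseteq> S"
  and d: "!!x. x : S ==> (F has_derivative D x) (at x)"
  and c: "!!b. b : Basis ==> continuous_on S (%x. D x b)"
  and z: "!!x. x ~: K ==> F x = 0"
  and z': "!!x. x ~: K ==> G x = 0" and e: "!!x. x : K ==> G x = (\<Sum>b\<in>Basis. D x b *. b)"
 shows "LI G = 0"
proof -
 define E where "E b x = (if x : K then D x b *. b else 0)" for b x
 have dz: "D x = (%h. 0)" if "x : S" "x ~: K" for x
 proof -
  have oK: "open (- K)" using compact_imp_closed[OF K(1)] by (simp add: open_Compl)
  have "(F has_derivative (%h. 0)) (at x)"
   by (rule has_derivative_transform_within_open[of "%x. 0" _ x UNIV "- K"]) (use oK that z in auto)
  then show ?thesis using d[OF that(1)] has_derivative_unique by blast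
 qed
 have "LI (E b) = 0" if b: "b : Basis" for b
 proof (rule integral_directional_derivative_zero[OF S K])
  show "((%x. F x *. b) has_derivative (%h. D x h *. b)) (at x)" if "x : S" for x
   by (rule has_derivative_inner_left[OF d[OF that]])
  show "continuous_on S (%x. D x b *. b)" by (intro continuous_intros c b)
 qed (use z in "auto simp: E_def")
 moreover have "integrable lborel (E b)" if b: "b : Basis" for b
 proof (rule integrable_cts_compact[OF K(1)])
  have "continuous_on K (%x. D x b *. b)"
   by (intro continuous_intros continuous_on_subset[OF c[OF b] K(2)])
  then show "continuous_on K (E b)" by (rule continuous_on_eq) (auto simp: E_def)
 qed (auto simp: E_def)
 moreover have "G = (%x. \<Sum>b\<in>Basis. E b x)"
 proof
  show "G x = (\<Sum>b\<in>Basis. E b x)" for x using e[of x] z'[of x] by (cases "x : K") (simp_all add: E_def)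
 qed
 ultimately show ?thesis by (simp add: integral_sum)
qed

text \<open>Gradient and Laplacian are explicit because they enter the integral identities; the
  Hessian stays existential since its trace is all that those identities mention. Continuity of each
  \<open>H x b\<close> is what the divergence theorem asks for.\<close>

definition C2on :: "'a::euclidean_space set => ('a => real) => ('a => 'a) => ('a => real) => bool" where
 "C2on S f g l \<longleftrightarrow> (EX H. (ALL x:S. (f has_derivative (%h. g x *. h)) (at x) & (g has_derivative H x) (at x)
   & l x = (\<Sum>b\<in>Basis. H x b *. b)) & (ALL b:Basis. continuous_on S (%x. H x b)))"

lemma C2onI:
 assumes "!!x. x : S ==> (f has_derivative (%h. g x *. h)) (at x)"
  "!!x. x : S ==> (g has_derivative H x) (at x)"
  "!!x. x : S ==> l x = (\<Sum>b\<in>Basis. H x b *. b)"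
  "!!b. b : Basis ==> continuous_on S (%x. H x b)"
 shows "C2on S f g l"
 using assms unfolding C2on_def by blast

lemma C2on_subset: "C2on S f g l ==> T \<subseteq> S ==> C2on T f g l"
 unfolding C2on_def by (meson continuous_on_subset subsetD)

lemma C2on_deriv: "C2on S f g l ==> x : S ==> (f has_derivative (%h. g x *. h)) (at x)"
 unfolding C2on_def by blast

lemma C2on_continuous:
 assumes "C2on S f g l"
 shows "continuous_on S f" "continuous_on S g" "continuous_on S l"
proof -
 obtain H where H: "ALL x:S. (f has_derivative (%h. g x *. h)) (at x) & (g has_derivative H x) (at x)
   & l x = (\<Sum>b\<in>Basis. H x b *. b)" "ALL b:Basis. continuous_on S (%x. H x b)"
  using assms unfolding C2on_def by blast
 show "continuous_on S f" "continuous_on S g"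
  using H(1) has_derivative_continuous continuous_at_imp_continuous_on by blast+
 have "continuous_on S (%x. \<Sum>b\<in>Basis. H x b *. b)" using H(2) by (auto intro!: continuous_intros)
 then show "continuous_on S l" by (rule continuous_on_eq) (use H(1) in auto)
qed

lemma C2on_zero:
 assumes "C2on S f g l" "open T" "T \<subseteq> S" "!!x. x : T ==> f x = 0" "x : T"
 shows "g x = 0" "l x = 0"
proof -
 obtain H where H: "!!x. x : S ==> (f has_derivative (%h. g x *. h)) (at x)" "!!x. x : S ==> (g has_derivative H x) (at x)"
   "!!x. x : S ==> l x = (\<Sum>b\<in>Basis. H x b *. b)"
  using assms(1) unfolding C2on_def by blast
 have g0: "g y = 0" if "y : T" for y
 proof -
  have "(f has_derivative (%h. 0)) (at y)"
   by (rule has_derivative_transform_within_open[of "%x. 0" _ y UNIV T]) (use assms that in auto)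
  then have "(%h. g y *. h) = (%h. 0)" using H(1) assms(3) that has_derivative_unique by blast
  then show ?thesis by (metis inner_eq_zero_iff)
 qed
 then show "g x = 0" using assms(5) .
 have "(g has_derivative (%h. 0)) (at x)"
  by (rule has_derivative_transform_within_open[of "%x. 0" _ x UNIV T]) (use assms g0 in auto)
 then have "H x = (%h. 0)" using H(2) assms(3,5) has_derivative_unique by blast
 then show "l x = 0" using H(3) assms(3,5) by auto
qed

lemma C2on_zero_off_compact:
 assumes "C2on UNIV f g l" "compact K" "!!x. x ~: K ==> f x = 0" "x ~: K"
 shows "g x = 0" "l x = 0"
 using C2on_zero[OF assms(1), of "- K" x] assms compact_imp_closed by auto

text \<open>Divergence theorem for the field \<open>f grad xi - xi grad f\<close>. Only
  \<open>xi\<close> has compact support, inside the set where \<open>f\<close> is C^2, so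
  \<open>f\<close> may be \<open>U\<close> on {U > 0}.\<close>

lemma green_compact_support:
 assumes f: "C2on S f g l" and xi: "C2on UNIV xi gxi lxi" and S: "open S"
  and K: "compact K" "K \<subseteq> S" "!!x. x ~: K ==> xi x = 0"
 shows "LI (%x. f x * lxi x) = LI (%x. xi x * l x)"
  "integrable lborel (%x. f x * lxi x)" "integrable lborel (%x. xi x * l x)"
proof -
 obtain H where H: "!!x. x : S ==> (f has_derivative (%h. g x *. h)) (at x)" "!!x. x : S ==> (g has_derivative H x) (at x)"
   "!!x. x : S ==> l x = (\<Sum>b\<in>Basis. H x b *. b)" "!!b. b : Basis ==> continuous_on S (%x. H x b)"
  using f unfolding C2on_def by blast
 obtain X where X: "!!x. (xi has_derivative (%h. gxi x *. h)) (at x)" "!!x. (gxi has_derivative X x) (at x)"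
   "!!x. lxi x = (\<Sum>b\<in>Basis. X x b *. b)" "!!b. b : Basis ==> continuous_on UNIV (%x. X x b)"
  using xi unfolding C2on_def by blast
 note z = C2on_zero_off_compact[OF xi K(1) K(3)]
 note cf = C2on_continuous[OF f] and cx = C2on_continuous[OF xi]
 have cS: "continuous_on S xi" "continuous_on S gxi" "continuous_on S lxi" "!!b. b : Basis ==> continuous_on S (%x. X x b)"
  using cx X(4) continuous_on_subset by blast+
 show i1: "integrable lborel (%x. f x * lxi x)"
  by (rule integrable_cts_compact[OF K(1)])
   (use z in "auto intro!: continuous_intros continuous_on_subset[OF _ K(2)] cf cS")
 show i2: "integrable lborel (%x. xi x * l x)"
  by (rule integrable_cts_compact[OF K(1)])
   (use K(3) in "auto intro!: continuous_intros continuous_on_subset[OF _ K(2)] cf cS")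
 have "LI (%x. f x * lxi x - xi x * l x) = 0"
 proof (rule integral_divergence_zero[OF S K(1,2), where F = "%x. f x *R gxi x - xi x *R g x"
    and D = "%x h. (f x *R X x h + (g x *. h) *R gxi x) - (xi x *R H x h + (gxi x *. h) *R g x)"])
  show "((%x. f x *R gxi x - xi x *R g x) has_derivative
   (%h. (f x *R X x h + (g x *. h) *R gxi x) - (xi x *R H x h + (gxi x *. h) *R g x))) (at x)" if "x : S" for x
   by (intro has_derivative_diff has_derivative_scaleR H X that)
  show "continuous_on S (%x. (f x *R X x b + (g x *. b) *R gxi x) - (xi x *R H x b + (gxi x *. b) *R g x))" if "b : Basis" for b
   by (intro continuous_intros cf cS H that)
  show "f x * lxi x - xi x * l x = (\<Sum>b\<in>Basis. ((f x *R X x b + (g x *. b) *R gxi x) - (xi x *R H x b + (gxi x *. b) *R g x)) *. b)"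
   if "x : K" for x
  proof -
   have "x : S" using that K by auto
   then show ?thesis
    by (simp add: H(3) X(3) inner_diff_left inner_add_left sum_subtractf sum.distrib sum_distrib_left mult.commute)
  qed
 qed (use z K(3) in auto)
 then show "LI (%x. f x * lxi x) = LI (%x. xi x * l x)"
  using i1 i2 by simp
qed

section \<open>Energy comparison for minimizers\<close>

text \<open>The inequality E(U) <= E(U + psi), with the common term |grad U|^2 cancelled and the
  cross term 2 grad U . grad psi integrated by parts into - 2 U lap psi. The two indicators are
  integrated as one difference, because that difference has compact support.\<close>

definition ac_min :: "('a::euclidean_space => real) => bool" where
 "ac_min U \<longleftrightarrow> continuous_on UNIV U & (ALL x. U x >= 0) &
  (ALL psi g l R. C2on UNIV psi g l --> (ALL x. R <= norm x --> psi x = 0) -->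
    LI (%x. of_bool (U x > 0) - of_bool (U x + psi x > 0) :: real)
     <= LI (%x. g x *. g x) - 2 * LI (%x. U x * l x))"

lemma ac_minD:
 assumes "ac_min U" "C2on UNIV psi g l" "!!x. R <= norm x ==> psi x = 0"
 shows "LI (%x. of_bool (U x > 0) - of_bool (U x + psi x > 0) :: real)
     <= LI (%x. g x *. g x) - 2 * LI (%x. U x * l x)"
 using assms unfolding ac_min_def by blast

lemma C2on_scale:
 assumes "C2on UNIV psi g l" "r > 0"
 shows "C2on UNIV (%x. r * psi ((x - z) /\<^sub>R r)) (%x. g ((x - z) /\<^sub>R r)) (%x. l ((x - z) /\<^sub>R r) / r)"
proof -
 obtain H where H: "!!x. (psi has_derivative (%h. g x *. h)) (at x)" "!!x. (g has_derivative H x) (at x)"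
   "!!x. l x = (\<Sum>b\<in>Basis. H x b *. b)" "!!b. b : Basis ==> continuous_on UNIV (%x. H x b)"
  using assms(1) unfolding C2on_def by blast
 have y: "((%x. (x - z) /\<^sub>R r) has_derivative (%h. h /\<^sub>R r)) (at x)" for x
  by (auto intro!: derivative_eq_intros)
 have lin: "H x (h /\<^sub>R r) = H x h /\<^sub>R r" for x h
  using linear_cmul[OF has_derivative_linear[OF H(2)]] by blast
 show ?thesis
 proof (rule C2onI)
  show "((%x. r * psi ((x - z) /\<^sub>R r)) has_derivative (%h. g ((x - z) /\<^sub>R r) *. h)) (at x)" for x
  proof -
   have "(%h. r * (g ((x - z) /\<^sub>R r) *. (h /\<^sub>R r))) = (%h. g ((x - z) /\<^sub>R r) *. h)"
    using assms(2) by (simp add: fun_eq_iff)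
   then show ?thesis using has_derivative_mult_right[OF has_derivative_compose[OF y H(1)], of r x] by simp
  qed
  show "((%x. g ((x - z) /\<^sub>R r)) has_derivative (%h. H ((x - z) /\<^sub>R r) h /\<^sub>R r)) (at x)" for x
   using has_derivative_compose[OF y H(2)] by (simp add: lin)
  show "l ((x - z) /\<^sub>R r) / r = (\<Sum>b\<in>Basis. (H ((x - z) /\<^sub>R r) b /\<^sub>R r) *. b)" for x
   by (simp add: H(3) divide_inverse sum_distrib_left mult.commute)
  show "continuous_on UNIV (%x. H ((x - z) /\<^sub>R r) b /\<^sub>R r)" if "b : Basis" for b
   by (intro continuous_intros continuous_on_compose2[OF H(4)[OF that]]) auto
 qed
qed

definition rescale :: "('a::real_vector => real) => 'a => real => 'a => real" where
 "rescale U z r y = U (z + r *R y) / r"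

text \<open>All integrals scale by the same power of \<open>r\<close>: the perturbation
  \<open>r psi ((x - z) / r)\<close> keeps its gradient, and the factor \<open>1 / r\<close> in its
  Laplacian is absorbed by \<open>U / r\<close>.\<close>

lemma ac_min_rescale:
 fixes U :: "'a::euclidean_space => real"
 assumes U: "ac_min U" and r: "r > 0"
 shows "ac_min (rescale U z r)"
 unfolding ac_min_def
proof (intro conjI allI impI)
 have cU: "continuous_on UNIV U" using U by (simp add: ac_min_def)
 show "continuous_on UNIV (rescale U z r)" unfolding rescale_def[abs_def]
  by (intro continuous_intros continuous_on_compose2[OF cU]) (use r in auto)
 show "rescale U z r x >= 0" for x using U r by (simp add: ac_min_def rescale_def)
 fix psi g l and R :: real
 assume C: "C2on UNIV psi g l" and z: "ALL x::'a. R <= norm x --> psi x = 0"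
 let ?y = "%x. (x - z) /\<^sub>R r"
 have yy: "?y (z + r *R x) = x" for x using r by simp
 have "LI (%x. of_bool (U x > 0) - of_bool (U x + r * psi (?y x) > 0) :: real)
     <= LI (%x. g (?y x) *. g (?y x)) - 2 * LI (%x. U x * (l (?y x) / r))"
  (is "?A' <= ?B' - 2 * ?E'")
 proof (rule ac_minD[OF U C2on_scale[OF C r], of "norm z + r * abs (R)"])
  fix x :: 'a assume "norm z + r * abs (R) <= norm x"
  then have "r * abs (R) <= norm (x - z)" using norm_triangle_ineq2[of x z] by linarith
  then have "abs (R) <= norm (x - z) / r" using r by (simp add: pos_le_divide_eq mult.commute)
  then have "R <= norm (x - z) / r" by linarith
  then have "R <= norm (?y x)" using r by (simp add: divide_inverse mult.commute)
  then show "r * psi (?y x) = 0" using z by simp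
 qed
 then have "LI (%x. of_bool (U (z + r *R x) > 0) - of_bool (U (z + r *R x) + r * psi x > 0) :: real)
     <= LI (%x. g x *. g x) - 2 * LI (%x. U (z + r *R x) * (l x / r))"
  (is "?A <= ?B - 2 * ?E")
 proof -
  assume a: "?A' <= ?B' - 2 * ?E'"
  have "?A = ?A' / r ^ DIM('a)" "?B = ?B' / r ^ DIM('a)" "?E = ?E' / r ^ DIM('a)"
   by (simp_all only: lborel_scale_integral[OF r, symmetric, of _ z] yy)
  then show ?thesis
   using divide_right_mono[OF a, of "r ^ DIM('a)"] r by (simp add: diff_divide_distrib)
 qed
 moreover have "(U (z + r *R x) > 0) = (rescale U z r x > 0)" for x
  using r by (simp add: rescale_def zero_less_divide_iff)
 moreover have "(U (z + r *R x) + r * psi x > 0) = (rescale U z r x + psi x > 0)" for x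
 proof -
  have "rescale U z r x + psi x = (U (z + r *R x) + r * psi x) / r" using r by (simp add: rescale_def field_simps)
  then show ?thesis using r by (simp add: zero_less_divide_iff)
 qed
 moreover have "U (z + r *R x) * (l x / r) = rescale U z r x * l x" for x by (simp add: rescale_def)
 ultimately show "LI (%x. of_bool (rescale U z r x > 0) - of_bool (rescale U z r x + psi x > 0) :: real)
     <= LI (%x. g x *. g x) - 2 * LI (%x. rescale U z r x * l x)"
  by (simp only:)
qed

text \<open>The Laplacian of \<open>psi0\<close>, that is, minus the divergence of
  \<open>bump 3 y *R y\<close>. The same expression is what \<open>s d/ds\<close> produces on
  averages with weight \<open>bump 3\<close> at scale \<open>s\<close>, so testing minimality with
  \<open>psi0\<close> controls the growth of means.\<close>

definition lap0 :: "'a::euclidean_space => real" where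
 "lap0 y = 6 * bump 2 y * (y *. y) - real DIM('a) * bump 3 y"

text \<open>The divisor 8 makes the gradient exactly \<open>- (bump 3 y *R y)\<close>.\<close>

definition psi0 :: "'a::euclidean_space => real" where "psi0 y = bump 4 y / 8"

lemma lap0_zero: "norm y >= 1 ==> lap0 y = 0"
 by (simp add: lap0_def bump_zero)

lemma lap0_continuous [continuous_intros]:
 "continuous_on S f ==> continuous_on S (%x. lap0 (f x))"
 unfolding lap0_def by (intro continuous_intros)

lemma C2on_psi0: "C2on UNIV (psi0 :: 'a::euclidean_space => real) (%y. - (bump 3 y *R y)) lap0"
proof (rule C2onI)
 fix y :: 'a
 have "((%y::'a. bump 4 y / 8) has_derivative (%h. - (2 * real 4 * bump (4 - 1) y) * (y *. h) / 8)) (at y)"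
  using has_derivative_mult_left[OF bump_has_derivative[of 4 y], of "1/8"] by simp
 then show "(psi0 has_derivative (%h. - (bump 3 y *R y) *. h)) (at y)"
  by (simp add: psi0_def[abs_def])
 have "((%y::'a. bump 3 y *R y) has_derivative (%h. bump 3 y *R h + (- (2 * real 3 * bump (3 - 1) y) * (y *. h)) *R y)) (at y)"
  by (intro has_derivative_scaleR bump_has_derivative has_derivative_ident) auto
 from has_derivative_minus[OF this]
 show "((%y. - (bump 3 y *R y)) has_derivative (%h. (6 * bump 2 y * (y *. h)) *R y - bump 3 y *R h)) (at y)"
  by (simp add: numeral_eq_Suc)
 show "lap0 y = (\<Sum>b\<in>Basis. ((6 * bump 2 y * (y *. b)) *R y - bump 3 y *R b) *. b)"
 proof -
  have "(\<Sum>b\<in>Basis. ((6 * bump 2 y * (y *. b)) *R y - bump 3 y *R b) *. b)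
   = (\<Sum>b\<in>Basis. 6 * bump 2 y * ((y *. b) * (y *. b)) - bump 3 y)"
   by (intro sum.cong) (auto simp: inner_diff_left mult_ac)
  also have "... = lap0 y" unfolding lap0_def
   by (simp add: sum_subtractf sum_distrib_left[symmetric] euclidean_inner[symmetric])
  finally show ?thesis by simp
 qed
 show "continuous_on UNIV (%y. (6 * bump 2 y * (y *. b)) *R y - bump 3 y *R b)" for b
  by (intro continuous_intros)
qed

lemma C2on_cmult: "C2on S f g l ==> C2on S (%x. c * f x) (%x. c *R g x) (%x. c * l x)"
proof -
 assume "C2on S f g l"
 then obtain H where H: "!!x. x : S ==> (f has_derivative (%h. g x *. h)) (at x)" "!!x. x : S ==> (g has_derivative H x) (at x)"
   "!!x. x : S ==> l x = (\<Sum>b\<in>Basis. H x b *. b)" "!!b. b : Basis ==> continuous_on S (%x. H x b)"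
  unfolding C2on_def by blast
 show ?thesis
 proof (rule C2onI)
  show "((%x. c * f x) has_derivative (%h. (c *R g x) *. h)) (at x)" if "x : S" for x
   using has_derivative_mult_right[OF H(1)[OF that], of c] by simp
  show "((%x. c *R g x) has_derivative (%h. c *R H x h)) (at x)" if "x : S" for x
   using has_derivative_scaleR_right[OF H(2)[OF that]] .
  show "c * l x = (\<Sum>b\<in>Basis. (c *R H x b) *. b)" if "x : S" for x
   by (simp add: H(3)[OF that] sum_distrib_left)
  show "continuous_on S (%x. c *R H x b)" if "b : Basis" for b by (intro continuous_intros H that)
 qed
qed

lemma C2on_add:
 assumes "C2on S f g l" "C2on S f' g' l'"
 shows "C2on S (%x. f x + f' x) (%x. g x + g' x) (%x. l x + l' x)"
proof -
 obtain H where H: "!!x. x : S ==> (f has_derivative (%h. g x *. h)) (at x)" "!!x. x : S ==> (g has_derivative H x) (at x)"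
   "!!x. x : S ==> l x = (\<Sum>b\<in>Basis. H x b *. b)" "!!b. b : Basis ==> continuous_on S (%x. H x b)"
  using assms(1) unfolding C2on_def by blast
 obtain X where X: "!!x. x : S ==> (f' has_derivative (%h. g' x *. h)) (at x)" "!!x. x : S ==> (g' has_derivative X x) (at x)"
   "!!x. x : S ==> l' x = (\<Sum>b\<in>Basis. X x b *. b)" "!!b. b : Basis ==> continuous_on S (%x. X x b)"
  using assms(2) unfolding C2on_def by blast
 show ?thesis
 proof (rule C2onI)
  show "((%x. f x + f' x) has_derivative (%h. (g x + g' x) *. h)) (at x)" if "x : S" for x
   using has_derivative_add[OF H(1)[OF that] X(1)[OF that]] by (simp add: inner_add_left)
  show "((%x. g x + g' x) has_derivative (%h. H x h + X x h)) (at x)" if "x : S" for x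
   by (intro has_derivative_add H X that)
  show "l x + l' x = (\<Sum>b\<in>Basis. (H x b + X x b) *. b)" if "x : S" for x
   by (simp add: H(3) X(3) that sum.distrib inner_add_left)
  show "continuous_on S (%x. H x b + X x b)" if "b : Basis" for b by (intro continuous_intros H X that)
 qed
qed

text \<open>The Dirichlet energy of \<open>psi0\<close>.\<close>

definition G0 :: "'a::euclidean_space itself => real" where
 "G0 _ = LI (%y::'a. (bump 3 y)\<^sup>2 * (y *. y))"

lemma G0_nonneg: "G0 TYPE('a::euclidean_space) >= 0"
 unfolding G0_def by (intro bi_nonneg) auto

lemma ac_min_psi0:
 fixes U :: "'a::euclidean_space => real"
 assumes U: "ac_min U"
 shows "LI (%x. of_bool (U x > 0) - of_bool (U x + ta * psi0 x > 0) :: real)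
     <= ta\<^sup>2 * G0 TYPE('a) - 2 * ta * LI (%x. U x * lap0 x)"
proof -
 have "LI (%x. of_bool (U x > 0) - of_bool (U x + ta * psi0 x > 0) :: real)
  <= LI (%x::'a. (ta *R (- (bump 3 x *R x))) *. (ta *R (- (bump 3 x *R x)))) - 2 * LI (%x. U x * (ta * lap0 x))"
  by (rule ac_minD[OF U C2on_cmult[OF C2on_psi0], where R = 1]) (simp add: psi0_def bump_zero)
 also have "(%x::'a. (ta *R (- (bump 3 x *R x))) *. (ta *R (- (bump 3 x *R x)))) = (%x::'a. ta\<^sup>2 * ((bump 3 x)\<^sup>2 * (x *. x)))"
  by (auto simp: power2_eq_square)
 also have "(%x. U x * (ta * lap0 x)) = (%x. ta * (U x * lap0 x))" by auto
 finally show ?thesis by (simp add: G0_def)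
qed

lemma of_bool_diff_integrable:
 fixes U :: "'a::euclidean_space => real"
 assumes "continuous_on UNIV U" "continuous_on UNIV psi" "!!x. R <= norm x ==> psi x = 0"
 shows "integrable lborel (%x. of_bool (U x > 0) - of_bool (U x + psi x > 0) :: real)"
proof (rule Bochner_Integration.integrable_bound[of _ "indicator (cball 0 R)"])
 show "integrable lborel (indicator (cball (0::'a) R) :: 'a => real)"
  by (rule integrable_real_indicator) (use emeasure_bounded_finite[of "cball (0::'a) R"] in auto)
 have [measurable]: "U : borel_measurable borel" "psi : borel_measurable borel"
  using assms borel_measurable_continuous_onI by auto
 show "(%x. of_bool (U x > 0) - of_bool (U x + psi x > 0) :: real) : borel_measurable lborel"
  unfolding of_bool_def by measurable
 show "AE x in lborel. norm (of_bool (U x > 0) - of_bool (U x + psi x > 0) :: real) <= norm (indicator (cball 0 R) x :: real)"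
  using assms(3) by (intro AE_I2) (auto simp: indicator_def)
qed

lemma psi0_continuous [continuous_intros]: "continuous_on S f ==> continuous_on S (%x. psi0 (f x))"
 unfolding psi0_def by (intro continuous_intros) auto

lemma psi0_nonneg: "psi0 x >= 0" by (simp add: psi0_def bump_nonneg)

text \<open>Adding \<open>ta * psi0\<close> makes the function positive on the whole unit ball, so
  the volume term grows by at most the measure of the zero set there.\<close>

lemma ac_min_upper:
 fixes U :: "'a::euclidean_space => real"
 assumes U: "ac_min U" and t: "ta > 0"
 shows "2 * ta * LI (%x. U x * lap0 x) <= ta\<^sup>2 * G0 TYPE('a) + measure lborel {x : ball 0 1. U x = 0}"
proof -
 have cU: "continuous_on UNIV U" and nn: "!!x. U x >= 0" using U by (auto simp: ac_min_def)
 have [measurable]: "U : borel_measurable borel" using cU borel_measurable_continuous_onI by auto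
 have S: "{x : ball 0 1. U x = 0} : sets borel" by measurable
 have fin: "emeasure lborel {x : ball 0 1. U x = 0} < top"
 proof -
  have "bounded {x : ball 0 1. U x = 0}" by (rule bounded_subset[OF bounded_ball[of 0 1]]) auto
  from emeasure_bounded_finite[OF this] show ?thesis by simp
 qed
 have "- measure lborel {x : ball 0 1. U x = 0} = LI (%x. - indicator {x : ball 0 1. U x = 0} x :: real)"
  using S by simp
 also have "... <= LI (%x. of_bool (U x > 0) - of_bool (U x + ta * psi0 x > 0) :: real)"
 proof (rule integral_mono)
  show "integrable lborel (%x. - indicator {x : ball 0 1. U x = 0} x :: real)"
   using S fin by (intro integrable_minus integrable_real_indicator) auto
  show "integrable lborel (%x. of_bool (U x > 0) - of_bool (U x + ta * psi0 x > 0) :: real)"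
   by (rule of_bool_diff_integrable[of _ _ 1]) (auto intro!: continuous_intros cU simp: psi0_def bump_zero)
  show "- indicator {x : ball 0 1. U x = 0} x <= of_bool (U x > 0) - (of_bool (U x + ta * psi0 x > 0) :: real)" for x
  proof (cases "norm x < 1")
   case True
   then show ?thesis using nn[of x] by (auto simp: indicator_def)
  next
   case False
   then have "psi0 x = 0" by (simp add: psi0_def bump_zero)
   then show ?thesis using False by (simp add: indicator_def)
  qed
 qed
 finally show ?thesis using ac_min_psi0[OF U, of ta] by linarith
qed

text \<open>Subtracting \<open>ta * psi0\<close> removes the set where \<open>U\<close> is positive
  but at most \<open>ta * psi0\<close>. The competitor may become negative; only its positivity set
  is counted.\<close>

lemma ac_min_lower:
 fixes U :: "'a::euclidean_space => real"
 assumes U: "ac_min U" and t: "ta > 0"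
 shows "measure lborel {x. 0 < U x & U x <= ta * psi0 x} <= ta\<^sup>2 * G0 TYPE('a) + 2 * ta * LI (%x. U x * lap0 x)"
proof -
 have "(%x. of_bool (U x > 0) - of_bool (U x + (- ta) * psi0 x > 0) :: real) = indicator {x. 0 < U x & U x <= ta * psi0 x}"
 proof
  fix x :: 'a
  have "ta * psi0 x >= 0" using psi0_nonneg[of x] t by simp
  then show "of_bool (U x > 0) - of_bool (U x + (- ta) * psi0 x > 0) = (indicator {x. 0 < U x & U x <= ta * psi0 x} x :: real)"
   by (cases "0 < U x"; cases "U x <= ta * psi0 x") (simp_all add: indicator_def)
 qed
 then show ?thesis using ac_min_psi0[OF U, of "- ta"] by simp
qed

lemma le_all_scaled_zero:
 fixes a b :: real
 assumes "!!ta. ta > 0 ==> ta * a <= ta\<^sup>2 * b" shows "a <= 0"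
proof (rule ccontr)
 assume "~ a <= 0"
 define t where "t = a / (2 * (abs (b) + 1))"
 have t: "t > 0" using \<open>~ a <= 0\<close> by (simp add: t_def)
 have "t * a <= t * (t * b)" using assms[OF t] by (simp add: power2_eq_square mult.assoc)
 then have "a <= t * b" using t by simp
 also have "... <= t * (abs (b) + 1)" using t by (intro mult_left_mono) auto
 also have "... = a / 2" by (simp add: t_def field_simps)
 finally show False using \<open>~ a <= 0\<close> by simp
qed

text \<open>First order in \<open>ta\<close> as \<open>ta\<close> tends to 0 in
  \<open>ac_min_lower\<close>: the measure on the left is nonnegative and the energy of the
  perturbation is quadratic in \<open>ta\<close>.\<close>

lemma ac_min_subharmonic:
 fixes U :: "'a::euclidean_space => real"
 assumes U: "ac_min U"
 shows "LI (%x. U x * lap0 x) >= 0"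
proof -
 have "ta * (- (2 * LI (%x. U x * lap0 x))) <= ta\<^sup>2 * G0 TYPE('a)" if "ta > 0" for ta
 proof -
  have "0 <= ta\<^sup>2 * G0 TYPE('a) + 2 * ta * LI (%x. U x * lap0 x)"
   using ac_min_lower[OF U that] measure_nonneg[of lborel "{x. 0 < U x & U x <= ta * psi0 x}"] by linarith
  then show ?thesis by (simp add: algebra_simps)
 qed
 from le_all_scaled_zero[OF this] show ?thesis by simp
qed

text \<open>Without zeros in the ball, raising \<open>U\<close> costs no volume either, so the first
  variation vanishes from both sides.\<close>

lemma ac_min_harmonic:
 fixes U :: "'a::euclidean_space => real"
 assumes U: "ac_min U" and p: "!!x. norm x < 1 ==> U x > 0"
 shows "LI (%x. U x * lap0 x) = 0"
proof -
 have "{x : ball 0 1. U x = 0} = {}" using p by force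
 then have "ta * (2 * LI (%x. U x * lap0 x)) <= ta\<^sup>2 * G0 TYPE('a)" if "ta > 0" for ta
 proof -
  have "2 * ta * LI (%x. U x * lap0 x) <= ta\<^sup>2 * G0 TYPE('a)"
   using ac_min_upper[OF U that] unfolding \<open>{x : ball 0 1. U x = 0} = {}\<close> by simp
  then show ?thesis by (simp add: algebra_simps)
 qed
 from le_all_scaled_zero[OF this] show ?thesis using ac_min_subharmonic[OF U] by simp
qed

section \<open>Means, growth and Harnack inequalities\<close>

definition I3 :: "'a::euclidean_space itself => real" where
 "I3 _ = LI (%y::'a. bump 3 y)"

text \<open>Unnormalised: at \<open>s = 0\<close> it is \<open>f z * I3\<close>. A C^2 weight
  replaces the indicator of the ball so that means can be differentiated in both \<open>z\<close>
  and \<open>s\<close>; \<open>dmean\<close> is \<open>s\<close> times the derivative in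
  \<open>s\<close>.\<close>

definition mean :: "('a::euclidean_space => real) => 'a => real => real" where
 "mean f z s = LI (%y. f (z + s *R y) * bump 3 y)"

definition dmean :: "('a::euclidean_space => real) => 'a => real => real" where
 "dmean f z s = LI (%y. f (z + s *R y) * lap0 y)"

lemma bump_integrable: "n > 0 ==> integrable lborel (bump n :: 'a::euclidean_space => real)"
 by (rule integrable_cts_supp[where R = 1]) (auto intro: bump_continuous[OF continuous_on_id] bump_zero)

lemma I3_pos: "I3 TYPE('a::euclidean_space) > 0"
proof -
 let ?B = "cball (0::'a) (1/2)"
 have "measure lborel ?B > 0" by (rule content_cball_pos) auto
 have fin: "emeasure lborel ?B < top" using emeasure_bounded_finite[of ?B] by simp
 have "(1 - (1/2)\<^sup>2) ^ 3 * measure lborel ?B = LI (%y. (1 - (1/2)\<^sup>2) ^ 3 * indicator ?B y :: real)"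
  by simp
 also have "... <= LI (%y::'a. bump 3 y)"
 proof (rule integral_mono)
  show "integrable lborel (%y. (1 - (1/2)\<^sup>2) ^ 3 * indicator ?B y :: real)"
   by (intro integrable_mult_right integrable_real_indicator) (use fin in auto)
  show "integrable lborel (%y::'a. bump 3 y)" by (rule bump_integrable) simp
  show "(1 - (1/2)\<^sup>2) ^ 3 * indicator ?B y <= bump 3 y" for y :: 'a
   using bump_ge[of y "1/2" 3] bump_nonneg[of 3 y] by (cases "y : ?B") auto
 qed
 finally have "(1 - (1/2)\<^sup>2) ^ 3 * measure lborel ?B <= I3 TYPE('a)" unfolding I3_def .
 moreover have "(1 - (1/2)\<^sup>2) ^ 3 * measure lborel ?B > 0"
  using \<open>measure lborel ?B > 0\<close> by (intro mult_pos_pos) (auto simp: power2_eq_square)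
 ultimately show ?thesis by linarith
qed

lemma mean_eq:
 fixes f :: "'a::euclidean_space => real"
 assumes "s > 0"
 shows "mean f z s = LI (%x. f x * bump 3 ((x - z) /\<^sub>R s)) / s ^ DIM('a)"
  "dmean f z s = LI (%x. f x * lap0 ((x - z) /\<^sub>R s)) / s ^ DIM('a)"
proof -
 have y: "((z + s *R y) - z) /\<^sub>R s = y" for y using assms by simp
 show "mean f z s = LI (%x. f x * bump 3 ((x - z) /\<^sub>R s)) / s ^ DIM('a)"
  using lborel_scale_integral[OF assms, of "%x. f x * bump 3 ((x - z) /\<^sub>R s)" z] unfolding y mean_def by simp
 show "dmean f z s = LI (%x. f x * lap0 ((x - z) /\<^sub>R s)) / s ^ DIM('a)"
  using lborel_scale_integral[OF assms, of "%x. f x * lap0 ((x - z) /\<^sub>R s)" z] unfolding y dmean_def by simp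
qed

lemma norm_scaled: "s > 0 ==> norm ((x - z) /\<^sub>R s) = dist x z / s"
 by (simp add: dist_norm divide_inverse mult.commute)

lemma norm_scaled_ge: "s > 0 ==> s <= dist x z ==> norm ((x - z) /\<^sub>R s) >= 1"
 by (simp only: norm_scaled le_divide_eq_1_pos)

lemma norm_scaled_le: "s > 0 ==> dist x z <= t * s ==> norm ((x - z) /\<^sub>R s) <= t"
 by (simp only: norm_scaled pos_divide_le_eq)

text \<open>Substituting x = z + s y moves the scale into the kernel, so \<open>f\<close> need only
  be continuous. The \<open>s\<close>-derivative of \<open>s ^ -d bump 3 ((x - z) / s)\<close> is
  \<open>s ^ -(d + 1)\<close> times \<open>lap0\<close> of the same argument.\<close>

lemma mean_has_derivative:
 fixes f :: "'a::euclidean_space => real"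
 assumes f: "continuous_on UNIV f" and s0: "s0 > 0"
 shows "(mean f z has_real_derivative dmean f z s0 / s0) (at s0)"
proof -
 \<comment> \<open>Scales bounded away from 0 and from infinity, so that all kernels are supported
   in one ball.\<close>
 define S where "S = {s0/2<..<2 * s0}"
 define d where "d = DIM('a)"
 have S: "open S" "convex S" "s0 : S" using s0 by (auto simp: S_def)
 have pos: "s > 0" if "s : S" for s using that s0 by (auto simp: S_def)
 define k where "k s x = f x * (bump 3 ((x - z) /\<^sub>R s) * inverse s ^ d)" for s x
 define K where "K s x = f x * (lap0 ((x - z) /\<^sub>R s) * inverse s ^ (d + 1))" for s x
 have out: "norm ((x - z) /\<^sub>R s) >= 1" if "s : S" "norm x > norm z + 2 * s0" for s x
 proof (rule norm_scaled_ge)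
  show "s <= dist x z" using that norm_triangle_ineq2[of x z] by (auto simp: S_def dist_norm)
 qed (use pos that in auto)
 have "((%s. LI (k s)) has_derivative (%h. LI (K s0) *. h)) (at s0)"
 proof (rule leibniz_lborel[where S = S and R = "norm z + 2 * s0"])
  show "((%s. k s x) has_derivative (%h. K s x *. h)) (at s)" if "s : S" for s x
  proof -
   define y where "y = (x - z) /\<^sub>R s"
   note sp = pos[OF that]
   have "((%s. inverse s *R (x - z)) has_derivative (%h. (- (inverse s * h * inverse s)) *R (x - z))) (at s)"
    using sp by (auto intro!: derivative_eq_intros)
   then have y': "((%s. (x - z) /\<^sub>R s) has_derivative (%h. (- (h * inverse s)) *R y)) (at s)"
    by (simp add: y_def mult_ac)
   have "((%s. bump 3 ((x - z) /\<^sub>R s)) has_derivative (%h. - (2 * real 3 * bump (3 - 1) y) * (y *. ((- (h * inverse s)) *R y)))) (at s)"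
    using has_derivative_compose[OF y' bump_has_derivative[of 3]] by (simp add: y_def)
   then have b: "((%s. bump 3 ((x - z) /\<^sub>R s)) has_real_derivative 6 * bump 2 y * (y *. y) * inverse s) (at s)"
    unfolding has_field_derivative_def by (rule has_derivative_eq_rhs) (auto simp: fun_eq_iff numeral_eq_Suc)
   have "((%s. inverse s ^ d) has_real_derivative real d * inverse s ^ (d - 1) * (- (inverse s ^ 2))) (at s)"
    using sp by (auto intro!: derivative_eq_intros simp: power2_eq_square)
   moreover have "real d * inverse s ^ (d - 1) * (- (inverse s ^ 2)) = - (real d) * inverse s ^ (d + 1)"
    using DIM_positive[where 'a='a] by (cases d) (auto simp: d_def power2_eq_square algebra_simps)
   ultimately have i: "((%s. inverse s ^ d) has_real_derivative - (real d) * inverse s ^ (d + 1)) (at s)" by (simp only:)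
   have "((%s. k s x) has_real_derivative f x * (6 * bump 2 y * (y *. y) * inverse s * inverse s ^ d + (- (real d) * inverse s ^ (d + 1)) * bump 3 y)) (at s)"
    unfolding k_def y_def
    by (intro DERIV_cmult DERIV_mult) (use b i in "simp_all add: y_def")
   moreover have "f x * (6 * bump 2 y * (y *. y) * inverse s * inverse s ^ d + (- (real d) * inverse s ^ (d + 1)) * bump 3 y) = K s x"
    by (simp add: K_def lap0_def y_def d_def algebra_simps)
   ultimately show ?thesis by (simp add: has_field_derivative_def)
  qed
  have "fst p ~= 0" if "p : S \<times> (UNIV :: 'a set)" for p using pos[of "fst p"] that by auto
  then show "continuous_on (S \<times> UNIV) (%(s, x). K s x)" unfolding K_def split_beta
   by (intro continuous_intros continuous_on_compose2[OF f]) auto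
  show "continuous_on UNIV (k s)" if "s : S" for s unfolding k_def
   by (intro continuous_intros f)
  show "k s x = 0" "K s x = 0" if "s : S" "norm x > norm z + 2 * s0" for s x
   using out[OF that] by (simp_all add: k_def K_def bump_zero lap0_zero)
 qed (use S in auto)
 moreover have "LI (k s) = mean f z s" if "s : S" for s
 proof -
  have "k s = (%x. f x * bump 3 ((x - z) /\<^sub>R s) / s ^ d)" by (simp add: k_def fun_eq_iff field_simps power_inverse)
  then show ?thesis by (simp add: mean_eq[OF pos[OF that]] d_def)
 qed
 moreover have "LI (K s0) = dmean f z s0 / s0"
 proof -
  have "K s0 = (%x. f x * lap0 ((x - z) /\<^sub>R s0) / (s0 ^ d * s0))" by (simp add: K_def fun_eq_iff field_simps power_inverse)
  then show ?thesis by (simp add: mean_eq[OF s0] d_def)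
 qed
 ultimately have 1: "((%s. LI (k s)) has_derivative (%h. (dmean f z s0 / s0) *. h)) (at s0)"
  and 2: "!!s. s : S ==> LI (k s) = mean f z s" by simp_all
 have "(mean f z has_derivative (%h. (dmean f z s0 / s0) *. h)) (at s0)"
  by (rule has_derivative_transform_within_open[OF 1 S(1,3) 2])
 then show ?thesis unfolding has_field_derivative_def inner_real_def .
qed

lemma mean_continuous:
 fixes f :: "'a::euclidean_space => real"
 assumes f: "continuous_on UNIV f"
 shows "continuous_on T (mean f z)"
proof -
 obtain a b :: 'a where ab: "cball 0 1 \<subseteq> cbox a b"
  using bounded_subset_cbox_symmetric[OF bounded_cball] by metis
 have "mean f z s = integral (cbox a b) (%y. f (z + s *R y) * bump 3 y)" for s
  unfolding mean_def
 proof (rule integral_lborel_eq_cbox(1)[symmetric])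
  show "continuous_on UNIV (%y. f (z + s *R y) * bump 3 y)"
   by (intro continuous_intros continuous_on_compose2[OF f]) auto
  fix x :: 'a assume "x ~: cbox a b"
  then have "x ~: cball 0 1" using ab by blast
  then show "f (z + s *R x) * bump 3 x = 0" by (simp add: bump_zero)
 qed
 moreover have "continuous_on T (%s. integral (cbox a b) (%y. f (z + s *R y) * bump 3 y))"
 proof (rule integral_continuous_on_param)
  show "continuous_on (T \<times> cbox a b) (%(s, y). f (z + s *R y) * bump 3 y)" unfolding split_beta
   by (intro continuous_intros continuous_on_compose2[OF f]) auto
 qed
 ultimately show ?thesis by (simp add: fun_eq_iff cong: continuous_on_cong)
qed

lemma mean_0: "mean (f :: 'a::euclidean_space => real) z 0 = f z * I3 TYPE('a)"
 by (simp add: mean_def I3_def)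

lemma mean_diff_bounds:
 fixes f :: "'a::euclidean_space => real"
 assumes f: "continuous_on UNIV f" and r: "0 <= r0" "r0 <= r"
  and b: "!!s. r0 < s ==> s < r ==> A * s <= dmean f z s & dmean f z s <= B * s"
 shows "A * (r - r0) <= mean f z r - mean f z r0" "mean f z r - mean f z r0 <= B * (r - r0)"
proof -
 have "A * (r - r0) <= mean f z r - mean f z r0 & mean f z r - mean f z r0 <= B * (r - r0)"
 proof (cases "r0 = r")
  case False
  then have "r0 < r" using r by simp
  have "EX l s. r0 < s & s < r & DERIV (mean f z) s :> l & mean f z r - mean f z r0 = (r - r0) * l"
  proof (rule MVT[OF \<open>r0 < r\<close> mean_continuous[OF f]])
   fix s assume "r0 < s" "s < r"
   then show "mean f z differentiable at s"
    using mean_has_derivative[OF f, of s z] r real_differentiable_def by auto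
  qed
  then obtain l s where ls: "r0 < s" "s < r" "(mean f z has_real_derivative l) (at s)" "mean f z r - mean f z r0 = (r - r0) * l"
   by blast
  have s: "s > 0" using ls r by simp
  have "l = dmean f z s / s" using DERIV_unique[OF ls(3) mean_has_derivative[OF f s]] .
  then have "A <= l" "l <= B" using b[OF ls(1,2)] s by (simp_all add: pos_le_divide_eq pos_divide_le_eq)
  then show ?thesis using ls(4) \<open>r0 < r\<close> by (simp add: mult.commute mult_left_mono)
 qed simp
 then show "A * (r - r0) <= mean f z r - mean f z r0" "mean f z r - mean f z r0 <= B * (r - r0)" by auto
qed

text \<open>Half of the right-hand side of \<open>ac_min_upper\<close> at \<open>ta = 1\<close>,
  with the zero set replaced by the ball; the added 1 gives positivity at once.\<close>

definition CG :: "'a::euclidean_space itself => real" where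
 "CG _ = (G0 TYPE('a) + measure lborel (ball (0::'a) 1)) / 2 + 1"

lemma CG_pos: "CG TYPE('a::euclidean_space) > 0"
proof -
 have "G0 TYPE('a) + measure lborel (ball (0::'a) 1) >= 0" using G0_nonneg[where 'a='a] by simp
 then show ?thesis unfolding CG_def by (simp add: field_simps)
qed

lemma dmean_rescale:
 "s > 0 ==> dmean U z s = s * LI (%y. rescale U z s y * lap0 y)"
 by (simp add: dmean_def rescale_def)

lemma ac_min_dmean:
 fixes U :: "'a::euclidean_space => real"
 assumes U: "ac_min U" and s: "s > 0"
 shows "0 <= dmean U z s" "dmean U z s <= CG TYPE('a) * s"
proof -
 note V = ac_min_rescale[OF U s, of z]
 show "0 <= dmean U z s" using ac_min_subharmonic[OF V] s by (simp add: dmean_rescale)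
 have "measure lborel {x : ball 0 1. rescale U z s x = 0} <= measure lborel (ball (0::'a) 1)"
 proof (rule measure_mono_fmeasurable)
  show "ball (0::'a) 1 : fmeasurable lborel"
   using emeasure_bounded_finite[of "ball (0::'a) 1"] by (intro fmeasurableI) auto
  have [measurable]: "rescale U z s : borel_measurable borel"
   using V borel_measurable_continuous_onI by (auto simp: ac_min_def)
  show "{x : ball 0 1. rescale U z s x = 0} : sets lborel" by measurable
 qed auto
 then have "2 * LI (%y. rescale U z s y * lap0 y) <= G0 TYPE('a) + measure lborel (ball (0::'a) 1)"
  using ac_min_upper[OF V, of 1] by simp
 then have "LI (%y. rescale U z s y * lap0 y) <= CG TYPE('a)"
  unfolding CG_def by (simp add: field_simps)
 then show "dmean U z s <= CG TYPE('a) * s" using s by (simp add: dmean_rescale mult.commute)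
qed

lemma ac_min_mean_bounds:
 fixes U :: "'a::euclidean_space => real"
 assumes U: "ac_min U" and s: "0 <= s0" "s0 <= s"
 shows "mean U z s0 <= mean U z s" "mean U z s <= mean U z s0 + CG TYPE('a) * (s - s0)"
proof -
 have cU: "continuous_on UNIV U" using U by (simp add: ac_min_def)
 note * = mean_diff_bounds[OF cU s, of 0 z "CG TYPE('a)"]
 show "mean U z s0 <= mean U z s" "mean U z s <= mean U z s0 + CG TYPE('a) * (s - s0)"
  using * ac_min_dmean[OF U] s by force+
qed

lemma ac_min_mean_harmonic:
 fixes U :: "'a::euclidean_space => real"
 assumes U: "ac_min U" and s: "s >= 0" and p: "!!x. dist z x < s ==> U x > 0"
 shows "mean U z s = U z * I3 TYPE('a)"
proof -
 have cU: "continuous_on UNIV U" using U by (simp add: ac_min_def)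
 have "dmean U z t = 0" if t: "0 < t" "t < s" for t
 proof -
  have "LI (%y. rescale U z t y * lap0 y) = 0"
  proof (rule ac_min_harmonic[OF ac_min_rescale[OF U t(1)]])
   fix x :: 'a assume "norm x < 1"
   then have "t * norm x < s" using t by (smt (verit) mult_less_cancel_left2)
   then have "dist z (z + t *R x) < s" using t by (simp add: dist_norm)
   then show "rescale U z t x > 0" using p t by (simp add: rescale_def)
  qed
  then show ?thesis using t by (simp add: dmean_rescale)
 qed
 then show ?thesis using mean_diff_bounds[OF cU order_refl s, of 0 z 0] mean_0[of U z] by simp
qed

text \<open>The reciprocal of \<open>bump 3\<close> at radius 7/8, where 1 - (7/8)^2 =
  15/64.\<close>

definition A0 :: real where "A0 = (64/15) ^ 3"

text \<open>The kernel centred at \<open>y\<close> is at most 1 and lives within radius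
  \<open>7/8 * r\<close> of \<open>z\<close>, where the larger kernel is at least
  \<open>1 / A0\<close>; the power of \<open>r / s\<close> is the ratio of the volume
  elements.\<close>

lemma mean_kernel_le:
 fixes f :: "'a::euclidean_space => real"
 assumes f: "continuous_on (cball z r) f" "!!x. x : cball z r ==> f x >= 0"
  and s: "s > 0" "dist y z + s <= 7/8 * r"
 shows "mean f y s <= A0 * (r / s) ^ DIM('a) * mean f z r"
proof -
 have r: "r > 0" using s zero_le_dist[of y z] by linarith
 have sub: "cball y s \<subseteq> cball z r"
  using s r by (intro cball_subset_cball_iff[THEN iffD2] disjI1) (simp add: dist_commute)
 have "LI (%x. f x * bump 3 ((x - y) /\<^sub>R s)) <= LI (%x. A0 * (f x * bump 3 ((x - z) /\<^sub>R r)))"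
 proof (rule integral_mono)
  show "integrable lborel (%x. f x * bump 3 ((x - y) /\<^sub>R s))"
  proof (rule integrable_cts_compact[of "cball y s"])
   show "continuous_on (cball y s) (%x. f x * bump 3 ((x - y) /\<^sub>R s))"
    by (intro continuous_intros continuous_on_subset[OF f(1)] sub)
   show "f x * bump 3 ((x - y) /\<^sub>R s) = 0" if "x ~: cball y s" for x
    using bump_zero[OF norm_scaled_ge[of s x y]] s that by (simp add: dist_commute)
  qed auto
  show "integrable lborel (%x. A0 * (f x * bump 3 ((x - z) /\<^sub>R r)))"
  proof (rule integrable_cts_compact[of "cball z r"])
   show "continuous_on (cball z r) (%x. A0 * (f x * bump 3 ((x - z) /\<^sub>R r)))"
    by (intro continuous_intros f)
   show "A0 * (f x * bump 3 ((x - z) /\<^sub>R r)) = 0" if "x ~: cball z r" for x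
    using bump_zero[OF norm_scaled_ge[of r x z]] r that by (simp add: dist_commute)
  qed auto
  fix x
  have rhs: "A0 * (f x * bump 3 ((x - z) /\<^sub>R r)) >= 0"
  proof (cases "x : cball z r")
   case True then show ?thesis using f(2) by (simp add: A0_def bump_nonneg)
  next
   case False
   then have "bump 3 ((x - z) /\<^sub>R r) = 0" using bump_zero[OF norm_scaled_ge[of r x z]] r by (simp add: dist_commute)
   then show ?thesis by simp
  qed
  show "f x * bump 3 ((x - y) /\<^sub>R s) <= A0 * (f x * bump 3 ((x - z) /\<^sub>R r))"
  proof (cases "dist x y < s")
   case False
   then have "bump 3 ((x - y) /\<^sub>R s) = 0" using bump_zero[OF norm_scaled_ge[of s x y]] s by simp
   then show ?thesis using rhs by simp
  next
   case True
   have "dist x z <= 7/8 * r" using True s dist_triangle[of x z y] by linarith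
   then have "norm ((x - z) /\<^sub>R r) <= 7/8" using norm_scaled_le r by blast
   from bump_ge[OF this] have "bump 3 ((x - z) /\<^sub>R r) >= (1 - (7/8)\<^sup>2) ^ 3" by simp
   also have "(1 - (7/8)\<^sup>2) ^ 3 = (15/64::real) ^ 3" by (simp add: power2_eq_square)
   finally have "A0 * bump 3 ((x - z) /\<^sub>R r) >= A0 * (15/64) ^ 3" by (simp add: A0_def)
   also have "A0 * (15/64) ^ 3 = 1" by (simp add: A0_def power_mult_distrib[symmetric])
   finally have "bump 3 ((x - y) /\<^sub>R s) <= A0 * bump 3 ((x - z) /\<^sub>R r)" using bump_le_one order_trans by blast
   moreover have "x : cball y s" using True by (simp add: dist_commute)
   then have "f x >= 0" using sub f(2) by blast
   ultimately have "f x * bump 3 ((x - y) /\<^sub>R s) <= f x * (A0 * bump 3 ((x - z) /\<^sub>R r))" by (rule mult_left_mono)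
   then show ?thesis by (simp add: mult_ac)
  qed
 qed
 then have le: "s ^ DIM('a) * mean f y s <= A0 * (r ^ DIM('a) * mean f z r)"
  using s(1) r by (simp add: mean_eq)
 have "mean f y s = s ^ DIM('a) * mean f y s / s ^ DIM('a)" using s by simp
 also have "... <= A0 * (r ^ DIM('a) * mean f z r) / s ^ DIM('a)" by (rule divide_right_mono[OF le]) (use s in simp)
 also have "... = A0 * (r / s) ^ DIM('a) * mean f z r" by (simp add: power_divide)
 finally show ?thesis .
qed

definition AH :: "'a::euclidean_space itself => real" where "AH _ = A0 * 3 ^ DIM('a)"

lemma AH_pos: "AH TYPE('a::euclidean_space) > 0" by (simp add: AH_def A0_def)

definition LU :: "'a::euclidean_space itself => real" where
 "LU _ = AH TYPE('a) * 3 * CG TYPE('a) / I3 TYPE('a)"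

lemma LU_pos: "LU TYPE('a::euclidean_space) > 0"
 using AH_pos[where 'a='a] CG_pos[where 'a='a] I3_pos[where 'a='a] by (simp add: LU_def)

text \<open>Sub-mean value property at \<open>x\<close>, then comparison with the mean over radius
  \<open>3 * s\<close> around the zero \<open>z\<close>, which is at most
  \<open>CG * (3 * s)\<close> because that mean starts from \<open>U z = 0\<close>.\<close>

lemma ac_min_growth:
 fixes U :: "'a::euclidean_space => real"
 assumes U: "ac_min U" and z: "U z = 0"
 shows "U x <= LU TYPE('a) * dist x z"
proof (cases "x = z")
 case False
 define s where "s = dist x z"
 have s: "s > 0" using False by (simp add: s_def)
 have cU: "continuous_on UNIV U" and nn: "!!x. U x >= 0" using U by (auto simp: ac_min_def)
 have "U x * I3 TYPE('a) <= mean U x s" using ac_min_mean_bounds(1)[OF U order_refl, of s x] s by (simp add: mean_0)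
 also have "... <= A0 * (3 * s / s) ^ DIM('a) * mean U z (3 * s)"
  by (rule mean_kernel_le) (use s nn in "auto intro: continuous_on_subset[OF cU] simp: s_def")
 also have "... = AH TYPE('a) * mean U z (3 * s)" using s by (simp add: AH_def)
 also have "... <= AH TYPE('a) * (CG TYPE('a) * (3 * s))"
  using ac_min_mean_bounds(2)[OF U order_refl, of "3 * s" z] s z AH_pos[where 'a='a] by (intro mult_left_mono) (auto simp: mean_0)
 finally have "U x <= AH TYPE('a) * (CG TYPE('a) * (3 * s)) / I3 TYPE('a)" using I3_pos[where 'a='a] by (simp add: pos_le_divide_eq)
 then show ?thesis by (simp add: LU_def s_def mult_ac)
qed (use z in simp)

lemma harnack_of_mean:
 fixes f :: "'a::euclidean_space => real"
 assumes f: "continuous_on (cball x (3 * s)) f" "!!y. y : cball x (3 * s) ==> f y >= 0"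
  and m: "mean f x (3 * s) = f x * I3 TYPE('a)" "mean f y s = f y * I3 TYPE('a)"
  and s: "s > 0" "dist x y <= s"
 shows "f y <= AH TYPE('a) * f x"
proof -
 have "mean f y s <= A0 * (3 * s / s) ^ DIM('a) * mean f x (3 * s)"
  by (rule mean_kernel_le[OF f s(1)]) (use s in "auto simp: dist_commute")
 then have "f y * I3 TYPE('a) <= AH TYPE('a) * f x * I3 TYPE('a)" using m s by (simp add: AH_def)
 then show ?thesis using I3_pos[where 'a='a] by simp
qed

lemma ac_min_harnack:
 fixes U :: "'a::euclidean_space => real"
 assumes U: "ac_min U" and p: "!!v. dist x v < 3 * s ==> U v > 0" and s: "s > 0" "dist x y <= s"
 shows "U y <= AH TYPE('a) * U x"
proof (rule harnack_of_mean[where s = s])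
 show "continuous_on (cball x (3 * s)) U" "!!y. y : cball x (3 * s) ==> U y >= 0"
  using U continuous_on_subset by (auto simp: ac_min_def)
 show "mean U x (3 * s) = U x * I3 TYPE('a)" by (rule ac_min_mean_harmonic[OF U]) (use s p in auto)
 show "mean U y s = U y * I3 TYPE('a)"
 proof (rule ac_min_mean_harmonic[OF U])
  fix v assume "dist y v < s"
  then have "dist x v < 3 * s" using s dist_triangle[of x v y] by linarith
  then show "U v > 0" by (rule p)
 qed (use s in auto)
qed (use s in auto)

lemma mean_cong:
 assumes "!!x. x : cball z r ==> f x = f' x" "r >= 0"
 shows "mean f z r = mean f' z r"
 unfolding mean_def
proof (rule Bochner_Integration.integral_cong[OF refl])
 fix y :: 'a
 show "f (z + r *R y) * bump 3 y = f' (z + r *R y) * bump 3 y"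
 proof (cases "norm y <= 1")
  case True
  then have "z + r *R y : cball z r" using assms(2) by (simp add: dist_norm mult_left_le)
  then show ?thesis using assms(1) by simp
 qed (simp add: bump_zero)
qed

lemma harmonic_mean_value:
 fixes f :: "'a::euclidean_space => real"
 assumes f: "C2on S f g (%_. 0)" and S: "open S" "cball z r \<subseteq> S" and r: "r >= 0"
 shows "mean f z r = f z * I3 TYPE('a)"
proof -
 \<comment> \<open>The lemmas on means ask for continuity on the whole space; composing with the
   projection onto the ball extends \<open>f\<close> without changing it there.\<close>
 define F where "F = f \<circ> closest_point (cball z r)"
 have ne: "cball z r ~= {}" using r by simp
 have F: "F x = f x" if "x : cball z r" for x using that by (simp add: F_def closest_point_self)
 have cf: "continuous_on (cball z r) f" using C2on_continuous(1)[OF f] S continuous_on_subset by blast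
 have cF: "continuous_on UNIV F" unfolding F_def
  by (intro continuous_on_compose continuous_on_closest_point continuous_on_subset[OF cf])
   (use ne closest_point_in_set[OF closed_cball ne] in auto)
 have "dmean F z s = 0" if s: "0 < s" "s < r" for s
 proof -
  have K: "cball z s \<subseteq> S" "cball z s \<subseteq> cball z r" using s S by auto
  have "LI (%x. f x * (lap0 ((x - z) /\<^sub>R s) / s)) = LI (%x. (s * psi0 ((x - z) /\<^sub>R s)) * 0)"
  proof (rule green_compact_support(1)[OF f C2on_scale[OF C2on_psi0 s(1)] S(1) compact_cball K(1)])
   fix x assume "x ~: cball z s"
   then have "norm ((x - z) /\<^sub>R s) >= 1" using norm_scaled_ge[of s x z] s by (simp add: dist_commute)
   then show "s * psi0 ((x - z) /\<^sub>R s) = 0" by (simp add: psi0_def bump_zero)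
  qed
  then have 0: "LI (%x. f x * lap0 ((x - z) /\<^sub>R s)) = 0" using s by simp
  have "F x * lap0 ((x - z) /\<^sub>R s) = f x * lap0 ((x - z) /\<^sub>R s)" for x
  proof (cases "x : cball z s")
   case True then show ?thesis using F K by auto
  next
   case False
   then have "norm ((x - z) /\<^sub>R s) >= 1" using norm_scaled_ge[of s x z] s by (simp add: dist_commute)
   then show ?thesis by (simp add: lap0_zero)
  qed
  then have "(%x. F x * lap0 ((x - z) /\<^sub>R s)) = (%x. f x * lap0 ((x - z) /\<^sub>R s))" by blast
  then show ?thesis using 0 by (simp add: mean_eq(2)[OF s(1)])
 qed
 then have "mean F z r = F z * I3 TYPE('a)"
  using mean_diff_bounds[OF cF order_refl r, of 0 z 0] mean_0[of F z] by simp
 moreover have "mean F z r = mean f z r" by (rule mean_cong[OF F r])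
 ultimately show ?thesis using F[of z] r by simp
qed

lemma harmonic_harnack:
 fixes f :: "'a::euclidean_space => real"
 assumes f: "C2on S f g (%_. 0)" and S: "open S" "cball x (3 * s) \<subseteq> S"
  and nn: "!!y. y : cball x (3 * s) ==> f y >= 0" and s: "s > 0" "dist x y <= s"
 shows "f y <= AH TYPE('a) * f x"
proof (rule harnack_of_mean[where s = s])
 show "continuous_on (cball x (3 * s)) f" using C2on_continuous(1)[OF f] S continuous_on_subset by blast
 have "cball y s \<subseteq> cball x (3 * s)"
  using s by (intro cball_subset_cball_iff[THEN iffD2] disjI1) (simp add: dist_commute)
 then show "mean f x (3 * s) = f x * I3 TYPE('a)" "mean f y s = f y * I3 TYPE('a)"
  using S s by (auto intro!: harmonic_mean_value[OF f S(1)])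
qed (use s nn in auto)

text \<open>If \<open>U x\<close> were small compared with \<open>r\<close>, Harnack would put
  \<open>U\<close> below a small multiple of \<open>psi0\<close> on a third of the ball; cutting it
  off there saves a fixed volume at a quadratically small energy cost.\<close>

lemma ac_min_nondegenerate:
 "EX c>0. ALL U (x::'a::euclidean_space) r. ac_min U --> r > 0 --> (ALL y. dist x y < r --> U y > 0) --> c * r <= U x"
proof -
 define v where "v = measure lborel (ball (0::'a) (1/3))"
 have v: "v > 0" unfolding v_def by (rule content_ball_pos) auto
 \<comment> \<open>Solves \<open>v = ta^2 * (G0 + 1)\<close> for \<open>V 0\<close> with
   \<open>ta = 16 * AH * V 0\<close>, hence the 256; \<open>G0 + 1\<close> avoids a zero
   denominator.\<close>
 define c where "c = sqrt (v / (256 * (AH TYPE('a))\<^sup>2 * (G0 TYPE('a) + 1)))"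
 have A: "AH TYPE('a) > 0" by (rule AH_pos)
 have G: "G0 TYPE('a) >= 0" by (rule G0_nonneg)
 have den: "256 * (AH TYPE('a))\<^sup>2 * (G0 TYPE('a) + 1) > 0" using A G by simp
 have c: "c > 0" using v den unfolding c_def by simp
 have "c * r <= U x" if U: "ac_min U" and r: "r > 0" and p: "ALL y. dist x y < r --> U y > 0" for U and x :: 'a and r
 proof -
  define V where "V = rescale U x r"
  have V: "ac_min V" unfolding V_def by (rule ac_min_rescale[OF U r])
  have pV: "V y > 0" if "norm y < 1" for y
  proof -
   have "r * norm y < r * 1" using that r by (intro mult_strict_left_mono) auto
   then have "dist x (x + r *R y) < r" using r by (simp add: dist_norm)
   then show ?thesis using p r by (simp add: V_def rescale_def)
  qed
  have I: "LI (%x. V x * lap0 x) = 0" by (rule ac_min_harmonic[OF V pV])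
  \<comment> \<open>On radius 1/3 the test function is at least 1/16, so \<open>ta * psi0\<close> is
    at least the Harnack bound \<open>AH * V 0\<close>.\<close>
  define ta where "ta = 16 * AH TYPE('a) * V 0"
  have t: "ta > 0" using A pV[of 0] by (simp add: ta_def)
  have le: "V y <= ta * psi0 y" if "norm y < 1/3" for y
  proof -
   have "V y <= AH TYPE('a) * V 0"
    by (rule ac_min_harnack[OF V, where s = "1/3"]) (use pV that in "auto simp: dist_norm")
   moreover have "psi0 y >= 1/16"
   proof -
    have "bump 4 y >= (1 - (1/3)\<^sup>2) ^ 4" using bump_ge[of y "1/3" 4] that by simp
    moreover have "(1 - (1/3)\<^sup>2) ^ 4 >= (1/2::real)" by (simp add: power2_eq_square power4_eq_xxxx)
    ultimately show ?thesis by (simp add: psi0_def)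
   qed
   moreover have "ta * (1/16) = AH TYPE('a) * V 0" by (simp add: ta_def)
   moreover have "ta * (1/16) <= ta * psi0 y" using t \<open>psi0 y >= 1/16\<close> by (intro mult_left_mono) auto
   ultimately show ?thesis by linarith
  qed
  have [measurable]: "V : borel_measurable borel" "psi0 : borel_measurable (borel :: 'a measure)"
   using V psi0_continuous[OF continuous_on_id, of UNIV] borel_measurable_continuous_onI by (auto simp: ac_min_def)
  have "v <= measure lborel {y. 0 < V y & V y <= ta * psi0 y}" unfolding v_def
  proof (rule measure_mono_fmeasurable)
   have "{y. 0 < V y & V y <= ta * psi0 y} \<subseteq> cball 0 1"
   proof
    fix y assume y: "y : {y. 0 < V y & V y <= ta * psi0 y}"
    show "y : cball 0 1"
    proof (rule ccontr)
     assume "y ~: cball 0 1"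
     then have "psi0 y = 0" by (simp add: psi0_def bump_zero)
     moreover have "0 < V y" "V y <= ta * psi0 y" using y by auto
     ultimately show False by simp
    qed
   qed
   from emeasure_bounded_finite[OF bounded_subset[OF bounded_cball this]]
   show "{y. 0 < V y & V y <= ta * psi0 y} : fmeasurable lborel" by (intro fmeasurableI) auto
   show "ball 0 (1/3) \<subseteq> {y. 0 < V y & V y <= ta * psi0 y}" using le pV by auto
  qed auto
  also have "... <= ta\<^sup>2 * G0 TYPE('a)" using ac_min_lower[OF V t] I by simp
  also have "... <= ta\<^sup>2 * (G0 TYPE('a) + 1)" by (intro mult_left_mono) auto
  finally have "v <= (V 0)\<^sup>2 * (256 * (AH TYPE('a))\<^sup>2 * (G0 TYPE('a) + 1))" by (simp add: ta_def power_mult_distrib mult_ac)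
  then have "v / (256 * (AH TYPE('a))\<^sup>2 * (G0 TYPE('a) + 1)) <= (V 0)\<^sup>2" using den by (simp add: pos_divide_le_eq)
  then have "c <= V 0" unfolding c_def using pV[of 0] by (intro real_le_lsqrt) auto
  then show ?thesis using r by (simp add: V_def rescale_def pos_le_divide_eq)
 qed
 then show ?thesis using c by blast
qed

section \<open>From weak to smooth competitors\<close>

lemma lebesgue_integrable_of_lborel:
 fixes f :: "'a::euclidean_space => 'b::euclidean_space"
 assumes "integrable lborel f"
 shows "integrable lebesgue f" "integral\<^sup>L lebesgue f = LI f"
 using assms integrable_completion[of f lborel] integral_completion[of f lborel] by auto

lemma continuous_lebesgue_measurable:
 fixes f :: "'a::euclidean_space => 'b::euclidean_space"
 assumes "continuous_on UNIV f"
 shows "f : borel_measurable lebesgue"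
 using borel_measurable_continuous_onI[OF assms] by (simp add: measurable_completion)

text \<open>Local square integrability gives local integrability through |g| <= 1 + |g|^2.\<close>

lemma H1_loc_integrable_mult:
 fixes gU :: "'a::euclidean_space => 'a"
 assumes H: "H1_loc U gU" and f: "continuous_on UNIV f" and K: "compact K" "!!x. x ~: K ==> f x = (0::real)"
 shows "integrable lebesgue (%x. (gU x *. b) * f x)"
proof -
 have "bounded (f ` K)" using compact_continuous_image[OF continuous_on_subset[OF f] K(1)] compact_imp_bounded by auto
 then obtain M where M: "!!x. x : K ==> norm (f x) <= M" "M > 0" unfolding bounded_pos by auto
 have gm: "gU : borel_measurable lebesgue" using H by (simp add: H1_loc_def)
 have i1: "integrable lebesgue (%x. indicator K x *R (norm (gU x))\<^sup>2)"
  using H K(1) by (simp add: H1_loc_def set_integrable_def)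
 have "integrable lborel (indicator K :: 'a => real)"
  using emeasure_bounded_finite[OF compact_imp_bounded[OF K(1)]] compact_imp_closed[OF K(1)]
  by (intro integrable_real_indicator) auto
 then have i2: "integrable lebesgue (indicator K :: 'a => real)" by (rule lebesgue_integrable_of_lborel)
 have "integrable lebesgue (%x. (M * norm b) * (indicator K x + indicator K x *R (norm (gU x))\<^sup>2))"
  by (intro integrable_mult_right bi_add i1 i2)
 then show ?thesis
 proof (rule Bochner_Integration.integrable_bound)
  show "(%x. (gU x *. b) * f x) : borel_measurable lebesgue"
   using gm continuous_lebesgue_measurable[OF f] by simp
  show "AE x in lebesgue. norm ((gU x *. b) * f x) <= norm ((M * norm b) * (indicator K x + indicator K x *R (norm (gU x))\<^sup>2))"
  proof (intro AE_I2)
   fix x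
   show "norm ((gU x *. b) * f x) <= norm ((M * norm b) * (indicator K x + indicator K x *R (norm (gU x))\<^sup>2))"
   proof (cases "x : K")
    case True
    have "abs (gU x *. b) * abs (f x) <= (norm (gU x) * norm b) * M"
     using M(1)[OF True] by (intro mult_mono Cauchy_Schwarz_ineq2) auto
    also have "... <= ((1 + (norm (gU x))\<^sup>2) * norm b) * M"
    proof (intro mult_right_mono)
     have "0 <= (norm (gU x) - 1/2)\<^sup>2" by simp
     then show "norm (gU x) <= 1 + (norm (gU x))\<^sup>2" by (simp add: power2_eq_square algebra_simps)
    qed (use M in auto)
    also have "... = norm ((M * norm b) * (indicator K x + indicator K x *R (norm (gU x))\<^sup>2))"
     using True M(2) by (simp add: abs_mult mult_ac)
    finally show ?thesis by (simp add: abs_mult)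
   qed (use K in simp)
  qed
 qed
qed

lemma weak_gradient_add_C2:
 fixes U :: "'a::euclidean_space => real"
 assumes H: "H1_loc U gU" and U: "continuous_on UNIV U" and C: "C2on UNIV psi g l"
 shows "weak_gradient (%x. U x + psi x) (%x. gU x + g x)"
 unfolding weak_gradient_def
proof (intro ballI allI impI)
 fix b :: 'a and xi :: "'a => real" assume b: "b : Basis" and t: "test_fun xi"
 note cp = C2on_continuous[OF C]
 define K where "K = closure {x. xi x ~= 0}"
 have K: "compact K" using t by (simp add: K_def test_fun_def)
 have z: "xi x = 0" if "x ~: K" for x using that closure_subset[of "{x. xi x ~= 0}"] unfolding K_def by blast
 define D where "D x = frechet_derivative xi (at x)" for x
 have d: "(xi has_derivative D x) (at x)" for x
  using t unfolding test_fun_def D_def using frechet_derivative_works by blast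
 have cxi: "continuous_on UNIV xi" by (intro continuous_at_imp_continuous_on ballI has_derivative_continuous[OF d])
 have cD: "continuous_on UNIV (%x. D x b)" using t b unfolding test_fun_def D_def by blast
 have dz: "D x b = 0" if "x ~: K" for x
 proof -
  have oK: "open (- K)" using compact_imp_closed[OF K] by (simp add: open_Compl)
  have "(xi has_derivative (%h. 0)) (at x)"
   by (rule has_derivative_transform_within_open[of "%x. 0" _ x UNIV "- K"]) (use oK that z in auto)
  then have "D x = (%h. 0)" using d has_derivative_unique by blast
  then show ?thesis by simp
 qed
 have ic: "integrable lborel F" if "continuous_on UNIV F" "!!x. x ~: K ==> F x = 0" for F :: "'a => real"
  by (rule integrable_cts_compact[OF K continuous_on_subset[OF that(1)] that(2)]) auto
 have iU: "integrable lborel (%x. U x * D x b)" "integrable lborel (%x. psi x * D x b)" "integrable lborel (%x. (g x *. b) * xi x)"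
  by (rule ic, intro continuous_intros U cD cp cxi, simp add: dz z)+
 have "LI (%x. psi x * D x b + (g x *. b) * xi x) = 0"
 proof (rule integral_directional_derivative_zero[where S = UNIV and K = K and f = "%x. psi x * xi x" and D = "%x h. psi x * D x h + (g x *. h) * xi x" and b = b])
  show "((%x. psi x * xi x) has_derivative (%h. psi x * D x h + (g x *. h) * xi x)) (at x)" for x
   by (rule has_derivative_mult[OF C2on_deriv[OF C UNIV_I] d])
  show "continuous_on UNIV (%x. psi x * D x b + (g x *. b) * xi x)" by (intro continuous_intros cp cD cxi)
 qed (use K z dz in auto)
 then have 1: "LI (%x. psi x * D x b) = - LI (%x. (g x *. b) * xi x)"
  using iU by simp
 have 2: "integral\<^sup>L lebesgue (%x. U x * D x b) = - integral\<^sup>L lebesgue (%x. (gU x *. b) * xi x)"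
  using H b t unfolding H1_loc_def weak_gradient_def D_def by blast
 note iL = lebesgue_integrable_of_lborel[OF iU(1)] lebesgue_integrable_of_lborel[OF iU(2)] lebesgue_integrable_of_lborel[OF iU(3)]
 have "integral\<^sup>L lebesgue (%x. (U x + psi x) * D x b) = integral\<^sup>L lebesgue (%x. U x * D x b) + integral\<^sup>L lebesgue (%x. psi x * D x b)"
  using iL by (simp add: distrib_right)
 also have "... = - (integral\<^sup>L lebesgue (%x. (gU x *. b) * xi x) + integral\<^sup>L lebesgue (%x. (g x *. b) * xi x))"
  using 1 2 iL by simp
 also have "integral\<^sup>L lebesgue (%x. (gU x *. b) * xi x) + integral\<^sup>L lebesgue (%x. (g x *. b) * xi x)
   = integral\<^sup>L lebesgue (%x. ((gU x + g x) *. b) * xi x)"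
  using H1_loc_integrable_mult[OF H cxi K z] iL by (simp add: inner_add_left distrib_right)
 finally show "integral\<^sup>L lebesgue (%x. (U x + psi x) * frechet_derivative xi (at x) b) = - integral\<^sup>L lebesgue (%x. ((gU x + g x) *. b) * xi x)"
  by (simp add: D_def)
qed

lemma H1_loc_add_C2:
 fixes U :: "'a::euclidean_space => real"
 assumes H: "H1_loc U gU" and U: "continuous_on UNIV U" and C: "C2on UNIV psi g l"
 shows "H1_loc (%x. U x + psi x) (%x. gU x + g x)"
 unfolding H1_loc_def
proof (intro conjI allI impI)
 note cp = C2on_continuous[OF C]
 have gm: "gU : borel_measurable lebesgue" using H by (simp add: H1_loc_def)
 have gm': "g : borel_measurable lebesgue" by (rule continuous_lebesgue_measurable[OF cp(2)])
 show "(%x. U x + psi x) : borel_measurable lebesgue"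
  by (intro continuous_lebesgue_measurable continuous_intros U cp)
 show m: "(%x. gU x + g x) : borel_measurable lebesgue" using gm gm' by simp
 show "weak_gradient (%x. U x + psi x) (%x. gU x + g x)" by (rule weak_gradient_add_C2[OF assms])
 fix K :: "'a set" assume K: "compact K"
 have "integrable lborel (%x. indicator K x *R (U x + psi x)\<^sup>2)"
  by (intro borel_integrable_compact[OF K] continuous_intros continuous_on_subset[OF U] continuous_on_subset[OF cp(1)]) auto
 then show "set_integrable lebesgue K (%x. (U x + psi x)\<^sup>2)"
  unfolding set_integrable_def by (rule lebesgue_integrable_of_lborel)
 have "integrable lborel (%x. indicator K x *R (norm (g x))\<^sup>2)"
  by (intro borel_integrable_compact[OF K] continuous_intros continuous_on_subset[OF cp(2)]) auto
 then have i2: "integrable lebesgue (%x. indicator K x *R (norm (g x))\<^sup>2)" by (rule lebesgue_integrable_of_lborel)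
 have i1: "integrable lebesgue (%x. indicator K x *R (norm (gU x))\<^sup>2)"
  using H K by (simp add: H1_loc_def set_integrable_def)
 have "integrable lebesgue (%x. 2 * (indicator K x *R (norm (gU x))\<^sup>2) + 2 * (indicator K x *R (norm (g x))\<^sup>2))"
  by (intro integrable_mult_right bi_add i1 i2)
 then show "set_integrable lebesgue K (%x. (norm (gU x + g x))\<^sup>2)" unfolding set_integrable_def
 proof (rule Bochner_Integration.integrable_bound)
  have "K : sets lebesgue" using K by (simp add: lmeasurable_compact fmeasurableD)
  then show "(%x. indicator K x *R (norm (gU x + g x))\<^sup>2) : borel_measurable lebesgue"
   using m by measurable
  show "AE x in lebesgue. norm (indicator K x *R (norm (gU x + g x))\<^sup>2)
    <= norm (2 * (indicator K x *R (norm (gU x))\<^sup>2) + 2 * (indicator K x *R (norm (g x))\<^sup>2))"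
  proof (intro AE_I2)
   fix x
   have "(norm (gU x + g x))\<^sup>2 <= (norm (gU x) + norm (g x))\<^sup>2" by (intro power_mono norm_triangle_ineq) auto
   also have "... <= 2 * (norm (gU x))\<^sup>2 + 2 * (norm (g x))\<^sup>2"
    using sum_squares_bound[of "norm (gU x)" "norm (g x)"] by (simp add: power2_eq_square algebra_simps)
   finally show "norm (indicator K x *R (norm (gU x + g x))\<^sup>2)
    <= norm (2 * (indicator K x *R (norm (gU x))\<^sup>2) + 2 * (indicator K x *R (norm (g x))\<^sup>2))"
    by (auto simp: indicator_def)
  qed
 qed
qed

text \<open>The components of \<open>g\<close>, the gradient of \<open>psi\<close>, are C^1 with
  compact support, hence admissible in the definition of the weak gradient; testing with them turns
  the cross term of the energy into the integral of \<open>- U x * l x\<close>.\<close>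

lemma global_minimizer_imp_ac_min:
 fixes U :: "'a::euclidean_space => real"
 assumes G: "global_minimizer U"
 shows "ac_min U"
 unfolding ac_min_def
proof (intro conjI allI impI)
 show U: "continuous_on UNIV U" using G by (simp add: global_minimizer_def)
 show "U x >= 0" for x using G by (simp add: global_minimizer_def)
 obtain gU where H: "H1_loc U gU" using G by (auto simp: global_minimizer_def)
 fix psi :: "'a => real" and g l and R :: real
 assume C: "C2on UNIV psi g l" and zR: "ALL x. R <= norm x --> psi x = 0"
 note cp = C2on_continuous[OF C]
 define K where "K = cball (0::'a) \<bar>R\<bar>"
 \<comment> \<open>Strictly larger than the support radius: the competitor must agree with
   \<open>U\<close> off an open ball of positive radius, while \<open>R\<close> may be
   nonpositive.\<close>
 define R1 where "R1 = abs (R) + 1"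
 define B where "B = ball (0::'a) R1"
 have K: "compact K" "K \<subseteq> B" by (auto simp: K_def B_def R1_def)
 have z: "psi x = 0" if "x ~: K" for x using that zR by (auto simp: K_def)
 note z' = C2on_zero_off_compact[OF C K(1) z]
 have le: "AC_energy U gU R1 <= AC_energy (%x. U x + psi x) (%x. gU x + g x) R1"
 proof -
  have "psi x = 0" if "x ~: ball 0 R1" for x using z[of x] K(2) that unfolding B_def by blast
  then have "R1 > 0" "ALL x. x ~: ball 0 R1 --> U x + psi x = U x" by (auto simp: R1_def)
  then show ?thesis using G H H1_loc_add_C2[OF H U C] unfolding global_minimizer_def by blast
 qed
 obtain X where X: "!!x. (g has_derivative X x) (at x)"
   "!!x. l x = (\<Sum>b\<in>Basis. X x b *. b)" "!!b. b : Basis ==> continuous_on UNIV (%x. X x b)"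
  using C unfolding C2on_def by blast
 have gb: "((%x. g x *. b) has_derivative (%h. X x h *. b)) (at x)" for b x by (rule has_derivative_inner_left[OF X(1)])
 have fd: "frechet_derivative (%x. g x *. b) (at x) = (%h. X x h *. b)" for b x using frechet_derivative_at[OF gb] by simp
 have Xz: "X x b = 0" if "x ~: K" for x b
 proof -
  have oK: "open (- K)" using compact_imp_closed[OF K(1)] by (simp add: open_Compl)
  have "(g has_derivative (%h. 0)) (at x)"
   by (rule has_derivative_transform_within_open[of "%x. 0" _ x UNIV "- K"]) (use oK that z' in auto)
  then have "X x = (%h. 0)" using X(1) has_derivative_unique by blast
  then show ?thesis by simp
 qed
 have ib: "integral\<^sup>L lebesgue (%x. (gU x *. b) * (g x *. b)) = - LI (%x. U x * (X x b *. b))"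
  "integrable lebesgue (%x. (gU x *. b) * (g x *. b))" "integrable lborel (%x. U x * (X x b *. b))" if b: "b : Basis" for b
 proof -
  have "test_fun (%x. g x *. b)" unfolding test_fun_def
  proof (intro conjI allI ballI)
   show "(%x. g x *. b) differentiable at x" for x using gb differentiable_def by blast
   show "continuous_on UNIV (%x. frechet_derivative (%x. g x *. b) (at x) c)" if "c : Basis" for c
    unfolding fd by (intro continuous_intros X(3) that)
   have "{x. g x *. b ~= 0} \<subseteq> K"
   proof
    fix x assume x: "x : {x. g x *. b ~= 0}"
    show "x : K" by (rule ccontr) (use x z'(1)[of x] in simp)
   qed
   then have "bounded {x. g x *. b ~= 0}" by (rule bounded_subset[OF compact_imp_bounded[OF K(1)]])
   then show "compact (closure {x. g x *. b ~= 0})" by (simp add: compact_closure)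
  qed
  moreover have "weak_gradient U gU" using H by (simp add: H1_loc_def)
  ultimately have "integral\<^sup>L lebesgue (%x. U x * frechet_derivative (%x. g x *. b) (at x) b) = - integral\<^sup>L lebesgue (%x. (gU x *. b) * (g x *. b))"
   using b unfolding weak_gradient_def by blast
  then have "integral\<^sup>L lebesgue (%x. U x * (X x b *. b)) = - integral\<^sup>L lebesgue (%x. (gU x *. b) * (g x *. b))"
   by (simp only: fd)
  moreover show i: "integrable lborel (%x. U x * (X x b *. b))"
   by (rule integrable_cts_compact[OF K(1)])
    (use Xz in "auto intro!: continuous_intros continuous_on_subset[OF U] continuous_on_subset[OF X(3)[OF b]]")
  ultimately show "integral\<^sup>L lebesgue (%x. (gU x *. b) * (g x *. b)) = - LI (%x. U x * (X x b *. b))"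
   using lebesgue_integrable_of_lborel[OF i] by simp
  show "integrable lebesgue (%x. (gU x *. b) * (g x *. b))"
   by (rule H1_loc_integrable_mult[OF H _ K(1)]) (use z' in "auto intro!: continuous_intros cp")
 qed
 have e1: "(%x. gU x *. g x) = (%x. \<Sum>b\<in>Basis. (gU x *. b) * (g x *. b))" by (rule ext) (rule euclidean_inner)
 have ig: "integrable lebesgue (%x. gU x *. g x)" unfolding e1 by (intro Bochner_Integration.integrable_sum ib)
 have "integral\<^sup>L lebesgue (%x. gU x *. g x) = (\<Sum>b\<in>Basis. integral\<^sup>L lebesgue (%x. (gU x *. b) * (g x *. b)))"
  unfolding e1 by (rule Bochner_Integration.integral_sum) (rule ib(2))
 also have "... = (\<Sum>b\<in>Basis. - LI (%x. U x * (X x b *. b)))" by (rule sum.cong[OF refl ib(1)])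
 also have "... = - (\<Sum>b\<in>Basis. LI (%x. U x * (X x b *. b)))" by (rule sum_negf)
 also have "(\<Sum>b\<in>Basis. LI (%x. U x * (X x b *. b))) = LI (%x. \<Sum>b\<in>Basis. U x * (X x b *. b))"
  by (rule Bochner_Integration.integral_sum[symmetric]) (rule ib(3))
 also have "... = LI (%x. U x * l x)" by (simp add: X(2) sum_distrib_left)
 finally have cross: "integral\<^sup>L lebesgue (%x. gU x *. g x) = - LI (%x. U x * l x)" .
 have igg: "integrable lborel (%x. g x *. g x)"
  by (rule integrable_cts_compact[OF K(1)]) (use z' in "auto intro!: continuous_intros continuous_on_subset[OF cp(2)]")
 note igg' = lebesgue_integrable_of_lborel[OF igg]
 have iB: "integrable lebesgue (%x. indicator B x *R (norm (gU x))\<^sup>2)"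
 proof -
  have "set_integrable lebesgue (cball 0 R1) (%x. (norm (gU x))\<^sup>2)" using H by (simp add: H1_loc_def)
  from set_integrable_subset[OF this, of B] show ?thesis by (auto simp: B_def set_integrable_def)
 qed
 have "(%x. indicator B x *R (norm (gU x + g x))\<^sup>2) = (%x. indicator B x *R (norm (gU x))\<^sup>2 + (2 * (gU x *. g x) + g x *. g x))"
 proof
  fix x
  show "indicator B x *R (norm (gU x + g x))\<^sup>2 = indicator B x *R (norm (gU x))\<^sup>2 + (2 * (gU x *. g x) + g x *. g x)"
  proof (cases "x : B")
   case True
   then show ?thesis by (simp add: power2_norm_eq_inner inner_add_left inner_add_right inner_commute)
  next
   case False
   then have "g x = 0" using z' K by blast
   then show ?thesis using False by simp
  qed
 qed
 then have "(LINT x:B|lebesgue. (norm (gU x + g x))\<^sup>2) = (LINT x:B|lebesgue. (norm (gU x))\<^sup>2)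
  + (2 * integral\<^sup>L lebesgue (%x. gU x *. g x) + integral\<^sup>L lebesgue (%x. g x *. g x))"
  unfolding set_lebesgue_integral_def
  using bi_iadd[OF iB bi_add[OF integrable_mult_right[OF ig, of 2] igg'(1)]]
   bi_iadd[OF integrable_mult_right[OF ig, of 2] igg'(1)] by simp
 then have en: "measure lebesgue {x : B. U x > 0} <= measure lebesgue {x : B. U x + psi x > 0}
   - 2 * LI (%x. U x * l x) + LI (%x. g x *. g x)"
  using le cross igg'(2) unfolding AC_energy_def B_def[symmetric] by linarith
 have [measurable]: "U : borel_measurable borel" "psi : borel_measurable borel"
  using U cp borel_measurable_continuous_onI by auto
 have mB: "{x : B. f x > 0} : sets borel" "integrable lborel (indicator {x : B. f x > 0} :: 'a => real)"
  if [measurable]: "f : borel_measurable borel" for f :: "'a => real"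
 proof -
  show s: "{x : B. f x > 0} : sets borel" unfolding B_def by measurable
  have "bounded {x : B. f x > 0}" by (rule bounded_subset[OF bounded_ball[of 0 R1]]) (auto simp: B_def)
  from emeasure_bounded_finite[OF this] show "integrable lborel (indicator {x : B. f x > 0} :: 'a => real)"
   using s by (intro integrable_real_indicator) auto
 qed
 have ml: "measure lebesgue {x : B. f x > 0} = LI (indicator {x : B. f x > 0} :: 'a => real)"
  if "f : borel_measurable borel" for f :: "'a => real" using mB(1)[OF that] by simp
 have "(%x. of_bool (U x > 0) - of_bool (U x + psi x > 0) :: real)
  = (%x. indicator {x : B. U x > 0} x - indicator {x : B. U x + psi x > 0} x)"
 proof
  fix x
  show "of_bool (U x > 0) - of_bool (U x + psi x > 0) = (indicator {x : B. U x > 0} x - indicator {x : B. U x + psi x > 0} x :: real)"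
  proof (cases "x : B")
   case False
   then have "psi x = 0" using z K by blast
   then show ?thesis using False by (simp add: indicator_def)
  qed (simp add: indicator_def)
 qed
 then have "LI (%x. of_bool (U x > 0) - of_bool (U x + psi x > 0) :: real)
  = measure lebesgue {x : B. U x > 0} - measure lebesgue {x : B. U x + psi x > 0}"
  using bi_idiff[OF mB(2)[of U] mB(2)[of "%x. U x + psi x"]] ml[of U] ml[of "%x. U x + psi x"] by simp
 then show "LI (%x. of_bool (U x > 0) - of_bool (U x + psi x > 0) :: real)
     <= LI (%x. g x *. g x) - 2 * LI (%x. U x * l x)"
  using en by linarith
qed

section \<open>Interior regularity\<close>

lemma lborel_param_continuous:
 fixes k :: "'b::euclidean_space => 'a::euclidean_space => 'c::euclidean_space"
 assumes c: "continuous_on (S \<times> UNIV) (%(s, x). k s x)"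
  and z: "!!s x. s : S ==> norm x > R ==> k s x = 0"
 shows "continuous_on S (%s. LI (k s))" "!!s. s : S ==> integrable lborel (k s)"
proof -
 obtain a b :: 'a where ab: "cball 0 R \<subseteq> cbox a b"
  using bounded_subset_cbox_symmetric[OF bounded_cball] by metis
 have ck: "continuous_on T (k s)" if "s : S" for s T
 proof -
  have "continuous_on T ((%(s, x). k s x) \<circ> (%x. (s, x)))"
   by (rule continuous_on_compose) (auto intro!: continuous_intros continuous_on_subset[OF c] that)
  then show ?thesis by (simp add: o_def)
 qed
 have out: "k s x = 0" if "s : S" "x ~: cbox a b" for s x
 proof -
  have "norm x > R" using that ab by (meson mem_cball_0 not_le subsetD)
  then show ?thesis using z that by blast
 qed
 show "integrable lborel (k s)" if "s : S" for s
  by (rule integral_lborel_eq_cbox(2)[OF ck[OF that] out[OF that]])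
 have 1: "integral (cbox a b) (k s) = LI (k s)" if "s : S" for s
  by (rule integral_lborel_eq_cbox(1)[OF ck[OF that] out[OF that]])
 have "continuous_on S (%s. integral (cbox a b) (k s))"
  by (rule integral_continuous_on_param) (rule continuous_on_subset[OF c], auto)
 then show "continuous_on S (%s. LI (k s))"
  by (rule continuous_on_eq) (rule 1)
qed

text \<open>By the mean value property \<open>U\<close> equals, near \<open>x0\<close>, its average
  at the fixed radius \<open>r\<close>, an integral against a C^2 kernel, so derivatives fall on the
  kernel. The explicit gradient formula is kept for the gradient bound.\<close>

lemma ac_min_C2_local:
 fixes U :: "'a::euclidean_space => real"
 assumes U: "ac_min U" and r: "r > 0" and p: "!!y. dist x0 y < 2 * r ==> U y > 0"
 shows "EX g H. (ALL x:ball x0 r. (U has_derivative (%h. g x *. h)) (at x) & (g has_derivative H x) (at x))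
  & (ALL b. continuous_on (ball x0 r) (%x. H x b))
  & (ALL x:ball x0 r. ALL e. g x *. e = 6 / (I3 TYPE('a) * r) * LI (%v. U (x + r *R v) * bump 2 v * (v *. e)))"
proof -
 define S where "S = ball x0 r"
 define c where "c = inverse (I3 TYPE('a) * r ^ DIM('a))"
 define w where "w x y = (y - x) /\<^sub>R r" for x y :: 'a
 define R where "R = norm x0 + 2 * r"
 have S: "open S" "convex S" by (auto simp: S_def)
 have I: "I3 TYPE('a) > 0" by (rule I3_pos)
 have cU: "continuous_on UNIV U" using U by (simp add: ac_min_def)
 have out: "norm (w x y) >= 1" if "x : S" "norm y > R" for x y
 proof -
  have "dist x0 x < r" using that by (simp add: S_def)
  moreover have "norm y <= norm x0 + norm (x - x0) + norm (y - x)"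
   using norm_triangle_ineq[of x0 "(x - x0) + (y - x)"] norm_triangle_ineq[of "x - x0" "y - x"] by simp
  ultimately have "r <= dist y x" using that by (simp add: R_def dist_norm norm_minus_commute)
  then show ?thesis unfolding w_def by (rule norm_scaled_ge[OF r])
 qed
 have cw: "continuous_on T (%p. w (f p) (g p))" if "continuous_on T f" "continuous_on T g" for T and f g :: "'z::topological_space => 'a"
  unfolding w_def by (intro continuous_intros that)
 have dw: "((%x. w x y) has_derivative (%h. - (h /\<^sub>R r))) (at x)" for x y
  unfolding w_def by (auto intro!: derivative_eq_intros simp: scaleR_right_diff_distrib)
 \<comment> \<open>\<open>K x y\<close> is the gradient in \<open>x\<close> of the kernel
   \<open>k x y\<close>, and \<open>K2 b x y\<close> is the gradient of the
   \<open>b\<close>-component of \<open>K x y\<close>.\<close>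
 define k where "k x y = (c * U y) * bump 3 (w x y)" for x y
 define K where "K x y = (6 * c * U y * bump 2 (w x y) / r) *R w x y" for x y
 define K2 where "K2 b x y = (6 * c * U y / r\<^sup>2) *R ((4 * bump 1 (w x y) * (w x y *. b)) *R w x y - bump 2 (w x y) *R b)" for b x y
 have cK: "continuous_on (S \<times> UNIV) (%(x, y). K x y)" unfolding K_def split_beta
  by (intro continuous_intros cw continuous_on_compose2[OF cU]) (use r in auto)
 have cK2: "continuous_on (S \<times> UNIV) (%(x, y). K2 b x y)" for b unfolding K2_def split_beta
  by (intro continuous_intros cw continuous_on_compose2[OF cU]) (use r in auto)
 have zK: "K x y = 0" "K2 b x y = 0" "k x y = 0" if "x : S" "norm y > R" for x y b
  using out[OF that] by (simp_all add: K_def K2_def k_def bump_zero)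
 define g where "g x = LI (K x)" for x
 define H where "H x h = (\<Sum>b\<in>Basis. (LI (K2 b x) *. h) *R b)" for x h
 have Uk: "U x = LI (k x)" if "x : S" for x
 proof -
  have "mean U x r = U x * I3 TYPE('a)"
  proof (rule ac_min_mean_harmonic[OF U])
   fix y assume "dist x y < r"
   then show "U y > 0" using that dist_triangle[of x0 y x] by (intro p) (simp add: S_def)
  qed (use r in simp)
  moreover have "mean U x r = LI (%y. U y * bump 3 (w x y)) / r ^ DIM('a)" unfolding w_def by (rule mean_eq(1)[OF r])
  ultimately have "U x = c * LI (%y. U y * bump 3 (w x y))" using I r by (simp add: c_def field_simps)
  moreover have "k x = (%y. c * (U y * bump 3 (w x y)))" by (simp add: k_def fun_eq_iff mult.assoc)
  ultimately show ?thesis by simp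
 qed
 have d1: "(U has_derivative (%h. g x *. h)) (at x)" if x: "x : S" for x
 proof -
  have "((%s. LI (k s)) has_derivative (%h. LI (K x) *. h)) (at x)"
  proof (rule leibniz_lborel[where S = S and R = R])
   fix s y
   have "((%s. bump 3 (w s y)) has_derivative (%h. - (2 * real 3 * bump (3 - 1) (w s y)) * (w s y *. (- (h /\<^sub>R r))))) (at s)"
    by (rule has_derivative_compose[OF dw bump_has_derivative]) simp
   from has_derivative_mult_right[OF this, of "c * U y"]
   show "((%s. k s y) has_derivative (%h. K s y *. h)) (at s)"
    unfolding k_def by (rule has_derivative_eq_rhs) (auto simp: K_def fun_eq_iff divide_inverse)
   show "continuous_on UNIV (k s)" unfolding k_def by (intro continuous_intros cw cU)
  qed (use S x zK cK in auto)
  from has_derivative_transform_within_open[OF this S(1) x] Uk show ?thesis by (simp add: g_def)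
 qed
 have gb: "g x *. e = LI (%y. K x y *. e)" if "x : S" for x e
  unfolding g_def using lborel_param_continuous(2)[OF cK zK(1) that] by simp
 have d2: "(g has_derivative H x) (at x)" if x: "x : S" for x
 proof (subst has_derivative_componentwise_within, intro ballI)
  fix b :: 'a assume b: "b : Basis"
  have "((%s. LI (%y. K s y *. b)) has_derivative (%h. LI (K2 b x) *. h)) (at x)"
  proof (rule leibniz_lborel[where S = S and R = R])
   fix s y
   have 1: "((%s. bump 2 (w s y)) has_derivative (%h. - (2 * real 2 * bump (2 - 1) (w s y)) * (w s y *. (- (h /\<^sub>R r))))) (at s)"
    by (rule has_derivative_compose[OF dw bump_has_derivative]) simp
   have 2: "((%s. w s y *. b) has_derivative (%h. (- (h /\<^sub>R r)) *. b)) (at s)"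
    by (rule has_derivative_inner_left[OF dw])
   from has_derivative_mult_right[OF has_derivative_mult[OF 1 2], of "6 * c * U y / r"]
   show "((%s. K s y *. b) has_derivative (%h. K2 b s y *. h)) (at s)"
    unfolding K_def
    by (rule has_derivative_eq_rhs[OF has_derivative_transform_within_open[OF _ open_UNIV UNIV_I]])
     (auto simp: K2_def fun_eq_iff divide_inverse power2_eq_square inner_diff_left inner_commute algebra_simps)
   show "continuous_on UNIV (%y. K s y *. b)" unfolding K_def by (intro continuous_intros cw cU) (use r in auto)
  qed (use S x zK cK2 in auto)
  from has_derivative_transform_within_open[OF this S(1) x, of "%x. g x *. b"] gb
  have "((%x. g x *. b) has_derivative (%h. LI (K2 b x) *. h)) (at x)" by simp
  moreover have "H x h *. b = LI (K2 b x) *. h" for h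
   using b by (simp add: H_def inner_sum_left inner_Basis if_distrib[of "%t. _ * t"] sum.delta cong: if_cong)
  ultimately show "((%x. g x *. b) has_derivative (%h. H x h *. b)) (at x)" by simp
 qed
 have cH: "continuous_on S (%x. H x b)" for b unfolding H_def
  by (intro continuous_intros lborel_param_continuous(1)[OF cK2 zK(2)])
 have gf: "g x *. e = 6 / (I3 TYPE('a) * r) * LI (%v. U (x + r *R v) * bump 2 v * (v *. e))" if "x : S" for x e
 proof -
  have ww: "w x (x + r *R v) = v" for v using r by (simp add: w_def)
  have "LI (%v. K x (x + r *R v) *. e) = LI (%y. K x y *. e) / r ^ DIM('a)"
   by (rule lborel_scale_integral[OF r])
  moreover have "(%v. K x (x + r *R v) *. e) = (%v. (6 * c / r) * (U (x + r *R v) * bump 2 v * (v *. e)))"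
   by (auto simp: K_def ww fun_eq_iff)
  ultimately have "(6 * c / r) * LI (%v. U (x + r *R v) * bump 2 v * (v *. e)) = (g x *. e) / r ^ DIM('a)"
   using gb[OF that] by simp
  then have "g x *. e = r ^ DIM('a) * ((6 * c / r) * LI (%v. U (x + r *R v) * bump 2 v * (v *. e)))"
   using r by (simp add: field_simps)
  also have "... = 6 / (I3 TYPE('a) * r) * LI (%v. U (x + r *R v) * bump 2 v * (v *. e))"
   using r I by (simp add: c_def field_simps)
  finally show ?thesis .
 qed
 show ?thesis
  by (rule exI[of _ g], rule exI[of _ H]) (use d1 d2 cH gf in "simp add: S_def")
qed

lemma open_pos_set: "ac_min U ==> open {x. U x > 0}"
 unfolding ac_min_def by (intro open_Collect_less continuous_intros) auto

lemma grad_eq: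
 assumes "(f has_derivative (%h. g *. h)) (at x)"
 shows "grad f x = g"
 unfolding grad_def frechet_derivative_at[OF assms, symmetric] by (simp add: euclidean_representation)

lemma ac_min_derivatives:
 fixes U :: "'a::euclidean_space => real"
 assumes U: "ac_min U"
 shows "U x > 0 ==> (U has_derivative (%h. grad U x *. h)) (at x)"
  "U x > 0 ==> (grad U has_derivative hess U x) (at x)"
  "continuous_on {x. U x > 0} (%x. hess U x b)"
proof -
 have *: "(U has_derivative (%h. grad U x *. h)) (at x) & (grad U has_derivative hess U x) (at x)
  & continuous (at x) (%x. hess U x b)" if x: "U x > 0" for x b
 proof -
  obtain r where r: "r > 0" "ball x (2 * r) \<subseteq> {x. U x > 0}"
  proof -
   obtain e where "e > 0" "ball x e \<subseteq> {x. U x > 0}" using open_pos_set[OF U] x open_contains_ball by blast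
   then show thesis using that[of "e/2"] by simp
  qed
  have "!!y. dist x y < 2 * r ==> U y > 0" using r by auto
  from ac_min_C2_local[OF U r(1) this] obtain g H where
   gH: "!!y. y : ball x r ==> (U has_derivative (%h. g y *. h)) (at y)"
    "!!y. y : ball x r ==> (g has_derivative H y) (at y)" "!!b. continuous_on (ball x r) (%x. H x b)" by blast
  have gg: "grad U y = g y" if "y : ball x r" for y by (rule grad_eq[OF gH(1)[OF that]])
  have dg: "(grad U has_derivative H y) (at y)" if "y : ball x r" for y
   by (rule has_derivative_transform_within_open[OF gH(2)[OF that] open_ball that]) (use gg in auto)
  have hh: "hess U y = H y" if "y : ball x r" for y
   unfolding hess_def by (rule frechet_derivative_at[OF dg[OF that], symmetric])
  have "continuous_on (ball x r) (%x. hess U x b)"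
   by (rule continuous_on_eq[OF gH(3)]) (use hh in auto)
  then have "continuous (at x) (%x. hess U x b)" using r by (simp add: continuous_on_eq_continuous_at)
  then show ?thesis using gH(1)[of x] dg[of x] gg[of x] hh[of x] r by simp
 qed
 show "U x > 0 ==> (U has_derivative (%h. grad U x *. h)) (at x)" "U x > 0 ==> (grad U has_derivative hess U x) (at x)"
  using * by blast+
 show "continuous_on {x. U x > 0} (%x. hess U x b)" using * by (intro continuous_at_imp_continuous_on) blast
qed

lemma ac_min_C2on: "ac_min U ==> C2on {x. U x > 0} U (grad U) (%x. \<Sum>b\<in>Basis. hess U x b *. b)"
 by (rule C2onI[where H = "hess U"]) (use ac_min_derivatives in auto)

lemma bump_integral_pos:
 assumes "n > 0" shows "LI (bump n :: 'a::euclidean_space => real) > 0"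
proof -
 let ?B = "cball (0::'a) (1/2)"
 have m: "measure lborel ?B > 0" by (rule content_cball_pos) auto
 have fin: "emeasure lborel ?B < top" using emeasure_bounded_finite[of ?B] by simp
 have "(1 - (1/2)\<^sup>2) ^ n * measure lborel ?B = LI (%y. (1 - (1/2)\<^sup>2) ^ n * indicator ?B y :: real)"
  by simp
 also have "... <= LI (%y::'a. bump n y)"
 proof (rule integral_mono)
  show "integrable lborel (%y. (1 - (1/2)\<^sup>2) ^ n * indicator ?B y :: real)"
   by (intro integrable_mult_right integrable_real_indicator) (use fin in auto)
  show "integrable lborel (%y::'a. bump n y)" using bump_integrable[OF assms] by simp
  show "(1 - (1/2)\<^sup>2) ^ n * indicator ?B y <= bump n y" for y :: 'a
   using bump_ge[of y "1/2" n] bump_nonneg[of n y] by (cases "y : ?B") auto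
 qed
 moreover have "(1 - (1/2)\<^sup>2) ^ n * measure lborel ?B > 0"
  using m by (intro mult_pos_pos) (auto simp: power2_eq_square)
 ultimately show ?thesis by simp
qed

text \<open>Were \<open>sg\<close> times the Laplacian positive at \<open>z\<close>, it would be so
  on a small ball, and Green's identity with a rescaled \<open>psi0\<close> would contradict the
  vanishing first variation. The two signs together give harmonicity.\<close>

lemma ac_min_laplace_nonpos:
 fixes U :: "'a::euclidean_space => real"
 assumes U: "ac_min U" and z: "U z > 0" and sg: "sg : {-1, 1::real}"
 shows "sg * (\<Sum>b\<in>Basis. hess U z b *. b) <= 0"
proof (rule ccontr)
 define l where "l x = (\<Sum>b\<in>Basis. hess U x b *. b)" for x
 assume "~ sg * (\<Sum>b\<in>Basis. hess U z b *. b) <= 0"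
 then have pos: "sg * l z > 0" by (simp add: l_def)
 have C: "C2on {x. U x > 0} U (grad U) l" using ac_min_C2on[OF U] by (simp add: l_def[abs_def])
 have op: "open {x. U x > 0}" by (rule open_pos_set[OF U])
 have "continuous_on {x. U x > 0} (%x. sg * l x)" by (intro continuous_intros C2on_continuous(3)[OF C])
 then have "continuous (at z) (%x. sg * l x)" using op z by (simp add: continuous_on_eq_continuous_at)
 then have "((%x. sg * l x) \<longlongrightarrow> sg * l z) (at z)" by (simp add: continuous_at)
 then have "\<forall>\<^sub>F x in at z. sg * l x > sg * l z / 2" by (rule order_tendstoD) (use pos in simp)
 then obtain e where e: "e > 0" "!!x. dist x z < e ==> x ~= z ==> sg * l x > sg * l z / 2"
  unfolding eventually_at by blast
 obtain e' where e': "e' > 0" "ball z e' \<subseteq> {x. U x > 0}" using op z open_contains_ball by blast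
 define s where "s = min e e' / 2"
 have s: "s > 0" "s < e" "s < e'" using e e' by (auto simp: s_def)
 have "cball z s \<subseteq> ball z e'" using s by auto
 then have K: "cball z s \<subseteq> {x. U x > 0}" using e'(2) by blast
 define xi where "xi x = s * psi0 ((x - z) /\<^sub>R s)" for x
 have Cxi: "C2on UNIV xi (%x. - (bump 3 ((x - z) /\<^sub>R s) *R ((x - z) /\<^sub>R s))) (%x. lap0 ((x - z) /\<^sub>R s) / s)"
  unfolding xi_def by (rule C2on_scale[OF C2on_psi0 s(1)])
 have zxi: "xi x = 0" if "x ~: cball z s" for x
 proof -
  have "norm ((x - z) /\<^sub>R s) >= 1" using norm_scaled_ge[of s x z] s that by (simp add: dist_commute)
  then show ?thesis by (simp add: xi_def psi0_def bump_zero)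
 qed
 note gr = green_compact_support[OF C Cxi op compact_cball K zxi]
 have "dmean U z s = 0"
 proof -
  have "LI (%y. rescale U z s y * lap0 y) = 0"
  proof (rule ac_min_harmonic[OF ac_min_rescale[OF U s(1)]])
   fix x :: 'a assume "norm x < 1"
   then have "z + s *R x : cball z s" using s by (simp add: dist_norm mult_left_le)
   then show "rescale U z s x > 0" using K s by (auto simp: rescale_def)
  qed
  then show ?thesis using s by (simp add: dmean_rescale)
 qed
 then have "LI (%x. U x * (lap0 ((x - z) /\<^sub>R s) / s)) = 0" using s by (simp add: mean_eq(2)[OF s(1)])
 then have 0: "LI (%x. xi x * l x) = 0" using gr(1) by linarith
 have ixi: "integrable lborel xi"
  by (rule integrable_cts_compact[OF compact_cball _ zxi]) (rule continuous_on_subset[OF C2on_continuous(1)[OF Cxi]], simp)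
 have "LI (%x. (sg * l z / 2) * xi x) <= LI (%x. sg * (xi x * l x))"
 proof (rule integral_mono)
  fix x
  show "(sg * l z / 2) * xi x <= sg * (xi x * l x)"
  proof (cases "x : cball z s")
   case True
   then have "sg * l x >= sg * l z / 2" using e(2)[of x] s pos by (cases "x = z") (auto simp: dist_commute)
   moreover have "xi x >= 0" unfolding xi_def using s(1) psi0_nonneg by (intro mult_nonneg_nonneg) auto
   ultimately have "(sg * l z / 2) * xi x <= (sg * l x) * xi x" by (rule mult_right_mono)
   then show ?thesis by (simp add: mult_ac)
  qed (simp add: zxi)
 qed (use ixi gr(3) in auto)
 then have "(sg * l z / 2) * LI xi <= 0" using 0 by simp
 moreover have "LI xi > 0"
 proof -
  have "LI (%y. xi (z + s *R y)) = LI xi / s ^ DIM('a)" by (rule lborel_scale_integral[OF s(1)])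
  moreover have "(%y. xi (z + s *R y)) = (%y. (s/8) * bump 4 y)" using s by (simp add: xi_def psi0_def)
  ultimately have "LI xi = s ^ DIM('a) * ((s/8) * LI (bump 4 :: 'a => real))" using s by (simp add: field_simps)
  also have "... > 0" using s(1) bump_integral_pos[of 4, where 'a='a] by (intro mult_pos_pos) auto
  finally show ?thesis .
 qed
 moreover have "sg * l z / 2 > 0" using pos by linarith
 ultimately show False using mult_pos_pos[of "sg * l z / 2" "LI xi"] by linarith
qed

lemma ac_min_harmonic_C2:
 fixes U :: "'a::euclidean_space => real"
 assumes U: "ac_min U"
 shows "C2on {x. U x > 0} U (grad U) (%_. 0)"
proof (rule C2onI[where H = "hess U"])
 show "0 = (\<Sum>b\<in>Basis. hess U x b *. b)" if "x : {x. U x > 0}" for x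
  using ac_min_laplace_nonpos[OF U, of x 1] ac_min_laplace_nonpos[OF U, of x "-1"] that by simp
qed (use ac_min_derivatives[OF U] in auto)

definition L1 :: "'a::euclidean_space itself => real" where
 "L1 _ = 18 * LU TYPE('a) * LI (bump 2 :: 'a => real) / I3 TYPE('a)"

lemma L1_pos: "L1 TYPE('a::euclidean_space) > 0"
 using LU_pos[where 'a='a] I3_pos[where 'a='a] bump_integral_pos[of 2, where 'a='a] by (simp add: L1_def)

lemma ac_min_zero_set_nearest:
 fixes U :: "'a::euclidean_space => real"
 assumes U: "ac_min U" and z0: "U z0 = 0" and x: "U x > 0"
 obtains z where "U z = 0" "dist x z > 0" "!!y. dist x y < dist x z ==> U y > 0" "dist x z <= dist x z0"
proof -
 have nn: "!!x. U x >= 0" and cU: "continuous_on UNIV U" using U by (auto simp: ac_min_def)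
 have "closed {y. U y = 0}" by (intro closed_Collect_eq continuous_intros cU)
 moreover have "{y. U y = 0} ~= {}" using z0 by auto
 ultimately obtain z where z: "z : {y. U y = 0}" "!!y. y : {y. U y = 0} ==> dist x z <= dist x y"
  using distance_attains_inf[of "{y. U y = 0}" x] by metis
 show thesis
 proof
  show "U z = 0" using z by simp
  show "dist x z > 0" using x z by auto
  show "U y > 0" if "dist x y < dist x z" for y using z(2)[of y] that nn[of y] by force
  show "dist x z <= dist x z0" using z(2) z0 by simp
 qed
qed

text \<open>The gradient formula at half the distance to the zero set: on that ball \<open>U\<close>
  is at most \<open>LU * (3 * r)\<close>, which cancels the factor \<open>1 / r\<close>; 6 times 3
  is the 18 in \<open>L1\<close>.\<close>

lemma ac_min_grad_bound:
 fixes U :: "'a::euclidean_space => real"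
 assumes U: "ac_min U" and z0: "U z0 = 0" and x: "U x > 0"
 shows "norm (grad U x) <= L1 TYPE('a)"
proof -
 obtain z where z: "U z = 0" "dist x z > 0" "!!y. dist x y < dist x z ==> U y > 0"
  using ac_min_zero_set_nearest[OF assms] by metis
 define r where "r = dist x z / 2"
 have r: "r > 0" using z by (simp add: r_def)
 have "!!y. dist x y < 2 * r ==> U y > 0" using z by (simp add: r_def)
 from ac_min_C2_local[OF U r this] obtain g H where
  g': "ALL y:ball x r. (U has_derivative (%h. g y *. h)) (at y) & (g has_derivative H y) (at y)"
   "ALL y:ball x r. ALL e. g y *. e = 6 / (I3 TYPE('a) * r) * LI (%v. U (y + r *R v) * bump 2 v * (v *. e))"
  by blast
 have xb: "x : ball x r" using r by simp
 note g = conjunct1[OF bspec[OF g'(1) xb]] spec[OF bspec[OF g'(2) xb]]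
 have gg: "grad U x = g x" by (rule grad_eq[OF g(1)])
 have nn: "!!x. U x >= 0" and cU: "continuous_on UNIV U" using U by (auto simp: ac_min_def)
 define e where "e = grad U x"
 have "LI (%v. U (x + r *R v) * bump 2 v * (v *. e)) <= LI (%v::'a. (LU TYPE('a) * (3 * r) * norm e) * bump 2 v)"
 proof (rule integral_mono)
  show "integrable lborel (%v. U (x + r *R v) * bump 2 v * (v *. e))"
   by (rule integrable_cts_compact[of "cball 0 1"]) (auto intro!: continuous_intros continuous_on_compose2[OF cU] simp: bump_zero)
  show "integrable lborel (%v::'a. (LU TYPE('a) * (3 * r) * norm e) * bump 2 v)"
   by (intro integrable_mult_right) (use bump_integrable[of 2] in simp)
  fix v :: 'a
  show "U (x + r *R v) * bump 2 v * (v *. e) <= (LU TYPE('a) * (3 * r) * norm e) * bump 2 v"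
  proof (cases "norm v < 1")
   case True
   have "U (x + r *R v) <= LU TYPE('a) * dist (x + r *R v) z" by (rule ac_min_growth[OF U z(1)])
   also have "... <= LU TYPE('a) * (3 * r)"
   proof (intro mult_left_mono)
    have "dist (x + r *R v) z <= dist (x + r *R v) x + dist x z" by (rule dist_triangle)
    moreover have "dist (x + r *R v) x <= r" using True r by (simp add: dist_norm mult_left_le)
    ultimately show "dist (x + r *R v) z <= 3 * r" by (simp add: r_def)
   qed (use LU_pos[where 'a='a] in simp)
   finally have 1: "U (x + r *R v) <= LU TYPE('a) * (3 * r)" .
   have "v *. e <= norm v * norm e" by (rule norm_cauchy_schwarz)
   also have "... <= 1 * norm e" using True by (intro mult_right_mono) auto
   finally have 2: "v *. e <= norm e" by simp
   have "U (x + r *R v) * (v *. e) <= U (x + r *R v) * norm e" using nn 2 by (intro mult_left_mono) auto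
   also have "... <= LU TYPE('a) * (3 * r) * norm e" using 1 by (intro mult_right_mono) auto
   finally have "(U (x + r *R v) * (v *. e)) * bump 2 v <= (LU TYPE('a) * (3 * r) * norm e) * bump 2 v"
    by (intro mult_right_mono bump_nonneg)
   then show ?thesis by (simp add: mult_ac)
  qed (simp add: bump_zero)
 qed
 then have "g x *. e <= 6 / (I3 TYPE('a) * r) * ((LU TYPE('a) * (3 * r) * norm e) * LI (bump 2 :: 'a => real))"
  unfolding g(2) using r I3_pos[where 'a='a] by (intro mult_left_mono) auto
 also have "... = L1 TYPE('a) * norm e" using r I3_pos[where 'a='a] by (simp add: L1_def field_simps)
 finally have "norm e * norm e <= L1 TYPE('a) * norm e" using gg
  by (simp add: e_def power2_norm_eq_inner[symmetric] power2_eq_square)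
 then show ?thesis using L1_pos[where 'a='a] unfolding e_def[symmetric] by (cases "e = 0") auto
qed

section \<open>Free boundary points with bounded Hessian\<close>

text \<open>Only derivatives on the positive side are controlled; the shape of the positivity set
  near \<open>z\<close> is derived from this bound, not assumed.\<close>

definition good :: "('a::euclidean_space => real) => 'a => real => bool" where
 "good U z rh \<longleftrightarrow> rh > 0 & U z = 0 & z : closure {x. U x > 0} & (ALL x:ball z rh. U x > 0 --> onorm (hess U x) <= 1 / rh)"

lemma good_pos: "good U z rh ==> rh > 0" by (simp add: good_def)

lemma grad_lipschitz_segment:
 fixes U :: "'a::euclidean_space => real"
 assumes U: "ac_min U" and g: "good U z rh" and s: "closed_segment x y \<subseteq> {x. U x > 0} Int ball z rh"
 shows "norm (grad U y - grad U x) <= norm (y - x) / rh"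
  "abs (U y - U x - grad U x *. (y - x)) <= (norm (y - x))\<^sup>2 / rh"
proof -
 have rh: "rh > 0" using g by (rule good_pos)
 have lip: "norm (grad U v - grad U x) <= norm (v - x) / rh" if v: "v : closed_segment x y" for v
 proof -
  have "norm (grad U v - grad U x) <= (1 / rh) * norm (v - x)"
  proof (rule differentiable_bound[where S = "closed_segment x y" and f' = "hess U"])
   show "(grad U has_derivative hess U w) (at w within closed_segment x y)" if "w : closed_segment x y" for w
    using ac_min_derivatives(2)[OF U] s that has_derivative_at_withinI by blast
   show "onorm (hess U w) <= 1 / rh" if "w : closed_segment x y" for w
    using g s that unfolding good_def by blast
  qed (use v in auto)
  then show ?thesis by simp
 qed
 show "norm (grad U y - grad U x) <= norm (y - x) / rh" by (rule lip) simp
 have "norm ((U y - grad U x *. y) - (U x - grad U x *. x)) <= (norm (y - x) / rh) * norm (y - x)"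
 proof (rule differentiable_bound[where S = "closed_segment x y" and f' = "%v h. (grad U v - grad U x) *. h" and f = "%v. U v - grad U x *. v"])
  fix w assume w: "w : closed_segment x y"
  have "(U has_derivative (%h. grad U w *. h)) (at w)" using ac_min_derivatives(1)[OF U] s w by blast
  then have "((%v. U v - grad U x *. v) has_derivative (%h. grad U w *. h - grad U x *. h)) (at w)"
   by (intro has_derivative_diff has_derivative_inner_right has_derivative_ident)
  then show "((%v. U v - grad U x *. v) has_derivative (%h. (grad U w - grad U x) *. h)) (at w within closed_segment x y)"
   by (simp add: inner_diff_left has_derivative_at_withinI)
  have "onorm (%h. (grad U w - grad U x) *. h) <= norm (grad U w - grad U x)"
   by (rule onorm_bound) (use Cauchy_Schwarz_ineq2 in auto)
  also have "... <= norm (w - x) / rh" by (rule lip[OF w])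
  also have "... <= norm (y - x) / rh" using segment_bound(1)[OF w] rh by (intro divide_right_mono) auto
  finally show "onorm (%h. (grad U w - grad U x) *. h) <= norm (y - x) / rh" .
 qed auto
 moreover have "(U y - grad U x *. y) - (U x - grad U x *. x) = U y - U x - grad U x *. (y - x)" by (simp add: inner_diff_right)
 ultimately show "abs (U y - U x - grad U x *. (y - x)) <= (norm (y - x))\<^sup>2 / rh" by (simp add: power2_eq_square)
qed

text \<open>Let \<open>t0\<close> be the first zero on the way from \<open>x\<close> to
  \<open>y\<close>. Before it Taylor's formula applies, and its lower bound interpolates between the
  positive numbers \<open>U x\<close> and \<open>U x + A - N\<close>; so \<open>U\<close> stays
  above a fixed \<open>m > 0\<close> up to \<open>t0\<close>, a contradiction.\<close>

lemma capture:
 fixes U :: "'a::euclidean_space => real"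
 assumes U: "ac_min U" and g: "good U z rh" and x: "U x > 0" "x : ball z rh" and y: "y : ball z rh"
  and gt: "U x + grad U x *. (y - x) > (norm (y - x))\<^sup>2 / rh"
 shows "closed_segment x y \<subseteq> {x. U x > 0} Int ball z rh"
proof (rule ccontr)
 assume no: "~ ?thesis"
 have nn: "!!x. U x >= 0" and cU: "continuous_on UNIV U" using U by (auto simp: ac_min_def)
 have rh: "rh > 0" using g by (rule good_pos)
 define p where "p t = x + t *R (y - x)" for t :: real
 have p01: "p t : ball z rh" if "t : {0..1}" for t
 proof -
  have "p t : closed_segment x y" using that by (auto simp: p_def in_segment algebra_simps intro!: exI[of _ t])
  then show ?thesis using closed_segment_subset[OF x(2) y convex_ball] by blast
 qed
 have cp: "continuous_on T (%t. U (p t))" for T unfolding p_def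
  by (intro continuous_on_compose2[OF cU] continuous_intros) auto
 define T where "T = {t : {0..1}. U (p t) = 0}"
 have "T ~= {}"
 proof -
  obtain w where w: "w : closed_segment x y" "~ (U w > 0 & w : ball z rh)" using no by blast
  obtain t where t: "0 <= t" "t <= 1" "w = p t" using w(1) by (auto simp: p_def in_segment algebra_simps)
  then have "U w = 0" using w(2) p01[of t] nn[of w] by force
  then show ?thesis using t by (auto simp: T_def)
 qed
 moreover have "closed T"
 proof -
  have "T = {0..1} Int {t. U (p t) = 0}" by (auto simp: T_def)
  then show ?thesis using closed_Collect_eq[OF cp[of UNIV] continuous_on_const[of UNIV 0]] by (auto intro: closed_Int)
 qed
 moreover have "bdd_below T" by (rule bdd_belowI[of _ 0]) (auto simp: T_def)
 ultimately have t0T: "Inf T : T" by (intro closed_contains_Inf)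
 define t0 where "t0 = Inf T"
 have t0: "0 <= t0" "t0 <= 1" "U (p t0) = 0" using t0T by (auto simp: T_def t0_def)
 have "t0 ~= 0" using t0 x by (auto simp: p_def)
 then have t0p: "t0 > 0" using t0 by simp
 have before: "U (p t) > 0" if "0 <= t" "t < t0" for t
 proof -
  have "t ~: T" using that cInf_lower[OF _ \<open>bdd_below T\<close>, of t] by (auto simp: t0_def)
  then have "U (p t) ~= 0" using that t0 by (auto simp: T_def)
  then show ?thesis using nn[of "p t"] by simp
 qed
 define A where "A = grad U x *. (y - x)"
 define N where "N = (norm (y - x))\<^sup>2 / rh"
 have N: "N >= 0" "U x + A > N" using gt rh by (auto simp: N_def A_def)
 define m where "m = min (U x) (U x + A - N)"
 have m: "m > 0" using N x by (simp add: m_def)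
 have lb: "m <= U (p t)" if t: "t : {0..<t0}" for t
 proof -
  have seg: "closed_segment x (p t) \<subseteq> {x. U x > 0} Int ball z rh"
  proof
   fix w assume "w : closed_segment x (p t)"
   then obtain s where s: "0 <= s" "s <= 1" "w = x + s *R (p t - x)" by (auto simp: in_segment algebra_simps)
   then have w: "w = p (s * t)" by (simp add: p_def)
   have "0 <= s * t" "s * t <= t" using s t by (auto simp: mult_left_le_one_le)
   then show "w : {x. U x > 0} Int ball z rh" using before[of "s * t"] p01[of "s * t"] t t0 w by auto
  qed
  have "U (p t) >= U x + grad U x *. (p t - x) - (norm (p t - x))\<^sup>2 / rh"
   using grad_lipschitz_segment(2)[OF U g seg] by linarith
  moreover have "grad U x *. (p t - x) = t * A" by (simp add: p_def A_def)
  moreover have "(norm (p t - x))\<^sup>2 / rh = t * t * N" by (simp add: p_def N_def power_mult_distrib power2_eq_square)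
  \<comment> \<open>Replacing the quadratic error by its chord makes the lower bound affine in
    \<open>t\<close>, so that its minimum is at an end point.\<close>
  moreover have "t * t * N <= t * N" using t t0 N by (intro mult_right_mono) (auto simp: mult_left_le_one_le)
  ultimately have "U (p t) >= U x + t * A - t * N" by linarith
  also have "U x + t * A - t * N = (1 - t) * U x + t * (U x + A - N)" by (simp add: algebra_simps)
  finally have "U (p t) >= (1 - t) * U x + t * (U x + A - N)" .
  moreover have "(1 - t) * U x >= (1 - t) * m" "t * (U x + A - N) >= t * m"
   using t t0 by (auto intro!: mult_left_mono simp: m_def)
  ultimately show ?thesis by (simp add: algebra_simps)
 qed
 have "m <= U (p t0)"
 proof (rule continuous_ge_on_closure[where S = "{0..<t0}" and f = "%t. U (p t)"])
  show "t0 : closure {0..<t0}" using t0p by simp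
 qed (use cp lb in auto)
 then show False using m t0 by simp
qed

text \<open>Let \<open>de\<close> be the distance to a nearest zero \<open>z'\<close>. Nondegeneracy
  gives \<open>U x >= cN * de\<close>; since \<open>z'\<close> is a zero, \<open>capture\<close>
  must fail there, so the slope towards \<open>z'\<close> has to consume this value up to the error
  \<open>de^2 / rh\<close>.\<close>

lemma grad_lower_bound:
 "EX c. 0 < c & c <= 1/4 & (ALL U z rh (x::'a::euclidean_space). ac_min U --> good U z rh --> dist z x < c * rh --> U x > 0 --> c <= norm (grad U x))"
proof -
 obtain cN where cN: "cN > 0" "!!U (x::'a) r. ac_min U ==> r > 0 ==> (!!y. dist x y < r ==> U y > 0) ==> cN * r <= U x"
  using ac_min_nondegenerate[where 'a='a] by blast
 define c where "c = min (cN / 2) (1/4)"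
 have c: "0 < c" "c <= 1/4" "2 * c <= cN" using cN by (auto simp: c_def min_def)
 have "c <= norm (grad U x)" if U: "ac_min U" and g: "good U z rh" and d: "dist z x < c * rh" and x: "U x > 0" for U z rh and x :: 'a
 proof -
  have rh: "rh > 0" using g by (rule good_pos)
  have z: "U z = 0" using g by (simp add: good_def)
  obtain z' where z': "U z' = 0" "dist x z' > 0" "!!y. dist x y < dist x z' ==> U y > 0" "dist x z' <= dist x z"
   using ac_min_zero_set_nearest[OF U z x] by metis
  define de where "de = dist x z'"
  have de: "de > 0" "de < c * rh" using z' d by (auto simp: de_def dist_commute)
  have Ux: "cN * de <= U x" using cN(2)[OF U de(1)] z'(3) by (simp add: de_def)
  have crh: "c * rh <= rh / 4" using c rh by simp
  have "dist z x < rh" "dist z z' < rh"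
   using d de crh rh dist_triangle[of z z' x] unfolding de_def by linarith+
  then have b: "x : ball z rh" "z' : ball z rh" by auto
  have "~ U x + grad U x *. (z' - x) > (norm (z' - x))\<^sup>2 / rh"
   using capture[OF U g x b] z'(1) by force
  moreover have "norm (z' - x) = de" by (simp add: de_def dist_norm norm_minus_commute)
  ultimately have "U x + grad U x *. (z' - x) <= de\<^sup>2 / rh" by simp
  moreover have "- (grad U x *. (z' - x)) <= norm (grad U x) * de"
   using Cauchy_Schwarz_ineq2[of "grad U x" "z' - x"] \<open>norm (z' - x) = de\<close> by simp
  moreover have "de\<^sup>2 / rh <= c * de" using de rh by (simp add: power2_eq_square pos_divide_le_eq)
  ultimately have "cN * de - c * de <= norm (grad U x) * de" using Ux by linarith
  then have "cN - c <= norm (grad U x)" using de by (simp flip: left_diff_distrib)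
  then show ?thesis using c by linarith
 qed
 then show ?thesis using c by blast
qed

lemma zero_set_borel: "ac_min U ==> {x : ball z r. U x = 0} : sets borel"
proof -
 assume "ac_min U"
 then have [measurable]: "U : borel_measurable borel" using borel_measurable_continuous_onI by (auto simp: ac_min_def)
 show ?thesis by measurable
qed

text \<open>\<open>ac_min_upper\<close> with \<open>ta\<close> chosen so that the quadratic term
  uses up at most half of the linear gain.\<close>

lemma zero_set_density:
 fixes U :: "'a::euclidean_space => real"
 assumes U: "ac_min U" and s: "s > 0" and c: "c > 0" and d: "c * s <= dmean U z s"
 shows "c\<^sup>2 / (G0 TYPE('a) + 1) * s ^ DIM('a) <= measure lborel {x : ball z s. U x = 0}"
proof -
 define V where "V = rescale U z s"
 have V: "ac_min V" unfolding V_def by (rule ac_min_rescale[OF U s])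
 define G where "G = G0 TYPE('a)"
 have G: "G >= 0" unfolding G_def by (rule G0_nonneg)
 have I: "c <= LI (%x. V x * lap0 x)" using d s by (simp add: dmean_rescale V_def)
 define ta where "ta = c / (G + 1)"
 have ta: "ta > 0" using c G by (simp add: ta_def)
 have "2 * ta * c <= 2 * ta * LI (%x. V x * lap0 x)" using I ta by simp
 also have "... <= ta\<^sup>2 * G + measure lborel {x : ball 0 1. V x = 0}" unfolding G_def by (rule ac_min_upper[OF V ta])
 also have "ta\<^sup>2 * G <= ta * c"
 proof -
  have "ta * G <= ta * (G + 1)" using ta by simp
  also have "... = c" using G by (simp add: ta_def)
  finally have "ta * (ta * G) <= ta * c" using ta by (intro mult_left_mono) auto
  then show ?thesis by (simp add: power2_eq_square mult.assoc)
 qed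
 finally have "ta * c <= measure lborel {x : ball 0 1. V x = 0}" by (simp add: mult.commute)
 moreover have "ta * c = c\<^sup>2 / (G + 1)" by (simp add: ta_def power2_eq_square)
 moreover have "measure lborel {x : ball 0 1. V x = 0} = measure lborel {x : ball z s. U x = 0} / s ^ DIM('a)"
 proof -
  have "LI (%x. indicator {x : ball z s. U x = 0} (z + s *R x) :: real)
   = LI (indicator {x : ball z s. U x = 0} :: 'a => real) / s ^ DIM('a)"
   by (rule lborel_scale_integral[OF s])
  moreover have "(%x. indicator {x : ball z s. U x = 0} (z + s *R x)) = (indicator {x : ball 0 1. V x = 0} :: 'a => real)"
   using s by (auto simp: indicator_def fun_eq_iff V_def rescale_def dist_norm)
  ultimately show ?thesis using zero_set_borel[OF U] zero_set_borel[OF V] by simp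
 qed
 ultimately show ?thesis using s by (simp add: pos_le_divide_eq G_def)
qed

lemma good_near_point:
 assumes "good U z rh" "de > 0"
 obtains x where "U x > 0" "dist z x < de"
 using assms unfolding good_def closure_approachable by (metis dist_commute mem_Collect_eq)

text \<open>The mean over radius \<open>r\<close> is at least a multiple of \<open>r\<close>, while
  over the tiny radius \<open>eps * r\<close> it is negligible by the growth bound; so
  \<open>dmean\<close> is large at some scale between, where \<open>zero_set_density\<close>
  applies.\<close>

lemma zero_set_density_good:
 "EX c. 0 < c & c <= 1/4 & (ALL U (z::'a::euclidean_space) rh r. ac_min U --> good U z rh --> 0 < r --> r <= c * rh
   --> c * r ^ DIM('a) <= measure lborel {x : ball z r. U x = 0})"
proof -
 obtain c0 where c0: "0 < c0" "c0 <= 1/4" "!!U z rh (x::'a). ac_min U ==> good U z rh ==> dist z x < c0 * rh ==> U x > 0 ==> c0 <= norm (grad U x)"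
  using grad_lower_bound[where 'a='a] by blast
 define d where "d = DIM('a)"
 define c2 where "c2 = c0 / 4 * I3 TYPE('a) / (A0 * 4 ^ d)"
 have c2: "c2 > 0" using c0 I3_pos[where 'a='a] by (simp add: c2_def A0_def)
 have CG: "CG TYPE('a) > 0" by (rule CG_pos)
 define eps where "eps = min (c2 / (4 * CG TYPE('a))) (1/2)"
 have eps: "0 < eps" "eps <= 1/2" "CG TYPE('a) * eps <= c2 / 4" using c2 CG by (auto simp: eps_def min_def field_simps)
 define c where "c = min (c0 / 2) ((c2 / 2)\<^sup>2 / (G0 TYPE('a) + 1) * eps ^ d)"
 have G: "G0 TYPE('a) >= 0" by (rule G0_nonneg)
 have "(c2 / 2)\<^sup>2 / (G0 TYPE('a) + 1) * eps ^ d > 0"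
  using c2 eps G by (intro mult_pos_pos divide_pos_pos zero_less_power) auto
 then have c: "0 < c" "c <= c0 / 2" "c <= (c2 / 2)\<^sup>2 / (G0 TYPE('a) + 1) * eps ^ d"
  using c0(1) unfolding c_def by linarith+
 have "c * r ^ d <= measure lborel {x : ball z r. U x = 0}" if U: "ac_min U" and g: "good U z rh" and r: "0 < r" "r <= c * rh" for U rh r and z :: 'a
 proof -
  have nn: "!!x. U x >= 0" and cU: "continuous_on UNIV U" using U by (auto simp: ac_min_def)
  have rh: "rh > 0" using g by (rule good_pos)
  have r2: "r <= c0 / 2 * rh" using r c rh by (meson mult_right_mono order_trans less_imp_le)
  have "c0 / 2 * rh <= 1/8 * rh" using c0(2) rh by (intro mult_right_mono) auto
  then have r3: "r <= rh / 8" using r2 by linarith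
  obtain x where x: "U x > 0" "dist z x < r / 8" using good_near_point[OF g, of "r/8"] r by auto
  define e where "e = grad U x"
  have "dist z x < c0 * rh" using x r2 r rh c0 mult_pos_pos[of c0 rh] by linarith
  then have e: "c0 <= norm e" unfolding e_def by (intro c0(3)[OF U g]) (use x in auto)
  have ne: "norm e > 0" using e c0(1) by linarith
  \<comment> \<open>A step of length \<open>r / 2\<close> along the gradient: the linear gain, at
    least \<open>c0 * r / 2\<close>, dominates the Taylor error, so \<open>U y\<close> is at least a
    multiple of \<open>r\<close>.\<close>
  define y where "y = x + (r / (2 * norm e)) *R e"
  have yx: "y - x = (r / (2 * norm e)) *R e" by (simp add: y_def)
  have nyx: "norm (y - x) = r / 2" using ne r by (simp add: yx)
  have ip: "e *. (y - x) = norm e * (r / 2)" using ne by (simp add: yx power2_norm_eq_inner[symmetric] power2_eq_square)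
  have dzy: "dist z y <= 5/8 * r" using dist_triangle[of z y x] x nyx by (simp add: dist_norm norm_minus_commute)
  have b: "x : ball z rh" "y : ball z rh" using x dzy r3 r rh by auto
  have q: "(r/2)\<^sup>2 / rh <= c0 * r / 8"
  proof -
   have "r * r <= r * (c0 / 2 * rh)" using r2 r by (intro mult_left_mono) auto
   then show ?thesis using rh by (simp add: power2_eq_square field_simps)
  qed
  have ip2: "e *. (y - x) >= c0 * (r / 2)" unfolding ip using e r by (intro mult_right_mono) auto
  have cr: "c0 * r > 0" using c0 r by simp
  have "U x + grad U x *. (y - x) > (norm (y - x))\<^sup>2 / rh"
   using q ip2 x cr unfolding nyx e_def[symmetric] by (simp add: field_simps)
  from capture[OF U g x(1) b this] have seg: "closed_segment x y \<subseteq> {x. U x > 0} Int ball z rh" .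
  have "U y >= U x + e *. (y - x) - (r/2)\<^sup>2 / rh"
   using grad_lipschitz_segment(2)[OF U g seg] nyx by (simp add: e_def)
  then have Uy: "U y >= c0 / 4 * r" using q ip2 x cr by (simp add: field_simps)
  have "U y * I3 TYPE('a) <= mean U y (r / 4)" using ac_min_mean_bounds(1)[OF U order_refl, of "r/4" y] r by (simp add: mean_0)
  also have "... <= A0 * (r / (r/4)) ^ DIM('a) * mean U z r"
   by (rule mean_kernel_le) (use r nn dzy in "auto intro: continuous_on_subset[OF cU] simp: dist_commute")
  also have "r / (r/4) = 4" using r by simp
  finally have "c0 / 4 * r * I3 TYPE('a) <= A0 * 4 ^ d * mean U z r"
   using Uy I3_pos[where 'a='a] unfolding d_def by (meson mult_right_mono order_trans less_imp_le)
  then have mr: "c2 * r <= mean U z r" by (simp add: c2_def A0_def field_simps)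
  \<comment> \<open>If \<open>dmean\<close> stayed below \<open>c2 / 2 * s\<close> throughout, the
    mean could grow by at most \<open>c2 / 2 * r\<close> from its value at \<open>eps * r\<close>,
    which is at most \<open>c2 / 4 * r\<close>.\<close>
  have "EX s. eps * r < s & s < r & c2 / 2 * s <= dmean U z s"
  proof (rule ccontr)
   assume no: "~ ?thesis"
   have er: "0 <= eps * r" "eps * r <= r" using eps r by auto
   have "mean U z r - mean U z (eps * r) <= c2 / 2 * (r - eps * r)"
   proof (rule mean_diff_bounds(2)[OF cU er, where A = 0])
    fix s assume s: "eps * r < s" "s < r"
    then have "s > 0" using er by linarith
    then show "0 * s <= dmean U z s & dmean U z s <= c2 / 2 * s" using no s ac_min_dmean(1)[OF U, of s z] by force
   qed
   moreover have "mean U z (eps * r) <= CG TYPE('a) * (eps * r)"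
    using ac_min_mean_bounds(2)[OF U order_refl er(1), of z] g by (simp add: mean_0 good_def)
   moreover have "CG TYPE('a) * (eps * r) <= c2 / 4 * r" using eps(3) r by (simp add: mult.assoc[symmetric] mult_right_mono)
   moreover have "c2 / 2 * (r - eps * r) <= c2 / 2 * r" using c2 er by (intro mult_left_mono) auto
   ultimately have "c2 * r <= c2 / 2 * r + c2 / 4 * r" using mr by linarith
   moreover have "c2 * r > 0" using c2 r by simp
   ultimately show False by linarith
  qed
  then obtain s where s: "eps * r < s" "s < r" "c2 / 2 * s <= dmean U z s" by blast
  have sp: "s > 0" using s eps r by (meson less_trans mult_pos_pos)
  have "(c2/2)\<^sup>2 / (G0 TYPE('a) + 1) * s ^ DIM('a) <= measure lborel {x : ball z s. U x = 0}"
   by (rule zero_set_density[OF U sp _ s(3)]) (use c2 in simp)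
  also have "... <= measure lborel {x : ball z r. U x = 0}"
  proof (rule measure_mono_fmeasurable)
   have "bounded {x : ball z r. U x = 0}" by (rule bounded_subset[OF bounded_ball[of z r]]) auto
   from emeasure_bounded_finite[OF this] show "{x : ball z r. U x = 0} : fmeasurable lborel"
    using zero_set_borel[OF U] by (intro fmeasurableI) auto
  qed (use zero_set_borel[OF U] s in auto)
  finally have 1: "(c2/2)\<^sup>2 / (G0 TYPE('a) + 1) * s ^ DIM('a) <= measure lborel {x : ball z r. U x = 0}" .
  have "c * r ^ d <= (c2 / 2)\<^sup>2 / (G0 TYPE('a) + 1) * eps ^ d * r ^ d" using c(3) r by (intro mult_right_mono) auto
  also have "... = (c2 / 2)\<^sup>2 / (G0 TYPE('a) + 1) * (eps * r) ^ d" by (simp add: power_mult_distrib)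
  also have "... <= (c2 / 2)\<^sup>2 / (G0 TYPE('a) + 1) * s ^ d"
   using s eps r G by (intro mult_left_mono power_mono) auto
  finally show ?thesis using 1 by (simp add: d_def)
 qed
 moreover have "c <= 1/4" using c c0 by linarith
 ultimately show ?thesis using c(1) unfolding d_def by blast
qed

section \<open>Existence of a normal at a good point\<close>

lemma measure_strip_ball_le:
 fixes u z :: "'a::euclidean_space"
 assumes u: "norm u = 1" and b: "be > 0" and r: "r > 0"
  and S: "S : sets borel" "S \<subseteq> {x : cball z r. abs (u *. x - u *. z) <= be * r}"
 shows "measure lborel S <= 6 * be * 2 ^ DIM('a) * measure lborel (ball (0::'a) 1) * r ^ DIM('a)"
proof -
 define T where "T = {x : cball z r. abs (u *. x - u *. z) <= be * r}"
 have cT: "closed T"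
 proof -
  have "T = cball z r Int {x. abs (u *. x - u *. z) <= be * r}" by (auto simp: T_def)
  moreover have "closed {x. abs (u *. x - u *. z) <= be * r}" by (intro closed_Collect_le continuous_intros)
  ultimately show ?thesis by (auto intro: closed_Int)
 qed
 have "measure lborel S <= measure lborel T"
 proof (rule measure_mono_fmeasurable)
  have "bounded T" by (rule bounded_subset[OF bounded_cball[of z r]]) (auto simp: T_def)
  from emeasure_bounded_finite[OF this] show "T : fmeasurable lborel"
   using borel_closed[OF cT] by (intro fmeasurableI) auto
 qed (use S in "auto simp: T_def")
 also have "measure lborel T = measure lebesgue T" using borel_closed[OF cT] by simp
 also have "... <= 6 * (be * r / r) * measure lebesgue (cball z (2 * r))"
  unfolding T_def by (rule measure_strip_le[OF u _ r]) (use b r in simp)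
 also have "measure lebesgue (cball z (2 * r)) = measure lborel (ball z (2 * r))"
  by (simp add: content_cball_conv_ball)
 also have "... = (2 * r) ^ DIM('a) * measure lborel (ball (0::'a) 1)" using r by (intro content_ball_conv_unit_ball) simp
 finally show ?thesis using r by (simp add: power_mult_distrib mult_ac)
qed

lemma unit_ball_pos: "measure lborel (ball (0::'a::euclidean_space) 1) > 0"
 by (rule content_ball_pos) simp

text \<open>When both gradients have a component at least \<open>ta\<close> along \<open>w\<close>,
  the point \<open>y\<close> at distance \<open>K * s\<close> from \<open>x'\<close> in direction
  \<open>w\<close> is captured from \<open>x\<close> as well as from \<open>x'\<close>, and the two
  gradients are compared through the one at \<open>y\<close>.\<close>

lemma grad_close_common:
 fixes U :: "'a::euclidean_space => real"
 assumes U: "ac_min U" and g: "good U z rh" and x: "U x > 0" "dist z x <= s" and x': "U x' > 0" "dist z x' <= s"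
  and s: "s > 0" and w: "norm w = 1" "ta <= grad U x *. w" "ta <= grad U x' *. w" and ta: "ta > 0"
  and L: "norm (grad U x) <= L" and K: "K >= 2" "4 * L <= ta * K" "9 * K * s <= ta * rh" "(2 + 2 * K) * s <= rh"
 shows "norm (grad U x - grad U x') <= 3 * K * s / rh"
proof -
 have rh: "rh > 0" using g by (rule good_pos)
 define l where "l = K * s"
 have l: "l > 0" "2 * s <= l" using K s by (auto simp: l_def mult_right_mono)
 have lrh: "9 * l <= ta * rh" "2 * s + 2 * l <= rh" using K by (auto simp: l_def algebra_simps)
 define y where "y = x' + l *R w"
 have yx': "y - x' = l *R w" by (simp add: y_def)
 have yx: "y - x = l *R w + (x' - x)" by (simp add: y_def)
 have nyx': "norm (y - x') = l" using w l by (simp add: yx')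
 have xx': "norm (x' - x) <= 2 * s" using dist_triangle[of x' x z] x x' by (simp add: dist_norm norm_minus_commute)
 have nyx: "norm (y - x) <= 2 * l" unfolding yx using norm_triangle_ineq[of "l *R w" "x' - x"] xx' l w by simp
 have b: "x : ball z rh" "x' : ball z rh" using x x' lrh l s by auto
 have "dist z y <= dist z x' + norm (y - x')" using dist_triangle[of z y x'] by (simp add: dist_norm norm_minus_commute)
 then have yb: "y : ball z rh" using x' nyx' lrh s l by simp
 have q: "l\<^sup>2 / rh <= ta * l / 9"
 proof -
  have "l * (9 * l) <= l * (ta * rh)" using lrh l by (intro mult_left_mono) auto
  then show ?thesis using rh by (simp add: power2_eq_square field_simps)
 qed
 have tl: "ta * l > 0" using ta l by simp
 have c1: "U x' + grad U x' *. (y - x') > (norm (y - x'))\<^sup>2 / rh"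
 proof -
  have "grad U x' *. (y - x') = l * (grad U x' *. w)" by (simp add: yx')
  also have "... >= l * ta" using w l by (intro mult_left_mono) auto
  finally show ?thesis using q tl x'(1) unfolding nyx' by (simp add: mult.commute)
 qed
 have c2: "U x + grad U x *. (y - x) > (norm (y - x))\<^sup>2 / rh"
 proof -
  have "grad U x *. (y - x) = l * (grad U x *. w) + grad U x *. (x' - x)" by (simp add: yx inner_add_right)
  moreover have "l * (grad U x *. w) >= l * ta" using w l by (intro mult_left_mono) auto
  moreover have "abs (grad U x *. (x' - x)) <= L * (2 * s)"
   using Cauchy_Schwarz_ineq2[of "grad U x" "x' - x"] mult_mono[OF L xx' order_trans[OF norm_ge_zero L] norm_ge_zero] by linarith
  moreover have "L * (2 * s) <= l * ta / 2"
  proof -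
   have "s * (4 * L) <= s * (ta * K)" using K s by (intro mult_left_mono) auto
   then show ?thesis by (simp add: l_def algebra_simps)
  qed
  moreover have "(norm (y - x))\<^sup>2 / rh <= 4 * (l\<^sup>2 / rh)"
   using power_mono[OF nyx, of 2] rh by (simp add: power_mult_distrib divide_right_mono)
  ultimately show ?thesis using q tl x(1) by (simp add: mult.commute)
 qed
 note s1 = capture[OF U g x'(1) b(2) yb c1] and s2 = capture[OF U g x(1) b(1) yb c2]
 have "norm (grad U y - grad U x') <= l / rh" using grad_lipschitz_segment(1)[OF U g s1] nyx' by simp
 moreover have "norm (grad U y - grad U x) <= 2 * l / rh"
  using grad_lipschitz_segment(1)[OF U g s2] divide_right_mono[OF nyx, of rh] rh by simp
 moreover have "norm (grad U x - grad U x') <= norm (grad U y - grad U x') + norm (grad U y - grad U x)"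
  using norm_triangle_ineq4[of "grad U y - grad U x'" "grad U y - grad U x"] by simp
 ultimately have "norm (grad U x - grad U x') <= l / rh + 2 * l / rh" by linarith
 also have "... = 3 * K * s / rh" by (simp add: l_def field_simps)
 finally show ?thesis .
qed

lemma unit_vectors_sum:
 fixes u v :: "'a::real_inner"
 assumes "norm u = 1" "norm v = 1" "u + v ~= 0"
 shows "u *. ((u + v) /\<^sub>R norm (u + v)) = norm (u + v) / 2" "v *. ((u + v) /\<^sub>R norm (u + v)) = norm (u + v) / 2"
proof -
 have uv: "u *. u = 1" "v *. v = 1" using assms by (auto simp: norm_eq_1)
 have n: "(norm (u + v))\<^sup>2 = 2 * (1 + u *. v)"
  using uv by (simp add: power2_norm_eq_inner inner_add_left inner_add_right inner_commute)
 have p: "norm (u + v) > 0" using assms(3) by simp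
 have "u *. (u + v) = (norm (u + v))\<^sup>2 / 2" "v *. (u + v) = (norm (u + v))\<^sup>2 / 2"
  unfolding n using uv by (auto simp: inner_add_right inner_commute)
 moreover have "inverse (norm (u + v)) * ((norm (u + v))\<^sup>2 / 2) = norm (u + v) / 2"
  using p by (simp add: power2_eq_square field_simps)
 ultimately show "u *. ((u + v) /\<^sub>R norm (u + v)) = norm (u + v) / 2" "v *. ((u + v) /\<^sub>R norm (u + v)) = norm (u + v) / 2"
  by (simp_all only: inner_scaleR_right)
qed

text \<open>Points whose height over \<open>z\<close> in direction \<open>v\<close> exceeds
  \<open>be * r\<close> are captured from \<open>x\<close>, because \<open>v\<close> is close to the
  gradient direction and the slope is at least \<open>c0\<close>.\<close>

lemma zero_set_in_strip:
 fixes U :: "'a::euclidean_space => real"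
 assumes U: "ac_min U" and g: "good U z rh" and x: "U x > 0" "dist z x <= s"
  and r: "0 < r" "r <= rh" and s: "s <= be / 4 * r" and be: "0 < be" "be <= 1"
  and e: "c0 <= norm (grad U x)" "c0 > 0" and eta: "16 * r <= c0 * be * rh"
  and v: "norm v = 1" "norm (v - grad U x /\<^sub>R norm (grad U x)) <= be / 4"
  and y: "y : ball z r" "v *. (y - z) > be * r"
 shows "U y > 0"
proof -
 have rh: "rh > 0" using g by (rule good_pos)
 define e where "e = grad U x"
 define u where "u = e /\<^sub>R norm e"
 have ne: "norm e > 0" "c0 <= norm e" using e by (auto simp: e_def)
 have nu: "norm u = 1" using ne by (simp add: u_def)
 have eu: "e = norm e *R u" using ne by (simp add: u_def)
 have sr: "s <= r / 4" using s be r mult_right_mono[of "be/4" "1/4" r] by linarith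
 have nyz: "norm (y - z) < r" using y(1) by (simp add: dist_norm norm_minus_commute)
 have nxz: "norm (x - z) <= s" using x by (simp add: dist_norm norm_minus_commute)
 have "abs ((v - u) *. (y - z)) <= be / 4 * r"
 proof -
  have "abs ((v - u) *. (y - z)) <= norm (v - u) * norm (y - z)" by (rule Cauchy_Schwarz_ineq2)
  also have "... <= be / 4 * r" using v(2) nyz r be by (intro mult_mono) (auto simp: u_def e_def)
  finally show ?thesis .
 qed
 then have "u *. (y - z) > 3/4 * (be * r)" using y(2) unfolding inner_diff_left[of v u] by linarith
 moreover have "abs (u *. (x - z)) <= s" using Cauchy_Schwarz_ineq2[of u "x - z"] nu nxz by simp
 ultimately have uyx: "u *. (y - x) > be * r / 2" using s by (simp add: inner_diff_right)
 have br: "be * r > 0" using be r by simp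
 have "e *. (y - x) = norm e * (u *. (y - x))" by (subst eu) simp
 also have "... >= c0 * (be * r / 2)" using ne uyx br e by (intro mult_mono) auto
 finally have 1: "e *. (y - x) >= c0 * be * r / 2" by simp
 have "norm (y - x) <= norm (y - z) + norm (x - z)" using norm_triangle_ineq4[of "y - z" "x - z"] by simp
 then have "norm (y - x) <= 2 * r" using nyz nxz sr r by linarith
 then have "(norm (y - x))\<^sup>2 / rh <= (2 * r)\<^sup>2 / rh" using rh by (intro divide_right_mono power_mono) auto
 also have "... <= c0 * be * r / 4"
 proof -
  have "r * (16 * r) <= r * (c0 * be * rh)" using eta r by (intro mult_left_mono) auto
  then show ?thesis using rh by (simp add: power2_eq_square field_simps)
 qed
 also have "... < U x + e *. (y - x)"
  using 1 x(1) mult_pos_pos[OF e(2) br] by (simp add: mult.assoc)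
 finally have "U x + grad U x *. (y - x) > (norm (y - x))\<^sup>2 / rh" by (simp add: e_def)
 moreover have "x : ball z rh" "y : ball z rh" using x sr r y by auto
 ultimately show ?thesis using capture[OF U g x(1)] by force
qed

text \<open>Nearly opposite unit gradients would make both sides of a thin strip positive and leave
  the zero set less measure than its density requires. Otherwise the normalised sum of the two
  directions is a common direction \<open>w\<close>.\<close>

lemma grad_close:
 "EX c C. 0 < c & c <= 1/4 & C > 0 & (ALL U z rh s (x::'a::euclidean_space) x'. ac_min U --> good U z rh --> 0 < s --> s <= c * rh -->
  U x > 0 --> dist z x <= s --> U x' > 0 --> dist z x' <= s --> c <= norm (grad U x) & norm (grad U x - grad U x') <= C * s / rh)"
proof -
 obtain c0 where c0: "0 < c0" "c0 <= 1/4" "!!U z rh (x::'a). ac_min U ==> good U z rh ==> dist z x < c0 * rh ==> U x > 0 ==> c0 <= norm (grad U x)"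
  using grad_lower_bound[where 'a='a] by blast
 obtain cd where cd: "0 < cd" "cd <= 1/4" "!!U (z::'a) rh r. ac_min U ==> good U z rh ==> 0 < r ==> r <= cd * rh
   ==> cd * r ^ DIM('a) <= measure lborel {x : ball z r. U x = 0}"
  using zero_set_density_good[where 'a='a] by blast
 define L where "L = L1 TYPE('a)"
 have L: "L > 0" unfolding L_def by (rule L1_pos)
 define W where "W = 6 * 2 ^ DIM('a) * measure lborel (ball (0::'a) 1)"
 have W: "W > 0" using unit_ball_pos[where 'a='a] by (simp add: W_def)
 \<comment> \<open>Relative width for which the measure factor \<open>be * W\<close> of the strip
   stays below the density \<open>cd\<close>.\<close>
 define be where "be = min 1 (cd / (2 * W))"
 have be: "0 < be" "be <= 1" "be * W < cd" using cd W by (auto simp: be_def min_def field_simps)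
 define ta where "ta = c0 * (be / 4) / 2"
 have ta: "ta > 0" using c0 be by (simp add: ta_def)
 define K where "K = 4 * L / ta + 2"
 have K: "K >= 2" "4 * L <= ta * K" using L ta by (auto simp: K_def field_simps)
 define eta where "eta = min cd (c0 * be / 16)"
 have eta: "0 < eta" "eta <= cd" "eta <= c0 * be / 16" using cd c0 be by (auto simp: eta_def)
 define c where "c = min (min (c0/2) (be / 4 * eta)) (min (ta / (9 * K)) (1 / (2 + 2 * K)))"
 have "0 < be / 4 * eta" "0 < ta / (9 * K)" "0 < 1 / (2 + 2 * K)" using be eta ta K by simp_all
 then have c: "0 < c" using c0 by (simp add: c_def)
 have c: "0 < c" "c <= c0/2" "c <= be / 4 * eta" "c <= ta / (9 * K)" "c <= 1 / (2 + 2 * K)"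
  using c unfolding c_def by linarith+
 have main: "c <= norm (grad U x) & norm (grad U x - grad U x') <= 3 * K * s / rh"
  if U: "ac_min U" and g: "good U z rh" and s: "0 < s" "s <= c * rh"
   and x: "U x > 0" "dist z x <= s" and x': "U x' > 0" "dist z x' <= s" for U z rh s and x x' :: 'a
 proof -
  have rh: "rh > 0" using g by (rule good_pos)
  have Uz: "U z = 0" using g by (simp add: good_def)
  have sc: "s <= c0/2 * rh" "s <= be / 4 * eta * rh" "s <= ta / (9 * K) * rh" "s <= 1 / (2 + 2 * K) * rh"
   using s c rh by (meson mult_right_mono order_trans less_imp_le)+
  have "s < c0 * rh" using sc(1) mult_pos_pos[OF c0(1) rh] by linarith
  then have e: "c0 <= norm (grad U x)" "c0 <= norm (grad U x')" using c0(3)[OF U g] x x' by auto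
  have eL: "norm (grad U x) <= L" unfolding L_def by (rule ac_min_grad_bound[OF U Uz x(1)])
  define u where "u = grad U x /\<^sub>R norm (grad U x)"
  define u' where "u' = grad U x' /\<^sub>R norm (grad U x')"
  have n: "norm (grad U x) > 0" "norm (grad U x') > 0" using e c0 by auto
  have nu: "norm u = 1" "norm u' = 1" using n by (auto simp: u_def u'_def)
  have eu: "grad U x = norm (grad U x) *R u" "grad U x' = norm (grad U x') *R u'" using n by (auto simp: u_def u'_def)
  have "norm (u + u') >= be / 4"
  proof (rule ccontr)
   assume small: "~ norm (u + u') >= be / 4"
   define r where "r = eta * rh"
   have r: "0 < r" "r <= cd * rh" "r <= rh" "16 * r <= c0 * be * rh" "s <= be / 4 * r"
    using eta rh sc(2) mult_right_mono[OF eta(2), of rh] mult_right_mono[OF eta(3), of rh] cd mult_right_mono[of cd 1 rh]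
    by (auto simp: r_def mult.assoc)
   have "{y : ball z r. U y = 0} \<subseteq> {y : cball z r. abs (u *. y - u *. z) <= be * r}"
   proof
    fix y assume "y : {y : ball z r. U y = 0}"
    then have y: "y : ball z r" "U y = 0" by auto
    have "~ u *. (y - z) > be * r"
     using zero_set_in_strip[OF U g x r(1,3,5) be(1,2) e(1) c0(1) r(4) nu(1) _ y(1)] y(2) be by (auto simp: u_def)
    moreover have "~ (- u) *. (y - z) > be * r"
    proof
     assume a: "(- u) *. (y - z) > be * r"
     have "norm (- u - grad U x' /\<^sub>R norm (grad U x')) = norm (u + u')"
      unfolding u'_def[symmetric] by (metis minus_diff_eq norm_minus_cancel add.commute diff_minus_eq_add minus_minus)
     then have "norm (- u - grad U x' /\<^sub>R norm (grad U x')) <= be / 4" using small by simp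
     from zero_set_in_strip[OF U g x' r(1,3,5) be(1,2) e(2) c0(1) r(4) _ this y(1) a] y(2) nu show False by simp
    qed
    ultimately show "y : {y : cball z r. abs (u *. y - u *. z) <= be * r}" using y(1) by (auto simp: inner_diff_right)
   qed
   from measure_strip_ball_le[OF nu(1) be(1) r(1) zero_set_borel[OF U] this]
   have "measure lborel {y : ball z r. U y = 0} <= 6 * be * 2 ^ DIM('a) * measure lborel (ball (0::'a) 1) * r ^ DIM('a)" .
   also have "... = be * W * r ^ DIM('a)" by (simp add: W_def)
   finally have "measure lborel {y : ball z r. U y = 0} <= be * W * r ^ DIM('a)" .
   moreover have "cd * r ^ DIM('a) <= measure lborel {y : ball z r. U y = 0}" by (rule cd(3)[OF U g r(1,2)])
   moreover have "be * W * r ^ DIM('a) < cd * r ^ DIM('a)" using be(3) r(1) by (intro mult_strict_right_mono) auto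
   ultimately show False by linarith
  qed
  then have un: "u + u' ~= 0" "norm (u + u') > 0" using be by auto
  define w where "w = (u + u') /\<^sub>R norm (u + u')"
  have w: "norm w = 1" using un by (simp add: w_def)
  have uw: "u *. w >= be / 4 / 2" "u' *. w >= be / 4 / 2"
   unfolding w_def unit_vectors_sum[OF nu un(1)] using \<open>norm (u + u') >= be / 4\<close> by auto
  have ew: "ta <= grad U x *. w" "ta <= grad U x' *. w"
  proof -
   have "c0 * (be / 4 / 2) <= norm (grad U x) * (u *. w)" by (rule mult_mono[OF e(1) uw(1)]) (use be in auto)
   moreover have "c0 * (be / 4 / 2) <= norm (grad U x') * (u' *. w)" by (rule mult_mono[OF e(2) uw(2)]) (use be in auto)
   ultimately show "ta <= grad U x *. w" "ta <= grad U x' *. w"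
    by (subst eu, simp add: ta_def)+
  qed
  have "9 * K * s <= ta * rh" "(2 + 2 * K) * s <= rh" using sc(3,4) K by (auto simp: field_simps)
  from grad_close_common[OF U g x x' s(1) w ew ta eL K this] show ?thesis using e(1) c c0 by linarith
 qed
 have "3 * K > 0" "c <= 1/4" using K c c0 by linarith+
 then show ?thesis using main c(1) by blast
qed

text \<open>Quadratic contact with a half-plane function, for the gradient, the positivity set and
  the values. The slope \<open>norm e\<close> is only bounded here; that it equals 1 is a further
  consequence of minimality.\<close>

definition reg_pt :: "real => real => ('a::euclidean_space => real) => 'a => real => 'a => bool" where
 "reg_pt c C U z rh e \<longleftrightarrow> c <= norm e & norm e <= L1 TYPE('a) &
  (ALL x. dist z x <= c * rh --> U x > 0 --> norm (grad U x - e) <= C * dist z x / rh) &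
  (ALL y. dist z y <= c * rh --> e *. (y - z) > C * (dist z y)\<^sup>2 / rh --> U y > 0) &
  (ALL y. dist z y <= c * rh --> U y > 0 --> e *. (y - z) >= - C * (dist z y)\<^sup>2 / rh) &
  (ALL y. dist z y <= c * rh --> abs (U y - max 0 (e *. (y - z))) <= C * (dist z y)\<^sup>2 / rh)"

text \<open>By \<open>grad_close\<close> the gradients along a sequence of positive points tending
  to \<open>z\<close> are Cauchy; the remaining properties come from \<open>capture\<close>, in the
  limit.\<close>

lemma normal_exists:
 "EX c C. 0 < c & c <= 1/4 & C > 0 & (ALL U (z::'a::euclidean_space) rh. ac_min U --> good U z rh --> (EX e. reg_pt c C U z rh e))"
proof -
 obtain c C where c: "0 < c" "c <= 1/4" "C > 0" and
  close: "!!U z rh s (x::'a) x'. ac_min U ==> good U z rh ==> 0 < s ==> s <= c * rh ==>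
  U x > 0 ==> dist z x <= s ==> U x' > 0 ==> dist z x' <= s ==> c <= norm (grad U x) & norm (grad U x - grad U x') <= C * s / rh"
  using grad_close[where 'a='a] by blast
 have "EX e. reg_pt c (2 + C) U z rh e" if U: "ac_min U" and g: "good U z rh" for U rh and z :: 'a
 proof -
  have nn: "!!x. U x >= 0" and cU: "continuous_on UNIV U" using U by (auto simp: ac_min_def)
  have rh: "rh > 0" using g by (rule good_pos)
  have Uz: "U z = 0" using g by (simp add: good_def)
  have crh: "c * rh > 0" "c * rh < rh" using c rh by auto
  obtain X where X: "!!k. U (X k) > 0" "X \<longlonglongrightarrow> z"
   using g unfolding good_def closure_sequential by auto
  have Xd: "(%k. dist z (X k)) \<longlonglongrightarrow> 0" using tendsto_dist[OF tendsto_const X(2), of z] by simp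
  have ev: "eventually (%k. dist z (X k) < de) sequentially" if "de > 0" for de
   using order_tendstoD(2)[OF Xd that] .
  have "Cauchy (%k. grad U (X k))"
  proof (rule metric_CauchyI)
   fix eps :: real assume eps: "eps > 0"
   define s where "s = min (c * rh) (eps * rh / (2 * C))"
   have s: "s > 0" "s <= c * rh" "C * s / rh <= eps / 2" using crh eps c rh by (auto simp: s_def min_def field_simps)
   obtain M where M: "!!k. k >= M ==> dist z (X k) < s" using ev[OF s(1)] unfolding eventually_sequentially by blast
   have "dist (grad U (X m)) (grad U (X n)) < eps" if "m >= M" "n >= M" for m n
   proof -
    have "norm (grad U (X m) - grad U (X n)) <= C * s / rh"
     using close[OF U g s(1,2) X(1)[of m] _ X(1)[of n]] M[OF that(1)] M[OF that(2)] less_imp_le by blast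
    then show ?thesis using s(3) eps unfolding dist_norm by linarith
   qed
   then show "EX M. ALL m>=M. ALL n>=M. dist (grad U (X m)) (grad U (X n)) < eps" by blast
  qed
  then obtain e where e: "(%k. grad U (X k)) \<longlonglongrightarrow> e" using Cauchy_convergent_iff convergent_def by blast
  have en: "(%k. norm (grad U (X k))) \<longlonglongrightarrow> norm e" by (rule tendsto_norm[OF e])
  have e1: "c <= norm e"
  proof (rule tendsto_lowerbound[OF en])
   show "eventually (%k. c <= norm (grad U (X k))) sequentially"
    using ev[OF crh(1)]
   proof eventually_elim
    case (elim k)
    then show ?case using close[OF U g crh(1) order_refl X(1)[of k] _ X(1)[of k]] less_imp_le by blast
   qed
  qed simp
  have e2: "norm e <= L1 TYPE('a)"
   by (rule tendsto_upperbound[OF en]) (use ac_min_grad_bound[OF U Uz X(1)] in auto)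
  have e3: "norm (grad U x - e) <= C * dist z x / rh" if x: "dist z x <= c * rh" "U x > 0" for x
  proof (rule tendsto_upperbound)
   show "(%k. norm (grad U x - grad U (X k))) \<longlonglongrightarrow> norm (grad U x - e)" by (intro tendsto_intros e)
   have dz: "dist z x > 0" using x Uz by auto
   show "eventually (%k. norm (grad U x - grad U (X k)) <= C * dist z x / rh) sequentially"
    using ev[OF dz] by eventually_elim (use close[OF U g dz x(1) x(2) order_refl X(1)] in "simp add: less_imp_le")
  qed simp
  have UX: "(%k. U (X k)) \<longlonglongrightarrow> 0"
   using continuous_on_tendsto_compose[OF cU X(2)] Uz by simp
  \<comment> \<open>\<open>y\<close> is captured from \<open>X k\<close> for large \<open>k\<close>;
    then Taylor's formula along these segments passes to the limit.\<close>
  have e4: "U y > 0 & abs (U y - e *. (y - z)) <= (dist z y)\<^sup>2 / rh" if y: "dist z y <= c * rh" "e *. (y - z) > (dist z y)\<^sup>2 / rh" for y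
  proof -
   have t1: "(%k. (norm (y - X k))\<^sup>2 / rh) \<longlonglongrightarrow> (norm (y - z))\<^sup>2 / rh" by (intro tendsto_intros X) (use rh in simp)
   have t2: "(%k. U (X k) + grad U (X k) *. (y - X k)) \<longlonglongrightarrow> 0 + e *. (y - z)" by (intro tendsto_intros UX e X)
   have nd: "norm (y - z) = dist z y" by (simp add: dist_norm norm_minus_commute)
   have t3: "(%k. U (X k) + grad U (X k) *. (y - X k) - (norm (y - X k))\<^sup>2 / rh) \<longlonglongrightarrow> 0 + e *. (y - z) - (norm (y - z))\<^sup>2 / rh"
    by (intro tendsto_diff t1 t2)
   have "eventually (%k. U (X k) + grad U (X k) *. (y - X k) - (norm (y - X k))\<^sup>2 / rh > 0) sequentially"
    by (rule order_tendstoD(1)[OF t3]) (use y nd in simp)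
   moreover have "eventually (%k. dist z (X k) < rh) sequentially" by (rule ev[OF rh])
   ultimately have cap: "eventually (%k. closed_segment (X k) y \<subseteq> {x. U x > 0} Int ball z rh) sequentially"
   proof eventually_elim
    case (elim k)
    show ?case by (rule capture[OF U g X(1)]) (use elim y crh in auto)
   qed
   then obtain k where "closed_segment (X k) y \<subseteq> {x. U x > 0} Int ball z rh"
    unfolding eventually_sequentially by blast
   then have "U y > 0" by auto
   moreover have "abs (U y - (0 + e *. (y - z))) <= (norm (y - z))\<^sup>2 / rh"
   proof (rule tendsto_le[OF _ t1])
    show "(%k. abs (U y - (U (X k) + grad U (X k) *. (y - X k)))) \<longlonglongrightarrow> \<bar>U y - (0 + e *. (y - z))\<bar>" by (intro tendsto_intros t2)
    show "eventually (%k. abs (U y - (U (X k) + grad U (X k) *. (y - X k))) <= (norm (y - X k))\<^sup>2 / rh) sequentially"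
     using cap by eventually_elim (use grad_lipschitz_segment(2)[OF U g] in "simp add: algebra_simps")
   qed simp
   ultimately show ?thesis using nd by simp
  qed
  \<comment> \<open>\<open>z\<close> is a zero, so it cannot be captured from \<open>y\<close>; the
    failing inequality bounds \<open>U y\<close> from above.\<close>
  have e5: "U y <= e *. (y - z) + (1 + C) * ((dist z y)\<^sup>2 / rh)" if y: "dist z y <= c * rh" "U y > 0" for y
  proof -
   have "dist z y < rh" using y crh by linarith
   then have b: "y : ball z rh" "z : ball z rh" using rh by auto
   have "~ U y + grad U y *. (z - y) > (norm (z - y))\<^sup>2 / rh"
    using capture[OF U g y(2) b] Uz by force
   then have "U y <= (dist z y)\<^sup>2 / rh + grad U y *. (y - z)" by (simp add: dist_norm inner_diff_right)
   moreover have "(grad U y - e) *. (y - z) <= C * dist z y / rh * dist z y"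
   proof -
    have "(grad U y - e) *. (y - z) <= norm (grad U y - e) * norm (y - z)" by (rule norm_cauchy_schwarz)
    also have "... <= C * dist z y / rh * dist z y"
     using e3[OF y] by (intro mult_mono) (auto simp: dist_norm norm_minus_commute c rh less_imp_le)
    finally show ?thesis .
   qed
   moreover have "C * dist z y / rh * dist z y = C * ((dist z y)\<^sup>2 / rh)" by (simp add: power2_eq_square)
   moreover have "grad U y *. (y - z) = e *. (y - z) + (grad U y - e) *. (y - z)" by (simp add: inner_diff_left)
   moreover have "(1 + C) * ((dist z y)\<^sup>2 / rh) = (dist z y)\<^sup>2 / rh + C * ((dist z y)\<^sup>2 / rh)" by (simp only: distrib_right mult_1)
   ultimately show ?thesis by linarith
  qed
  have "reg_pt c (2 + C) U z rh e" unfolding reg_pt_def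
  proof (intro conjI allI impI e1 e2)
   fix x assume x: "dist z x <= c * rh"
   define D where "D = (dist z x)\<^sup>2 / rh"
   have D: "D >= 0" using rh by (simp add: D_def)
   have CD: "C * D >= 0" using D c by simp
   have ex: "(2 + C) * (dist z x)\<^sup>2 / rh = 2 * D + C * D" "- (2 + C) * (dist z x)\<^sup>2 / rh = - 2 * D - C * D"
   proof -
    have "(2 + C) * (dist z x)\<^sup>2 / rh = (2 + C) * D" "- (2 + C) * (dist z x)\<^sup>2 / rh = - ((2 + C) * D)"
     by (simp_all only: D_def times_divide_eq_right minus_mult_left[symmetric] minus_divide_left[symmetric])
    then show "(2 + C) * (dist z x)\<^sup>2 / rh = 2 * D + C * D" "- (2 + C) * (dist z x)\<^sup>2 / rh = - 2 * D - C * D"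
     by (simp_all only: distrib_right)
   qed
   have e5': "U x <= e *. (x - z) + D + C * D" if "U x > 0"
   proof -
    have "(1 + C) * D = D + C * D" by (simp only: distrib_right mult_1)
    then show ?thesis using e5[OF x that] unfolding D_def[symmetric] by linarith
   qed
   { assume u: "U x > 0"
    have "C * dist z x / rh <= (2 + C) * dist z x / rh" using rh by (intro divide_right_mono mult_right_mono) auto
    then show "norm (grad U x - e) <= (2 + C) * dist z x / rh" using e3[OF x u] by linarith
    show "e *. (x - z) >= - (2 + C) * (dist z x)\<^sup>2 / rh" unfolding ex using e5'[OF u] u D CD by linarith }
   { assume u: "e *. (x - z) > (2 + C) * (dist z x)\<^sup>2 / rh"
    then have "e *. (x - z) > D" unfolding ex using D CD by linarith
    then show "U x > 0" using e4[OF x] by (simp add: D_def) }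
   show "abs (U x - max 0 (e *. (x - z))) <= (2 + C) * (dist z x)\<^sup>2 / rh" unfolding ex
   proof (cases "e *. (x - z) > D")
    case True
    then show "abs (U x - max 0 (e *. (x - z))) <= 2 * D + C * D" using e4[OF x] D CD by (simp add: D_def)
   next
    case False
    show "abs (U x - max 0 (e *. (x - z))) <= 2 * D + C * D"
    proof (cases "U x > 0")
     case True
     have "U x <= e *. (x - z) + D + C * D" by (rule e5'[OF True])
     then show ?thesis using True False D CD by (cases "e *. (x - z) >= 0") (auto simp: max_def)
    next
     case False2: False
     then have "U x = 0" using nn[of x] by simp
     then show ?thesis using False D CD by (auto simp: max_def)
    qed
   qed
  qed
  then show ?thesis by blast
 qed
 then show ?thesis using c by (intro exI[of _ c] exI[of _ "2 + C"]) auto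
qed

text \<open>Translates by multiples of \<open>2 * h\<close> along \<open>u\<close> are disjoint,
  because each line in direction \<open>u\<close> meets \<open>S\<close> within length
  \<open>h\<close>.\<close>

lemma measure_chord_le:
 fixes u :: "'a::euclidean_space"
 assumes S: "S : sets lebesgue" "S \<subseteq> cball z R" and u: "norm u = 1" and h: "h > 0" and R: "R > 0"
  and ch: "!!x t. x : S ==> t > 0 ==> x + t *R u : S ==> t <= h"
 shows "measure lebesgue S <= 4 * (h / R) * measure lebesgue (cball z (2 * R))"
proof (cases "R <= 4 * h")
 case True
 have "measure lebesgue S <= measure lebesgue (cball z (2 * R))"
  by (intro measure_mono_fmeasurable) (use S R in auto)
 also have "... <= 4 * (h / R) * measure lebesgue (cball z (2 * R))"
  using True R mult_right_mono[of 1 "4 * (h/R)" "measure lebesgue (cball z (2 * R))"] by (simp add: field_simps)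
 finally show ?thesis .
next
 case False
 define n where "n = nat \<lfloor>R / (2 * h)\<rfloor>"
 have n1: "real n <= R / (2 * h)" using R h by (simp add: n_def)
 have "R / (2 * h) > 2" using False h by (simp add: field_simps)
 moreover have "real n > R / (2 * h) - 1" using R h by (simp add: n_def)
 moreover have "R / (4 * h) = R / (2 * h) / 2" by simp
 ultimately have n2: "real n >= R / (4 * h)" by linarith
 have "real n * measure lebesgue S <= measure lebesgue (cball z (2 * R))"
 proof (rule measure_translates_le[OF S, of n "(2 * h) *R u"])
  show "real n * norm ((2 * h) *R u) <= R" using n1 u h by (simp add: field_simps)
  fix x j assume x: "x : S" and j: "1 <= j" "j < n"
  show "x + real j *R (2 * h) *R u ~: S"
  proof
   assume "x + real j *R (2 * h) *R u : S"
   then have "real j * (2 * h) <= h" using ch[OF x, of "real j * (2 * h)"] j h by simp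
   moreover have "real j * (2 * h) >= 1 * (2 * h)" using j h by (intro mult_right_mono) auto
   ultimately show False using h by linarith
  qed
 qed
 then have "R / (4 * h) * measure lebesgue S <= measure lebesgue (cball z (2 * R))"
  using mult_right_mono[OF n2, of "measure lebesgue S"] by simp
 then show ?thesis using h R by (simp add: field_simps)
qed

text \<open>A C^2 regularisation of \<open>max 0 t\<close> at scale \<open>ka\<close>: the second
  derivative \<open>sm2\<close> is the tent over [0, ka] of height \<open>2 / ka\<close> and
  integral 1, so the slope rises from 0 to 1 there.\<close>

definition sm :: "real => real => real" where
 "sm ka t = 2 / (3 * ka\<^sup>2) * ((max 0 t) ^ 3 - 2 * (max 0 (t - ka/2)) ^ 3 + (max 0 (t - ka)) ^ 3)"
definition sm1 :: "real => real => real" where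
 "sm1 ka t = 2 / ka\<^sup>2 * ((max 0 t) ^ 2 - 2 * (max 0 (t - ka/2)) ^ 2 + (max 0 (t - ka)) ^ 2)"
definition sm2 :: "real => real => real" where
 "sm2 ka t = 4 / ka\<^sup>2 * (max 0 t - 2 * max 0 (t - ka/2) + max 0 (t - ka))"

lemma pos_power_shift:
 "n >= 2 ==> ((%t::real. (max 0 (t - c)) ^ n) has_real_derivative real n * (max 0 (t - c)) ^ (n - 1)) (at t)"
 using DERIV_shift[of "%t. (max 0 t) ^ n" _ t "- c"] pos_power_has_derivative[of n "t - c"] by simp

lemma sm_deriv: "(sm ka has_real_derivative sm1 ka t) (at t)"
proof -
 have "((%t. 2 / (3 * ka\<^sup>2) * ((max 0 (t - 0)) ^ 3 - 2 * (max 0 (t - ka/2)) ^ 3 + (max 0 (t - ka)) ^ 3)) has_real_derivative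
  2 / (3 * ka\<^sup>2) * (real 3 * (max 0 (t - 0)) ^ (3 - 1) - 2 * (real 3 * (max 0 (t - ka/2)) ^ (3 - 1)) + real 3 * (max 0 (t - ka)) ^ (3 - 1))) (at t)"
  by (intro DERIV_cmult DERIV_add DERIV_diff pos_power_shift) auto
 moreover have "2 / (3 * ka\<^sup>2) * (real 3 * (max 0 (t - 0)) ^ (3 - 1) - 2 * (real 3 * (max 0 (t - ka/2)) ^ (3 - 1)) + real 3 * (max 0 (t - ka)) ^ (3 - 1)) = sm1 ka t"
 proof -
  have "2 / (3 * ka\<^sup>2) * (3 * a - 2 * (3 * b) + 3 * c) = 2 / ka\<^sup>2 * (a - 2 * b + c)" for a b c
   by (cases "ka = 0") (auto simp: field_simps)
  then show ?thesis unfolding sm1_def by simp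
 qed
 ultimately show ?thesis by (simp add: sm_def[abs_def])
qed

lemma sm1_deriv: "(sm1 ka has_real_derivative sm2 ka t) (at t)"
proof -
 have "((%t. 2 / ka\<^sup>2 * ((max 0 (t - 0)) ^ 2 - 2 * (max 0 (t - ka/2)) ^ 2 + (max 0 (t - ka)) ^ 2)) has_real_derivative
  2 / ka\<^sup>2 * (real 2 * (max 0 (t - 0)) ^ (2 - 1) - 2 * (real 2 * (max 0 (t - ka/2)) ^ (2 - 1)) + real 2 * (max 0 (t - ka)) ^ (2 - 1))) (at t)"
  by (intro DERIV_cmult DERIV_add DERIV_diff pos_power_shift) auto
 moreover have "2 / ka\<^sup>2 * (real 2 * (max 0 (t - 0)) ^ (2 - 1) - 2 * (real 2 * (max 0 (t - ka/2)) ^ (2 - 1)) + real 2 * (max 0 (t - ka)) ^ (2 - 1)) = sm2 ka t"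
 proof -
  have "2 / ka\<^sup>2 * (2 * a - 2 * (2 * b) + 2 * c) = 4 / ka\<^sup>2 * (a - 2 * b + c)" for a b c
   by (cases "ka = 0") (auto simp: field_simps)
  then show ?thesis unfolding sm2_def by simp
 qed
 ultimately show ?thesis by (simp add: sm1_def[abs_def])
qed

lemma sm2_continuous: "continuous_on S (sm2 ka)"
 unfolding sm2_def[abs_def] by (intro continuous_intros)

lemma sm1_continuous: "continuous_on S (sm1 ka)"
 by (intro continuous_at_imp_continuous_on ballI DERIV_isCont[OF sm1_deriv])
lemma sm_zero: "t <= 0 ==> ka > 0 ==> sm ka t = 0" "t <= 0 ==> ka > 0 ==> sm1 ka t = 0"
 by (simp_all add: sm_def sm1_def max_def)

lemma sm_large: "t >= ka ==> ka > 0 ==> sm1 ka t = 1"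
proof -
 assume t: "t >= ka" "ka > 0"
 have m: "max 0 t = t" "max 0 (t - ka/2) = t - ka/2" "max 0 (t - ka) = t - ka" using t by auto
 have "t ^ 2 - 2 * (t - ka/2) ^ 2 + (t - ka) ^ 2 = ka\<^sup>2 / 2"
  by (simp add: power2_eq_square algebra_simps)
 then show "sm1 ka t = 1" unfolding sm1_def m using t by simp
qed

lemma sm1_mid: assumes "ka/2 <= t" "t <= ka" "ka > 0" shows "sm1 ka t = 1 - 2 * (ka - t)\<^sup>2 / ka\<^sup>2"
proof -
 have m: "max 0 t = t" "max 0 (t - ka/2) = t - ka/2" "max 0 (t - ka) = 0" using assms by auto
 have "t ^ 2 - 2 * (t - ka/2) ^ 2 + 0 ^ 2 = ka\<^sup>2 / 2 - (ka - t)\<^sup>2"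
  by (simp add: power2_eq_square algebra_simps)
 moreover have "2 / ka\<^sup>2 * (ka\<^sup>2 / 2 - (ka - t)\<^sup>2) = 1 - 2 * (ka - t)\<^sup>2 / ka\<^sup>2"
  using assms(3) by (simp add: right_diff_distrib)
 ultimately show ?thesis unfolding sm1_def m by (simp only:)
qed

lemma sm1_low: assumes "0 <= t" "t <= ka/2" "ka > 0" shows "sm1 ka t = 2 * t\<^sup>2 / ka\<^sup>2"
proof -
 have m: "max 0 t = t" "max 0 (t - ka/2) = 0" "max 0 (t - ka) = 0" using assms by auto
 show ?thesis unfolding sm1_def m by simp
qed

lemma sm1_bounds:
 assumes "ka > 0" shows "0 <= sm1 ka t" "sm1 ka t <= 1"
proof -
 have "0 <= sm1 ka t & sm1 ka t <= 1"
 proof -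
  consider "t <= 0" | "0 <= t" "t <= ka/2" | "ka/2 <= t" "t <= ka" | "ka <= t" by linarith
  then show ?thesis
  proof cases
   case 2
   have "t\<^sup>2 <= (ka/2)\<^sup>2" using 2 by (intro power_mono) auto
   then have "t\<^sup>2 <= ka\<^sup>2 / 4" by (simp add: power_divide)
   then have "2 * t\<^sup>2 <= ka\<^sup>2" using zero_le_power2[of t] by linarith
   then show ?thesis using sm1_low[OF 2 assms] assms by simp
  next
   case 3
   have "(ka - t)\<^sup>2 <= (ka/2)\<^sup>2" using 3 by (intro power_mono) auto
   then have "(ka - t)\<^sup>2 <= ka\<^sup>2 / 4" by (simp add: power_divide)
   then have "2 * (ka - t)\<^sup>2 <= ka\<^sup>2" using zero_le_power2[of "ka - t"] by linarith
   then show ?thesis using sm1_mid[OF 3 assms] assms by simp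
  qed (use sm_zero sm_large assms in auto)
 qed
 then show "0 <= sm1 ka t" "sm1 ka t <= 1" by auto
qed

lemma sm_bounds:
 assumes "ka > 0" shows "0 <= sm ka t" "sm ka t <= max 0 t" "t - ka <= sm ka t"
proof -
 have mono: "sm ka a <= sm ka b" if "a <= b" for a b
 proof (rule DERIV_nonneg_imp_nondecreasing[OF that])
  fix x show "EX y. (sm ka has_real_derivative y) (at x) & 0 <= y"
   by (rule exI[of _ "sm1 ka x"]) (simp add: sm_deriv sm1_bounds(1)[OF assms])
 qed
 have mono2: "a - sm ka a <= b - sm ka b" if "a <= b" for a b
 proof (rule DERIV_nonneg_imp_nondecreasing[OF that, of "%t. t - sm ka t"])
  fix x
  have "((%t. t - sm ka t) has_real_derivative 1 - sm1 ka x) (at x)" by (intro DERIV_diff DERIV_ident sm_deriv)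
  then show "EX y. ((%t. t - sm ka t) has_real_derivative y) (at x) & 0 <= y"
   using sm1_bounds(2)[OF assms, of x] by (intro exI[of _ "1 - sm1 ka x"]) simp
 qed
 have z: "sm ka 0 = 0" by (rule sm_zero[OF order_refl assms])
 show "0 <= sm ka t" using mono[of 0 t] z sm_zero(1)[of t ka] assms by (cases "t >= 0") auto
 show "sm ka t <= max 0 t" using mono2[of 0 t] z sm_zero(1)[of t ka] assms by (cases "t >= 0") auto
 show "t - ka <= sm ka t"
 proof (cases "t <= ka")
  case True then show ?thesis using \<open>0 <= sm ka t\<close> by linarith
 next
  case False
  have "(%t. t - sm ka t) t <= (%t. t - sm ka t) ka"
  proof (rule DERIV_nonpos_imp_nonincreasing[of ka t])
   fix x assume "ka <= x" "x <= t"
   have "((%t. t - sm ka t) has_real_derivative 1 - sm1 ka x) (at x)" by (intro DERIV_diff DERIV_ident sm_deriv)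
   then show "EX y. ((%t. t - sm ka t) has_real_derivative y) (at x) & y <= 0"
    using sm_large[OF \<open>ka <= x\<close> assms] by auto
  qed (use False in simp)
  then show ?thesis using mono[of 0 ka] z assms by simp
 qed
qed

lemma C2on_compose:
 assumes f: "C2on S f g l" and F: "!!t. (F has_real_derivative F1 t) (at t)" "!!t. (F1 has_real_derivative F2 t) (at t)" "continuous_on UNIV F2"
 shows "C2on S (%x. F (f x)) (%x. F1 (f x) *R g x) (%x. F2 (f x) * (g x *. g x) + F1 (f x) * l x)"
proof -
 obtain H where H: "!!x. x : S ==> (f has_derivative (%h. g x *. h)) (at x)" "!!x. x : S ==> (g has_derivative H x) (at x)"
   "!!x. x : S ==> l x = (\<Sum>b\<in>Basis. H x b *. b)" "!!b. b : Basis ==> continuous_on S (%x. H x b)"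
  using f unfolding C2on_def by blast
 have d: "((%x. F (f x)) has_derivative (%h. F1 (f x) * (g x *. h))) (at x)" if "x : S" for x
  using has_derivative_compose[OF H(1)[OF that] F(1)[unfolded has_field_derivative_def]] by simp
 have d1: "((%x. F1 (f x)) has_derivative (%h. F2 (f x) * (g x *. h))) (at x)" if "x : S" for x
  using has_derivative_compose[OF H(1)[OF that] F(2)[unfolded has_field_derivative_def]] by simp
 have cF1: "continuous_on UNIV F1" by (intro continuous_at_imp_continuous_on ballI DERIV_isCont[OF F(2)])
 note cf = C2on_continuous[OF f]
 show ?thesis
 proof (rule C2onI)
  show "((%x. F (f x)) has_derivative (%h. (F1 (f x) *R g x) *. h)) (at x)" if "x : S" for x using d[OF that] by simp
  show "((%x. F1 (f x) *R g x) has_derivative (%h. F1 (f x) *R H x h + (F2 (f x) * (g x *. h)) *R g x)) (at x)" if "x : S" for x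
   by (rule has_derivative_scaleR[OF d1[OF that] H(2)[OF that]])
  show "F2 (f x) * (g x *. g x) + F1 (f x) * l x = (\<Sum>b\<in>Basis. (F1 (f x) *R H x b + (F2 (f x) * (g x *. b)) *R g x) *. b)" if "x : S" for x
  proof -
   have "(\<Sum>b\<in>Basis. (F1 (f x) *R H x b + (F2 (f x) * (g x *. b)) *R g x) *. b)
    = F1 (f x) * (\<Sum>b\<in>Basis. H x b *. b) + F2 (f x) * (\<Sum>b\<in>Basis. (g x *. b) * (g x *. b))"
    by (simp add: inner_add_left sum.distrib sum_distrib_left mult.assoc)
   then show ?thesis using H(3)[OF that] euclidean_inner[of "g x" "g x"] by simp
  qed
  show "continuous_on S (%x. F1 (f x) *R H x b + (F2 (f x) * (g x *. b)) *R g x)" if "b : Basis" for b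
   by (intro continuous_intros H(4)[OF that] cf continuous_on_compose2[OF cF1] continuous_on_compose2[OF F(3)]) auto
 qed
qed

lemma C2on_sm: "C2on S f g l ==> C2on S (%x. sm ka (f x)) (%x. sm1 ka (f x) *R g x) (%x. sm2 ka (f x) * (g x *. g x) + sm1 ka (f x) * l x)"
 by (rule C2on_compose) (auto intro: sm_deriv sm1_deriv sm2_continuous)

lemma C2on_linear: "C2on S (%y. e *. y + c) (%_. e) (%_. 0)"
proof (rule C2onI[where H = "%_ _. 0"])
 show "((%y. e *. y + c) has_derivative (%h. e *. h)) (at x)" for x
  using has_derivative_add[OF has_derivative_inner_right[OF has_derivative_ident] has_derivative_const[of c]] by simp
qed auto

lemma C2on_diff: "C2on S f g l ==> C2on S f' g' l' ==> C2on S (%x. f x - f' x) (%x. g x - g' x) (%x. l x - l' x)"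
 using C2on_add[of S f g l "%x. -1 * f' x" "%x. -1 *R g' x" "%x. -1 * l' x"] C2on_cmult[of S f' g' l' "-1"] by simp

lemma le_zero_of_le_small:
 fixes X C :: real
 assumes "!!ka. 0 < ka ==> ka <= 1 ==> X <= C * ka" shows "X <= 0"
proof (rule ccontr)
 assume "~ X <= 0"
 define k where "k = min 1 (X / (2 * (abs (C) + 1)))"
 have k: "0 < k" "k <= 1" "k <= X / (2 * (abs (C) + 1))" using \<open>~ X <= 0\<close> by (auto simp: k_def)
 have "X <= C * k" by (rule assms[OF k(1,2)])
 also have "... <= (abs (C) + 1) * k" using k by (intro mult_right_mono) auto
 also have "... <= (abs (C) + 1) * (X / (2 * (abs (C) + 1)))" using k by (intro mult_left_mono) auto
 also have "... = X / 2" by (simp add: field_simps)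
 finally show False using \<open>~ X <= 0\<close> by simp
qed

lemma integral_pos_of_continuous:
 fixes f :: "'a::euclidean_space => real"
 assumes f: "continuous_on UNIV f" "!!x. f x >= 0" "integrable lborel f" and x: "f x0 > 0"
 shows "LI f > 0"
proof -
 have op: "open {x. f x > f x0 / 2}" by (intro open_Collect_less continuous_intros f(1))
 have "x0 : {x. f x > f x0 / 2}" using x by simp
 then obtain r where r: "r > 0" "ball x0 r \<subseteq> {x. f x > f x0 / 2}" using op open_contains_ball by blast
 have fin: "emeasure lborel (ball x0 r) < top" using emeasure_bounded_finite[of "ball x0 r"] by simp
 have "measure lborel (ball x0 r) > 0" by (rule content_ball_pos[OF r(1)])
 then have "0 < (f x0 / 2) * measure lborel (ball x0 r)" using x by simp
 also have "... = LI (%x. (f x0 / 2) * indicator (ball x0 r) x)" by simp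
 also have "... <= LI f"
 proof (rule integral_mono)
  show "integrable lborel (%x. (f x0 / 2) * indicator (ball x0 r) x)"
   by (intro integrable_mult_right integrable_real_indicator) (use fin in auto)
  show "(f x0 / 2) * indicator (ball x0 r) x <= f x" for x
   using r(2) f(2)[of x] by (cases "x : ball x0 r") auto
 qed (rule f(3))
 finally show ?thesis .
qed

lemma bounded_borel_integrable:
 fixes f :: "'a::euclidean_space => real"
 assumes m: "f : borel_measurable borel" and b: "!!x. abs (f x) <= M" and z: "!!x. norm x > R ==> f x = 0"
 shows "integrable lborel f"
proof (rule Bochner_Integration.integrable_bound[of _ "%x. M * indicator (cball 0 R) x"])
 have "emeasure lborel (cball (0::'a) R) < top" using emeasure_bounded_finite[of "cball (0::'a) R"] by simp
 then show "integrable lborel (%x. M * indicator (cball (0::'a) R) x)"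
  by (intro integrable_mult_right integrable_real_indicator) auto
 show "f : borel_measurable lborel" using m by simp
 show "AE x in lborel. norm (f x) <= norm (M * indicator (cball 0 R) x)"
 proof (intro AE_I2)
  fix x show "norm (f x) <= norm (M * indicator (cball 0 R) x)"
   using b[of x] z[of x] by (cases "norm x > R") (auto simp: abs_le_iff)
 qed
qed

section \<open>The slope at regular free boundary points is one\<close>

text \<open>Divergence theorem for \<open>f *R gxi\<close>. A single derivative of \<open>f\<close>
  enters, which is what the truncations below possess.\<close>

lemma green_first_order:
 assumes f: "!!x. x : S ==> (f has_derivative (%h. gf x *. h)) (at x)" "continuous_on S gf"
  and xi: "C2on UNIV xi gxi lxi" and S: "open S"
  and K: "compact K" "K \<subseteq> S" "!!x. x ~: K ==> xi x = 0"
 shows "LI (%x. f x * lxi x) = - LI (%x. gf x *. gxi x)"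
  "integrable lborel (%x. f x * lxi x)" "integrable lborel (%x. gf x *. gxi x)"
proof -
 obtain X where X: "!!x. (gxi has_derivative X x) (at x)"
   "!!x. lxi x = (\<Sum>b\<in>Basis. X x b *. b)" "!!b. b : Basis ==> continuous_on UNIV (%x. X x b)"
  using xi unfolding C2on_def by blast
 note z = C2on_zero_off_compact[OF xi K(1) K(3)]
 note cx = C2on_continuous[OF xi]
 have cf: "continuous_on S f" by (intro continuous_at_imp_continuous_on ballI has_derivative_continuous[OF f(1)])
 have cS: "continuous_on S xi" "continuous_on S gxi" "continuous_on S lxi" "!!b. b : Basis ==> continuous_on S (%x. X x b)"
  using cx X(3) continuous_on_subset by blast+
 show i1: "integrable lborel (%x. f x * lxi x)"
  by (rule integrable_cts_compact[OF K(1)])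
   (use z in "auto intro!: continuous_intros continuous_on_subset[OF _ K(2)] cf cS")
 show i2: "integrable lborel (%x. gf x *. gxi x)"
  by (rule integrable_cts_compact[OF K(1)])
   (use z in "auto intro!: continuous_intros continuous_on_subset[OF _ K(2)] f(2) cS")
 have "LI (%x. f x * lxi x + gf x *. gxi x) = 0"
 proof (rule integral_divergence_zero[OF S K(1,2), where F = "%x. f x *R gxi x" and D = "%x h. f x *R X x h + (gf x *. h) *R gxi x"])
  show "((%x. f x *R gxi x) has_derivative (%h. f x *R X x h + (gf x *. h) *R gxi x)) (at x)" if "x : S" for x
   by (rule has_derivative_scaleR[OF f(1)[OF that] X(1)])
  show "continuous_on S (%x. f x *R X x b + (gf x *. b) *R gxi x)" if "b : Basis" for b
   by (intro continuous_intros cf cS f(2) that)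
  show "f x * lxi x + gf x *. gxi x = (\<Sum>b\<in>Basis. (f x *R X x b + (gf x *. b) *R gxi x) *. b)" for x
  proof -
   have "gf x *. gxi x = (\<Sum>b\<in>Basis. (gf x *. b) * (gxi x *. b))" by (rule euclidean_inner)
   then show ?thesis by (simp add: X(2) inner_add_left sum.distrib sum_distrib_left)
  qed
 qed (use z in auto)
 then show "LI (%x. f x * lxi x) = - LI (%x. gf x *. gxi x)"
  using i1 i2 by simp
qed

section \<open>Domain variations of half-plane functions\<close>

lemma integral_abs_le_indicator:
 fixes F :: "'a::euclidean_space => real"
 assumes b: "!!y. abs (F y) <= M * indicator T y" and T: "T : sets borel" "bounded T"
 shows "abs (LI F) <= M * measure lborel T"
proof -
 have "emeasure lborel T < top" using emeasure_bounded_finite[OF T(2)] by simp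
 then have i: "integrable lborel (%y. M * indicator T y :: real)"
  by (intro integrable_mult_right integrable_real_indicator) (use T in auto)
 have M: "0 <= M * indicator T y" for y using b[of y] by (meson abs_ge_zero order_trans)
 have "LI F <= LI (%y. M * indicator T y)"
 proof (rule integral_mono'[OF i])
  show "F y <= M * indicator T y" for y using b[of y] by linarith
 qed (rule M)
 moreover have "LI (%y. - F y) <= LI (%y. M * indicator T y)"
 proof (rule integral_mono'[OF i])
  show "- F y <= M * indicator T y" for y using b[of y] by linarith
 qed (rule M)
 ultimately show ?thesis using T by auto
qed

text \<open>Level function of a half-space perturbed by a bump of height \<open>s\<close>; the
  factor 8 turns \<open>psi0\<close> into \<open>bump 4\<close>.\<close>

definition fs :: "'a::euclidean_space => real => 'a => real" where
 "fs e s y = e *. y + s * (8 * psi0 y)"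

definition gpsi :: "'a::euclidean_space => 'a" where "gpsi y = 8 *R (- (bump 3 y *R y))"

lemma C2on_psi8: "C2on UNIV (%y. 8 * psi0 y) gpsi (%y. 8 * lap0 y)"
 unfolding gpsi_def by (rule C2on_cmult[OF C2on_psi0])

lemma psi8_bounds: "0 <= 8 * psi0 y" "8 * psi0 y <= 1" "norm y >= 1 ==> psi0 y = 0" "norm y >= 1 ==> gpsi y = 0"
 by (simp_all add: psi0_def bump_nonneg bump_le_one bump_zero gpsi_def)

lemma gpsi_bound: "norm (gpsi y) <= 8"
proof (cases "norm y >= 1")
 case False
 have "bump 3 y * norm y <= 1 * 1" by (intro mult_mono bump_le_one) (use False in auto)
 then show ?thesis by (simp add: gpsi_def bump_nonneg)
qed (simp add: psi8_bounds)

lemma C2on_fs: "C2on UNIV (%y. fs e s y + k) (%y. e + s *R gpsi y) (%y. 0 + s * (8 * lap0 y))"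
proof -
 have "C2on UNIV (%y. (e *. y + k) + s * (8 * psi0 y)) (%y. e + s *R gpsi y) (%y. 0 + s * (8 * lap0 y))"
  by (intro C2on_add C2on_linear C2on_cmult C2on_psi8)
 moreover have "(%y. (e *. y + k) + s * (8 * psi0 y)) = (%y. fs e s y + k)" by (auto simp: fs_def)
 ultimately show ?thesis by simp
qed

lemma fs_continuous: "continuous_on S (fs e s)"
 unfolding fs_def[abs_def] by (intro continuous_intros)

lemma gpsi_continuous: "continuous_on S gpsi"
 using C2on_continuous(2)[OF C2on_psi8] continuous_on_subset by blast

text \<open>The bump has slope at most 8, so \<open>16 * |s| <= norm e\<close> leaves half the slope
  of the linear part. Hence \<open>fs\<close> crosses each level once along \<open>e\<close>, and
  thin level strips have small measure.\<close>

lemma fs_increasing: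
 assumes e: "e ~= 0" "16 * abs (s) <= norm e" and t: "t >= 0"
 shows "fs e s (y + t *R (e /\<^sub>R norm e)) - fs e s y >= t * norm e / 2"
proof -
 define u where "u = e /\<^sub>R norm e"
 have u: "norm u = 1" "e *. u = norm e" using e by (auto simp: u_def power2_norm_eq_inner[symmetric] power2_eq_square)
 have "norm (8 * psi0 (y + t *R u) - 8 * psi0 y) <= 8 * norm ((y + t *R u) - y)"
 proof (rule differentiable_bound[where S = UNIV and f' = "%x h. gpsi x *. h"])
  show "((%y. 8 * psi0 y) has_derivative (%h. gpsi x *. h)) (at x within UNIV)" for x
   using C2on_deriv[OF C2on_psi8] by simp
  show "onorm (%h. gpsi x *. h) <= 8" for x :: 'a
  proof (rule onorm_bound)
   show "norm (gpsi x *. h) <= 8 * norm h" for h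
    using Cauchy_Schwarz_ineq2[of "gpsi x" h] mult_right_mono[OF gpsi_bound[of x], of "norm h"] by simp
  qed simp
 qed auto
 then have "abs (8 * psi0 (y + t *R u) - 8 * psi0 y) <= 8 * t" using u t by simp
 then have "abs (s) * abs (8 * psi0 (y + t *R u) - 8 * psi0 y) <= abs (s) * (8 * t)" by (intro mult_left_mono) auto
 also have "abs (s) * (8 * t) <= t * norm e / 2" using mult_right_mono[OF e(2) t] by (simp add: mult_ac)
 finally have "abs (s * (8 * psi0 (y + t *R u) - 8 * psi0 y)) <= t * norm e / 2" by (simp only: abs_mult)
 moreover have "fs e s (y + t *R u) - fs e s y = t * norm e + s * (8 * psi0 (y + t *R u) - 8 * psi0 y)"
  using u by (simp add: fs_def inner_add_right algebra_simps)
 ultimately show ?thesis unfolding u_def by linarith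
qed

definition strip :: "'a::euclidean_space => real => real => 'a set" where
 "strip e s ka = {y : cball 0 1. abs (fs e s y) <= ka}"

definition mu2 :: "'a::euclidean_space itself => real" where "mu2 _ = measure lebesgue (cball (0::'a) 2)"

lemma strip_closed: "closed (strip e s ka)"
proof -
 have "strip e s ka = cball 0 1 Int {y. abs (fs e s y) <= ka}" by (auto simp: strip_def)
 moreover have "closed {y. abs (fs e s y) <= ka}" by (intro closed_Collect_le continuous_intros fs_continuous)
 ultimately show ?thesis by (auto intro: closed_Int)
qed

lemma strip_facts: "strip e s ka : sets borel" "bounded (strip e s ka)"
 using borel_closed[OF strip_closed] by (auto simp: strip_def intro: bounded_subset[OF bounded_cball[of 0 1]])

lemma strip_measure:
 fixes e :: "'a::euclidean_space"
 assumes e: "e ~= 0" "16 * abs (s) <= norm e" and k: "ka > 0"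
 shows "measure lborel (strip e s ka) <= 16 * mu2 TYPE('a) / norm e * ka"
proof -
 have ne: "norm e > 0" using e by simp
 have "measure lebesgue (strip e s ka) <= 4 * ((4 * ka / norm e) / 1) * measure lebesgue (cball (0::'a) (2 * 1))"
 proof (rule measure_chord_le[where u = "e /\<^sub>R norm e"])
  show "strip e s ka : sets lebesgue" using strip_facts(1)[of e s ka] by simp
  fix x :: 'a and t :: real assume a: "x : strip e s ka" "t > 0" "x + t *R (e /\<^sub>R norm e) : strip e s ka"
  have "t * norm e / 2 <= fs e s (x + t *R (e /\<^sub>R norm e)) - fs e s x" by (rule fs_increasing) (use e a in auto)
  moreover have "abs (fs e s (x + t *R (e /\<^sub>R norm e))) <= ka" "abs (fs e s x) <= ka" using a(1,3) unfolding strip_def by auto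
  ultimately have "t * norm e <= 4 * ka" by linarith
  then show "t <= 4 * ka / norm e" using ne by (simp add: pos_le_divide_eq)
 qed (use ne k in "auto simp: strip_def")
 then show ?thesis using strip_facts(1)[of e s ka] by (simp add: mu2_def mult_ac)
qed

definition Pn :: "'a::euclidean_space => real => 'a => real" where "Pn e s y = of_bool (fs e s y > 0)"

lemma Pn_measurable [measurable]: "Pn e s : borel_measurable borel"
proof -
 have [measurable]: "fs e s : borel_measurable borel" by (rule borel_measurable_continuous_onI[OF fs_continuous])
 show ?thesis unfolding Pn_def[abs_def] of_bool_def by measurable
qed

lemma gpsi_measurable [measurable]: "gpsi : borel_measurable borel"
 by (rule borel_measurable_continuous_onI[OF gpsi_continuous])

lemma Pn_bounds: "0 <= Pn e s y" "Pn e s y <= 1"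
 by (auto simp: Pn_def)

lemma Pn_integrals:
 "integrable lborel (%y. Pn e s y - Pn e 0 y)" "integrable lborel (%y. Pn e s y * (e *. gpsi y))"
 "integrable lborel (%y. Pn e s y * (gpsi y *. gpsi y))"
proof -
 show "integrable lborel (%y. Pn e s y - Pn e 0 y)"
 proof (rule bounded_borel_integrable[of _ 1 1])
  show "abs (Pn e s y - Pn e 0 y) <= 1" for y by (simp add: Pn_def)
  show "Pn e s y - Pn e 0 y = 0" if "norm y > 1" for y using that by (simp add: Pn_def fs_def psi8_bounds)
 qed measurable
 show "integrable lborel (%y. Pn e s y * (e *. gpsi y))"
 proof (rule bounded_borel_integrable[of _ "norm e * 8" 1])
  fix y
  have "abs (e *. gpsi y) <= norm e * 8"
   using Cauchy_Schwarz_ineq2[of e "gpsi y"] mult_left_mono[OF gpsi_bound[of y], of "norm e"] by simp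
  then show "abs (Pn e s y * (e *. gpsi y)) <= norm e * 8" by (auto simp: Pn_def)
 qed (auto simp: psi8_bounds)
 show "integrable lborel (%y. Pn e s y * (gpsi y *. gpsi y))"
 proof (rule bounded_borel_integrable[of _ "8 * 8" 1])
  fix y :: 'a
  have "abs (gpsi y *. gpsi y) <= 8 * 8"
   using Cauchy_Schwarz_ineq2[of "gpsi y" "gpsi y"] mult_mono[OF gpsi_bound[of y] gpsi_bound[of y]] by simp
  then show "abs (Pn e s y * (gpsi y *. gpsi y)) <= 8 * 8" by (auto simp: Pn_def)
 qed (auto simp: psi8_bounds)
qed

lemma sm1_vs_Pn:
 assumes k: "ka > 0"
 shows "abs (Pn e s y - sm1 ka (fs e s y)) <= of_bool (abs (fs e s y) <= ka)"
  "abs (fs e s y) > ka ==> sm1 ka (fs e s y + ka) = Pn e s y"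
proof -
 show "abs (Pn e s y - sm1 ka (fs e s y)) <= of_bool (abs (fs e s y) <= ka)"
 proof (cases "abs (fs e s y) <= ka")
  case True
  then show ?thesis using Pn_bounds(1,2)[of e s y] sm1_bounds[OF k, of "fs e s y"] by (simp add: abs_le_iff)
 next
  case False
  then consider "fs e s y > ka" | "fs e s y < - ka" by linarith
  then show ?thesis
   by cases (use k sm_large[of ka "fs e s y"] sm_zero(2)[of "fs e s y" ka] in "auto simp: Pn_def")
 qed
 assume "abs (fs e s y) > ka"
 then consider "fs e s y > ka" | "fs e s y < - ka" by linarith
 then show "sm1 ka (fs e s y + ka) = Pn e s y"
  by cases (use k sm_large[of ka "fs e s y + ka"] sm_zero(2)[of "fs e s y + ka" ka] in "auto simp: Pn_def")
qed

lemma strip2_measure: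
 fixes e :: "'a::euclidean_space"
 assumes e: "e ~= 0" "16 * abs (s) <= norm e" and k: "ka > 0"
 shows "measure lborel (strip e s ka Un strip e 0 ka) <= 32 * mu2 TYPE('a) / norm e * ka"
proof -
 have "measure lborel (strip e s ka Un strip e 0 ka) <= measure lborel (strip e s ka) + measure lborel (strip e 0 ka)"
  by (rule measure_Un_le) (use strip_facts in auto)
 also have "... <= 16 * mu2 TYPE('a) / norm e * ka + 16 * mu2 TYPE('a) / norm e * ka"
  by (intro add_mono strip_measure) (use e k in auto)
 also have "... = 32 * mu2 TYPE('a) / norm e * ka" by (simp add: mult_ac)
 finally show ?thesis .
qed

lemma strip_outside: "y ~: strip e s ka ==> norm y <= 1 ==> abs (fs e s y) > ka"
 by (simp add: strip_def)

lemma fs_zero: "fs e 0 y = e *. y" "norm y >= 1 ==> fs e s y = e *. y"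
 by (simp_all add: fs_def psi8_bounds)

lemma s_gpsi_bound:
 assumes "16 * abs (s) <= norm e"
 shows "norm (s *R gpsi y) <= norm e / 2" "abs (s * (e *. gpsi y)) <= (norm e)\<^sup>2 / 2"
proof -
 have "abs (s) * norm (gpsi y) <= (norm e / 16) * 8" using assms by (intro mult_mono gpsi_bound) auto
 then show 1: "norm (s *R gpsi y) <= norm e / 2" by simp
 have "abs (e *. (s *R gpsi y)) <= norm e * norm (s *R gpsi y)" by (rule Cauchy_Schwarz_ineq2)
 also have "... <= norm e * (norm e / 2)" by (rule mult_left_mono[OF 1]) simp
 finally show "abs (s * (e *. gpsi y)) <= (norm e)\<^sup>2 / 2" by (simp add: power2_eq_square)
qed

text \<open>The \<open>e\<close>-derivative of the compactly supported difference of the positive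
  parts of \<open>fs e s\<close> and \<open>fs e 0\<close> integrates to zero. The positive parts
  are regularised by \<open>sm\<close>, at a cost of the order of the strip measure, hence of
  \<open>ka\<close>.\<close>

lemma Pn_identity:
 fixes e :: "'a::euclidean_space"
 assumes e: "e ~= 0" "16 * abs (s) <= norm e"
 shows "(norm e)\<^sup>2 * LI (%y. Pn e s y - Pn e 0 y) + s * LI (%y. Pn e s y * (e *. gpsi y)) = 0"
  (is "?X = 0")
proof -
 define al where "al = norm e"
 have al: "al > 0" "e *. e = al\<^sup>2" using e by (auto simp: al_def power2_norm_eq_inner)
 define W where "W = 32 * mu2 TYPE('a) / al"
 have key: "abs (?X) <= 3 * al\<^sup>2 * W * ka" if k: "0 < ka" "ka <= 1" for ka
 proof -
  define q where "q y = sm1 ka (fs e s y) * ((e + s *R gpsi y) *. e) - sm1 ka (fs e 0 y) * (e *. e)" for y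
  have csm: "continuous_on S (%y. sm1 ka (fs e t y))" for S t
   by (rule continuous_on_compose2[OF sm1_continuous[of UNIV] fs_continuous]) auto
  have q0: "LI q = 0"
  proof (rule integral_directional_derivative_zero[where S = UNIV and K = "cball 0 1" and b = e
     and f = "%y. sm ka (fs e s y) - sm ka (fs e 0 y)"
     and D = "%y h. (sm1 ka (fs e s y) *R (e + s *R gpsi y)) *. h - (sm1 ka (fs e 0 y) *R e) *. h"])
   show "((%y. sm ka (fs e s y) - sm ka (fs e 0 y)) has_derivative
    (%h. (sm1 ka (fs e s y) *R (e + s *R gpsi y)) *. h - (sm1 ka (fs e 0 y) *R e) *. h)) (at y)" for y
    using C2on_deriv[OF C2on_sm[OF C2on_fs[of e s 0], of ka], of y] C2on_deriv[OF C2on_sm[OF C2on_fs[of e 0 0], of ka], of y]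
    by (intro has_derivative_diff) simp_all
   show "continuous_on UNIV (%y. (sm1 ka (fs e s y) *R (e + s *R gpsi y)) *. e - (sm1 ka (fs e 0 y) *R e) *. e)"
    by (intro continuous_intros gpsi_continuous csm)
  qed (auto simp: q_def fs_def psi8_bounds)
  have qi: "integrable lborel q"
  proof (rule integrable_cts_compact[of "cball 0 1"])
   show "continuous_on (cball 0 1) q" unfolding q_def by (intro continuous_intros gpsi_continuous csm)
  qed (auto simp: q_def fs_def psi8_bounds)
  define F where "F y = al\<^sup>2 * (Pn e s y - Pn e 0 y) + s * (Pn e s y * (e *. gpsi y)) - q y" for y
  have i1: "integrable lborel (%y. al\<^sup>2 * (Pn e s y - Pn e 0 y))" "integrable lborel (%y. s * (Pn e s y * (e *. gpsi y)))"
   using Pn_integrals[of e s] by auto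
  have "LI F = LI (%y. al\<^sup>2 * (Pn e s y - Pn e 0 y) + s * (Pn e s y * (e *. gpsi y))) - LI q"
   unfolding F_def by (intro bi_idiff bi_add i1 qi)
  also have "... = ?X" unfolding bi_iadd[OF i1] q0 al_def[symmetric] by simp
  finally have "abs (?X) = abs (LI F)" by simp
  also have "abs (LI F) <= 3 * al\<^sup>2 * measure lborel (strip e s ka Un strip e 0 ka)"
  proof (rule integral_abs_le_indicator)
   fix y
   show "abs (F y) <= 3 * al\<^sup>2 * indicator (strip e s ka Un strip e 0 ka) y"
   proof (cases "norm y <= 1")
    case False
    then have "F y = 0" by (simp add: F_def q_def fs_def Pn_def psi8_bounds)
    then show ?thesis by simp
   next
    case True
    have eg: "abs (s * (e *. gpsi y)) <= al\<^sup>2 / 2" unfolding al_def by (rule s_gpsi_bound(2)[OF e(2)])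
    have "F y = (Pn e s y - sm1 ka (fs e s y)) * (al\<^sup>2 + s * (e *. gpsi y)) - (Pn e 0 y - sm1 ka (fs e 0 y)) * al\<^sup>2"
     using al(2) by (simp add: F_def q_def inner_add_left inner_commute algebra_simps)
    moreover have a1: "abs ((Pn e s y - sm1 ka (fs e s y)) * (al\<^sup>2 + s * (e *. gpsi y))) <= of_bool (abs (fs e s y) <= ka) * (2 * al\<^sup>2)"
     unfolding abs_mult using eg by (intro mult_mono sm1_vs_Pn(1)[OF k(1)]) auto
    moreover have a2: "abs ((Pn e 0 y - sm1 ka (fs e 0 y)) * al\<^sup>2) <= of_bool (abs (fs e 0 y) <= ka) * al\<^sup>2"
     unfolding abs_mult by (intro mult_mono sm1_vs_Pn(1)[OF k(1)]) auto
    ultimately have b: "abs (F y) <= of_bool (abs (fs e s y) <= ka) * (2 * al\<^sup>2) + of_bool (abs (fs e 0 y) <= ka) * al\<^sup>2" by linarith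
    show ?thesis
    proof (cases "y : strip e s ka Un strip e 0 ka")
     case True
     have "of_bool (abs (fs e s y) <= ka) * (2 * al\<^sup>2) <= 2 * al\<^sup>2" "of_bool (abs (fs e 0 y) <= ka) * al\<^sup>2 <= al\<^sup>2" by auto
     then show ?thesis using b True by simp
    next
     case False
     then have "~ abs (fs e s y) <= ka" "~ abs (fs e 0 y) <= ka" using strip_outside \<open>norm y <= 1\<close> by force+
     then show ?thesis using b by simp
    qed
   qed
  qed (use strip_facts in auto)
  also have "... <= 3 * al\<^sup>2 * (W * ka)"
   using strip2_measure[OF e k(1)] by (intro mult_left_mono) (auto simp: W_def al_def)
  finally show ?thesis by (simp only: mult.assoc)
 qed
 have "abs (?X) <= 0" by (rule le_zero_of_le_small[OF key])
 then show ?thesis by simp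
qed

lemma half_linear_green:
 fixes e :: "'a::euclidean_space"
 assumes e: "e ~= 0" and w: "C2on UNIV w gw lw" and z: "!!x. x ~: cball 0 1 ==> w x = 0"
 shows "LI (%y. max 0 (e *. y) * lw y) = - LI (%y. Pn e 0 y * (e *. gw y))"
  "integrable lborel (%y. max 0 (e *. y) * lw y)" "integrable lborel (%y. Pn e 0 y * (e *. gw y))"
  "integrable lborel (%y. abs (lw y))"
proof -
 note cw = C2on_continuous[OF w]
 have zw: "gw x = 0" "lw x = 0" if "~ norm x <= 1" for x
  using C2on_zero_off_compact[OF w compact_cball[of 0 1] z, of x] that by auto
 have "bounded (gw ` cball 0 1)" by (intro compact_imp_bounded compact_continuous_image continuous_on_subset[OF cw(2)]) auto
 then obtain G where G': "G > 0" "ALL x:gw ` cball 0 1. norm x <= G" unfolding bounded_pos by blast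
 then have G: "!!y. y : cball 0 1 ==> norm (gw y) <= G" "G > 0" by blast+
 define M where "M = norm e * G"
 have M: "abs (e *. gw y) <= M" for y
 proof (cases "y : cball 0 1")
  case True
  have "abs (e *. gw y) <= norm e * norm (gw y)" by (rule Cauchy_Schwarz_ineq2)
  also have "... <= M" unfolding M_def by (intro mult_left_mono G True) simp
  finally show ?thesis .
 next
  case False
  then show ?thesis using zw(1) G(2) by (simp add: M_def)
 qed
 have [measurable]: "gw : borel_measurable borel" by (rule borel_measurable_continuous_onI[OF cw(2)])
 show i2: "integrable lborel (%y. Pn e 0 y * (e *. gw y))"
 proof (rule bounded_borel_integrable[of _ M 1])
  show "abs (Pn e 0 y * (e *. gw y)) <= M" for y using M[of y] by (auto simp: Pn_def)
 qed (auto simp: zw(1))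
 show i1: "integrable lborel (%y. max 0 (e *. y) * lw y)"
  by (rule integrable_cts_compact[of "cball 0 1"]) (auto intro!: continuous_intros continuous_on_subset[OF cw(3)] simp: zw(2))
 show i3: "integrable lborel (%y. abs (lw y))"
  by (rule integrable_cts_compact[of "cball 0 1"]) (auto intro!: continuous_intros continuous_on_subset[OF cw(3)] simp: zw(2))
 let ?X = "LI (%y. max 0 (e *. y) * lw y) + LI (%y. Pn e 0 y * (e *. gw y))"
 define W where "W = LI (%y. abs (lw y)) + M * (16 * mu2 TYPE('a) / norm e)"
 have key: "abs (?X) <= W * ka" if k: "0 < ka" "ka <= 1" for ka
 proof -
  have dsm: "((%y. sm ka (fs e 0 y)) has_derivative (%h. (sm1 ka (fs e 0 y) *R e) *. h)) (at y)" for y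
   using C2on_deriv[OF C2on_sm[OF C2on_fs[of e 0 0], of ka], of y] by simp
  have csm: "continuous_on UNIV (%y. sm1 ka (fs e 0 y) *R e)"
   by (intro continuous_intros continuous_on_compose2[OF sm1_continuous[of UNIV] fs_continuous]) auto
  note gr = green_first_order[OF dsm csm w open_UNIV compact_cball[of 0 1] subset_UNIV z]
  have ii: "integrable lborel (%y. sm1 ka (fs e 0 y) * (e *. gw y))" using gr(3) by simp
  have "?X = LI (%y. max 0 (e *. y) * lw y - sm ka (fs e 0 y) * lw y)
   + LI (%y. Pn e 0 y * (e *. gw y) - sm1 ka (fs e 0 y) * (e *. gw y))"
   using i1 i2 gr(1,2) ii by simp
  moreover have "abs (LI (%y. max 0 (e *. y) * lw y - sm ka (fs e 0 y) * lw y)) <= ka * LI (%y. abs (lw y))"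
  proof -
   have "abs (LI (%y. max 0 (e *. y) * lw y - sm ka (fs e 0 y) * lw y))
    <= LI (%y. abs (max 0 (e *. y) * lw y - sm ka (fs e 0 y) * lw y))" by (rule integral_abs_bound)
   also have "... <= LI (%y. ka * abs (lw y))"
   proof (rule integral_mono)
    show "integrable lborel (%y. abs (max 0 (e *. y) * lw y - sm ka (fs e 0 y) * lw y))"
     by (intro integrable_abs bi_diff i1 gr(2))
    show "integrable lborel (%y. ka * abs (lw y))" using i3 by simp
    fix y
    have "abs (max 0 (e *. y) - sm ka (fs e 0 y)) <= ka"
     using sm_bounds[OF k(1), of "e *. y"] k unfolding fs_zero by (auto simp: max_def abs_le_iff)
    then have "abs (max 0 (e *. y) - sm ka (fs e 0 y)) * abs (lw y) <= ka * abs (lw y)" by (rule mult_right_mono) simp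
    then show "abs (max 0 (e *. y) * lw y - sm ka (fs e 0 y) * lw y) <= ka * abs (lw y)" by (simp only: left_diff_distrib[symmetric] abs_mult)
   qed
   finally show ?thesis by simp
  qed
  moreover have "abs (LI (%y. Pn e 0 y * (e *. gw y) - sm1 ka (fs e 0 y) * (e *. gw y))) <= M * measure lborel (strip e 0 ka)"
  proof (rule integral_abs_le_indicator)
   fix y
   show "abs (Pn e 0 y * (e *. gw y) - sm1 ka (fs e 0 y) * (e *. gw y)) <= M * indicator (strip e 0 ka) y"
   proof (cases "y : cball 0 1")
    case False then show ?thesis using zw(1) by (auto simp: indicator_def strip_def)
   next
    case True
    have "abs (Pn e 0 y - sm1 ka (fs e 0 y)) * abs (e *. gw y) <= of_bool (abs (fs e 0 y) <= ka) * M"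
     by (intro mult_mono sm1_vs_Pn(1)[OF k(1)] M) auto
    moreover have "of_bool (abs (fs e 0 y) <= ka) = (indicator (strip e 0 ka) y :: real)" using True by (auto simp: strip_def indicator_def)
    ultimately have "abs (Pn e 0 y - sm1 ka (fs e 0 y)) * abs (e *. gw y) <= M * indicator (strip e 0 ka) y" by (simp only: mult.commute)
    then show ?thesis by (simp only: left_diff_distrib[symmetric] abs_mult)
   qed
  qed (use strip_facts in auto)
  moreover have "M * measure lborel (strip e 0 ka) <= M * (16 * mu2 TYPE('a) / norm e * ka)"
   using strip_measure[OF e _ k(1), of 0] G(2) by (intro mult_left_mono) (auto simp: M_def)
  ultimately show ?thesis unfolding W_def by (simp add: algebra_simps)
 qed
 have "abs (?X) <= 0" by (rule le_zero_of_le_small[OF key])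
 then show "LI (%y. max 0 (e *. y) * lw y) = - LI (%y. Pn e 0 y * (e *. gw y))" by linarith
qed

text \<open>The regularised change from the positive part of \<open>fs e 0\<close> to that of
  \<open>fs e s\<close>. The shift by \<open>ka\<close> makes the competitor \<open>V + wk\<close>
  nonpositive where, off the strips, \<open>fs e s\<close> is negative, although \<open>V\<close> is
  known only up to an error of \<open>ka / 4\<close>.\<close>

definition wk :: "'a::euclidean_space => real => real => 'a => real" where
 "wk e s ka y = sm (ka/2) (fs e s y + ka) - sm (ka/2) (fs e 0 y + ka)"

definition gwk :: "'a::euclidean_space => real => real => 'a => 'a" where
 "gwk e s ka y = sm1 (ka/2) (fs e s y + ka) *R (e + s *R gpsi y) - sm1 (ka/2) (fs e 0 y + ka) *R (e + 0 *R gpsi y)"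

lemma C2on_wk: "EX lw. C2on UNIV (wk e s ka) (gwk e s ka) lw"
 unfolding wk_def[abs_def] gwk_def[abs_def]
 using C2on_diff[OF C2on_sm[OF C2on_fs[of e s ka], of "ka/2"] C2on_sm[OF C2on_fs[of e 0 ka], of "ka/2"]] by blast

lemma wk_outside: "norm y >= 1 ==> wk e s ka y = 0" "norm y >= 1 ==> gwk e s ka y = 0"
 by (simp_all add: wk_def gwk_def fs_zero psi8_bounds)

lemma sm1_shift:
 assumes k: "ka > 0" and f: "abs (fs e s y) > ka"
 shows "sm1 (ka/2) (fs e s y + ka) = Pn e s y"
proof -
 consider "fs e s y > ka" | "fs e s y < - ka" using f by linarith
 then show ?thesis
  by cases (use k sm_large[of "ka/2" "fs e s y + ka"] sm_zero(2)[of "fs e s y + ka" "ka/2"] in "auto simp: Pn_def")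
qed

text \<open>Off the strips the regularised slopes are exactly 0 or 1 and the two expressions agree;
  on them each term is bounded separately, with 9 + 6 + 1 + 1 + 1 = 18.\<close>

lemma competitor_gradient_bound:
 fixes e y :: "'a::euclidean_space"
 assumes e: "16 * abs (s) <= norm e" and k: "ka > 0"
 shows "\<bar>gwk e s ka y *. gwk e s ka y + 2 * (Pn e 0 y * (e *. gwk e s ka y))
  - ((norm e)\<^sup>2 * (Pn e s y - Pn e 0 y) + 2 * s * (Pn e s y * (e *. gpsi y)) + s\<^sup>2 * (Pn e s y * (gpsi y *. gpsi y)))\<bar>
  <= 18 * (norm e)\<^sup>2 * indicator (strip e s ka Un strip e 0 ka) y" (is "abs (?j - ?q) <= _")
proof -
 define al where "al = norm e"
 have ee: "e *. e = al\<^sup>2" by (simp add: al_def power2_norm_eq_inner)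
 show ?thesis
 proof (cases "norm y <= 1 & y : strip e s ka Un strip e 0 ka")
  case False
  have "?j = ?q"
  proof (cases "norm y <= 1")
   case True
   then have "abs (fs e s y) > ka" "abs (fs e 0 y) > ka" using False strip_outside by force+
   then have g: "gwk e s ka y = Pn e s y *R (e + s *R gpsi y) - Pn e 0 y *R e"
    by (simp add: gwk_def sm1_shift[OF k])
   show ?thesis unfolding g
    by (cases "fs e s y > 0"; cases "fs e 0 y > 0")
     (simp_all add: Pn_def inner_add_left inner_add_right inner_commute power2_eq_square power2_norm_eq_inner[unfolded power2_eq_square])
  next
   case False
   then show ?thesis by (simp add: wk_outside psi8_bounds Pn_def fs_zero)
  qed
  then show ?thesis by simp
 next
  case True
  have sg: "norm (s *R gpsi y) <= al / 2" "abs (s * (e *. gpsi y)) <= al\<^sup>2 / 2"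
   unfolding al_def by (rule s_gpsi_bound[OF e])+
  have k2: "ka/2 > 0" using k by simp
  have gn: "norm (gwk e s ka y) <= 3 * al"
  proof -
   have "norm (gwk e s ka y) <= norm (sm1 (ka/2) (fs e s y + ka) *R (e + s *R gpsi y)) + norm (sm1 (ka/2) (fs e 0 y + ka) *R e)"
    unfolding gwk_def using norm_triangle_ineq4[of "sm1 (ka/2) (fs e s y + ka) *R (e + s *R gpsi y)" "sm1 (ka/2) (fs e 0 y + ka) *R e"] by simp
   also have "... <= 1 * (al + al / 2) + 1 * al"
   proof (rule add_mono)
    have "norm (e + s *R gpsi y) <= al + al/2" using norm_triangle_ineq[of e "s *R gpsi y"] sg(1) by (simp add: al_def)
    then show "norm (sm1 (ka/2) (fs e s y + ka) *R (e + s *R gpsi y)) <= 1 * (al + al / 2)"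
     unfolding norm_scaleR using sm1_bounds[OF k2] by (intro mult_mono) auto
    show "norm (sm1 (ka/2) (fs e 0 y + ka) *R e) <= 1 * al"
     unfolding norm_scaleR al_def using sm1_bounds[OF k2] by (intro mult_mono) auto
   qed
   also have "... <= 3 * al" by (simp add: al_def)
   finally show ?thesis .
  qed
  have 1: "abs (gwk e s ka y *. gwk e s ka y) <= 9 * al\<^sup>2"
   using power_mono[OF gn norm_ge_zero, of 2] by (simp add: power2_norm_eq_inner[symmetric] power_mult_distrib)
  have 2: "abs (2 * (Pn e 0 y * (e *. gwk e s ka y))) <= 6 * al\<^sup>2"
  proof -
   have "abs (e *. gwk e s ka y) <= al * norm (gwk e s ka y)" unfolding al_def by (rule Cauchy_Schwarz_ineq2)
   also have "... <= al * (3 * al)" by (rule mult_left_mono[OF gn]) (simp add: al_def)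
   finally show ?thesis by (auto simp: Pn_def power2_eq_square)
  qed
  have 3: "abs (al\<^sup>2 * (Pn e s y - Pn e 0 y)) <= al\<^sup>2" by (auto simp: Pn_def)
  have 4: "abs (2 * s * (Pn e s y * (e *. gpsi y))) <= al\<^sup>2" using sg(2) by (auto simp: Pn_def abs_mult)
  have 5: "abs (s\<^sup>2 * (Pn e s y * (gpsi y *. gpsi y))) <= al\<^sup>2"
  proof -
   have "s\<^sup>2 * (gpsi y *. gpsi y) = (norm (s *R gpsi y))\<^sup>2" by (simp only: power2_norm_eq_inner) (simp add: power2_eq_square)
   also have "... <= (al/2)\<^sup>2" by (intro power_mono sg) auto
   also have "... <= al\<^sup>2" by (simp add: power_divide)
   finally have "s\<^sup>2 * (gpsi y *. gpsi y) <= al\<^sup>2" .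
   then show ?thesis by (auto simp: Pn_def)
  qed
  have "abs (?j - ?q) <= 18 * al\<^sup>2" using 1 2 3 4 5 unfolding al_def by linarith
  then show ?thesis using True by (simp add: al_def)
 qed
qed

text \<open>Off the strips the four sign patterns of the two level functions are treated separately;
  a change from positive to negative is the case that relies on the shift in
  \<open>wk\<close>.\<close>

lemma competitor_measure_bound:
 fixes e y :: "'a::euclidean_space"
 assumes k: "ka > 0" and d: "0 < de" "de <= ka/4" and V: "V y >= 0"
  "norm y <= 1 ==> abs (V y - max 0 (e *. y)) <= de" "norm y <= 1 ==> e *. y > de ==> V y > 0" "norm y <= 1 ==> V y > 0 ==> e *. y >= - de"
 shows "- (Pn e s y - Pn e 0 y) - 2 * indicator (strip e s ka Un strip e 0 ka) y <= (of_bool (V y > 0) - of_bool (V y + wk e s ka y > 0) :: real)"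
proof (cases "norm y <= 1")
 case False
 then show ?thesis by (simp add: wk_outside Pn_def fs_zero)
next
 case n: True
 have k2: "ka/2 > 0" using k by simp
 show ?thesis
 proof (cases "y : strip e s ka Un strip e 0 ka")
  case True
  then show ?thesis by (auto simp: Pn_def)
 next
  case False
  then have f: "abs (fs e s y) > ka" "abs (fs e 0 y) > ka" using n strip_outside by force+
  consider "fs e 0 y > ka" "fs e s y > ka" | "fs e 0 y > ka" "fs e s y < - ka"
   | "fs e 0 y < - ka" "fs e s y > ka" | "fs e 0 y < - ka" "fs e s y < - ka" using f by linarith
  then show ?thesis
  proof cases
   case 1
   then have "V y > 0" using V(3)[OF n] d k by (simp add: fs_zero)
   then show ?thesis using 1 k False by (simp add: Pn_def)
  next
   case 2
   have a: "e *. y > ka" using 2 by (simp add: fs_zero)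
   have "V y > 0" using V(3)[OF n] a d k by simp
   moreover have "sm (ka/2) (fs e s y + ka) = 0" using 2 by (intro sm_zero(1) k2) simp
   moreover have "fs e 0 y + ka - ka/2 <= sm (ka/2) (fs e 0 y + ka)" by (rule sm_bounds(3)[OF k2])
   moreover have "V y <= e *. y + de" using V(2)[OF n] a k by simp
   ultimately have "V y + wk e s ka y <= 0" using d k unfolding wk_def fs_zero by linarith
   then show ?thesis using 2 k False \<open>V y > 0\<close> by (simp add: Pn_def)
  next
   case 3
   then show ?thesis using k False by (simp add: Pn_def)
  next
   case 4
   then have "~ V y > 0" using V(4)[OF n] d k by (auto simp: fs_zero)
   moreover have "sm (ka/2) (fs e s y + ka) = 0" "sm (ka/2) (fs e 0 y + ka) = 0" using 4 by (auto intro!: sm_zero(1) k2)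
   ultimately show ?thesis using 4 k False by (simp add: Pn_def wk_def)
  qed
 qed
qed

text \<open>A blow-up statement without a limiting process: minimizers approximate the half-plane
  function of slope \<open>e\<close> to every accuracy, together with their positivity sets.\<close>

definition half_plane_approx :: "'a::euclidean_space => bool" where
 "half_plane_approx e \<longleftrightarrow> (ALL de>0. EX V. ac_min V & (ALL y. norm y <= 1 --> abs (V y - max 0 (e *. y)) <= de & (e *. y > de --> V y > 0) & (V y > 0 --> e *. y >= - de)))"

text \<open>Minimality of \<open>V\<close> against \<open>V + wk\<close>, as \<open>ka\<close> tends
  to 0, gives \<open>0 <= A + |e|^2 A + 2 s B + s^2 D\<close> for the volume change
  \<open>A\<close>; \<open>Pn_identity\<close> then eliminates \<open>A\<close>.\<close>

lemma flat_inequality: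
 fixes e :: "'a::euclidean_space"
 assumes ap: "half_plane_approx e" and e: "e ~= 0" "16 * abs (s) <= norm e"
 shows "0 <= - (1 - (norm e)\<^sup>2) * s * LI (%y. Pn e s y * (e *. gpsi y))
  + (norm e)\<^sup>2 * s\<^sup>2 * LI (%y. Pn e s y * (gpsi y *. gpsi y))"
proof -
 define al where "al = norm e"
 define A where "A = LI (%y. Pn e s y - Pn e 0 y)"
 define B where "B = LI (%y. Pn e s y * (e *. gpsi y))"
 define D where "D = LI (%y. Pn e s y * (gpsi y *. gpsi y))"
 define W where "W = 32 * mu2 TYPE('a) / al"
 have key: "- (A + al\<^sup>2 * A + 2 * s * B + s\<^sup>2 * D) <= ((2 + 18 * al\<^sup>2) * W + 1) * ka" if k: "0 < ka" "ka <= 1" for ka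
 proof -
  define w where "w = wk e s ka"
  define gw where "gw = gwk e s ka"
  obtain lw where w: "C2on UNIV w gw lw" using C2on_wk unfolding w_def gw_def by blast
  have wz: "w x = 0" if "x ~: cball 0 1" for x using wk_outside[of x e s ka] that unfolding w_def by simp
  have zw: "gw x = 0" "lw x = 0" if "~ norm x <= 1" for x
   using C2on_zero_off_compact[OF w compact_cball[of 0 1] wz, of x] that by auto
  note cw = C2on_continuous[OF w]
  note hl = half_linear_green[OF e(1) w wz]
  define N where "N = LI (%y. abs (lw y))"
  have N: "N >= 0" unfolding N_def by (rule bi_nonneg) simp
  \<comment> \<open>Small enough that replacing \<open>V\<close> by the half-plane function in the
    integral against \<open>lw\<close> costs at most \<open>ka\<close>; \<open>N\<close> itself
    depends on \<open>ka\<close>, so \<open>de\<close> is chosen after it.\<close>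
  define de where "de = min (ka/4) (ka / (2 * N + 1))"
  have "0 < ka / (2 * N + 1)" using k N by simp
  then have de: "0 < de" "de <= ka/4" "de <= ka / (2 * N + 1)" using k unfolding de_def by linarith+
  have deN: "2 * de * N <= ka"
  proof -
   have "0 < 2 * N + 1" using N by simp
   then have "de * (2 * N + 1) <= ka" using de(3) by (simp only: pos_le_divide_eq)
   then have "2 * de * N + de <= ka" by (simp add: algebra_simps)
   then show ?thesis using de by linarith
  qed
  obtain V where V: "ac_min V" "!!y. norm y <= 1 ==> abs (V y - max 0 (e *. y)) <= de" "!!y. norm y <= 1 ==> e *. y > de ==> V y > 0"
   "!!y. norm y <= 1 ==> V y > 0 ==> e *. y >= - de"
   using ap de(1) unfolding half_plane_approx_def by blast
  have Vn: "V y >= 0" and cV: "continuous_on UNIV V" for y using V(1) by (auto simp: ac_min_def)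
  define T where "T = strip e s ka Un strip e 0 ka"
  have T: "T : sets borel" "bounded T" using strip_facts by (auto simp: T_def)
  have Tm: "measure lborel T <= W * ka" using strip2_measure[OF e k(1)] by (simp add: T_def W_def al_def)
  have iT: "integrable lborel (%y. indicator T y :: real)"
   using emeasure_bounded_finite[OF T(2)] T(1) by (intro integrable_real_indicator) auto
  let ?l = "%y. of_bool (V y > 0) - of_bool (V y + w y > 0) :: real"
  have il: "integrable lborel ?l"
   by (rule of_bool_diff_integrable[OF cV cw(1), of 1]) (auto simp: w_def wk_outside)
  have main: "LI ?l <= LI (%y. gw y *. gw y) - 2 * LI (%y. V y * lw y)"
   by (rule ac_minD[OF V(1) w, where R = 1]) (auto simp: w_def wk_outside)
  have lower: "- A - 2 * measure lborel T <= LI ?l"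
  proof -
   have "LI (%y. - (Pn e s y - Pn e 0 y) - 2 * indicator T y) <= LI ?l"
   proof (rule integral_mono)
    show "integrable lborel (%y. - (Pn e s y - Pn e 0 y) - 2 * indicator T y)"
     by (intro bi_diff integrable_minus Pn_integrals integrable_mult_right iT)
    show "- (Pn e s y - Pn e 0 y) - 2 * indicator T y <= ?l y" for y
     unfolding T_def w_def by (rule competitor_measure_bound[OF k(1) de(1,2) Vn V(2,3,4)])
   qed (rule il)
   moreover have "LI (%y. - (Pn e s y - Pn e 0 y) - 2 * indicator T y) = - A - 2 * measure lborel T"
    unfolding A_def using Pn_integrals(1)[of e s] iT T(1)
    by (subst bi_idiff) (auto intro!: integrable_minus simp del: minus_diff_eq)
   ultimately show ?thesis by simp
  qed
  have iV: "integrable lborel (%y. V y * lw y)"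
   by (rule integrable_cts_compact[of "cball 0 1"]) (auto intro!: continuous_intros continuous_on_subset[OF cw(3)] continuous_on_subset[OF cV] simp: zw(2))
  have Vl: "LI (%y. max 0 (e *. y) * lw y) - de * N <= LI (%y. V y * lw y)"
  proof -
   have "LI (%y. max 0 (e *. y) * lw y - de * abs (lw y)) <= LI (%y. V y * lw y)"
   proof (rule integral_mono)
    show "integrable lborel (%y. max 0 (e *. y) * lw y - de * abs (lw y))"
     by (intro bi_diff hl(2) integrable_mult_right hl(4))
    fix y
    show "max 0 (e *. y) * lw y - de * abs (lw y) <= V y * lw y"
    proof (cases "y : cball 0 1")
     case True
     then have "abs (V y - max 0 (e *. y)) * abs (lw y) <= de * abs (lw y)" using V(2) by (intro mult_right_mono) auto
     then have "abs (V y * lw y - max 0 (e *. y) * lw y) <= de * abs (lw y)" by (simp only: left_diff_distrib[symmetric] abs_mult)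
     then show ?thesis by linarith
    qed (simp add: zw(2))
   qed (rule iV)
   then show ?thesis unfolding N_def using hl(2,4) by simp
  qed
  have igw: "integrable lborel (%y. gw y *. gw y)"
   by (rule integrable_cts_compact[of "cball 0 1"]) (auto intro!: continuous_intros continuous_on_subset[OF cw(2)] simp: zw(1))
  let ?j = "%y. gw y *. gw y + 2 * (Pn e 0 y * (e *. gw y))"
  let ?q = "%y. al\<^sup>2 * (Pn e s y - Pn e 0 y) + 2 * s * (Pn e s y * (e *. gpsi y)) + s\<^sup>2 * (Pn e s y * (gpsi y *. gpsi y))"
  have ij: "integrable lborel ?j" by (intro bi_add igw integrable_mult_right hl(3))
  have i0: "integrable lborel (%y. al\<^sup>2 * (Pn e s y - Pn e 0 y))" "integrable lborel (%y. 2 * s * (Pn e s y * (e *. gpsi y)))"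
   "integrable lborel (%y. s\<^sup>2 * (Pn e s y * (gpsi y *. gpsi y)))"
   using Pn_integrals[of e s] by (auto intro: integrable_mult_right)
  have ij0: "integrable lborel ?q" by (intro bi_add i0)
  have j0: "LI ?q = al\<^sup>2 * A + 2 * s * B + s\<^sup>2 * D"
   unfolding A_def B_def D_def bi_iadd[OF bi_add[OF i0(1,2)] i0(3)] bi_iadd[OF i0(1,2)]
   by (simp only: integral_mult_right_zero)
  have "abs (LI (%y. ?j y - ?q y)) <= 18 * al\<^sup>2 * measure lborel T"
  proof (rule integral_abs_le_indicator[OF _ T])
   show "abs (?j y - ?q y) <= 18 * al\<^sup>2 * indicator T y" for y
    using competitor_gradient_bound[OF e(2) k(1), of y] unfolding gw_def T_def al_def .
  qed
  then have "LI ?j <= LI ?q + 18 * al\<^sup>2 * measure lborel T"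
   unfolding bi_idiff[OF ij ij0] by linarith
  moreover have "LI ?j = LI (%y. gw y *. gw y) + 2 * LI (%y. Pn e 0 y * (e *. gw y))"
   using igw hl(3) by simp
  ultimately have "- (A + al\<^sup>2 * A + 2 * s * B + s\<^sup>2 * D) <= 2 * measure lborel T + 18 * al\<^sup>2 * measure lborel T + ka"
   using main lower Vl hl(1) j0 deN by linarith
  also have "2 * measure lborel T + 18 * al\<^sup>2 * measure lborel T + ka = (2 + 18 * al\<^sup>2) * measure lborel T + ka" by (simp add: distrib_right)
  also have "... <= (2 + 18 * al\<^sup>2) * (W * ka) + ka" by (intro add_right_mono mult_left_mono Tm) auto
  finally show ?thesis by (simp add: algebra_simps)
 qed
 have "- (A + al\<^sup>2 * A + 2 * s * B + s\<^sup>2 * D) <= 0" by (rule le_zero_of_le_small[OF key])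
 moreover have id: "al\<^sup>2 * A + s * B = 0" unfolding al_def A_def B_def by (rule Pn_identity[OF e])
 ultimately have "0 <= (1 - al\<^sup>2) * A + s\<^sup>2 * D" by (simp add: algebra_simps)
 then have "0 <= al\<^sup>2 * ((1 - al\<^sup>2) * A + s\<^sup>2 * D)" by simp
 also have "... = (1 - al\<^sup>2) * (al\<^sup>2 * A) + al\<^sup>2 * s\<^sup>2 * D" by (simp add: algebra_simps)
 also have "al\<^sup>2 * A = - (s * B)" using id by linarith
 finally show ?thesis by (simp add: al_def B_def D_def algebra_simps)
qed

text \<open>Dividing \<open>flat_inequality\<close> by \<open>s\<close> of either sign and letting
  \<open>s\<close> tend to 0 leaves \<open>(1 - |e|^2) * b = 0\<close>, where \<open>b > 0\<close>
  is the integral of \<open>8 * bump 3 y\<close> against the positive part of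
  \<open>e *. y\<close>.\<close>

lemma half_plane_slope_one:
 fixes e :: "'a::euclidean_space"
 assumes ap: "half_plane_approx e" and e: "e ~= 0"
 shows "norm e = 1"
proof -
 define al where "al = norm e"
 have al: "al > 0" using e by (simp add: al_def)
 define B where "B s = LI (%y. Pn e s y * (e *. gpsi y))" for s
 define D where "D s = LI (%y. Pn e s y * (gpsi y *. gpsi y))" for s
 define b where "b = - B 0"
 have b: "b > 0"
 proof -
  define f where "f y = 8 * bump 3 y * max 0 (e *. y)" for y
  have cf: "continuous_on S f" for S unfolding f_def by (intro continuous_intros)
  have "LI f > 0"
  proof (rule integral_pos_of_continuous[OF cf])
   show "f y >= 0" for y by (simp add: f_def bump_nonneg)
   show "integrable lborel f" by (rule integrable_cts_compact[of "cball 0 1"]) (simp_all add: cf, simp add: f_def bump_zero)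
   show "f ((1 / (2 * al)) *R e) > 0"
   proof -
    have "norm ((1 / (2 * al)) *R e) < 1" using al by (simp add: al_def)
    moreover have "e *. ((1 / (2 * al)) *R e) > 0" using al e by simp
    ultimately show ?thesis using bump_pos[of "(1 / (2 * al)) *R e" 3] unfolding f_def by (intro mult_pos_pos) auto
   qed
  qed
  moreover have "(%y. Pn e 0 y * (e *. gpsi y)) = (%y. - f y)"
   by (auto simp: f_def Pn_def gpsi_def fs_zero max_def fun_eq_iff)
  ultimately show ?thesis by (simp add: b_def B_def)
 qed
 define K where "K = 8 * al * (16 * mu2 TYPE('a) / al)"
 have K: "K >= 0" using al by (simp add: K_def mu2_def)
 have BK: "abs (B s + b) <= K * abs (s)" if s: "16 * abs (s) <= al" "s ~= 0" for s
 proof -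
  have "B s + b = LI (%y. Pn e s y * (e *. gpsi y) - Pn e 0 y * (e *. gpsi y))"
   unfolding b_def B_def using Pn_integrals(2)[of e s] Pn_integrals(2)[of e 0] by simp
  also have "abs (...) <= 8 * al * measure lborel (strip e 0 \<bar>s\<bar>)"
  proof (rule integral_abs_le_indicator)
   fix y
   have eg: "abs (e *. gpsi y) <= 8 * al"
    using Cauchy_Schwarz_ineq2[of e "gpsi y"] mult_left_mono[OF gpsi_bound[of y], of "norm e"] by (simp add: al_def)
   show "abs (Pn e s y * (e *. gpsi y) - Pn e 0 y * (e *. gpsi y)) <= 8 * al * indicator (strip e 0 \<bar>s\<bar>) y"
   proof (cases "y : strip e 0 \<bar>s\<bar>")
    case True
    then show ?thesis using eg by (auto simp: Pn_def)
   next
    case False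
    have "Pn e s y = Pn e 0 y"
    proof (cases "norm y <= 1")
     case True
     then have "abs (e *. y) > \<bar>s\<bar>" using strip_outside[OF False True] by (simp add: fs_zero)
     moreover have "abs (s * (8 * psi0 y)) <= abs (s) * 1" unfolding abs_mult using psi8_bounds(1,2)[of y] by (intro mult_left_mono) auto
     ultimately have "(fs e s y > 0) = (e *. y > 0)" unfolding fs_def by linarith
     then show ?thesis by (simp add: Pn_def fs_zero)
    qed (simp add: Pn_def fs_zero)
    then show ?thesis by (simp add: False)
   qed
  qed (use strip_facts in auto)
  also have "... <= 8 * al * (16 * mu2 TYPE('a) / norm e * abs (s))"
   using strip_measure[of e 0 "abs (s)"] e s al by (intro mult_left_mono) auto
  finally show ?thesis by (simp only: K_def al_def mult.assoc)
 qed
 define M where "M = 64 * measure lborel (cball (0::'a) 1)"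
 have DM: "abs (D s) <= M" for s unfolding D_def M_def
 proof (rule integral_abs_le_indicator)
  fix y :: 'a
  have "abs (gpsi y *. gpsi y) <= 8 * 8"
   using Cauchy_Schwarz_ineq2[of "gpsi y" "gpsi y"] mult_mono[OF gpsi_bound[of y] gpsi_bound[of y]] by simp
  then show "abs (Pn e s y * (gpsi y *. gpsi y)) <= 64 * indicator (cball 0 1) y"
   by (cases "norm y <= 1") (auto simp: Pn_def psi8_bounds)
 qed auto
 define a where "a = 1 - al\<^sup>2"
 define C where "C = abs (a) * K + al\<^sup>2 * M"
 \<comment> \<open>\<open>s\<close> has the sign opposite to \<open>sg\<close>, so the first-order
   term appears as \<open>sg * a * B s\<close>, with \<open>B s\<close> close to
   \<open>- b\<close>.\<close>
 have step: "sg * (a * b) <= C * abs (s)" if s: "16 * abs (s) <= al" "s ~= 0" "s = - sg * abs (s)" for s sg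
 proof -
  have "0 <= - a * s * B s + al\<^sup>2 * s\<^sup>2 * D s"
   unfolding a_def al_def B_def D_def by (rule flat_inequality[OF ap e]) (use s in "simp add: al_def")
  also have "- a * s * B s = - a * (- sg * abs (s)) * B s" using s(3) by (rule arg_cong)
  also have "... = abs (s) * (sg * a * B s)" by (simp add: algebra_simps)
  also have "al\<^sup>2 * s\<^sup>2 * D s = abs (s) * (al\<^sup>2 * abs (s) * D s)" by (simp add: power2_eq_square)
  finally have "0 <= abs (s) * (sg * a * B s + al\<^sup>2 * abs (s) * D s)" by (simp add: distrib_left)
  then have "0 <= sg * a * B s + al\<^sup>2 * abs (s) * D s" using s(2) by (simp add: zero_le_mult_iff)
  moreover have "sg * a * (B s + b) <= abs (a) * (K * abs (s))"
  proof -
   have "abs (s) = abs (sg) * abs (s)" using arg_cong[OF s(3), of abs] by (simp only: abs_mult abs_minus_cancel abs_abs)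
   then have "abs (sg) = 1" using s(2) by simp
   have "sg * a * (B s + b) <= abs (sg * a * (B s + b))" by simp
   also have "... = abs (a) * abs (B s + b)" using \<open>\<bar>sg\<bar> = 1\<close> by (simp add: abs_mult)
   also have "... <= abs (a) * (K * abs (s))" by (intro mult_left_mono BK s) auto
   finally show ?thesis .
  qed
  moreover have "al\<^sup>2 * abs (s) * D s <= al\<^sup>2 * abs (s) * M" using DM[of s] by (intro mult_left_mono) auto
  ultimately show ?thesis by (simp add: C_def algebra_simps)
 qed
 have "sg * (a * b) <= (C * (al / 16)) * t" if "sg : {1, -1}" "0 < t" "t <= 1" for sg t
 proof -
  define s where "s = - sg * (al / 16 * t)"
  have as: "abs (s) = al / 16 * t" using that al by (auto simp: s_def abs_mult)
  have "al * t <= al * 1" using that al by (intro mult_left_mono) auto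
  then have "sg * (a * b) <= C * abs (s)" using that al as by (intro step) (auto simp: s_def)
  then show ?thesis unfolding as by (simp add: mult.assoc)
 qed
 then have "sg * (a * b) <= 0" if "sg : {1, -1}" for sg using that by (intro le_zero_of_le_small[of _ "C * (al / 16)"]) blast
 from this[of 1] this[of "-1"] have "1 * (a * b) <= 0" "-1 * (a * b) <= 0" by simp_all
 then have "a * b = 0" by linarith
 then have "al\<^sup>2 = 1" using b by (simp add: a_def)
 then have "al = 1 | al = - 1" by (simp only: power2_eq_1_iff)
 then show ?thesis using al unfolding al_def by linarith
qed

text \<open>Rescaling at \<open>z\<close> with a small factor makes the quadratic errors of
  \<open>reg_pt\<close> arbitrarily small relative to the scale, which is
  \<open>half_plane_approx\<close>.\<close>

lemma normal_unit:
 fixes U :: "'a::euclidean_space => real"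
 assumes U: "ac_min U" and g: "good U z rh" and r: "reg_pt c C U z rh e" and c: "c > 0" "C > 0"
 shows "norm e = 1"
proof (rule half_plane_slope_one)
 have rh: "rh > 0" using g by (rule good_pos)
 show "e ~= 0" using r c by (auto simp: reg_pt_def)
 show "half_plane_approx e" unfolding half_plane_approx_def
 proof (intro allI impI)
  fix de :: real assume de: "de > 0"
  define t where "t = min (c * rh) (de * rh / C)"
  have t: "t > 0" "t <= c * rh" "t <= de * rh / C" using c rh de by (auto simp: t_def)
  have tC: "C * t / rh <= de" using t(3) c rh by (simp add: field_simps)
  define V where "V = rescale U z t"
  have "abs (V y - max 0 (e *. y)) <= de & (e *. y > de --> V y > 0) & (V y > 0 --> e *. y >= - de)" if y: "norm y <= 1" for y
  proof -
   define x where "x = z + t *R y"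
   have xz: "e *. (x - z) = t * (e *. y)" by (simp add: x_def)
   have "dist z x = t * norm y" using t by (simp add: x_def dist_norm)
   then have d: "dist z x <= t" using y t by (simp add: mult_left_le)
   then have d1: "dist z x <= c * rh" using t by linarith
   have "C * (dist z x)\<^sup>2 / rh <= C * t\<^sup>2 / rh" using c rh d by (intro divide_right_mono mult_left_mono power_mono) auto
   also have "... = (C * t / rh) * t" by (simp add: power2_eq_square)
   also have "... <= de * t" using tC t by (intro mult_right_mono) auto
   finally have q: "C * (dist z x)\<^sup>2 / rh <= de * t" .
   have Vx: "U x = t * V y" using t by (simp add: V_def rescale_def x_def)
   have m: "max 0 (t * (e *. y)) = t * max 0 (e *. y)" using t by (auto simp: max_def zero_le_mult_iff)
   have "abs (U x - max 0 (e *. (x - z))) <= de * t" using r d1 q unfolding reg_pt_def by fastforce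
   then have "t * abs (V y - max 0 (e *. y)) <= t * de" unfolding xz m Vx using t by (simp add: right_diff_distrib[symmetric] abs_mult mult.commute)
   then have 1: "abs (V y - max 0 (e *. y)) <= de" using t by simp
   have 2: "V y > 0" if "e *. y > de"
   proof -
    have "t * (e *. y) > de * t" using that t by (simp add: mult.commute)
    then have "e *. (x - z) > C * (dist z x)\<^sup>2 / rh" using q xz by linarith
    then have "U x > 0" using r d1 unfolding reg_pt_def by blast
    then show ?thesis using t by (simp add: Vx zero_less_mult_iff)
   qed
   have 3: "e *. y >= - de" if "V y > 0"
   proof -
    have "U x > 0" using that t by (simp add: Vx)
    then have "e *. (x - z) >= - C * (dist z x)\<^sup>2 / rh" using r d1 unfolding reg_pt_def by blast
    then have "t * (e *. y) >= t * (- de)" using q xz by (simp add: mult.commute)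
    then show ?thesis using t by (simp only: mult_le_cancel_left_pos)
   qed
   show ?thesis using 1 2 3 by blast
  qed
  moreover have "ac_min V" unfolding V_def by (rule ac_min_rescale[OF U t(1)])
  ultimately show "EX V. ac_min V & (ALL y. norm y <= 1 --> abs (V y - max 0 (e *. y)) <= de & (e *. y > de --> V y > 0) & (V y > 0 --> e *. y >= - de))" by blast
 qed
qed

section \<open>The Gaussian Poincare inequality\<close>

definition gauss :: "'a::euclidean_space => real" where "gauss x = exp (- (x *. x) / 2)"

lemma gauss_pos: "gauss x > 0" by (simp add: gauss_def)
lemma gauss_continuous [continuous_intros]: "continuous_on S f ==> continuous_on S (%x. gauss (f x))"
 unfolding gauss_def by (intro continuous_intros) auto

lemma gauss_has_derivative: "(gauss has_derivative (%h. - (gauss x * (x *. h)))) (at x)"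
proof -
 have 1: "((%x. - (x *. x) / 2) has_derivative (%h. - (x *. h))) (at x)"
  by (auto intro!: derivative_eq_intros simp: inner_commute)
 have 2: "(exp has_derivative (%h. exp (- (x *. x) / 2) * h)) (at (- (x *. x) / 2))"
  using DERIV_exp[of "- (x *. x) / 2"] by (simp add: has_field_derivative_def)
 show ?thesis using has_derivative_compose[OF 1 2] by (simp add: gauss_def[abs_def])
qed

text \<open>Domination by \<open>2 / (1 + t^2)\<close>, whose primitive is
  \<open>2 * arctan t\<close>. Finiteness suffices, since the total mass is carried along as
  \<open>ZG\<close>.\<close>

lemma nn_integral_gauss_real_finite: "(\<integral>\<^sup>+t. ennreal (exp (- t\<^sup>2 / 2)) \<partial>lborel) < (top :: ennreal)"
proof -
 define q where "q t = 2 / (1 + t\<^sup>2)" for t :: real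
 have [measurable]: "q : borel_measurable borel" unfolding q_def by measurable
 have fin: "(\<integral>\<^sup>+t. ennreal (q t) * indicator {0..} t \<partial>lborel) = ennreal (2 * (pi/2) - 2 * arctan 0)"
 proof (rule nn_integral_FTC_atLeast)
  show "((%t. 2 * arctan t) has_real_derivative q t) (at t)" for t
   unfolding q_def by (auto intro!: derivative_eq_intros simp: add_pos_nonneg divide_inverse)
  show "((%t. 2 * arctan t) \<longlongrightarrow> 2 * (pi/2)) at_top" by (intro tendsto_intros tendsto_arctan_at_top)
 qed (auto simp: q_def)
 have le: "exp (- t\<^sup>2 / 2) <= q t" for t
 proof -
  have "1 + t\<^sup>2 / 2 <= exp (t\<^sup>2 / 2)" by (rule exp_ge_add_one_self)
  then have "1 + t\<^sup>2 <= 2 * exp (t\<^sup>2 / 2)" using zero_le_power2[of t] by linarith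
  then have "exp (- t\<^sup>2 / 2) * (1 + t\<^sup>2) <= exp (- t\<^sup>2 / 2) * (2 * exp (t\<^sup>2 / 2))" by (rule mult_left_mono) simp
  also have "... = 2 * exp (- t\<^sup>2 / 2 + t\<^sup>2 / 2)" by (simp only: exp_add mult.left_commute)
  finally have "exp (- t\<^sup>2 / 2) * (1 + t\<^sup>2) <= 2" by simp
  moreover have "0 < 1 + t\<^sup>2" using zero_le_power2[of t] by linarith
  ultimately show ?thesis unfolding q_def by (simp only: mult_imp_le_div_pos)
 qed
 have "(\<integral>\<^sup>+t. ennreal (exp (- t\<^sup>2 / 2)) \<partial>lborel) <= (\<integral>\<^sup>+t. ennreal (q t) * indicator {0..} t + ennreal (q (0 + (-1) * t)) * indicator {0..} (0 + (-1) * t) \<partial>lborel)"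
 proof (rule nn_integral_mono)
  fix t :: real
  have "ennreal (exp (- t\<^sup>2 / 2)) <= ennreal (q t)" using le by (simp add: ennreal_leI)
  then show "ennreal (exp (- t\<^sup>2 / 2)) <= ennreal (q t) * indicator {0..} t + ennreal (q (0 + (-1) * t)) * indicator {0..} (0 + (-1) * t)"
   by (cases "t >= 0"; cases "t <= 0") (auto simp: indicator_def q_def add_increasing2)
 qed
 also have "... = (\<integral>\<^sup>+t. ennreal (q t) * indicator {0..} t \<partial>lborel) + (\<integral>\<^sup>+t. ennreal (q (0 + (-1) * t)) * indicator {0..} (0 + (-1) * t) \<partial>lborel)"
  by (rule nn_integral_add) auto
 also have "(\<integral>\<^sup>+t. ennreal (q (0 + (-1) * t)) * indicator {0..} (0 + (-1) * t) \<partial>lborel) = (\<integral>\<^sup>+t. ennreal (q t) * indicator {0..} t \<partial>lborel)"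
  using nn_integral_real_affine[of "%t. ennreal (q t) * indicator {0..} t" "-1" 0] by simp
 finally have le2: "(\<integral>\<^sup>+t. ennreal (exp (- t\<^sup>2 / 2)) \<partial>lborel) <= ennreal pi + ennreal pi" unfolding fin by simp
 have "ennreal pi + ennreal pi < top" by simp
 with le2 show ?thesis by (rule le_less_trans)
qed

lemma gauss_integrable: "integrable lborel (gauss :: 'a::euclidean_space => real)"
proof (rule integrableI_nonneg)
 show "gauss : borel_measurable lborel"
  using borel_measurable_continuous_onI[OF gauss_continuous[OF continuous_on_id]] by simp
 show "AE x in lborel. 0 <= gauss x" using gauss_pos by (auto intro: less_imp_le)
 have "ennreal (gauss x) = (\<Prod>b\<in>Basis. ennreal (exp (- (x *. b)\<^sup>2 / 2)))" for x :: 'a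
 proof -
  have "- (x *. x) / 2 = (\<Sum>b\<in>Basis. - (x *. b)\<^sup>2 / 2)"
   by (subst euclidean_inner) (simp add: sum_negf sum_divide_distrib power2_eq_square)
  then have "gauss x = (\<Prod>b\<in>Basis. exp (- (x *. b)\<^sup>2 / 2))" by (simp add: gauss_def exp_sum)
  then show ?thesis by (simp add: prod_ennreal)
 qed
 then have "(\<integral>\<^sup>+x. ennreal (gauss (x :: 'a)) \<partial>lborel) = (\<integral>\<^sup>+x. (\<Prod>b\<in>(Basis :: 'a set). ennreal (exp (- (x *. b)\<^sup>2 / 2))) \<partial>lborel)" by (simp only:)
 also have "... = (\<Prod>b\<in>(Basis :: 'a set). (\<integral>\<^sup>+t. ennreal (exp (- t\<^sup>2 / 2)) \<partial>lborel))"
  by (rule nn_integral_lborel_prod) auto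
 also have "... < top" using nn_integral_gauss_real_finite by (simp add: ennreal_prod_eq_top less_top prod_constant power_less_top_ennreal)
 finally show "(\<integral>\<^sup>+x. ennreal (gauss (x :: 'a)) \<partial>lborel) < \<infinity>" by simp
qed

definition ZG :: "'a::euclidean_space itself => real" where "ZG _ = LI (gauss :: 'a => real)"

lemma gauss_pair: "gauss (x, y) = gauss x * gauss y"
 by (simp add: gauss_def exp_add[symmetric] add_divide_distrib)

text \<open>Mehler kernel: for independent Gaussians X and Y the pair (X, c X + s Y) has a density
  symmetric in its two entries.\<close>

lemma mehler_symmetric:
 fixes x u :: "'a::euclidean_space"
 assumes "c\<^sup>2 + s\<^sup>2 = 1" "s ~= 0"
 shows "gauss x * gauss ((u - c *R x) /\<^sub>R s) = gauss u * gauss ((x - c *R u) /\<^sub>R s)"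
proof -
 have s2: "s\<^sup>2 ~= 0" "s\<^sup>2 = 1 - c\<^sup>2" using assms by auto
 have n: "((v - c *R w) /\<^sub>R s) *. ((v - c *R w) /\<^sub>R s) = (v *. v - 2 * c * (v *. w) + c\<^sup>2 * (w *. w)) / s\<^sup>2" for v w :: 'a
  by (simp add: inner_diff_left inner_diff_right inner_commute power2_eq_square divide_inverse algebra_simps)
 have key: "x *. x + (u *. u - 2 * c * (u *. x) + c\<^sup>2 * (x *. x)) / s\<^sup>2 = (x *. x + u *. u - 2 * c * (u *. x)) / s\<^sup>2" for x u :: 'a
 proof -
  have "x *. x = s\<^sup>2 * (x *. x) / s\<^sup>2" using s2 by simp
  then have "x *. x + (u *. u - 2 * c * (u *. x) + c\<^sup>2 * (x *. x)) / s\<^sup>2 = (s\<^sup>2 * (x *. x) + (u *. u - 2 * c * (u *. x) + c\<^sup>2 * (x *. x))) / s\<^sup>2"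
   by (simp only: add_divide_distrib)
  also have "s\<^sup>2 * (x *. x) + (u *. u - 2 * c * (u *. x) + c\<^sup>2 * (x *. x)) = x *. x + u *. u - 2 * c * (u *. x)"
   unfolding s2(2) by (simp add: algebra_simps)
  finally show ?thesis .
 qed
 have "x *. x + ((u - c *R x) /\<^sub>R s) *. ((u - c *R x) /\<^sub>R s) = u *. u + ((x - c *R u) /\<^sub>R s) *. ((x - c *R u) /\<^sub>R s)"
  unfolding n key by (simp add: inner_commute add.commute)
 then have "- (x *. x) / 2 + - (((u - c *R x) /\<^sub>R s) *. ((u - c *R x) /\<^sub>R s)) / 2
  = - (u *. u) / 2 + - (((x - c *R u) /\<^sub>R s) *. ((x - c *R u) /\<^sub>R s)) / 2" by linarith
 then show ?thesis unfolding gauss_def by (simp only: exp_add[symmetric])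
qed

lemma mehler_ibp:
 fixes f :: "'a::euclidean_space => real"
 assumes d: "!!x. (f has_derivative (%h. gf x *. h)) (at x)" and cg: "continuous_on UNIV gf"
  and z: "!!x. norm x > R ==> f x = 0" "!!x. norm x > R ==> gf x = 0" and s: "s ~= 0"
 shows "LI (%x. f x * ((v - x) *. b) * gauss ((x - v) /\<^sub>R s)) = - (s\<^sup>2 * LI (%x. (gf x *. b) * gauss ((x - v) /\<^sub>R s)))"
proof -
 have cf: "continuous_on UNIV f" by (intro continuous_at_imp_continuous_on ballI has_derivative_continuous[OF d])
 have i: "integrable lborel (%x. (gf x *. b) * gauss ((x - v) /\<^sub>R s))"
  by (rule integrable_cts_supp[of _ R]) (auto intro!: continuous_intros cg simp: z)
 have i': "integrable lborel (%x. f x * ((v - x) *. b) * gauss ((x - v) /\<^sub>R s))"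
  by (rule integrable_cts_supp[of _ R]) (auto intro!: continuous_intros cf simp: z)
 have "LI (%x. (gf x *. b) * gauss ((x - v) /\<^sub>R s) + (f x * ((v - x) *. b) * gauss ((x - v) /\<^sub>R s)) / s\<^sup>2) = 0"
 proof (rule integral_directional_derivative_zero[where S = UNIV and K = "cball 0 R" and b = b and f = "%x. f x * gauss ((x - v) /\<^sub>R s)"
    and D = "%x h. f x * (- (gauss ((x - v) /\<^sub>R s) * (((x - v) /\<^sub>R s) *. (h /\<^sub>R s)))) + (gf x *. h) * gauss ((x - v) /\<^sub>R s)"])
  fix x
  have 1: "((%x. (x - v) /\<^sub>R s) has_derivative (%h. h /\<^sub>R s)) (at x)" by (auto intro!: derivative_eq_intros)
  show "((%x. f x * gauss ((x - v) /\<^sub>R s)) has_derivative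
   (%h. f x * (- (gauss ((x - v) /\<^sub>R s) * (((x - v) /\<^sub>R s) *. (h /\<^sub>R s)))) + (gf x *. h) * gauss ((x - v) /\<^sub>R s))) (at x)"
   by (rule has_derivative_mult[OF d has_derivative_compose[OF 1 gauss_has_derivative]])
  show "(gf x *. b) * gauss ((x - v) /\<^sub>R s) + (f x * ((v - x) *. b) * gauss ((x - v) /\<^sub>R s)) / s\<^sup>2
   = f x * (- (gauss ((x - v) /\<^sub>R s) * (((x - v) /\<^sub>R s) *. (b /\<^sub>R s)))) + (gf x *. b) * gauss ((x - v) /\<^sub>R s)"
  proof -
   have "((x - v) /\<^sub>R s) *. (b /\<^sub>R s) = - (((v - x) *. b) / s\<^sup>2)"
    by (simp add: inner_diff_left power2_eq_square divide_inverse algebra_simps)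
   then show ?thesis by simp
  qed
 next
  show "continuous_on UNIV (%x. f x * (- (gauss ((x - v) /\<^sub>R s) * (((x - v) /\<^sub>R s) *. (b /\<^sub>R s)))) + (gf x *. b) * gauss ((x - v) /\<^sub>R s))"
   by (intro continuous_intros cg cf)
 qed (auto simp: z)
 then have "LI (%x. (gf x *. b) * gauss ((x - v) /\<^sub>R s)) + LI (%x. f x * ((v - x) *. b) * gauss ((x - v) /\<^sub>R s)) / s\<^sup>2 = 0"
  using i i' by simp
 then show ?thesis using s by (simp add: field_simps)
qed

lemma lborel_fubini:
 fixes F :: "'a::euclidean_space \<times> 'b::euclidean_space => real"
 assumes "integrable lborel F"
 shows "LI F = LI (%x. LI (%y. F (x, y)))"
  "LI F = LI (%y. LI (%x. F (x, y)))"
proof -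
 have i: "integrable (lborel \<Otimes>\<^sub>M lborel) F" using assms by (simp add: lborel_prod)
 show "LI F = LI (%x. LI (%y. F (x, y)))"
  using lborel_pair.integral_fst'[OF i] by (simp add: lborel_prod)
 have i': "integrable (lborel \<Otimes>\<^sub>M lborel) (case_prod (%x y. F (x, y)))" using i by simp
 show "LI F = LI (%y. LI (%x. F (x, y)))"
  using lborel_pair.integral_snd[OF i'] by (simp add: lborel_prod)
qed

lemma gauss_scaled:
 fixes v :: "'a::euclidean_space"
 assumes s: "s > 0"
 shows "LI (%u. gauss ((u - v) /\<^sub>R s)) = s ^ DIM('a) * ZG TYPE('a)" "integrable lborel (%u. gauss ((u - v) /\<^sub>R s))"
proof -
 have "LI (%x. gauss (((v + s *R x) - v) /\<^sub>R s)) = LI (%u. gauss ((u - v) /\<^sub>R s)) / s ^ DIM('a)"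
  by (rule lborel_scale_integral[OF s])
 moreover have "(%x. gauss (((v + s *R x) - v) /\<^sub>R s)) = (gauss :: 'a => real)" using s by simp
 ultimately show 1: "LI (%u. gauss ((u - v) /\<^sub>R s)) = s ^ DIM('a) * ZG TYPE('a)" using s by (simp add: ZG_def field_simps)
 show "integrable lborel (%u. gauss ((u - v) /\<^sub>R s))"
 proof (rule ccontr)
  assume "~ ?thesis"
  then have "LI (%u. gauss ((u - v) /\<^sub>R s)) = 0" by (rule not_integrable_integral_eq)
  moreover have "ZG TYPE('a) > 0" unfolding ZG_def
   by (rule integral_pos_of_continuous[OF gauss_continuous[OF continuous_on_id] less_imp_le[OF gauss_pos] gauss_integrable gauss_pos])
  ultimately show False using 1 s by simp
 qed
qed

lemma ZG_pos: "ZG TYPE('a::euclidean_space) > 0" unfolding ZG_def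
 by (rule integral_pos_of_continuous[OF gauss_continuous[OF continuous_on_id] less_imp_le[OF gauss_pos] gauss_integrable gauss_pos])

locale compact_C1 =
 fixes f :: "'a::euclidean_space => real" and gf :: "'a => 'a" and R :: real
 assumes d: "!!x. (f has_derivative (%h. gf x *. h)) (at x)" and cg: "continuous_on UNIV gf"
  and zf: "!!x. norm x > R ==> f x = 0" and zg: "!!x. norm x > R ==> gf x = 0" and R: "R > 0"
begin

lemma cf: "continuous_on UNIV f" by (intro continuous_at_imp_continuous_on ballI has_derivative_continuous[OF d])

lemmas cf' [continuous_intros] = continuous_on_compose2[OF cf _ subset_UNIV]
lemmas cg' [continuous_intros] = continuous_on_compose2[OF cg _ subset_UNIV]

definition Q where "Q = LI (%x. (gf x *. gf x) * gauss x)"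

text \<open>The inner product of the two gradients is at most half the sum of their squares; by
  symmetry of the kernel one variable can be integrated out in each square, which leaves
  \<open>Q\<close> both times.\<close>

lemma mehler_dirichlet:
 assumes cs: "c\<^sup>2 + s\<^sup>2 = 1" "s > 0"
 shows "LI (%p. gauss (snd p) * gauss ((fst p - c *R snd p) /\<^sub>R s) * (gf (fst p) *. gf (snd p))) <= s ^ DIM('a) * (ZG TYPE('a) * Q)"
  "integrable lborel (%p. gauss (snd p) * gauss ((fst p - c *R snd p) /\<^sub>R s) * (gf (fst p) *. gf (snd p)))"
proof -
 let ?T = "%p. gauss (snd p) * gauss ((fst p - c *R snd p) /\<^sub>R s) * (gf (fst p) *. gf (snd p))"
 show iT: "integrable lborel ?T"
 proof (rule integrable_cts_supp[of _ "2 * R"])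
  show "continuous_on UNIV ?T" by (intro continuous_intros)
  fix p :: "'a \<times> 'a" assume "norm p > 2 * R"
  then have "norm (fst p) > R | norm (snd p) > R" using norm_Pair_le[of "fst p" "snd p"] by (simp add: not_less) linarith
  then show "?T p = 0" using zg by auto
 qed
 define P where "P p = (gf (fst p) *. gf (fst p)) * gauss (fst p) * gauss ((snd p - c *R fst p) /\<^sub>R s)" for p :: "'a \<times> 'a"
 have cP: "continuous_on UNIV P" unfolding P_def by (intro continuous_intros)
 note inner = gauss_scaled[OF cs(2)]
 have Pu: "LI (%u. P (x, u)) = s ^ DIM('a) * ZG TYPE('a) * ((gf x *. gf x) * gauss x)" "integrable lborel (%u. P (x, u))" for x
  unfolding P_def fst_conv snd_conv by (simp_all only: integral_mult_right_zero inner(1) integrable_mult_right inner(2)) (simp add: mult_ac)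
 have iQ: "integrable lborel (%x. (gf x *. gf x) * gauss x)"
  by (rule integrable_cts_supp[of _ R]) (auto intro!: continuous_intros simp: zg)
 have nP: "P p >= 0" for p unfolding P_def by (intro mult_nonneg_nonneg less_imp_le[OF gauss_pos] inner_ge_zero)
 have iP: "integrable (lborel \<Otimes>\<^sub>M lborel) P"
 proof (rule lborel_pair.Fubini_integrable)
  show "P : borel_measurable (lborel \<Otimes>\<^sub>M lborel)" unfolding lborel_prod using borel_measurable_continuous_onI[OF cP] by simp
  show "integrable lborel (%x. \<integral>y. norm (P (x, y)) \<partial>lborel)" using nP by (simp add: Pu(1) iQ)
  show "AE x in lborel. integrable lborel (%y. P (x, y))" using Pu(2) by simp
 qed
 have IP: "LI P = s ^ DIM('a) * (ZG TYPE('a) * Q)"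
  using lborel_fubini(1)[of P] iP by (simp add: lborel_prod Pu(1) Q_def)
 have sw: "(%p. P (snd p, fst p)) = (%(x, y). P (y, x))" by (auto simp: fun_eq_iff)
 have iP': "integrable lborel (%p. P (snd p, fst p))"
  unfolding sw using lborel_pair.integrable_product_swap[OF iP] by (simp add: lborel_prod)
 have IP': "LI (%p. P (snd p, fst p)) = s ^ DIM('a) * (ZG TYPE('a) * Q)"
  unfolding sw using lborel_pair.integral_product_swap[of P] iP by (simp add: lborel_prod IP)
 have "LI ?T <= LI (%p. 1/2 * P p + 1/2 * P (snd p, fst p))"
 proof (rule integral_mono[OF iT])
  show "integrable lborel (%p. 1/2 * P p + 1/2 * P (snd p, fst p))"
   using iP by (intro bi_add integrable_mult_right iP') (simp add: lborel_prod)
  fix p :: "'a \<times> 'a"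
  define N where "N = gauss (snd p) * gauss ((fst p - c *R snd p) /\<^sub>R s)"
  have N: "N >= 0" "N = gauss (fst p) * gauss ((snd p - c *R fst p) /\<^sub>R s)"
   unfolding N_def using mehler_symmetric[OF cs(1), of "fst p" "snd p"] cs gauss_pos by (auto intro: less_imp_le mult_pos_pos)
  have "0 <= (gf (fst p) - gf (snd p)) *. (gf (fst p) - gf (snd p))" by simp
  then have "gf (fst p) *. gf (snd p) <= 1/2 * (gf (fst p) *. gf (fst p)) + 1/2 * (gf (snd p) *. gf (snd p))"
   by (simp add: inner_diff_left inner_diff_right inner_commute)
  from mult_left_mono[OF this N(1)]
  have "N * (gf (fst p) *. gf (snd p)) <= 1/2 * ((gf (fst p) *. gf (fst p)) * N) + 1/2 * ((gf (snd p) *. gf (snd p)) * N)"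
   by (simp add: algebra_simps)
  moreover have "P p = (gf (fst p) *. gf (fst p)) * N" unfolding P_def N(2) by simp
  moreover have "P (snd p, fst p) = (gf (snd p) *. gf (snd p)) * N" unfolding P_def N_def by simp
  ultimately show "?T p <= 1/2 * P p + 1/2 * P (snd p, fst p)" unfolding N_def by simp
 qed
 also have "... = 1/2 * LI P + 1/2 * LI (%p. P (snd p, fst p))"
  using iP iP' by (simp add: lborel_prod)
 also have "... = s ^ DIM('a) * (ZG TYPE('a) * Q)" unfolding IP IP' by simp
 finally show "LI ?T <= s ^ DIM('a) * (ZG TYPE('a) * Q)" .
qed

text \<open>Correlation of \<open>f\<close> at X and at cos(th) X + sin(th) Y: the
  Ornstein-Uhlenbeck semigroup with cos(th) = exp(-t). It joins \<open>ZG\<close> times the second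
  moment at angle 0 to the squared mean at \<open>pi / 2\<close>.\<close>

definition Phi where "Phi th = LI (%p. f (fst p) * f (cos th *R fst p + sin th *R snd p) * gauss p)"

lemma support_bound:
 assumes "norm p > R + 2 * R / m" "m > 0" "m <= abs (s)" "abs (c) <= 1" "norm (fst p) <= R"
 shows "norm (c *R fst p + s *R snd p) > R"
proof -
 have "norm (snd p) > 2 * R / m" using assms norm_Pair_le[of "fst p" "snd p"] by simp
 then have "2 * R < m * norm (snd p)" using assms by (simp add: field_simps)
 also have "... <= abs (s) * norm (snd p)" using assms by (intro mult_right_mono) auto
 finally have "2 * R < norm (s *R snd p)" by simp
 moreover have "norm (c *R fst p) <= R" using mult_mono[OF assms(4,5)] by simp
 moreover have "norm (s *R snd p) <= norm (c *R fst p + s *R snd p) + norm (c *R fst p)"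
  using norm_triangle_ineq4[of "c *R fst p + s *R snd p" "c *R fst p"] by simp
 ultimately show ?thesis by linarith
qed

text \<open>While \<open>sin th\<close> is bounded away from 0 the support in the second variable is
  uniformly bounded, which permits differentiation under the integral.\<close>

lemma Phi_deriv:
 assumes s: "sin th > 0"
 shows "(Phi has_real_derivative LI (%p. f (fst p) * (gf (cos th *R fst p + sin th *R snd p) *. (- sin th *R fst p + cos th *R snd p)) * gauss p)) (at th)"
proof -
 define m where "m = sin th / 2"
 have "isCont sin th" by simp
 moreover have "m < sin th" using s by (simp add: m_def)
 ultimately have "eventually (%t. m < sin t) (nhds th)"
  by (metis eventually_nhds_conv_at isCont_def order_tendstoD(1))
 then obtain e where e: "e > 0" "!!t. dist t th < e ==> m < sin t" unfolding eventually_nhds_metric by blast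
 have m: "m > 0" using s by (simp add: m_def)
 have sin: "m <= abs (sin t)" if "t : ball th e" for t using e(2)[of t] that by (simp add: dist_commute)
 have "((%t. LI (%p. f (fst p) * f (cos t *R fst p + sin t *R snd p) * gauss p)) has_derivative
  (%h. LI (%p. f (fst p) * (gf (cos th *R fst p + sin th *R snd p) *. (- sin th *R fst p + cos th *R snd p)) * gauss p) *. h)) (at th)"
 proof (rule leibniz_lborel[where S = "ball th e" and R = "R + 2 * R / m"
    and K = "%t p. f (fst p) * (gf (cos t *R fst p + sin t *R snd p) *. (- sin t *R fst p + cos t *R snd p)) * gauss p"])
  fix t :: real and p :: "'a \<times> 'a"
  have 1: "((%t. cos t *R fst p + sin t *R snd p) has_derivative (%h. h *R (- sin t *R fst p + cos t *R snd p))) (at t)"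
   by (auto intro!: derivative_eq_intros simp: scaleR_add_right scaleR_diff_right algebra_simps)
  have "((%t. f (fst p) * f (cos t *R fst p + sin t *R snd p) * gauss p) has_derivative
   (%h. f (fst p) * (gf (cos t *R fst p + sin t *R snd p) *. (h *R (- sin t *R fst p + cos t *R snd p))) * gauss p)) (at t)"
   by (intro has_derivative_mult_left has_derivative_mult_right has_derivative_compose[OF 1 d])
  then show "((%t. f (fst p) * f (cos t *R fst p + sin t *R snd p) * gauss p) has_derivative
   (%h. (f (fst p) * (gf (cos t *R fst p + sin t *R snd p) *. (- sin t *R fst p + cos t *R snd p)) * gauss p) *. h)) (at t)"
   by (simp add: mult_ac)
 next
  show "continuous_on (ball th e \<times> UNIV) (%(t, p). f (fst p) * (gf (cos t *R fst p + sin t *R snd p) *. (- sin t *R fst p + cos t *R snd p)) * gauss p)"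
   unfolding case_prod_beta by (intro continuous_intros)
  show "continuous_on UNIV (%p. f (fst p) * f (cos t *R fst p + sin t *R snd p) * gauss p)" for t
   by (intro continuous_intros)
 next
  fix t :: real and p :: "'a \<times> 'a" assume t: "t : ball th e" and p: "norm p > R + 2 * R / m"
  have "f (fst p) = 0 | norm (cos t *R fst p + sin t *R snd p) > R"
   using support_bound[OF p m sin[OF t], of "cos t"] zf[of "fst p"] by fastforce
  then show "f (fst p) * f (cos t *R fst p + sin t *R snd p) * gauss p = 0"
   "f (fst p) * (gf (cos t *R fst p + sin t *R snd p) *. (- sin t *R fst p + cos t *R snd p)) * gauss p = 0"
   using zf zg by auto
 qed (use e in auto)
 then show ?thesis unfolding has_field_derivative_def Phi_def[abs_def] inner_real_def .
qed

text \<open>The substitution u = c x + s y exhibits the Mehler kernel. Integration by parts in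
  \<open>x\<close> puts a derivative on the other copy of \<open>f\<close> as well, and
  \<open>mehler_dirichlet\<close> bounds the result.\<close>

lemma Phi_deriv_ge:
 assumes s: "s > 0" and cs: "c\<^sup>2 + s\<^sup>2 = 1"
 shows "- (s * (ZG TYPE('a) * Q)) <= LI (%p. f (fst p) * (gf (c *R fst p + s *R snd p) *. (- s *R fst p + c *R snd p)) * gauss p)"
proof -
 define n where "n = DIM('a)"
 let ?F1 = "%p. f (fst p) * (gf (c *R fst p + s *R snd p) *. (- s *R fst p + c *R snd p)) * gauss p"
 let ?F2 = "%p. f (fst p) * ((c *R snd p - fst p) *. gf (snd p)) * gauss ((fst p - c *R snd p) /\<^sub>R s) * gauss (snd p)"
 let ?T = "%p. gauss (snd p) * gauss ((fst p - c *R snd p) /\<^sub>R s) * (gf (fst p) *. gf (snd p))"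
 have c1: "abs (c) <= 1" using cs by (metis abs_le_square_iff abs_one le_add_same_cancel1 one_power2 zero_le_power2)
 have iF1: "integrable lborel ?F1"
 proof (rule integrable_cts_supp[of _ "R + 2 * R / s"])
  show "continuous_on UNIV ?F1" by (intro continuous_intros)
  fix p :: "'a \<times> 'a" assume p: "norm p > R + 2 * R / s"
  have "f (fst p) = 0 | norm (c *R fst p + s *R snd p) > R"
   using support_bound[OF p s _ c1, of s] s zf[of "fst p"] by fastforce
  then show "?F1 p = 0" using zf zg by auto
 qed
 have iF2: "integrable lborel ?F2"
 proof (rule integrable_cts_supp[of _ "2 * R"])
  show "continuous_on UNIV ?F2" by (intro continuous_intros)
  fix p :: "'a \<times> 'a" assume "norm p > 2 * R"
  then have "norm (fst p) > R | norm (snd p) > R" using norm_Pair_le[of "fst p" "snd p"] by (simp add: not_less) linarith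
  then show "?F2 p = 0" using zf zg by auto
 qed
 have "LI (%y. ?F1 (x, y)) = LI (%u. ?F2 (x, u)) / (s * s ^ n)" for x
 proof -
  let ?G = "%u. f x * (gf u *. (- s *R x + (c / s) *R (u - c *R x))) * (gauss x * gauss ((u - c *R x) /\<^sub>R s))"
  have "(%y. ?F1 (x, y)) = (%y. ?G (c *R x + s *R y))" using s by (simp add: gauss_pair fun_eq_iff)
  then have "LI (%y. ?F1 (x, y)) = LI ?G / s ^ n"
   unfolding n_def using lborel_scale_integral[OF s, of ?G "c *R x"] by simp
  also have "?G = (%u. ?F2 (x, u) / s)"
  proof
   fix u
   have "s *R (- s *R x + (c / s) *R (u - c *R x)) = c *R u - (c\<^sup>2 + s\<^sup>2) *R x"
    using s by (simp add: scaleR_diff_right scaleR_add_left power2_eq_square algebra_simps)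
   then have "- s *R x + (c / s) *R (u - c *R x) = (c *R u - x) /\<^sub>R s"
    unfolding cs using s by (metis scaleR_one divideR_right less_irrefl)
   moreover have "gauss x * gauss ((u - c *R x) /\<^sub>R s) = gauss u * gauss ((x - c *R u) /\<^sub>R s)"
    using s by (intro mehler_symmetric[OF cs]) simp
   ultimately show "?G u = ?F2 (x, u) / s" by (simp add: divide_inverse inner_commute mult_ac)
  qed
  finally show ?thesis by (simp add: mult.commute)
 qed
 then have "LI ?F1 = LI ?F2 / (s * s ^ n)"
  unfolding lborel_fubini(1)[OF iF1] lborel_fubini(1)[OF iF2] by simp
 also have "LI ?F2 = LI (%u. LI (%x. ?F2 (x, u)))" by (rule lborel_fubini(2)[OF iF2])
 also have "(%u. LI (%x. ?F2 (x, u))) = (%u. - s\<^sup>2 * LI (%x. ?T (x, u)))"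
 proof
  fix u
  have "LI (%x. ?F2 (x, u)) = LI (%x. f x * ((c *R u - x) *. gf u) * gauss ((x - c *R u) /\<^sub>R s)) * gauss u"
   by simp
  also have "LI (%x. f x * ((c *R u - x) *. gf u) * gauss ((x - c *R u) /\<^sub>R s)) = - (s\<^sup>2 * LI (%x. (gf x *. gf u) * gauss ((x - c *R u) /\<^sub>R s)))"
   by (rule mehler_ibp[OF d cg, of R]) (use zf zg s in auto)
  also have "- (s\<^sup>2 * LI (%x. (gf x *. gf u) * gauss ((x - c *R u) /\<^sub>R s))) * gauss u = - s\<^sup>2 * (LI (%x. (gf x *. gf u) * gauss ((x - c *R u) /\<^sub>R s)) * gauss u)" by simp
  also have "LI (%x. (gf x *. gf u) * gauss ((x - c *R u) /\<^sub>R s)) * gauss u = LI (%x. ?T (x, u))"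
   unfolding integral_mult_left_zero[symmetric] by (rule arg_cong[where f = "LI"]) (simp add: fun_eq_iff mult_ac)
  finally show "LI (%x. ?F2 (x, u)) = - s\<^sup>2 * LI (%x. ?T (x, u))" .
 qed
 also have "LI (%u. - s\<^sup>2 * LI (%x. ?T (x, u))) = - s\<^sup>2 * LI ?T"
  unfolding integral_mult_right_zero lborel_fubini(2)[OF mehler_dirichlet(2)[OF cs s]] ..
 also have "- s\<^sup>2 * LI ?T / (s * s ^ n) = - (s * LI ?T / s ^ n)"
  using s by (simp add: power2_eq_square)
 finally have 1: "LI ?F1 = - (s * LI ?T / s ^ n)" .
 have "LI ?T <= s ^ n * (ZG TYPE('a) * Q)" unfolding n_def by (rule mehler_dirichlet(1)[OF cs s])
 then have "LI ?T / s ^ n <= ZG TYPE('a) * Q" using s by (simp add: pos_divide_le_eq mult.commute)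
 then have "s * (LI ?T / s ^ n) <= s * (ZG TYPE('a) * Q)" using s by (intro mult_left_mono) auto
 then show ?thesis unfolding 1 by simp
qed

text \<open>\<open>Phi th - cos th * (ZG * Q)\<close> is nondecreasing for
  \<open>0 < th <= pi / 2\<close>, which compares the second moment with the squared mean. The end
  point 0, where the support bound degenerates, is reached by dominated convergence.\<close>

lemma gauss_poincare:
 "ZG TYPE('a) * LI (%x. (f x)\<^sup>2 * gauss x) <= ZG TYPE('a) * Q + (LI (%x. f x * gauss x))\<^sup>2"
proof -
 obtain M where M: "!!x. abs (f x) <= M"
 proof -
  have "compact (f ` cball 0 R)" by (intro compact_continuous_image continuous_on_subset[OF cf]) auto
  then obtain M where M: "!!y. y : f ` cball 0 R ==> norm y <= M" by (meson compact_imp_bounded bounded_iff)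
  have "abs (f x) <= max M 0" for x
   by (cases "norm x > R") (use M zf in "auto simp: not_less intro: max.coboundedI1")
  then show ?thesis by (rule that)
 qed
 have M0: "M >= 0" using M[of 0] by simp
 have key: "Phi eps - cos eps * (ZG TYPE('a) * Q) <= (LI (%x. f x * gauss x))\<^sup>2" if e: "0 < eps" "eps <= pi / 2" for eps
 proof -
  have "Phi eps - cos eps * (ZG TYPE('a) * Q) <= Phi (pi/2) - cos (pi/2) * (ZG TYPE('a) * Q)"
  proof (rule DERIV_nonneg_imp_nondecreasing[OF e(2)])
   fix t assume t: "eps <= t" "t <= pi / 2"
   then have s: "sin t > 0" using e by (intro sin_gt_zero) auto
   have "((%t. Phi t - cos t * (ZG TYPE('a) * Q)) has_real_derivative
    LI (%p. f (fst p) * (gf (cos t *R fst p + sin t *R snd p) *. (- sin t *R fst p + cos t *R snd p)) * gauss p) + sin t * (ZG TYPE('a) * Q)) (at t)"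
    using DERIV_diff[OF Phi_deriv[OF s] DERIV_cmult_right[OF DERIV_cos, of "ZG TYPE('a) * Q" t]] by simp
   moreover have "0 <= LI (%p. f (fst p) * (gf (cos t *R fst p + sin t *R snd p) *. (- sin t *R fst p + cos t *R snd p)) * gauss p) + sin t * (ZG TYPE('a) * Q)"
    using Phi_deriv_ge[OF s, of "cos t"] by simp
   ultimately show "EX y. ((%t. Phi t - cos t * (ZG TYPE('a) * Q)) has_real_derivative y) (at t) & 0 <= y" by blast
  qed
  also have "Phi (pi/2) = LI (%p. f (fst p) * f (snd p) * gauss p)" by (simp add: Phi_def)
  also have "... = LI (%x. LI (%y. f x * gauss x * (f y * gauss y)))"
  proof -
   have "integrable lborel (%p. f (fst p) * f (snd p) * gauss p)"
   proof (rule integrable_cts_supp[of _ "2 * R"])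
    show "continuous_on UNIV (%p. f (fst p) * f (snd p) * gauss p)" by (intro continuous_intros)
    fix p :: "'a \<times> 'a" assume "norm p > 2 * R"
    then have "norm (fst p) > R | norm (snd p) > R" using norm_Pair_le[of "fst p" "snd p"] by (simp add: not_less) linarith
    then show "f (fst p) * f (snd p) * gauss p = 0" using zf by auto
   qed
   from lborel_fubini(1)[OF this] show ?thesis by (simp add: gauss_pair mult_ac)
  qed
  also have "... = (LI (%x. f x * gauss x))\<^sup>2" by (simp add: power2_eq_square)
  finally show ?thesis by simp
 qed
 define th where "th n = 1 / real (Suc n)" for n
 have th: "0 < th n" "th n <= pi / 2" for n
 proof -
  show "0 < th n" by (simp add: th_def)
  have "th n <= 1" by (simp add: th_def)
  then show "th n <= pi/2" using pi_ge_two by linarith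
 qed
 have t0: "th \<longlonglongrightarrow> 0" unfolding th_def by (rule LIMSEQ_Suc[OF lim_1_over_n])
 have cF: "continuous_on UNIV (%p. f (fst p) * f (cos t *R fst p + sin t *R snd p) * gauss p)" for t by (intro continuous_intros)
 have mF: "(%p. f (fst p) * f (cos t *R fst p + sin t *R snd p) * gauss p) : borel_measurable lborel" for t
  using borel_measurable_continuous_onI[OF cF[of t]] by simp
 have cp: "continuous_on UNIV (%t. f (fst p) * f (cos t *R fst p + sin t *R snd p) * gauss p)" for p by (intro continuous_intros)
 have bd: "norm (f (fst p) * f v * gauss p) <= M * M * gauss p" for p v
  unfolding real_norm_def abs_mult using M M0 gauss_pos[of p] by (intro mult_mono) auto
 have lim: "AE p in lborel. (%n. f (fst p) * f (cos (th n) *R fst p + sin (th n) *R snd p) * gauss p) \<longlonglongrightarrow> f (fst p) * f (cos 0 *R fst p + sin 0 *R snd p) * gauss p"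
 proof (rule AE_I2)
  fix p :: "'a \<times> 'a"
  show "(%n. f (fst p) * f (cos (th n) *R fst p + sin (th n) *R snd p) * gauss p) \<longlonglongrightarrow> f (fst p) * f (cos 0 *R fst p + sin 0 *R snd p) * gauss p"
   by (rule continuous_on_tendsto_compose[OF cp t0]) auto
 qed
 have iw: "integrable lborel (%p. M * M * gauss (p :: 'a \<times> 'a))" by (intro integrable_mult_right gauss_integrable)
 have conv: "(%n. Phi (th n)) \<longlonglongrightarrow> Phi 0" unfolding Phi_def
  by (rule integral_dominated_convergence[OF mF mF iw lim]) (rule AE_I2, rule bd)
 have i0: "integrable lborel (%p. f (fst p) * f (cos 0 *R fst p + sin 0 *R snd p) * gauss p)"
  by (rule Bochner_Integration.integrable_bound[OF iw mF], rule AE_I2, rule order_trans[OF bd]) simp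
 have "Phi 0 = LI (%x. LI (%y. (f x)\<^sup>2 * gauss x * gauss (y :: 'a)))"
  unfolding Phi_def lborel_fubini(1)[OF i0] by (simp add: gauss_pair power2_eq_square mult_ac)
 also have "... = ZG TYPE('a) * LI (%x. (f x)\<^sup>2 * gauss x)" by (simp add: ZG_def mult.commute)
 finally have P0: "Phi 0 = ZG TYPE('a) * LI (%x. (f x)\<^sup>2 * gauss x)" .
 have "(%n. cos (th n)) \<longlonglongrightarrow> cos 0" by (intro tendsto_intros t0)
 then have "(%n. Phi (th n) - cos (th n) * (ZG TYPE('a) * Q)) \<longlonglongrightarrow> Phi 0 - cos 0 * (ZG TYPE('a) * Q)"
  by (intro tendsto_diff tendsto_mult conv tendsto_const)
 then have "Phi 0 - cos 0 * (ZG TYPE('a) * Q) <= (LI (%x. f x * gauss x))\<^sup>2"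
  by (rule LIMSEQ_le_const2) (use key th in auto)
 then show ?thesis unfolding P0 by simp
qed

end

section \<open>Boundary Harnack inequality for the Robin condition\<close>

lemma local_min_laplacian_nonneg:
 fixes v :: "'a::euclidean_space => real"
 assumes v: "C2on S v G l" and S: "open S" "x : S" and e: "e > 0" and m: "!!y. dist x y < e ==> y : S ==> v x <= v y"
 shows "l x >= 0"
proof -
 obtain H where H: "!!x. x : S ==> (v has_derivative (%h. G x *. h)) (at x)" "!!x. x : S ==> (G has_derivative H x) (at x)"
  "!!x. x : S ==> l x = (\<Sum>b\<in>Basis. H x b *. b)"
  using v unfolding C2on_def by blast
 obtain e1 where e1: "e1 > 0" "ball x e1 \<subseteq> S" using S by (meson open_contains_ball)
 define e2 where "e2 = min e e1"
 have e2: "e2 > 0" using e e1 by (simp add: e2_def)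
 have ine2: "x + s *R b : S" "v x <= v (x + s *R b)" if "abs (s) < e2" "b : Basis" for s b
 proof -
  have "dist x (x + s *R b) < e2" using that by (simp add: dist_norm)
  then show "x + s *R b : S" using e1 by (auto simp: e2_def)
  then show "v x <= v (x + s *R b)" using m[of "x + s *R b"] \<open>dist x (x + s *R b) < e2\<close> by (simp add: e2_def)
 qed
 have "H x b *. b >= 0" if b: "b : Basis" for b
 proof (rule ccontr)
  assume neg: "~ H x b *. b >= 0"
  have dv: "((%s. v (x + s *R b)) has_real_derivative G (x + s *R b) *. b) (at s)" if "abs (s) < e2" for s
  proof -
   have 1: "((%s. x + s *R b) has_derivative (%h. h *R b)) (at s)" by (auto intro!: derivative_eq_intros)
   show ?thesis using has_derivative_compose[OF 1 H(1)[OF ine2(1)[OF that b]]] by (simp add: has_field_derivative_def mult.commute[of _ "G _ *. _"])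
  qed
  have dG: "((%s. G (x + s *R b) *. b) has_real_derivative H x b *. b) (at 0)"
  proof -
   have 1: "((%s. x + s *R b) has_derivative (%h. h *R b)) (at 0)" by (auto intro!: derivative_eq_intros)
   have 2: "(G has_derivative H x) (at (x + 0 *R b))" using H(2)[OF S(2)] by simp
   have "((%s. G (x + s *R b) *. b) has_derivative (%h. H x (h *R b) *. b)) (at 0)"
    by (rule has_derivative_inner_left[OF has_derivative_compose[OF 1 2]])
   moreover have "H x (h *R b) = h *R H x b" for h using has_derivative_linear[OF H(2)[OF S(2)]] by (simp add: linear_cmul)
   ultimately show ?thesis by (simp add: has_field_derivative_def mult.commute[of _ "H x b *. b"])
  qed
  have G0: "G x *. b = 0"
   using DERIV_local_min[OF dv[of 0] e2] ine2(2)[OF _ b] e2 by simp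
  obtain d where d: "d > 0" "!!h. 0 < h ==> h < d ==> G (x + h *R b) *. b < 0"
   using DERIV_neg_dec_right[OF dG] neg G0 by auto
  define s where "s = min d e2 / 2"
  have s: "0 < s" "s < d" "s < e2" using d e2 by (auto simp: s_def)
  have "EX t>0. t < s & v (x + s *R b) - v (x + 0 *R b) = (s - 0) * (G (x + t *R b) *. b)"
   by (rule MVT2[OF s(1)]) (use s in "intro dv, auto")
  then obtain t where t: "0 < t" "t < s" "v (x + s *R b) - v x = s * (G (x + t *R b) *. b)" by auto
  have "s * (G (x + t *R b) *. b) < 0" using d(2)[of t] t s by (simp add: mult_pos_neg)
  then show False using t(3) ine2(2)[of s b] s b by simp
 qed
 then show ?thesis unfolding H(3)[OF S(2)] by (rule sum_nonneg)
qed

text \<open>Near \<open>z\<close> the set \<open>Om\<close> lies above a Lipschitz graph in the direction \<open>u\<close>, with inner normals \<open>\<nu>\<close> close to \<open>u\<close>.\<close>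

definition lip_dom :: "'a::euclidean_space set => 'a => real => 'a => ('a => 'a) => bool" where
 "lip_dom Om z R u \<nu> \<longleftrightarrow> open Om & norm u = 1 & R > 0 & z : closure Om &
  (ALL x v. x : closure Om --> x : ball z R --> x + v : ball z R --> v ~= 0 --> norm v / 8 <= v *. u --> x + v : Om) &
  (ALL x:frontier Om Int ball z R. norm (\<nu> x) = 1 & norm (\<nu> x - u) <= 1/8)"

text \<open>Every point of that ball differs from \<open>x\<close> by a vector well inside the cone:
  its component along \<open>u\<close> is at least \<open>s / 2\<close> and its length at most
  \<open>3/2 * s\<close>.\<close>

lemma lip_dom_ball:
 assumes L: "lip_dom Om z R u \<nu>" and x: "x : closure Om" and s: "s > 0" "dist z x + 2 * s <= R"
 shows "cball (x + s *R u) (s / 2) \<subseteq> Om"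
proof
 fix y assume y: "y : cball (x + s *R u) (s / 2)"
 have u: "norm u = 1" and uu: "u *. u = 1" using L by (auto simp: lip_dom_def norm_eq_1)
 define w where "w = y - (x + s *R u)"
 have w: "norm w <= s / 2" using y by (simp add: w_def dist_norm norm_minus_commute)
 have wu: "abs (w *. u) <= s / 2" using Cauchy_Schwarz_ineq2[of w u] u w by simp
 have n: "norm (s *R u + w) <= 3/2 * s" using norm_triangle_ineq[of "s *R u" w] w u s by simp
 have i: "(s *R u + w) *. u >= s / 2" using wu uu by (simp add: inner_add_left)
 have y': "y = x + (s *R u + w)" by (simp add: w_def)
 have "dist z y <= dist z x + norm (s *R u + w)" unfolding y' using dist_triangle[of z "x + (s *R u + w)" x] norm_minus_commute[of x "x + (s *R u + w)"] by (simp only: dist_norm add_diff_cancel_left')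
 then have "y : ball z R" using n s by simp
 moreover have "x : ball z R" using s by simp
 moreover have "s *R u + w ~= 0" using i s by auto
 moreover have "norm (s *R u + w) / 8 <= (s *R u + w) *. u" using n i s by linarith
 ultimately show "y : Om" using L x unfolding lip_dom_def y' by blast
qed

text \<open>Exponent of the Gaussian barrier: with \<open>a = BA / r^2\<close> the Laplacian of
  exp(- a |x - y|^2) is positive for |x - y| > r/8, because 4 a^2 (r/8)^2 = a BA / 16 = 4 a d
  exceeds 2 a d.\<close>

definition BA :: "'a::euclidean_space itself => real" where "BA _ = 64 * real DIM('a)"

text \<open>The barrier at distance \<open>r\<close> from its centre, after subtracting its value at
  distance \<open>5/4 * r\<close> so that it vanishes there; the division by \<open>AH\<close> is
  the Harnack loss in the inner ball.\<close>

definition cE :: "'a::euclidean_space itself => real" where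
 "cE _ = (exp (- BA TYPE('a)) - exp (- (25/16 * BA TYPE('a)))) / AH TYPE('a)"

lemma BA_ge: "BA TYPE('a::euclidean_space) >= 64"
 using DIM_positive[where 'a='a] unfolding BA_def by (simp add: Suc_le_eq)

lemma AH_ge_1: "AH TYPE('a::euclidean_space) >= 1"
proof -
 have "(1::real) * 1 <= (64/15) ^ 3 * 3 ^ DIM('a)" by (rule mult_mono) (simp_all add: power3_eq_cube)
 then show ?thesis by (simp add: AH_def A0_def)
qed

lemma cE_pos: "cE TYPE('a::euclidean_space) > 0"
 using BA_ge[where 'a='a] AH_pos[where 'a='a] by (simp add: cE_def)

lemma cE_le: "cE TYPE('a::euclidean_space) <= 1"
proof -
 have "exp (- BA TYPE('a)) <= 1" using BA_ge[where 'a='a] by simp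
 then have "exp (- BA TYPE('a)) - exp (- (25/16 * BA TYPE('a))) <= AH TYPE('a)"
  using AH_ge_1[where 'a='a] exp_gt_zero[of "- (25/16 * BA TYPE('a))"] by linarith
 then show ?thesis using AH_pos[where 'a='a] by (simp add: cE_def)
qed

lemma C2on_gaussian:
 fixes y :: "'a::euclidean_space"
 shows "C2on S (%x. exp (- (a * ((x - y) *. (x - y)))) - k) (%x. - (2 * a * exp (- (a * ((x - y) *. (x - y))))) *R (x - y))
  (%x. exp (- (a * ((x - y) *. (x - y)))) * (4 * a\<^sup>2 * ((x - y) *. (x - y)) - 2 * a * real DIM('a)))"
proof -
 have 1: "C2on S (%x. (x - y) *. (x - y)) (%x. 2 *R (x - y)) (%_. 2 * real DIM('a))"
 proof (rule C2onI[where H = "%_ h. 2 *R h"])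
  fix x
  show "((%x. (x - y) *. (x - y)) has_derivative (%h. 2 *R (x - y) *. h)) (at x)"
   by (auto intro!: derivative_eq_intros simp: inner_commute)
  show "((%x. 2 *R (x - y)) has_derivative (%h. 2 *R h)) (at x)" by (auto intro!: derivative_eq_intros)
 qed (auto intro!: continuous_intros)
 have 2: "((%t. exp (- (a * t))) has_real_derivative - a * exp (- (a * t))) (at t)" for t by (auto intro!: derivative_eq_intros)
 have 3: "((%t. - a * exp (- (a * t))) has_real_derivative a\<^sup>2 * exp (- (a * t))) (at t)" for t
  by (auto intro!: derivative_eq_intros simp: power2_eq_square)
 have 4: "continuous_on UNIV (%t. a\<^sup>2 * exp (- (a * t)))" by (intro continuous_intros)
 have "C2on S (%x. exp (- (a * ((x - y) *. (x - y)))) - (0 *. x + k)) (%x. (- a * exp (- (a * ((x - y) *. (x - y))))) *R (2 *R (x - y)) - 0)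
   (%x. (a\<^sup>2 * exp (- (a * ((x - y) *. (x - y)))) * ((2 *R (x - y)) *. (2 *R (x - y))) + (- a * exp (- (a * ((x - y) *. (x - y))))) * (2 * real DIM('a))) - 0)"
  by (rule C2on_diff[OF C2on_compose[OF 1 2 3 4] C2on_linear])
 then show ?thesis by (simp add: algebra_simps power2_eq_square)
qed

text \<open>\<open>v\<close> need not be differentiable at \<open>x\<close> itself: the mean value
  theorem on the inward segment and the continuity of the extended gradient \<open>G\<close> replace
  that.\<close>

lemma boundary_min_gradient:
 fixes v :: "'a::euclidean_space => real"
 assumes X: "continuous_on X v" "continuous_on X G" "x : X" and d: "d > 0"
  and seg: "!!s. 0 < s ==> s < d ==> x + s *R n : X & (v has_derivative (%h. G (x + s *R n) *. h)) (at (x + s *R n)) & v x <= v (x + s *R n)"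
 shows "G x *. n >= 0"
proof (rule ccontr)
 assume neg: "~ G x *. n >= 0"
 have inX: "x + s *R n : X" if "s : {0..<d}" for s using seg[of s] X(3) that by (cases "s = 0") auto
 have cl: "continuous_on {0..<d} (%s. x + s *R n)" by (intro continuous_intros)
 have cG: "continuous_on {0..<d} (%s. G (x + s *R n) *. n)"
  using inX by (intro continuous_intros continuous_on_compose2[OF X(2) cl]) auto
 have cv: "continuous_on {0..<d} (%s. v (x + s *R n))"
  using inX by (intro continuous_on_compose2[OF X(1) cl]) auto
 have "EX e>0. ALL s:{0..<d}. dist s 0 < e --> dist (G (x + s *R n) *. n) (G (x + 0 *R n) *. n) < - (G x *. n)"
  using cG[unfolded continuous_on_iff, rule_format, of 0 "- (G x *. n)"] neg d by auto
 then obtain e where e: "e > 0" "!!s. s : {0..<d} ==> abs (s) < e ==> G (x + s *R n) *. n < 0"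
  by (force simp: dist_real_def)
 define s where "s = min d e / 2"
 have s: "0 < s" "s < d" "s < e" using d e by (auto simp: s_def)
 have "EX t. 0 < t & t < s & v (x + s *R n) - v (x + 0 *R n) = (G (x + t *R n) *. (1 *R n)) * (s - 0)"
 proof -
  have "EX t. 0 < t & t < s & v (x + s *R n) - v (x + 0 *R n) = (%h. G (x + t *R n) *. (h *R n)) (s - 0)"
  proof (rule mvt[OF s(1), of "%s. v (x + s *R n)" "%t h. G (x + t *R n) *. (h *R n)"])
   show "continuous_on {0..s} (%s. v (x + s *R n))" by (rule continuous_on_subset[OF cv]) (use s in auto)
   fix t assume t: "0 < t" "t < s"
   have 1: "((%s. x + s *R n) has_derivative (%h. h *R n)) (at t)" by (auto intro!: derivative_eq_intros)
   show "((%s. v (x + s *R n)) has_derivative (%h. G (x + t *R n) *. (h *R n))) (at t)"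
    by (rule has_derivative_compose[OF 1]) (use seg[of t] t s in auto)
  qed blast
  then show ?thesis by (auto simp: mult.commute)
 qed
 then obtain t where t: "0 < t" "t < s" "v (x + s *R n) - v x = (G (x + t *R n) *. n) * s" by auto
 have "(G (x + t *R n) *. n) * s < 0" using e(2)[of t] t s by (simp add: mult_neg_pos)
 moreover have "v x <= v (x + s *R n)" using seg[of s] s by auto
 ultimately show False using t(3) by linarith
qed

text \<open>Compare \<open>w\<close> with \<open>m * h\<close>, where \<open>h\<close> is a Gaussian
  around the interior point \<open>y\<close>, lowered to vanish at distance \<open>5/4 * r\<close>.
  A negative minimum of the difference lies neither in the inner ball (Harnack), nor on the outer
  sphere (\<open>h = 0\<close>), nor in between (\<open>h\<close> strictly subharmonic), nor on the
  frontier, where the normal slope of \<open>h\<close> beats the Robin term.\<close>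

lemma barrier_lower_bound:
 fixes w :: "'a::euclidean_space => real"
 assumes L: "lip_dom Om z R u \<nu>" and x0: "x0 : closure Om" and r: "r > 0" "dist z x0 + 3 * r <= R"
  and w: "continuous_on (closure Om Int ball x0 (3 * r)) w" "continuous_on (closure Om Int ball x0 (3 * r)) g"
   "C2on (Om Int ball x0 (3 * r)) w g (%_. 0)" "!!x. x : closure Om Int ball x0 (3 * r) ==> w x >= 0"
  and bc: "!!x. x : frontier Om Int ball x0 (3 * r) ==> g x *. \<nu> x <= K * w x" and K: "K >= 0" "K * r <= 1"
 shows "cE TYPE('a) * w (x0 + r *R u) <= w x0"
proof -
 define B where "B = ball x0 (3 * r)"
 have BR: "B \<subseteq> ball z R"
 proof
  fix x assume "x : B"
  then show "x : ball z R" using r dist_triangle[of z x x0] by (simp add: B_def)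
 qed
 have Om: "open Om" and u: "norm u = 1" and uu: "u *. u = 1" using L by (auto simp: lip_dom_def norm_eq_1)
 have cone: "x + v : Om" if "x : closure Om" "x : B" "x + v : B" "v ~= 0" "norm v / 8 <= v *. u" for x v
  using L that BR unfolding lip_dom_def by blast
 have nu: "norm (\<nu> x) = 1" "norm (\<nu> x - u) <= 1/8" if "x : frontier Om Int B" for x
  using L that BR unfolding lip_dom_def by blast+
 define y where "y = x0 + r *R u"
 have dy: "dist x0 y = r" using u r by (simp add: y_def dist_norm)
 have yb: "cball y (r / 2) \<subseteq> Om" unfolding y_def by (rule lip_dom_ball[OF L x0 r(1)]) (use r in simp)
 have yB: "cball y (5/4 * r) \<subseteq> B"
 proof
  fix x assume "x : cball y (5/4 * r)"
  then have "dist x0 x <= r + 5/4 * r" using dist_triangle[of x0 x y] dy by simp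
  then show "x : B" using r by (simp add: B_def)
 qed
 define A where "A = BA TYPE('a)"
 have A: "A >= 64" using BA_ge by (simp add: A_def)
 define a where "a = A / r\<^sup>2"
 have a: "a > 0" using A r by (simp add: a_def)
 have ar: "a * r\<^sup>2 = A" using r by (simp add: a_def)
 define E where "E x = exp (- (a * ((x - y) *. (x - y))))" for x
 define k where "k = exp (- (25/16 * A))"
 define h where "h x = E x - k" for x
 define gh where "gh x = - (2 * a * E x) *R (x - y)" for x
 define lh where "lh x = E x * (4 * a\<^sup>2 * ((x - y) *. (x - y)) - 2 * a * real DIM('a))" for x
 have Ch: "C2on S h gh lh" for S unfolding h_def[abs_def] gh_def[abs_def] lh_def[abs_def] E_def by (rule C2on_gaussian)
 have dxy: "(x - y) *. (x - y) = (dist y x)\<^sup>2" for x by (simp add: dist_norm norm_minus_commute power2_norm_eq_inner[symmetric])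
 have E: "E x > 0" "E x <= 1" "h x < E x" for x using a by (simp_all add: E_def h_def k_def)
 define m where "m = w y / AH TYPE('a)"
 have yin: "y : closure Om Int B" using yb yB r closure_subset by fastforce
 have m0: "m >= 0" using w(4) yin AH_pos[where 'a='a] by (simp add: m_def B_def)
 define v where "v x = w x - m * h x" for x
 define G where "G x = g x - m *R gh x" for x
 have Cv: "C2on (Om Int B) v G (%x. 0 - m * lh x)"
  unfolding v_def[abs_def] G_def[abs_def] using w(3) by (intro C2on_diff C2on_cmult Ch) (simp add: B_def)
 have cv: "continuous_on (closure Om Int B) v" "continuous_on (closure Om Int B) G"
  unfolding v_def[abs_def] G_def[abs_def] using w(1,2) unfolding B_def[symmetric]
  by (auto intro!: continuous_intros C2on_continuous[OF Ch])
 have inner: "m <= w x" if x: "dist y x <= r / 8" for x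
 proof -
  have sub: "cball x (3 * (r / 8)) \<subseteq> Om Int B"
  proof
   fix p assume "p : cball x (3 * (r / 8))"
   then have "dist y p <= r / 8 + 3 * (r / 8)" using dist_triangle[of y p x] x by simp
   then have "p : cball y (r / 2)" "p : cball y (5/4 * r)" using r by auto
   then show "p : Om Int B" using yb yB by blast
  qed
  have "w y <= AH TYPE('a) * w x"
  proof (rule harmonic_harnack[OF w(3)[folded B_def] _ sub])
   show "w p >= 0" if "p : cball x (3 * (r / 8))" for p using that sub w(4) closure_subset unfolding B_def by blast
  qed (use Om x r in "auto simp: B_def dist_commute")
  then show ?thesis using AH_pos[where 'a='a] by (simp add: m_def divide_le_eq mult.commute)
 qed
 have "v x0 >= 0"
 proof (rule ccontr)
  assume neg: "~ v x0 >= 0"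
  define D where "D = closure Om Int cball y (5/4 * r)"
  have "compact D" unfolding D_def by (rule closed_Int_compact) auto
  moreover have x0D: "x0 : D" using x0 dy r by (simp add: D_def dist_commute)
  moreover have DB: "D \<subseteq> closure Om Int B" using yB by (auto simp: D_def)
  ultimately obtain x1 where x1: "x1 : D" "!!x. x : D ==> v x1 <= v x"
   using continuous_attains_inf[of D v] continuous_on_subset[OF cv(1) DB] by blast
  have v1: "v x1 < 0" using x1(2)[OF x0D] neg by linarith
  have x1B: "x1 : closure Om" "x1 : B" using x1(1) DB by auto
  have w1: "w x1 >= 0" using w(4) x1B by (simp add: B_def)
  have mh: "w x1 < m * h x1" using v1 by (simp add: v_def)
  have m: "m > 0" using mh w1 m0 by (cases "m = 0") auto
  have h1: "h x1 > 0" using mh w1 m by (metis le_less_trans zero_less_mult_pos)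
  have far: "dist y x1 > r / 8"
  proof (rule ccontr)
   assume "~ ?thesis"
   then have "m <= w x1" by (intro inner) simp
   moreover have "m * h x1 <= m * 1" using E[of x1] m by (intro mult_left_mono) auto
   ultimately show False using mh by simp
  qed
  have near: "dist y x1 < 5/4 * r"
  proof -
   have "- (25/16 * A) < - (a * (dist y x1)\<^sup>2)" using h1 by (simp add: h_def k_def E_def dxy)
   then have "a * (dist y x1)\<^sup>2 < 25/16 * (a * r\<^sup>2)" unfolding ar by linarith
   also have "... = a * (5/4 * r)\<^sup>2" by (simp add: power2_eq_square)
   finally have "a * (dist y x1)\<^sup>2 < a * (5/4 * r)\<^sup>2" .
   then have "(dist y x1)\<^sup>2 < (5/4 * r)\<^sup>2" using a by simp
   then show ?thesis by (rule power_less_imp_less_base) (use r in simp)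
  qed
  define e where "e = 5/4 * r - dist y x1"
  have e: "e > 0" using near by (simp add: e_def)
  have inD: "x : D" if "x : Om" "dist x1 x < e" for x
   using that dist_triangle[of y x x1] closure_subset[of Om] by (auto simp: D_def e_def)
  show False
  proof (cases "x1 : Om")
   case True
   have "0 - m * lh x1 >= 0"
   proof (rule local_min_laplacian_nonneg[OF Cv _ _ e])
    show "v x1 <= v x" if "dist x1 x < e" "x : Om Int B" for x using that inD x1(2) by blast
   qed (use Om True x1B in "auto simp: B_def")
   moreover have "lh x1 > 0"
   proof -
    have "(r / 8)\<^sup>2 < (dist y x1)\<^sup>2" using far r by (intro power_strict_mono) auto
    then have "4 * a\<^sup>2 * (r / 8)\<^sup>2 < 4 * a\<^sup>2 * (dist y x1)\<^sup>2" using a by simp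
    moreover have "4 * a\<^sup>2 * (r / 8)\<^sup>2 = a * A / 16" using ar by (simp add: power2_eq_square algebra_simps)
    moreover have "a * A / 16 >= 2 * a * real DIM('a)" using a by (simp add: A_def BA_def)
    ultimately have "4 * a\<^sup>2 * (dist y x1)\<^sup>2 - 2 * a * real DIM('a) > 0" by linarith
    then show ?thesis unfolding lh_def dxy using E by simp
   qed
   ultimately show False using m by (simp add: mult_le_0_iff)
  next
   case False
   then have fr: "x1 : frontier Om Int B" using x1B Om by (simp add: frontier_def interior_open)
   define n where "n = \<nu> x1"
   have n: "norm n = 1" "norm (n - u) <= 1/8" using nu[OF fr] by (simp_all add: n_def)
   have nu1: "n *. u >= 7/8"
   proof -
    have "abs ((n - u) *. u) <= 1/8" using Cauchy_Schwarz_ineq2[of "n - u" u] n u by simp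
    then show ?thesis using uu unfolding inner_diff_left by linarith
   qed
   \<comment> \<open>A frontier point cannot lie in the upward cone at \<open>x0\<close>; this
     bounds the height of \<open>x1\<close> and keeps \<open>y\<close> above it.\<close>
   have up: "(x0 - x1) *. u >= - (norm (x0 - x1) / 8)"
   proof (rule ccontr)
    assume c: "~ ?thesis"
    then have "norm (x1 - x0) / 8 <= (x1 - x0) *. u" by (simp add: inner_diff_left norm_minus_commute)
    moreover have "x1 - x0 ~= 0" using c by auto
    ultimately have "x0 + (x1 - x0) : Om" using x0 r x1B by (intro cone) (auto simp: B_def)
    then show False using False by simp
   qed
   have n01: "norm (x0 - x1) <= 9/4 * r" using dist_triangle[of x0 x1 y] dy near by (simp add: dist_norm)
   have yu: "(y - x1) *. u >= 23/32 * r" using up n01 uu by (simp add: y_def inner_diff_left inner_add_left)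
   have yn: "abs ((y - x1) *. (n - u)) <= 5/32 * r"
   proof -
    have "abs ((y - x1) *. (n - u)) <= norm (y - x1) * norm (n - u)" by (rule Cauchy_Schwarz_ineq2)
    also have "... <= (5/4 * r) * (1/8)" using near n r by (intro mult_mono) (auto simp: dist_norm)
    finally show ?thesis by simp
   qed
   have yn1: "(y - x1) *. n >= r / 2"
   proof -
    have "(y - x1) *. n = (y - x1) *. u + (y - x1) *. (n - u)" by (simp add: inner_diff_right)
    then show ?thesis using yu yn r by linarith
   qed
   have "G x1 *. n >= 0"
   proof (rule boundary_min_gradient[OF cv _ e])
    show "x1 : closure Om Int B" using x1B by simp
    fix s assume s: "0 < s" "s < e"
    have d1: "dist x1 (x1 + s *R n) < e" using s n by (simp add: dist_norm)
    then have "dist y (x1 + s *R n) <= 5/4 * r" using dist_triangle[of y "x1 + s *R n" x1] by (simp add: e_def)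
    then have inB: "x1 + s *R n : B" using yB by auto
    have inOm: "x1 + s *R n : Om"
    proof (rule cone[OF x1B inB])
     show "s *R n ~= 0" using s n by auto
     have "s * (1/8) <= s * (n *. u)" using nu1 s by (intro mult_left_mono) auto
     then show "norm (s *R n) / 8 <= s *R n *. u" using s n by simp
    qed
    show "x1 + s *R n : closure Om Int B & (v has_derivative (%h. G (x1 + s *R n) *. h)) (at (x1 + s *R n)) & v x1 <= v (x1 + s *R n)"
     using inOm inB closure_subset[of Om] C2on_deriv[OF Cv, of "x1 + s *R n"] x1(2)[OF inD[OF inOm d1]] by blast
   qed
   moreover have "G x1 *. n < 0"
   proof -
    have ghn: "gh x1 *. n = 2 * a * E x1 * ((y - x1) *. n)" by (simp add: gh_def inner_diff_left algebra_simps)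
    have "2 * a * E x1 * (r / 2) <= 2 * a * E x1 * ((y - x1) *. n)" using yn1 a E[of x1] by (intro mult_left_mono) auto
    then have "gh x1 *. n >= a * r * E x1" unfolding ghn by (simp add: mult_ac)
    moreover have "K * h x1 <= 1 / r * E x1"
    proof (rule mult_mono)
     show "K <= 1 / r" using K r by (simp add: field_simps)
    qed (use E[of x1] h1 r in auto)
    \<comment> \<open>Since \<open>a * r^2 = A >= 64\<close>, the slope of the Gaussian dominates
      the Robin coefficient \<open>K <= 1 / r\<close>.\<close>
    moreover have "1 / r * E x1 < a * r * E x1"
    proof -
     have "1 / r < a * r" using ar A r by (simp add: field_simps power2_eq_square)
     then show ?thesis using E by (intro mult_strict_right_mono)
    qed
    ultimately have "m * (K * h x1) < m * (gh x1 *. n)" using m by simp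
    moreover have "g x1 *. n <= K * w x1" using bc fr by (simp add: n_def B_def)
    moreover have "K * w x1 <= K * (m * h x1)" using mh K by (intro mult_left_mono) auto
    ultimately show ?thesis by (simp add: G_def inner_diff_left mult.left_commute)
   qed
   ultimately show False by simp
  qed
 qed
 then have "m * h x0 <= w x0" by (simp add: v_def)
 moreover have "h x0 = exp (- A) - exp (- (25/16 * A))"
  using ar dy by (simp add: h_def E_def k_def dxy dist_commute)
 ultimately show ?thesis by (simp add: cE_def A_def m_def y_def mult.commute)
qed

text \<open>Each shrinking of the depth by 5/6 costs a factor \<open>A <= (6/5) ^ N\<close>, so the
  total loss is a power of the ratio of depths. \<open>n\<close> bounds the number of steps and
  drives the induction.\<close>

lemma harnack_chain:
 fixes f :: "real => real"
 assumes step: "!!s s'. r <= s' ==> s' <= s ==> s <= T ==> 5/6 * s <= s' ==> f s' <= A * f s"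
  and pos: "!!s. r <= s ==> s <= T ==> f s >= 0" and N: "A <= (6/5) ^ N" "A >= 1" and r: "r > 0"
 shows "r <= s ==> s <= T ==> s <= (6/5) ^ n * r ==> f r <= A * (s / r) ^ N * f s"
proof (induction n arbitrary: s)
 case 0
 then have "s = r" by simp
 then show ?case using step[of r r] 0 r by simp
next
 case (Suc n)
 have fs: "f s >= 0" using pos Suc.prems by blast
 show ?case
 proof (cases "5/6 * s <= r")
  case True
  have "f r <= A * f s" using step[of r s] Suc.prems True by simp
  also have "... <= A * ((s / r) ^ N * f s)"
  proof (rule mult_left_mono)
   have "1 <= (s / r) ^ N" using Suc.prems r by (intro one_le_power) simp
   then show "f s <= (s / r) ^ N * f s" using mult_right_mono[OF _ fs] by fastforce
  qed (use N in simp)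
  finally show ?thesis by simp
 next
  case False
  define s' where "s' = 5/6 * s"
  have s': "r <= s'" "s' <= s" "s' <= T" "s' <= (6/5) ^ n * r" using False Suc.prems r by (auto simp: s'_def)
  have "f r <= A * (s' / r) ^ N * f s'" by (rule Suc.IH[OF s'(1,3,4)])
  also have "... <= A * (s' / r) ^ N * ((6/5) ^ N * f s)"
  proof (rule mult_left_mono)
   have "f s' <= A * f s" by (rule step) (use s' Suc.prems in "auto simp: s'_def")
   also have "... <= (6/5) ^ N * f s" by (rule mult_right_mono[OF N(1) fs])
   finally show "f s' <= (6/5) ^ N * f s" .
   show "0 <= A * (s' / r) ^ N" using N s' r by (intro mult_nonneg_nonneg zero_le_power) auto
  qed
  also have "... = A * ((s' / r * (6/5)) ^ N) * f s" by (simp only: power_mult_distrib mult_ac)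
  also have "s' / r * (6/5) = s / r" by (simp add: s'_def)
  finally show ?thesis .
 qed
qed

text \<open>The Robin condition is a two-sided inequality because the barrier is applied to
  \<open>ph\<close> for the lower estimate and to a constant minus \<open>ph\<close> for the upper
  one.\<close>

definition robin :: "'a::euclidean_space set => 'a => real => ('a => 'a) => real => ('a => real) => ('a => 'a) => bool" where
 "robin Om z R \<nu> K ph g \<longleftrightarrow> continuous_on (closure Om Int ball z R) ph & continuous_on (closure Om Int ball z R) g &
  C2on (Om Int ball z R) ph g (%_. 0) & (ALL x:closure Om Int ball z R. ph x > 0) &
  (ALL x:frontier Om Int ball z R. abs (g x *. \<nu> x) <= K * ph x)"

lemma robin_harnack:
 assumes L: "lip_dom Om z R u \<nu>" and B: "robin Om z R \<nu> K ph (g :: 'a::euclidean_space => 'a)" and x: "x : closure Om" "s > 0" "dist z x + 3 * s <= R"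
  and y: "dist (x + s *R u) y <= s / 6"
 shows "ph y <= AH TYPE('a) * ph (x + s *R u)"
proof -
 have Om: "open Om" and u: "norm u = 1" using L by (auto simp: lip_dom_def)
 have sub: "cball (x + s *R u) (3 * (s / 6)) \<subseteq> Om Int ball z R"
 proof
  fix p assume p: "p : cball (x + s *R u) (3 * (s / 6))"
  then have "p : cball (x + s *R u) (s / 2)" by simp
  moreover have "dist z p <= dist z x + dist x (x + s *R u) + dist (x + s *R u) p"
   using dist_triangle[of z p x] dist_triangle[of x p "x + s *R u"] by linarith
  moreover have "dist x (x + s *R u) = s" using u x by (simp add: dist_norm)
  ultimately show "p : Om Int ball z R" using lip_dom_ball[OF L x(1,2)] x by auto
 qed
 show ?thesis
 proof (rule harmonic_harnack[OF _ _ sub])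
  show "C2on (Om Int ball z R) ph g (%_. 0)" using B by (simp add: robin_def)
  show "ph p >= 0" if "p : cball (x + s *R u) (3 * (s / 6))" for p
   using that sub B closure_subset[of Om] unfolding robin_def by (meson IntD1 IntD2 IntI less_imp_le subsetD)
 qed (use Om x y in auto)
qed

lemma robin_lower:
 assumes L: "lip_dom Om z R u \<nu>" and B: "robin Om z R \<nu> K ph (g :: 'a::euclidean_space => 'a)" and K: "K >= 0" "K * R <= 1"
  and x: "x : closure Om" "dist z x <= R / 64"
 shows "cE TYPE('a) * ph (z + (R/8) *R u) <= AH TYPE('a) * ph x"
proof -
 have R: "R > 0" and z: "z : closure Om" using L by (auto simp: lip_dom_def)
 have sub: "ball x (3 * (R/8)) \<subseteq> ball z R"
 proof
  fix p assume "p : ball x (3 * (R/8))"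
  then show "p : ball z R" using x R dist_triangle[of z p x] by simp
 qed
 have "cE TYPE('a) * ph (x + (R/8) *R u) <= ph x"
 proof (rule barrier_lower_bound[OF L x(1)])
  show "g p *. \<nu> p <= K * ph p" if "p : frontier Om Int ball x (3 * (R/8))" for p
   using that sub B unfolding robin_def by (meson IntD1 IntD2 IntI abs_le_D1 subsetD)
  have "K * (R / 8) <= K * R" using K R by (intro mult_left_mono) auto
  then show "K * (R / 8) <= 1" using K by simp
  show "ph p >= 0" if "p : closure Om Int ball x (3 * (R/8))" for p
   using that sub B unfolding robin_def by (meson IntD1 IntD2 IntI less_imp_le subsetD)
  have i: "S Int ball x (3 * (R/8)) \<subseteq> S Int ball z R" for S using sub by blast
  show "continuous_on (closure Om Int ball x (3 * (R/8))) ph" "continuous_on (closure Om Int ball x (3 * (R/8))) g" "C2on (Om Int ball x (3 * (R/8))) ph g (%_. 0)"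
   using B continuous_on_subset[OF _ i] C2on_subset[OF _ i] unfolding robin_def by blast+
 qed (use x R K in auto)
 moreover have "ph (z + (R/8) *R u) <= AH TYPE('a) * ph (x + (R/8) *R u)"
  by (rule robin_harnack[OF L B x(1)]) (use x R in "auto simp: dist_norm norm_minus_commute")
 ultimately have "cE TYPE('a) * ph (z + (R/8) *R u) <= AH TYPE('a) * (cE TYPE('a) * ph (x + (R/8) *R u))"
  using cE_pos[where 'a='a] by (simp add: mult.left_commute)
 also have "... <= AH TYPE('a) * ph x" using \<open>cE TYPE('a) * ph (x + (R/8) *R u) <= ph x\<close> AH_pos[where 'a='a] by simp
 finally show ?thesis .
qed

text \<open>The weighted maximum of \<open>ph(x) (t - |x - z|)^N\<close> turns the polynomial growth from Harnack chains into a bound: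
 by the barrier, a near maximum is also attained at an interior point of comparable depth.\<close>

lemma robin_upper:
 "EX ka C. 0 < ka & ka <= 1 & C > 0 & (ALL Om z R u \<nu> K ph (g :: 'a::euclidean_space => 'a) x. lip_dom Om z R u \<nu> --> robin Om z R \<nu> K ph g --> K >= 0 --> K * R <= ka
  --> x : closure Om --> dist z x <= R / 128 --> ph x <= C * ph (z + (R/8) *R u))"
proof -
 define A where "A = AH TYPE('a)"
 have A: "A >= 1" unfolding A_def by (rule AH_ge_1)
 define c where "c = cE TYPE('a)"
 have c: "0 < c" "c <= 1" unfolding c_def using cE_pos cE_le by auto
 \<comment> \<open>Makes \<open>2 * th * ph0 = c * (ph0 / 2)\<close>, so that the barrier below
   loses at most half of the maximum.\<close>
 define th where "th = c / 4"
 have th: "0 < th" "th <= 1/4" using c by (auto simp: th_def)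
 obtain N where N: "A <= (6/5 :: real) ^ N" "N > 0"
 proof -
  obtain n where n: "A < (6/5 :: real) ^ n" using real_arch_pow[of "6/5" A] by auto
  also have "... <= (6/5) ^ Suc n" by simp
  finally show ?thesis by (intro that[of "Suc n"]) auto
 qed
 define q where "q = (1 / (1 + th))"
 have q: "0 < q" "q < 1" using th by (auto simp: q_def)
 \<comment> \<open>Within \<open>3 * de\<close> times the distance to the sphere the weight drops by
   a factor no smaller than \<open>q\<close>, so near the maximum point \<open>ph\<close> is at most
   \<open>1 + th\<close> times its value there.\<close>
 obtain de where de: "0 < de" "de <= 1/8" "q <= (1 - 3 * de) ^ N"
 proof -
  have "((%l. (1 - 3 * l) ^ N) \<longlongrightarrow> (1 - 3 * 0) ^ N) (at_right (0::real))" by (intro tendsto_intros)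
  then have "eventually (%l. q < (1 - 3 * l) ^ N) (at_right (0::real))" using q by (intro order_tendstoD(1)[of _ 1]) auto
  then obtain b where b: "b > 0" "!!l. 0 < l ==> l < b ==> q < (1 - 3 * l) ^ N" unfolding eventually_at_right_field by blast
  have "0 < min (b/2) (1/8)" "min (b/2) (1/8) < b" using b(1) by auto
  then show ?thesis using b(2)[of "min (b/2) (1/8)"] by (intro that[of "min (b/2) (1/8)"]) auto
 qed
 define C where "C = 2 * A * A * (16 / de) ^ N"
 show ?thesis
 proof (rule exI[of _ "th / 2"], rule exI[of _ C], intro conjI allI impI)
  show "0 < th / 2" "th / 2 <= 1" using th by auto
  show "C > 0" using A de by (simp add: C_def)
  fix Om and z :: 'a and R u \<nu> K ph and g :: "'a => 'a" and x
  assume L: "lip_dom Om z R u \<nu>" and B: "robin Om z R \<nu> K ph g" and K: "K >= 0" "K * R <= th / 2" and x: "x : closure Om" "dist z x <= R / 128"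
  have R: "R > 0" and z: "z : closure Om" and u: "norm u = 1" using L by (auto simp: lip_dom_def)
  have Bc: "continuous_on (closure Om Int ball z R) ph" "continuous_on (closure Om Int ball z R) g" "C2on (Om Int ball z R) ph g (%_. 0)"
   "!!x. x : closure Om Int ball z R ==> ph x > 0" "!!x. x : frontier Om Int ball z R ==> abs (g x *. \<nu> x) <= K * ph x"
   using B unfolding robin_def by auto
  define t where "t = R / 64"
  have t: "t > 0" using R by (simp add: t_def)
  define D where "D = closure Om Int cball z t"
  have DB: "D \<subseteq> closure Om Int ball z R" using R by (auto simp: D_def t_def)
  have zD: "z : D" using z t by (simp add: D_def)
  have "compact D" unfolding D_def by (rule closed_Int_compact) auto
  moreover have "continuous_on D (%x. ph x * (t - dist z x) ^ N)" by (intro continuous_intros continuous_on_subset[OF Bc(1) DB])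
  ultimately obtain x0 where x0: "x0 : D" "!!y. y : D ==> ph y * (t - dist z y) ^ N <= ph x0 * (t - dist z x0) ^ N"
   using continuous_attains_sup[of D "%x. ph x * (t - dist z x) ^ N"] zD by blast
  have pos: "ph y > 0" if "y : D" for y using Bc(4) DB that by blast
  define M where "M = ph (z + (R/8) *R u)"
  have xD: "x : D" using x R by (simp add: D_def t_def)
  have zR: "z + (R/8) *R u : closure Om Int ball z R"
  proof -
   have "cball (z + (R/8) *R u) (R/8/2) \<subseteq> Om" by (rule lip_dom_ball[OF L z]) (use R in auto)
   then show ?thesis using R u closure_subset[of Om] by (fastforce simp: dist_norm)
  qed
  have M: "M > 0" unfolding M_def by (rule Bc(4)[OF zR])
  have key: "ph x0 * (t - dist z x0) ^ N <= 2 * A * A * (8 * t / de) ^ N * M"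
  proof (cases "dist z x0 = t")
   case True
   then show ?thesis using M A t de N by (simp add: zero_power)
  next
   case False
   define sg where "sg = t - dist z x0"
   have sg: "sg > 0" "sg <= t" using x0(1) False by (auto simp: sg_def D_def)
   define r where "r = de * sg"
   have r: "r > 0" "r <= sg / 8" using de sg mult_right_mono[OF de(2), of sg] by (auto simp: r_def)
   define ph0 where "ph0 = ph x0"
   have ph0: "ph0 > 0" using pos[OF x0(1)] by (simp add: ph0_def)
   have sub: "ball x0 (3 * r) \<subseteq> ball z R" "closure Om Int ball x0 (3 * r) \<subseteq> D"
   proof -
    have "dist z p <= t" if "p : ball x0 (3 * r)" for p
     using that r sg dist_triangle[of z p x0] by (simp add: sg_def)
    then show "ball x0 (3 * r) \<subseteq> ball z R" "closure Om Int ball x0 (3 * r) \<subseteq> D"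
     using R by (force simp: t_def, force simp: D_def)
   qed
   have up: "ph p <= (1 + th) * ph0" if p: "p : closure Om Int ball x0 (3 * r)" for p
   proof -
    have pD: "p : D" using p sub by blast
    have d: "(1 - 3 * de) * sg <= t - dist z p"
     using p dist_triangle[of z p x0] by (simp add: sg_def r_def left_diff_distrib)
    have "ph p * (q * sg ^ N) <= ph p * ((1 - 3 * de) * sg) ^ N"
     unfolding power_mult_distrib using pos[OF pD] de sg by (intro mult_left_mono mult_right_mono) auto
    also have "... <= ph p * (t - dist z p) ^ N"
     using pos[OF pD] d de sg by (intro mult_left_mono power_mono) auto
    also have "... <= ph0 * sg ^ N" using x0(2)[OF pD] by (simp add: ph0_def sg_def)
    finally have "ph p * q <= ph0" using sg by (simp add: mult.assoc[symmetric])
    then show ?thesis using th by (simp add: q_def divide_le_eq mult.commute)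
   qed
   \<comment> \<open>Harmonic and at least \<open>th * ph0\<close>, hence with Robin constant
     \<open>2 * K / th\<close>. The barrier turns its small value at \<open>x0\<close> into a small
     value at the interior point \<open>x0 + r *R u\<close>, where \<open>ph\<close> is then at
     least half of \<open>ph0\<close>.\<close>
   define w where "w p = (1 + 2 * th) * ph0 - ph p" for p
   have wlow: "th * ph0 <= w p" if "p : closure Om Int ball x0 (3 * r)" for p
    using up[OF that] by (simp add: w_def algebra_simps)
   have i: "S Int ball x0 (3 * r) \<subseteq> S Int ball z R" for S using sub by blast
   have "c * w (x0 + r *R u) <= w x0" unfolding c_def
   proof (rule barrier_lower_bound[OF L _ r(1)])
    show "x0 : closure Om" using x0 by (simp add: D_def)
    show "dist z x0 + 3 * r <= R" using r sg R by (simp add: sg_def t_def)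
    show "continuous_on (closure Om Int ball x0 (3 * r)) w" "continuous_on (closure Om Int ball x0 (3 * r)) (%p. - g p)"
     unfolding w_def by (intro continuous_intros continuous_on_subset[OF Bc(1) i] continuous_on_subset[OF Bc(2) i])+
    have "C2on (Om Int ball x0 (3 * r)) (%p. (0 *. p + (1 + 2 * th) * ph0) - ph p) (%p. 0 - g p) (%p. 0 - 0)"
     by (rule C2on_diff[OF C2on_linear C2on_subset[OF Bc(3) i]])
    then show "C2on (Om Int ball x0 (3 * r)) w (%p. - g p) (%_. 0)" by (simp add: w_def[abs_def])
    show "w p >= 0" if "p : closure Om Int ball x0 (3 * r)" for p
     using wlow[OF that] th ph0 mult_pos_pos[of th ph0] by linarith
    show "- g p *. \<nu> p <= 2 * K / th * w p" if p: "p : frontier Om Int ball x0 (3 * r)" for p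
    proof -
     have pc: "p : closure Om Int ball x0 (3 * r)" using p by (auto simp: frontier_def)
     have "- g p *. \<nu> p <= K * ph p" using Bc(5)[of p] p sub by auto
     also have "... <= K * ((1 + th) * ph0)" using up[OF pc] K by (intro mult_left_mono) auto
     also have "... <= K * (2 * ph0)" using th ph0 K by (intro mult_left_mono mult_right_mono) auto
     also have "... = 2 * K / th * (th * ph0)" using th by simp
     also have "... <= 2 * K / th * w p" using wlow[OF pc] K th by (intro mult_left_mono) auto
     finally show ?thesis .
    qed
    have "K * r <= K * R" using r sg R K by (intro mult_left_mono) (auto simp: t_def)
    then have "K * r <= th / 2" using K by linarith
    then show "2 * K / th * r <= 1" using th by (simp add: field_simps)
   qed (use K th in auto)
   moreover have "w x0 = 2 * th * ph0" by (simp add: w_def ph0_def algebra_simps)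
   moreover have "2 * th * ph0 = c * (ph0 / 2)" by (simp add: th_def)
   ultimately have "w (x0 + r *R u) <= ph0 / 2" using c by simp
   moreover have "0 < th * ph0" using th ph0 by simp
   ultimately have half: "ph0 <= 2 * ph (x0 + r *R u)" unfolding w_def by (simp add: algebra_simps)
   \<comment> \<open>A Harnack chain leads from depth \<open>r\<close> to depth \<open>T\<close>;
     its loss \<open>(T / r) ^ N\<close> is cancelled by the weight \<open>sg ^ N\<close>, as
     \<open>r = de * sg\<close>.\<close>
   define T where "T = R / 8"
   have rT: "r <= T" using r sg by (simp add: T_def t_def)
   have x0c: "x0 : closure Om" "dist z x0 <= R / 64" using x0 by (auto simp: D_def t_def)
   have "ph (x0 + r *R u) <= A * (T / r) ^ N * ph (x0 + T *R u)"
   proof -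
    obtain n where n: "T / r <= (6/5 :: real) ^ n" using real_arch_pow[of "6/5" "T / r"] less_imp_le by auto
    show ?thesis
    proof (rule harnack_chain[where f = "%s. ph (x0 + s *R u)" and T = T and n = n])
     show "T <= (6/5) ^ n * r" using n r by (simp add: pos_divide_le_eq)
     fix s' s assume s: "r <= s'" "s' <= s" "s <= T" "5/6 * s <= s'"
     show "ph (x0 + s' *R u) <= A * ph (x0 + s *R u)" unfolding A_def
     proof (rule robin_harnack[OF L B x0c(1)])
      have "dist (x0 + s *R u) (x0 + s' *R u) = norm ((s - s') *R u)" by (simp add: dist_norm scaleR_diff_left)
      then show "dist (x0 + s *R u) (x0 + s' *R u) <= s / 6" using u s by simp
     qed (use s r x0c R in "auto simp: T_def")
    next
     fix s assume s: "r <= s" "s <= T"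
     have "cball (x0 + s *R u) (s/2) \<subseteq> Om" by (rule lip_dom_ball[OF L x0c(1)]) (use s r x0c R in "auto simp: T_def")
     moreover have "dist z (x0 + s *R u) <= dist z x0 + s" using dist_triangle[of z "x0 + s *R u" x0] s r u by (simp add: dist_norm)
     moreover have "x0 + s *R u : cball (x0 + s *R u) (s/2)" using s r by simp
     moreover have "dist z x0 + s < R" using s x0c R by (simp add: T_def)
     ultimately have "x0 + s *R u : closure Om" "x0 + s *R u : ball z R" using closure_subset[of Om] by (blast, simp)
     then have "x0 + s *R u : closure Om Int ball z R" by blast
     then show "ph (x0 + s *R u) >= 0" using Bc(4) less_imp_le by blast
    qed (use N A r rT in auto)
   qed
   moreover have "ph (x0 + T *R u) <= A * M" unfolding A_def M_def T_def
    by (rule robin_harnack[OF L B z]) (use x0c R in "auto simp: dist_norm norm_minus_commute")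
   moreover have "0 <= A * (T / r) ^ N" using A rT r by (intro mult_nonneg_nonneg zero_le_power) auto
   ultimately have "ph (x0 + r *R u) <= A * (T / r) ^ N * (A * M)" by (meson mult_left_mono order_trans)
   then have "ph0 <= 2 * (A * (T / r) ^ N * (A * M))" using half by linarith
   then have "ph0 * sg ^ N <= 2 * (A * (T / r) ^ N * (A * M)) * sg ^ N" using sg by (intro mult_right_mono) auto
   also have "... = 2 * A * A * (T / r * sg) ^ N * M" by (simp only: power_mult_distrib mult_ac)
   also have "T / r * sg = 8 * t / de" using sg de by (simp add: r_def T_def t_def)
   finally show ?thesis by (simp add: ph0_def sg_def)
  qed
  have "ph x * (t / 2) ^ N <= ph x * (t - dist z x) ^ N"
   using pos[OF xD] x t by (intro mult_left_mono power_mono) (auto simp: t_def)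
  also have "... <= ph x0 * (t - dist z x0) ^ N" by (rule x0(2)[OF xD])
  also have "... <= 2 * A * A * (8 * t / de) ^ N * M" by (rule key)
  also have "8 * t / de = 16 / de * (t / 2)" by simp
  also have "2 * A * A * (16 / de * (t / 2)) ^ N * M = (C * M) * (t / 2) ^ N" by (simp only: C_def power_mult_distrib mult_ac)
  finally show "ph x <= C * ph (z + (R/8) *R u)" using t by (simp add: M_def)
 qed
qed

section \<open>Connectedness of the positivity set of a cone\<close>

lemma gauss_moment_integrable: "integrable lborel (%x::'a::euclidean_space. (1 + x *. x)\<^sup>2 * gauss x)"
proof (rule Bochner_Integration.integrable_bound)
 show "integrable lborel (%x::'a. 64 * gauss ((x - 0) /\<^sub>R sqrt 2))" by (intro integrable_mult_right gauss_scaled(2)) simp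
 have "continuous_on UNIV (%x::'a. (1 + x *. x)\<^sup>2 * gauss x)" by (intro continuous_intros)
 then show "(%x::'a. (1 + x *. x)\<^sup>2 * gauss x) : borel_measurable lborel" using borel_measurable_continuous_onI by auto
 show "AE x in lborel. norm ((1 + x *. x)\<^sup>2 * gauss (x :: 'a)) <= norm (64 * gauss ((x - 0) /\<^sub>R sqrt 2))"
 proof (rule AE_I2)
  fix x :: 'a
  define t where "t = x *. x"
  have t: "t >= 0" by (simp add: t_def)
  have "1 + t <= 8 * (1 + t / 8)" using t by simp
  also have "... <= 8 * exp (t / 8)" by (intro mult_left_mono exp_ge_add_one_self) simp
  finally have "(1 + t)\<^sup>2 <= (8 * exp (t / 8))\<^sup>2" using t by (intro power_mono) auto
  also have "... = 64 * exp (t / 8 + t / 8)" unfolding exp_add by (simp add: power2_eq_square)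
  finally have "(1 + t)\<^sup>2 * exp (- t / 2) <= 64 * exp (t / 8 + t / 8) * exp (- t / 2)" by (rule mult_right_mono) simp
  also have "... = 64 * exp (t / 8 + t / 8 + - t / 2)" by (simp only: exp_add mult.assoc)
  also have "t / 8 + t / 8 + - t / 2 = - (t / 2) / 2" by simp
  finally have "(1 + t)\<^sup>2 * exp (- t / 2) <= 64 * exp (- (t / 2) / 2)" .
  moreover have "gauss ((x - 0) /\<^sub>R sqrt 2) = exp (- (t / 2) / 2)" by (simp add: gauss_def t_def mult.assoc[symmetric] flip: inverse_mult_distrib)
  moreover have "gauss x = exp (- t / 2)" by (simp add: gauss_def t_def)
  ultimately show "norm ((1 + x *. x)\<^sup>2 * gauss x) <= norm (64 * gauss ((x - 0) /\<^sub>R sqrt 2))" by (simp add: t_def)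
 qed
qed

definition WG :: "'a::euclidean_space itself => real" where "WG _ = LI (%x::'a. (1 + x *. x)\<^sup>2 * gauss x)"

lemma WG_nonneg: "WG TYPE('a::euclidean_space) >= 0"
 unfolding WG_def by (rule bi_nonneg) (simp add: less_imp_le gauss_pos)

text \<open>The set {U > de |x|} is split rather than {U > 0}: pieces joined only through a region
  where \<open>U\<close> is small relative to |x| count as separate, which makes the later
  conclusion quantitative.\<close>

locale cone_piece =
 fixes U :: "'a::euclidean_space => real" and de :: real and C C' :: "'a set"
 assumes U: "ac_min U" and hom: "!!t x. t > 0 ==> U (t *R x) = t * U x" and de: "0 < de" "de <= 1"
  and oC: "open C" and oC': "open C'" and disj: "C Int C' = {}" and cov: "C Un C' = {x. U x > de * norm x}"
  and cone: "!!t x. x : C ==> t > 0 ==> t *R x : C"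
begin

lemma cU: "continuous_on UNIV U" and Unn: "U x >= 0" using U by (auto simp: ac_min_def)

lemma U0: "U 0 = 0" using hom[of 2 0] by simp

lemma growth: "U x <= LU TYPE('a) * norm x" using ac_min_growth[OF U U0, of x] by (simp add: dist_norm)

lemma norm_le_poly: "norm x <= 1 + x *. x" for x :: 'a
proof -
 have "0 <= (norm x - 1)\<^sup>2" by simp
 then have "2 * norm x <= 1 + x *. x" by (simp add: power2_diff power2_norm_eq_inner)
 then show ?thesis using norm_ge_zero[of x] by linarith
qed

lemma growth2: "U x <= LU TYPE('a) * (1 + x *. x)"
 using growth[of x] mult_left_mono[OF norm_le_poly[of x], of "LU TYPE('a)"] LU_pos[where 'a='a] by linarith

text \<open>A paraboloid instead of \<open>de * norm x\<close> makes the truncation compactly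
  supported, since \<open>U\<close> grows only linearly, and is smooth at the origin; as 2 |x| <= 1
  + |x|^2, the set {P >= 0} stays inside the split set.\<close>

definition P where "P x = U x - de * (1 + x *. x)"
definition gP where "gP x = grad U x - (2 * de) *R x"
definition V where "V x = (if x : C then sm de (P x) else 0)"
definition gV where "gV x = (if x : C then sm1 de (P x) *R gP x else 0)"
text \<open>The exact 1-homogeneous truncation. \<open>V\<close> enters the Gaussian inequality and
  \<open>u\<close> the dilation identity; they differ by at most
  \<open>de * (2 + x *. x)\<close>.\<close>

definition u where "u x = (if x : C then U x - de * norm x else 0)"

lemma C_pos: "x : C ==> U x > de * norm x" "x : C ==> U x > 0"
proof -
 assume "x : C"
 then show "U x > de * norm x" using cov by blast
 then show "U x > 0" using de by (meson le_less_trans mult_nonneg_nonneg norm_ge_zero less_imp_le)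
qed

lemma P_pos_imp: assumes "P x >= 0" shows "x : C Un C'" "norm x <= LU TYPE('a) / de"
proof -
 have "0 <= de * (norm x - 1)\<^sup>2" using de by simp
 then have 1: "2 * de * norm x <= de * (1 + x *. x)" by (simp add: power2_diff power2_norm_eq_inner algebra_simps)
 have Ux: "U x >= de * (1 + x *. x)" using assms by (simp add: P_def)
 have "x ~= 0" using Ux U0 de by auto
 then have "de * norm x > 0" using de by simp
 then have "U x > de * norm x" using 1 Ux by linarith
 then show "x : C Un C'" using cov by blast
 have "de * (norm x)\<^sup>2 <= LU TYPE('a) * norm x" using Ux growth[of x] de by (simp add: power2_norm_eq_inner algebra_simps)
 then have "(de * norm x) * norm x <= LU TYPE('a) * norm x" by (simp add: power2_eq_square mult.assoc)
 then have "de * norm x <= LU TYPE('a)" using \<open>x ~= 0\<close> by simp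
 then show "norm x <= LU TYPE('a) / de" using de by (simp add: field_simps)
qed

lemma cP: "continuous_on S P" unfolding P_def by (intro continuous_intros continuous_on_subset[OF cU]) auto

lemma gP_deriv: "x : C ==> (P has_derivative (%h. gP x *. h)) (at x)"
 using C2on_deriv[OF ac_min_harmonic_C2[OF U], of x] C_pos(2)[of x] unfolding P_def gP_def
 by (auto intro!: derivative_eq_intros simp: inner_diff_left inner_commute algebra_simps)

lemma cgP: "continuous_on C gP"
 unfolding gP_def using C_pos by (intro continuous_intros continuous_on_subset[OF C2on_continuous(2)[OF ac_min_harmonic_C2[OF U]]]) auto

lemma V_nonneg: "V x >= 0" using de by (simp add: V_def sm_bounds)

lemma V_zero: "P x <= 0 ==> V x = 0" "P x <= 0 ==> gV x = 0" using de by (simp_all add: V_def gV_def sm_zero)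

lemma u_nonneg: "u x >= 0" using less_imp_le[OF C_pos(1)[of x]] by (simp add: u_def)

lemma V_le_u: "V x <= u x"
proof (cases "x : C")
 case True
 have "de * norm x <= de * (1 + x *. x)" using de norm_le_poly[of x] by (intro mult_left_mono) auto
 then have "max 0 (P x) <= u x" using u_nonneg[of x] True by (simp add: u_def P_def)
 moreover have "V x = sm de (P x)" using True by (simp add: V_def)
 ultimately show ?thesis using sm_bounds(2)[OF de(1), of "P x"] by linarith
qed (simp add: V_def u_def)

lemma V_ge: "x : C ==> U x - de * (2 + x *. x) <= V x"
 using sm_bounds(3)[OF de(1), of "P x"] by (simp add: V_def P_def algebra_simps)

lemma u_le_V: "u x <= V x + de * (2 + x *. x)"
proof (cases "x : C")
 case True
 have "de * norm x >= 0" using de by simp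
 then show ?thesis using V_ge[OF True] True by (simp add: u_def)
qed (use de in "simp add: V_def u_def")

lemma u_le_U: "u x <= U x" using de Unn[of x] by (simp add: u_def)

lemma V_le: "V x <= LU TYPE('a) * (1 + x *. x)" using V_le_u[of x] u_le_U[of x] growth2[of x] by linarith

lemma u_continuous: "continuous_on S u"
proof -
 \<comment> \<open>\<open>C\<close> and \<open>C'\<close> are open and disjoint, so their
   complements are closed and cover the space, and on each of them \<open>u\<close> has a continuous
   formula.\<close>
 have "continuous_on ((- C') Un (- C)) (%x. if x : - C' then max 0 (U x - de * norm x) else 0)"
  apply (rule continuous_on_If)
  using oC oC' disj cov by (auto intro!: continuous_intros continuous_on_subset[OF cU])
 moreover have "(if x : - C' then max 0 (U x - de * norm x) else 0) = u x" for x
  using disj cov C_pos(1)[of x] by (auto simp: u_def max_def)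
 moreover have "(- C') Un (- C) = UNIV" using disj by blast
 ultimately have "continuous_on UNIV u" by simp
 then show ?thesis by (rule continuous_on_subset) simp
qed

lemma u_hom: "t > 0 ==> u (t *R x) = t * u x"
proof -
 assume t: "t > 0"
 have "t *R x : C \<longleftrightarrow> x : C" using cone[of x t] cone[of "t *R x" "1/t"] t by auto
 then show ?thesis using t by (simp add: u_def hom right_diff_distrib)
qed

lemma V_C1: "compact_C1 V gV (LU TYPE('a) / de + 1)"
proof
 define N where "N = {x. P x < 0} Un C'"
 have oN: "open N" unfolding N_def using oC' by (intro open_Un open_Collect_less cP continuous_intros) auto
 have N: "V x = 0" "gV x = 0" if "x : N" for x
  using that V_zero[of x] disj by (auto simp: N_def V_def gV_def)
 have CN: "x : C | x : N" for x using P_pos_imp(1)[of x] by (cases "P x < 0") (auto simp: N_def not_less)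
 show "(V has_derivative (%h. gV x *. h)) (at x)" for x
 proof (cases "x : C")
  case True
  have "((%x. sm de (P x)) has_derivative (%h. (gP x *. h) * sm1 de (P x))) (at x)"
   using has_derivative_compose[OF gP_deriv[OF True] sm_deriv[unfolded has_field_derivative_def]] by (simp add: mult.commute)
  then have "((%x. sm de (P x)) has_derivative (%h. gV x *. h)) (at x)" using True by (simp add: gV_def mult.commute)
  then show ?thesis by (rule has_derivative_transform_within_open[OF _ oC True]) (simp add: V_def)
 next
  case False
  then have xN: "x : N" using CN by blast
  have "((%_. 0) has_derivative (%h. gV x *. h)) (at x)" using N(2)[OF xN] by simp
  then show ?thesis by (rule has_derivative_transform_within_open[OF _ oN xN]) (simp add: N)
 qed
 have "continuous_on C (%x. sm1 de (P x) *R gP x)"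
  by (intro continuous_intros cgP continuous_on_compose2[OF sm1_continuous cP]) auto
 then have "continuous_on C gV" by (rule continuous_on_eq) (simp add: gV_def)
 moreover have "continuous_on N gV" by (rule continuous_on_eq[of _ "%_. 0"]) (auto simp: N)
 ultimately have "continuous_on (C Un N) gV" by (rule continuous_on_open_Un[OF oC oN])
 moreover have "C Un N = UNIV" using CN by blast
 ultimately show "continuous_on UNIV gV" by simp
 have "P x <= 0" if "norm x > LU TYPE('a) / de + 1" for x using P_pos_imp(2)[of x] that by linarith
 then show "V x = 0" "gV x = 0" if "norm x > LU TYPE('a) / de + 1" for x using that V_zero by auto
 show "0 < LU TYPE('a) / de + 1" using LU_pos[where 'a='a] de by (simp add: add_pos_pos)
qed

lemma euler: "x : C ==> grad U x *. x = U x"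
proof -
 assume x: "x : C"
 have 1: "((%t. t *R x) has_derivative (%h. h *R x)) (at 1)" by (auto intro!: derivative_eq_intros)
 have 2: "(U has_derivative (%h. grad U x *. h)) (at (1 *R x))" using C2on_deriv[OF ac_min_harmonic_C2[OF U], of x] C_pos(2)[OF x] by simp
 have "((%t. U (t *R x)) has_derivative (%h. grad U x *. (h *R x))) (at 1)" by (rule has_derivative_compose[OF 1 2])
 then have "((%t. t * U x) has_derivative (%h. grad U x *. (h *R x))) (at 1)"
  by (rule has_derivative_transform_within_open[of _ _ _ _ "{0<..}"]) (auto simp: hom)
 moreover have "((%t. t * U x) has_derivative (%h. h * U x)) (at 1)" by (auto intro!: derivative_eq_intros)
 ultimately have "(%h. grad U x *. (h *R x)) = (%h. h * U x)" by (rule has_derivative_unique)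
 from fun_cong[OF this, of 1] show ?thesis by simp
qed

text \<open>Integrate the divergence of \<open>V gauss grad P\<close>. Euler's identity makes
  \<open>x *. grad P\<close> equal to \<open>U\<close> up to a term with factor \<open>de\<close>,
  and \<open>U\<close> is harmonic, so the Dirichlet integral of \<open>V\<close> exceeds its second
  moment by at most \<open>O(de)\<close>.\<close>

lemma energy:
 "LI (%x. (gV x *. gV x) * gauss x) <= LI (%x. (V x)\<^sup>2 * gauss x) + de * (LU TYPE('a) * (2 * real DIM('a) + 2) * WG TYPE('a))"
proof -
 interpret V: compact_C1 V gV "LU TYPE('a) / de + 1" by (rule V_C1)
 define n where "n = real DIM('a)"
 obtain H where H: "!!x. U x > 0 ==> (grad U has_derivative H x) (at x)" "!!x. U x > 0 ==> (\<Sum>b\<in>Basis. H x b *. b) = 0"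
  "!!b. b : Basis ==> continuous_on {x. U x > 0} (%x. H x b)"
  using ac_min_harmonic_C2[OF U] unfolding C2on_def by (auto simp: eq_commute[of 0])
 \<comment> \<open>{P >= 0} lies in \<open>C Un C'\<close>, so removing the open set
   \<open>C'\<close> leaves a compact subset of \<open>C\<close>.\<close>
 define K where "K = {x. 0 <= P x} - C'"
 have clP: "closed {x. 0 <= P x}" by (intro closed_Collect_le continuous_intros cP)
 have "bounded K" unfolding bounded_iff K_def using P_pos_imp(2) by auto
 then have K: "compact K" unfolding compact_eq_bounded_closed K_def using clP oC' by (auto intro: closed_Diff)
 have KC: "K \<subseteq> C" using P_pos_imp(1) by (auto simp: K_def)
 have offK: "V x = 0" "gV x = 0" if "x ~: K" for x
  using that V_zero[of x] disj by (auto simp: K_def V_def gV_def)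
 define G where "G x = (if x : C then gauss x * (gV x *. gP x) - V x * gauss x * (U x - 2 * de * (x *. x) + 2 * de * n) else 0)" for x
 define D where "D x h = (V x * gauss x) *R (H x h - (2 * de) *R h) + (V x * (- (gauss x * (x *. h))) + (gV x *. h) * gauss x) *R gP x" for x h
 have G0: "LI G = 0"
 proof (rule integral_divergence_zero[OF oC K KC, where F = "%x. (V x * gauss x) *R gP x" and D = D])
  show "((%x. (V x * gauss x) *R gP x) has_derivative D x) (at x)" if "x : C" for x
  proof -
   have "((%x. grad U x - (2 * de) *R x) has_derivative (%h. H x h - (2 * de) *R h)) (at x)"
    by (intro has_derivative_diff H(1) C_pos(2) that has_derivative_scaleR_right has_derivative_ident)
   then have 1: "(gP has_derivative (%h. H x h - (2 * de) *R h)) (at x)" by (simp add: gP_def[abs_def])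
   show ?thesis unfolding D_def[abs_def] by (rule has_derivative_scaleR[OF has_derivative_mult[OF V.d gauss_has_derivative] 1])
  qed
  show "continuous_on C (%x. D x b)" if "b : Basis" for b unfolding D_def
   using C_pos(2) by (intro continuous_intros cgP continuous_on_subset[OF H(3)[OF that]]) auto
  show "(V x * gauss x) *R gP x = 0" if "x ~: K" for x using offK[OF that] by simp
  show "G x = 0" if "x ~: K" for x using offK[OF that] by (simp add: G_def)
  show "G x = (\<Sum>b\<in>Basis. D x b *. b)" if "x : K" for x
  proof -
   have x: "x : C" using that KC by blast
   have "(\<Sum>b\<in>Basis. D x b *. b) = V x * gauss x * (\<Sum>b\<in>Basis. H x b *. b) - 2 * de * V x * gauss x * n
    - V x * gauss x * (\<Sum>b\<in>Basis. (x *. b) * (gP x *. b)) + gauss x * (\<Sum>b\<in>Basis. (gV x *. b) * (gP x *. b))"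
    unfolding sum_distrib_left n_def
    by (simp add: D_def inner_add_left inner_diff_left sum.distrib sum_subtractf sum_negf algebra_simps)
   also have "(\<Sum>b\<in>Basis. H x b *. b) = 0" using H(2) C_pos(2)[OF x] by simp
   also have "(\<Sum>b\<in>Basis. (x *. b) * (gP x *. b)) = x *. gP x" by (rule euclidean_inner[symmetric])
   also have "(\<Sum>b\<in>Basis. (gV x *. b) * (gP x *. b)) = gV x *. gP x" by (rule euclidean_inner[symmetric])
   also have "x *. gP x = U x - 2 * de * (x *. x)" using euler[OF x] by (simp add: gP_def inner_diff_right inner_commute)
   finally show ?thesis using x by (simp add: G_def algebra_simps)
  qed
 qed
 have iG: "integrable lborel G"
 proof (rule integrable_cts_compact[OF K])
  have "continuous_on K (%x. gauss x * (gV x *. gP x) - V x * gauss x * (U x - 2 * de * (x *. x) + 2 * de * n))"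
   by (intro continuous_intros continuous_on_subset[OF cgP KC] continuous_on_subset[OF cU]) auto
  then show "continuous_on K G" by (rule continuous_on_eq) (use KC in "auto simp: G_def")
  show "G x = 0" if "x ~: K" for x using offK[OF that] by (simp add: G_def)
 qed
 have i1: "integrable lborel (%x. (gV x *. gV x) * gauss x)" "integrable lborel (%x. (V x)\<^sup>2 * gauss x)"
  by (rule integrable_cts_compact[OF K]; auto intro!: continuous_intros simp: offK)+
 define L where "L = LU TYPE('a) * (2 * n + 2)"
 have L: "L >= 0" using LU_pos[where 'a='a] by (simp add: L_def n_def)
 have i2: "integrable lborel (%x. de * L * ((1 + x *. x)\<^sup>2 * gauss (x :: 'a)))" by (intro integrable_mult_right gauss_moment_integrable)
 have "LI (%x. (gV x *. gV x) * gauss x - ((V x)\<^sup>2 * gauss x + de * L * ((1 + x *. x)\<^sup>2 * gauss x))) <= LI G"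
 proof (rule integral_mono[OF _ iG])
  show "integrable lborel (%x. (gV x *. gV x) * gauss x - ((V x)\<^sup>2 * gauss x + de * L * ((1 + x *. x)\<^sup>2 * gauss x)))"
   by (intro bi_diff bi_add i1 i2)
  fix x :: 'a
  have g: "gauss x >= 0" using gauss_pos[of x] by simp
  show "(gV x *. gV x) * gauss x - ((V x)\<^sup>2 * gauss x + de * L * ((1 + x *. x)\<^sup>2 * gauss x)) <= G x"
  proof (cases "x : C")
   case False
   have "0 <= de * L * ((1 + x *. x)\<^sup>2 * gauss x)" using de L g by simp
   then show ?thesis using False by (simp add: G_def gV_def V_def)
  next
   case True
   define s where "s = sm1 de (P x)"
   have s: "0 <= s" "s <= 1" using sm1_bounds[OF de(1)] by (auto simp: s_def)
   have gs: "gV x = s *R gP x" using True by (simp add: gV_def s_def)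
   \<comment> \<open>\<open>gV = s *R gP\<close> with \<open>0 <= s <= 1\<close>, so the square of
     \<open>gV\<close> is at most its product with \<open>gP\<close>.\<close>
   have "s * s * (gP x *. gP x) <= s * (gP x *. gP x)" using s mult_left_le[of s s] by (intro mult_right_mono) auto
   then have 1: "gV x *. gV x <= gV x *. gP x" by (simp add: gs mult.assoc)
   have "V x * (U x - 2 * de * (x *. x) + 2 * de * n) <= V x * (V x + de * ((2 * n + 2) * (1 + x *. x)))"
   proof (rule mult_left_mono[OF _ V_nonneg])
    have "U x <= V x + de * (2 + x *. x)" using V_ge[OF True] by simp
    moreover have "de * (2 + x *. x) - 2 * de * (x *. x) + 2 * de * n <= de * ((2 * n + 2) * (1 + x *. x))"
    proof -
     have "2 + x *. x - 2 * (x *. x) + 2 * n <= (2 * n + 2) * (1 + x *. x)"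
     proof -
      define q where "q = (2 * n + 2) * (x *. x)"
      have "0 <= q" by (simp add: q_def n_def)
      have ar: "2 + t - 2 * t + 2 * n' <= (2 * n' + 2) * 1 + q'" if "0 <= t" "0 <= q'" for t n' q' :: real using that by simp
      show ?thesis unfolding distrib_left q_def[symmetric] by (rule ar[OF inner_ge_zero \<open>0 <= q\<close>])
     qed
     from mult_left_mono[OF this, of de] de show ?thesis by (simp add: algebra_simps)
    qed
    ultimately show "U x - 2 * de * (x *. x) + 2 * de * n <= V x + de * ((2 * n + 2) * (1 + x *. x))" by linarith
   qed
   also have "... = (V x)\<^sup>2 + V x * (de * (2 * n + 2) * (1 + x *. x))" by (simp add: power2_eq_square distrib_left mult_ac)
   also have "V x * (de * (2 * n + 2) * (1 + x *. x)) <= (LU TYPE('a) * (1 + x *. x)) * (de * (2 * n + 2) * (1 + x *. x))"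
    using de by (intro mult_right_mono V_le) (simp add: n_def)
   also have "... = de * L * (1 + x *. x)\<^sup>2" by (simp add: L_def power2_eq_square mult_ac)
   finally have 2: "V x * (U x - 2 * de * (x *. x) + 2 * de * n) <= (V x)\<^sup>2 + de * L * (1 + x *. x)\<^sup>2" by simp
   have "gV x *. gV x - ((V x)\<^sup>2 + de * L * (1 + x *. x)\<^sup>2) <= gV x *. gP x - V x * (U x - 2 * de * (x *. x) + 2 * de * n)" using 1 2 by linarith
   from mult_right_mono[OF this g] show ?thesis using True by (simp add: G_def algebra_simps)
  qed
 qed
 then have "LI (%x. (gV x *. gV x) * gauss x) - (LI (%x. (V x)\<^sup>2 * gauss x) + de * L * WG TYPE('a)) <= 0"
  unfolding G0 bi_idiff[OF i1(1) bi_add[OF i1(2) i2]] bi_iadd[OF i1(2) i2]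
  by (simp only: integral_mult_right_zero WG_def)
 then show ?thesis by (simp add: L_def n_def)
qed

end

section \<open>From an almost extremal function to an almost linear one\<close>

lemma bump_times_bounds: "norm (bump 3 y *R y) <= 1" "abs (lap0 (y::'a::euclidean_space)) <= 6 + real DIM('a)" "psi0 y <= 1"
proof -
 show "norm (bump 3 y *R y) <= 1"
  by (cases "norm y <= 1") (use mult_mono[OF bump_le_one[of 3 y], of "norm y" 1] in "auto simp: bump_nonneg bump_zero")
 show "psi0 y <= 1" using bump_le_one[of 4 y] by (simp add: psi0_def)
 show "abs (lap0 y) <= 6 + real DIM('a)"
 proof (cases "norm y <= 1")
  case True
  then have yy: "y *. y <= 1" by (simp add: power2_norm_eq_inner[symmetric] power_le_one)
  have "bump 2 y * (y *. y) <= 1 * 1" using yy by (intro mult_mono) (auto simp: bump_nonneg bump_le_one)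
  moreover have "0 <= bump 2 y * (y *. y)" by (simp add: bump_nonneg)
  moreover have "0 <= real DIM('a) * bump 3 y" "real DIM('a) * bump 3 y <= real DIM('a) * 1" by (auto intro!: mult_left_mono simp: bump_nonneg bump_le_one)
  ultimately show ?thesis unfolding lap0_def mult.assoc by linarith
 qed (simp add: lap0_zero)
qed

lemma abs_integral_le_cball:
 fixes f :: "'a::euclidean_space => real"
 assumes "!!x. norm x <= S ==> abs (f x) <= M" "!!x. norm x > S ==> f x = 0" "M >= 0"
 shows "abs (LI f) <= M * measure lborel (cball (0::'a) S)"
proof (rule integral_abs_le_indicator)
 show "abs (f x) <= M * indicator (cball 0 S) x" for x
  using assms(1)[of x] assms(2)[of x] assms(3) by (cases "norm x <= S") auto
qed auto

text \<open>Weak form of Euler's identity. The integral of \<open>w x * xi (t *R x)\<close> equals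
  \<open>t ^ -(d + 1)\<close> times its value at \<open>t = 1\<close>; both expressions are
  differentiated at \<open>t = 1\<close>.\<close>

lemma homogeneous_dilation_identity:
 fixes w :: "'a::euclidean_space => real"
 assumes cw: "continuous_on UNIV w" and hw: "!!t x. t > 0 ==> w (t *R x) = t * w x"
  and xi: "C2on UNIV xi gxi lxi" and z: "!!x. norm x > S ==> xi x = 0" "!!x. norm x > S ==> gxi x = 0" and S: "S > 0"
 shows "LI (%x. w x * ((real DIM('a) + 1) * xi x + x *. gxi x)) = 0"
proof -
 define n where "n = DIM('a)"
 note cx = C2on_continuous[OF xi]
 note c1 = continuous_on_compose2[OF cx(1) _ subset_UNIV] continuous_on_compose2[OF cx(2) _ subset_UNIV] continuous_on_compose2[OF cw _ subset_UNIV]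
 define I where "I = LI (%x. w x * xi x)"
 have i1: "integrable lborel (%x. w x * xi x)" "integrable lborel (%x. w x * (x *. gxi x))"
  by (rule integrable_cts_supp[of _ S]; auto intro!: continuous_intros c1 simp: z)+
 have h: "LI (%x. w x * xi (t *R x)) = I / t ^ (n + 1)" if t: "t > 0" for t
 proof -
  have "(%x. w x * xi (t *R x)) = (%x. (%x. w ((1/t) *R x) * xi x) (0 + t *R x))" using t by (simp add: fun_eq_iff)
  then have "LI (%x. w x * xi (t *R x)) = LI (%x. w ((1/t) *R x) * xi x) / t ^ n"
   using lborel_scale_integral[OF t, of "%x. w ((1/t) *R x) * xi x" 0] by (simp add: n_def)
  also have "(%x. w ((1/t) *R x) * xi x) = (%x. (1/t) * (w x * xi x))" using t by (simp add: hw fun_eq_iff)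
  finally show ?thesis unfolding integral_mult_right_zero I_def by simp
 qed
 have "((%t. LI (%x. w x * xi (t *R x))) has_derivative (%h. LI (%x. w x * (x *. gxi (1 *R x))) *. h)) (at 1)"
 proof (rule leibniz_lborel[where S = "ball 1 (1/2)" and R = "2 * S" and K = "%t x. w x * (x *. gxi (t *R x))"])
  fix t :: real and x :: 'a
  have 1: "((%t. t *R x) has_derivative (%h. h *R x)) (at t)" by (auto intro!: derivative_eq_intros)
  have "((%t. w x * xi (t *R x)) has_derivative (%h. w x * (gxi (t *R x) *. (h *R x)))) (at t)"
   by (intro has_derivative_mult_right has_derivative_compose[OF 1 C2on_deriv[OF xi]]) simp
  then show "((%t. w x * xi (t *R x)) has_derivative (%h. (w x * (x *. gxi (t *R x))) *. h)) (at t)"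
   by (simp add: inner_commute mult_ac)
 next
  show "continuous_on (ball 1 (1/2) \<times> UNIV) (%(t, x). w x * (x *. gxi (t *R x)))"
   unfolding case_prod_beta by (intro continuous_intros c1)
  show "continuous_on UNIV (%x. w x * xi (t *R x))" for t by (intro continuous_intros c1)
 next
  fix t :: real and x :: 'a assume t: "t : ball 1 (1/2)" and x: "norm x > 2 * S"
  have "1/2 <= abs (t)" using t unfolding mem_ball dist_real_def by linarith
  then have "1/2 * norm x <= abs (t) * norm x" by (intro mult_right_mono) auto
  then have "norm (t *R x) > S" using x by simp
  then show "w x * xi (t *R x) = 0" "w x * (x *. gxi (t *R x)) = 0" using z by auto
 qed auto
 then have d1: "((%t. LI (%x. w x * xi (t *R x))) has_real_derivative LI (%x. w x * (x *. gxi x))) (at 1)"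
  unfolding has_field_derivative_def inner_real_def by simp
 have "((%t. I / t ^ (n + 1)) has_real_derivative LI (%x. w x * (x *. gxi x))) (at 1)"
  using d1 unfolding has_field_derivative_def
  by (rule has_derivative_transform_within_open[of _ _ _ _ "{0<..}"]) (auto simp: h)
 moreover have "((%t. I / t ^ (n + 1)) has_real_derivative - (I * (real n + 1))) (at 1)"
  by (auto intro!: derivative_eq_intros)
 ultimately have "LI (%x. w x * (x *. gxi x)) = - (I * (real n + 1))" by (rule DERIV_unique)
 moreover have "(%x. w x * ((real DIM('a) + 1) * xi x + x *. gxi x)) = (%x. (real n + 1) * (w x * xi x) + w x * (x *. gxi x))"
  by (simp add: n_def algebra_simps fun_eq_iff)
 ultimately show ?thesis using i1 by (simp add: I_def)
qed

locale cone_split = A: cone_piece U de C1 C2 + B: cone_piece U de C2 C1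
 for U :: "'a::euclidean_space => real" and de C1 C2
begin

text \<open>By the Poincare inequality, \<open>ZG\<close> times (Dirichlet integral minus second
  moment) plus the squared mean is a nonnegative quadratic form. It is \<open>O(de)\<close> at the
  balanced difference \<open>f\<close>, so its polar form with \<open>eta\<close> is
  \<open>O(sqrt de)\<close>, as in Cauchy-Schwarz; integration by parts gives the integral on the
  left.\<close>

lemma quadratic_form_bound:
 assumes bal: "LI (%x. A.V x * gauss x) = c * LI (%x. B.V x * gauss x)"
  and xi: "C2on UNIV xi gxi lxi" and S: "S > 0" and z: "!!x. norm x > S ==> xi x = 0 & gxi x = 0 & lxi x = 0"
  and b: "!!x. norm x <= S ==> abs (xi x) <= M" "!!x. norm x <= S ==> norm (gxi x) <= 1" "M >= 0"
  and mv: "mv = measure lborel (cball (0::'a) S)"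
 shows "abs (LI (%x. (A.V x - c * B.V x) * (lxi x + ((real DIM('a) + 1) * xi x + x *. gxi x))))
  <= sqrt de * ((1 + c\<^sup>2) * (LU TYPE('a) * (2 * real DIM('a) + 2) * WG TYPE('a)) + (ZG TYPE('a) * ((1 + M * S)\<^sup>2 * exp (S\<^sup>2 / 2) * mv) + (M * mv)\<^sup>2) / ZG TYPE('a))"
proof -
 note cx = C2on_continuous[OF xi]
 define Z where "Z = ZG TYPE('a)"
 have Z: "Z > 0" unfolding Z_def by (rule ZG_pos)
 define R where "R = LU TYPE('a) / de + 1"
 interpret VA: compact_C1 A.V A.gV R unfolding R_def by (rule A.V_C1)
 interpret VB: compact_C1 B.V B.gV R unfolding R_def by (rule B.V_C1)
 define f where "f x = A.V x - c * B.V x" for x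
 define g where "g x = A.gV x - c *R B.gV x" for x
 have cf: "continuous_on UNIV f" and cg: "continuous_on UNIV g"
  unfolding f_def g_def by (intro continuous_intros VA.cf VB.cf VA.cg VB.cg)+
 have df: "(f has_derivative (%h. g x *. h)) (at x)" for x
  unfolding f_def[abs_def] g_def using VA.d[of x] VB.d[of x]
  by (auto intro!: derivative_eq_intros simp: inner_diff_left)
 have zf: "f x = 0" "g x = 0" if "norm x > R" for x using that by (simp_all add: f_def g_def VA.zf VB.zf VA.zg VB.zg)
 \<comment> \<open>Inverse of the Gaussian weight: with \<open>eta = xi * ig\<close> the polar form
   becomes an unweighted integral against \<open>xi\<close> and its derivatives.\<close>
 define ig where "ig x = exp (x *. x / 2)" for x :: 'a
 have ig: "ig x * gauss x = 1" "ig x > 0" for x by (simp_all add: ig_def gauss_def exp_add[symmetric])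
 have cig: "continuous_on S' ig" for S' unfolding ig_def by (intro continuous_intros) auto
 define eta where "eta x = xi x * ig x" for x
 define geta where "geta x = ig x *R (gxi x + xi x *R x)" for x
 have deta: "(eta has_derivative (%h. geta x *. h)) (at x)" for x
 proof -
  have 1: "((%x. x *. x / 2) has_derivative (%h. x *. h)) (at x)" by (auto intro!: derivative_eq_intros simp: inner_commute)
  have "(ig has_derivative (%h. ig x * (x *. h))) (at x)"
   unfolding ig_def[abs_def] using has_derivative_compose[OF 1 DERIV_exp[unfolded has_field_derivative_def]] by simp
  from has_derivative_mult[OF C2on_deriv[OF xi UNIV_I] this] show ?thesis
   unfolding eta_def[abs_def] geta_def by (simp add: inner_add_left algebra_simps)
 qed
 define a where "a = LI (%x. (g x *. g x) * gauss x)"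
 define bb where "bb = LI (%x. (f x)\<^sup>2 * gauss x)"
 define e where "e = LI (%x. g x *. (gxi x + xi x *R x))"
 define h where "h = LI (%x. f x * xi x)"
 define q where "q = LI (%x. ig x * ((gxi x + xi x *R x) *. (gxi x + xi x *R x)))"
 define r where "r = LI (%x. ig x * (xi x)\<^sup>2)"
 define m where "m = LI xi"
 have zS: "xi x = 0" "gxi x = 0" "lxi x = 0" if "norm x > S" for x using z[OF that] by auto
 note ci = continuous_intros cf cg cx cig
 have I: "integrable lborel (%x. (g x *. g x) * gauss x)" "integrable lborel (%x. (f x)\<^sup>2 * gauss x)" "integrable lborel (%x. f x * gauss x)"
  "integrable lborel (%x. A.V x * gauss x)" "integrable lborel (%x. B.V x * gauss x)"
  "integrable lborel (%x. (A.V x)\<^sup>2 * gauss x)" "integrable lborel (%x. (B.V x)\<^sup>2 * gauss x)"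
  "integrable lborel (%x. (A.gV x *. A.gV x) * gauss x)" "integrable lborel (%x. (B.gV x *. B.gV x) * gauss x)"
  by (rule integrable_cts_supp[of _ R]; auto intro!: ci VA.cf VA.cg VB.cf VB.cg simp: zf VA.zf VA.zg VB.zf VB.zg)+
 have J: "integrable lborel (%x. g x *. (gxi x + xi x *R x))" "integrable lborel (%x. f x * xi x)"
  "integrable lborel (%x. ig x * ((gxi x + xi x *R x) *. (gxi x + xi x *R x)))" "integrable lborel (%x. ig x * (xi x)\<^sup>2)" "integrable lborel xi"
  "integrable lborel (%x. f x * (x *. gxi x))" "integrable lborel (%x. f x * lxi x)" "integrable lborel (%x. g x *. gxi x)" "integrable lborel (%x. xi x * (g x *. x))"
  by (rule integrable_cts_supp[of _ S]; auto intro!: ci simp: zS)+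
 have f0: "LI (%x. f x * gauss x) = 0"
 proof -
  have "(%x. f x * gauss x) = (%x. A.V x * gauss x - c * (B.V x * gauss x))" by (simp add: f_def fun_eq_iff algebra_simps)
  then show ?thesis using I(4,5) bal by simp
 qed
 \<comment> \<open>The Poincare inequality for \<open>f + t * eta\<close>, a quadratic polynomial in
   \<open>t\<close>. The mean of \<open>f\<close> vanishes by balance; the second moment
   \<open>r\<close> of \<open>eta\<close> has a favourable sign and is dropped.\<close>
 have key: "0 <= Z * (a - bb) + 2 * t * (Z * (e - h)) + t\<^sup>2 * (Z * q + m\<^sup>2)" for t
 proof -
  interpret T: compact_C1 "%x. f x + t * eta x" "%x. g x + t *R geta x" "R + S"
  proof
   show "((%x. f x + t * eta x) has_derivative (%h. (g x + t *R geta x) *. h)) (at x)" for x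
    using df[of x] deta[of x] by (auto intro!: derivative_eq_intros simp: inner_add_left)
   show "continuous_on UNIV (%x. g x + t *R geta x)" unfolding geta_def by (intro ci)
   show "f x + t * eta x = 0" "g x + t *R geta x = 0" if "norm x > R + S" for x
    using zf[of x] zS[of x] that VA.R S by (simp_all add: eta_def geta_def)
   show "0 < R + S" using VA.R S by simp
  qed
  have "T.Q = LI (%x. (g x *. g x) * gauss x + 2 * t * (g x *. (gxi x + xi x *R x)) + t\<^sup>2 * (ig x * ((gxi x + xi x *R x) *. (gxi x + xi x *R x))))"
   unfolding T.Q_def
  proof (rule arg_cong[where f = "LI"], rule ext)
   fix x
   define v where "v = gxi x + xi x *R x"
   have "((g x + t *R geta x) *. (g x + t *R geta x)) * gauss x = (g x *. g x) * gauss x + 2 * t * (ig x * gauss x) * (g x *. v) + t\<^sup>2 * (ig x * (ig x * gauss x) * (v *. v))"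
    unfolding geta_def v_def[symmetric] by (simp add: inner_add_left inner_add_right inner_commute power2_eq_square algebra_simps)
   then show "((g x + t *R geta x) *. (g x + t *R geta x)) * gauss x = (g x *. g x) * gauss x + 2 * t * (g x *. (gxi x + xi x *R x)) + t\<^sup>2 * (ig x * ((gxi x + xi x *R x) *. (gxi x + xi x *R x)))"
    unfolding ig v_def by simp
  qed
  also have "... = a + 2 * t * e + t\<^sup>2 * q"
   unfolding a_def e_def q_def bi_iadd[OF bi_add[OF I(1) integrable_mult_right[OF J(1)]] integrable_mult_right[OF J(3)]]
    bi_iadd[OF I(1) integrable_mult_right[OF J(1)]] integral_mult_right_zero ..
  finally have Q: "T.Q = a + 2 * t * e + t\<^sup>2 * q" .
  have "(%x. (f x + t * eta x)\<^sup>2 * gauss x) = (%x. (f x)\<^sup>2 * gauss x + 2 * t * (f x * xi x) + t\<^sup>2 * (ig x * (xi x)\<^sup>2))"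
  proof
   fix x
   have "(f x + t * eta x)\<^sup>2 * gauss x = (f x)\<^sup>2 * gauss x + 2 * t * (f x * xi x) * (ig x * gauss x) + t\<^sup>2 * (ig x * (xi x)\<^sup>2 * (ig x * gauss x))"
    unfolding eta_def by (simp add: power2_eq_square algebra_simps)
   then show "(f x + t * eta x)\<^sup>2 * gauss x = (f x)\<^sup>2 * gauss x + 2 * t * (f x * xi x) + t\<^sup>2 * (ig x * (xi x)\<^sup>2)" unfolding ig by simp
  qed
  then have 2: "LI (%x. (f x + t * eta x)\<^sup>2 * gauss x) = bb + 2 * t * h + t\<^sup>2 * r"
   unfolding bb_def h_def r_def using I(2) J(2,4) by simp
  have "(%x. (f x + t * eta x) * gauss x) = (%x. f x * gauss x + t * xi x)"
  proof
   fix x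
   have "(f x + t * eta x) * gauss x = f x * gauss x + t * xi x * (ig x * gauss x)" by (simp add: eta_def algebra_simps)
   then show "(f x + t * eta x) * gauss x = f x * gauss x + t * xi x" unfolding ig by simp
  qed
  then have 3: "LI (%x. (f x + t * eta x) * gauss x) = t * m"
   unfolding m_def using I(3) J(5) f0 by simp
  have "Z * (bb + 2 * t * h + t\<^sup>2 * r) <= Z * (a + 2 * t * e + t\<^sup>2 * q) + (t * m)\<^sup>2"
   using T.gauss_poincare unfolding Q 2 3 Z_def .
  moreover have "0 <= r" unfolding r_def using less_imp_le[OF ig(2)] by (intro bi_nonneg mult_nonneg_nonneg) auto
  then have "0 <= Z * (t\<^sup>2 * r)" using Z by simp
  ultimately show ?thesis by (simp add: algebra_simps power_mult_distrib)
 qed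
 define L0 where "L0 = LU TYPE('a) * (2 * real DIM('a) + 2) * WG TYPE('a)"
 have ab: "a - bb <= de * ((1 + c\<^sup>2) * L0)"
 proof -
  \<comment> \<open>The two truncations live on disjoint sets, so all cross terms vanish and the two
    energy estimates add up.\<close>
  have dis: "A.V x * B.V x = 0" "A.gV x *. B.gV x = 0" for x
   using A.disj by (auto simp: A.V_def B.V_def A.gV_def B.gV_def)
  have "(%x. (g x *. g x) * gauss x) = (%x. (A.gV x *. A.gV x) * gauss x + c\<^sup>2 * ((B.gV x *. B.gV x) * gauss x))"
   using dis(2) by (simp add: g_def fun_eq_iff inner_diff_left inner_diff_right inner_commute power2_eq_square algebra_simps)
  then have "a = LI (%x. (A.gV x *. A.gV x) * gauss x) + c\<^sup>2 * LI (%x. (B.gV x *. B.gV x) * gauss x)"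
   unfolding a_def using I(8,9) by simp
  moreover have "(f x)\<^sup>2 = (A.V x)\<^sup>2 + c\<^sup>2 * (B.V x)\<^sup>2" for x
  proof -
   have "(f x)\<^sup>2 = (A.V x)\<^sup>2 + c\<^sup>2 * (B.V x)\<^sup>2 - 2 * c * (A.V x * B.V x)" by (simp add: f_def power2_eq_square algebra_simps)
   then show ?thesis unfolding dis by simp
  qed
  then have "(%x. (f x)\<^sup>2 * gauss x) = (%x. (A.V x)\<^sup>2 * gauss x + c\<^sup>2 * ((B.V x)\<^sup>2 * gauss x))" by (simp add: distrib_right mult.assoc)
  then have "bb = LI (%x. (A.V x)\<^sup>2 * gauss x) + c\<^sup>2 * LI (%x. (B.V x)\<^sup>2 * gauss x)"
   unfolding bb_def using I(6,7) by simp
  moreover have "c\<^sup>2 * LI (%x. (B.gV x *. B.gV x) * gauss x) <= c\<^sup>2 * (LI (%x. (B.V x)\<^sup>2 * gauss x) + de * L0)"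
   unfolding L0_def by (intro mult_left_mono B.energy) simp
  ultimately show ?thesis using A.energy unfolding L0_def[symmetric] by (simp add: algebra_simps)
 qed
 have eh: "e - h = - LI (%x. f x * (lxi x + ((real DIM('a) + 1) * xi x + x *. gxi x)))"
 proof -
  have 1: "LI (%x. f x * lxi x) = - LI (%x. g x *. gxi x)"
   by (rule green_first_order(1)[OF df cg xi open_UNIV compact_cball[of 0 S]]) (auto simp: zS)
  have "LI (%x. xi x * (g x *. x) + f x * (x *. gxi x) + real DIM('a) * (f x * xi x)) = 0"
  proof (rule integral_divergence_zero[OF open_UNIV compact_cball[of 0 S] subset_UNIV, where F = "%x. (f x * xi x) *R x"
     and D = "%x h. (f x * xi x) *R h + (f x * (gxi x *. h) + (g x *. h) * xi x) *R x"])
   show "((%x. (f x * xi x) *R x) has_derivative (%h. (f x * xi x) *R h + (f x * (gxi x *. h) + (g x *. h) * xi x) *R x)) (at x)" for x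
    by (rule has_derivative_scaleR[OF has_derivative_mult[OF df C2on_deriv[OF xi UNIV_I]] has_derivative_ident])
   show "xi x * (g x *. x) + f x * (x *. gxi x) + real DIM('a) * (f x * xi x) = (\<Sum>b\<in>Basis. ((f x * xi x) *R b + (f x * (gxi x *. b) + (g x *. b) * xi x) *R x) *. b)" for x
   proof -
    have "(\<Sum>b\<in>Basis. ((f x * xi x) *R b + (f x * (gxi x *. b) + (g x *. b) * xi x) *R x) *. b)
     = real DIM('a) * (f x * xi x) + f x * (\<Sum>b\<in>Basis. (x *. b) * (gxi x *. b)) + xi x * (\<Sum>b\<in>Basis. (g x *. b) * (x *. b))"
     unfolding sum_distrib_left by (simp add: inner_add_left sum.distrib algebra_simps)
    then show ?thesis unfolding euclidean_inner[symmetric] by simp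
   qed
  qed (auto intro!: ci simp: zS)
  then have 2: "LI (%x. xi x * (g x *. x)) + LI (%x. f x * (x *. gxi x)) + real DIM('a) * h = 0"
   unfolding h_def using J by simp
  have 3: "e = LI (%x. g x *. gxi x) + LI (%x. xi x * (g x *. x))"
   unfolding e_def using J(8,9) by (simp add: inner_add_right)
  have "(%x. f x * (lxi x + ((real DIM('a) + 1) * xi x + x *. gxi x))) = (%x. f x * lxi x + ((real DIM('a) + 1) * (f x * xi x) + f x * (x *. gxi x)))"
   by (simp add: algebra_simps fun_eq_iff)
  then have "LI (%x. f x * (lxi x + ((real DIM('a) + 1) * xi x + x *. gxi x))) = LI (%x. f x * lxi x) + ((real DIM('a) + 1) * h + LI (%x. f x * (x *. gxi x)))"
   unfolding h_def using J by simp
  then show ?thesis using 1 2 3 by (simp add: algebra_simps)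
 qed
 define K where "K = Z * ((1 + M * S)\<^sup>2 * exp (S\<^sup>2 / 2) * mv) + (M * mv)\<^sup>2"
 have qK: "Z * q + m\<^sup>2 <= K"
 proof -
  have "abs (q) <= (1 + M * S)\<^sup>2 * exp (S\<^sup>2 / 2) * mv" unfolding q_def mv
  proof (rule abs_integral_le_cball)
   fix x :: 'a assume x: "norm x <= S"
   have "norm (gxi x + xi x *R x) <= 1 + M * S"
    using norm_triangle_ineq[of "gxi x" "xi x *R x"] b(2)[OF x] mult_mono[OF b(1)[OF x] x b(3)] by simp
   then have 1: "(gxi x + xi x *R x) *. (gxi x + xi x *R x) <= (1 + M * S)\<^sup>2"
    unfolding power2_norm_eq_inner[symmetric] by (intro power_mono) auto
   have "x *. x <= S\<^sup>2" unfolding power2_norm_eq_inner[symmetric] using x by (intro power_mono) auto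
   then have 2: "ig x <= exp (S\<^sup>2 / 2)" by (simp add: ig_def)
   have "ig x * ((gxi x + xi x *R x) *. (gxi x + xi x *R x)) <= exp (S\<^sup>2 / 2) * (1 + M * S)\<^sup>2"
    by (rule mult_mono[OF 2 1]) auto
   then show "abs (ig x * ((gxi x + xi x *R x) *. (gxi x + xi x *R x))) <= (1 + M * S)\<^sup>2 * exp (S\<^sup>2 / 2)"
    using ig(2)[of x] by (simp add: abs_mult mult.commute)
  qed (auto simp: zS)
  moreover have "abs (m) <= M * mv" unfolding m_def mv by (rule abs_integral_le_cball) (use b zS in auto)
  then have "m\<^sup>2 <= (M * mv)\<^sup>2" using abs_le_square_iff[of m "M * mv"] by fastforce
  ultimately show ?thesis using Z unfolding K_def by (intro add_mono mult_left_mono) auto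
 qed
 define s where "s = sqrt de"
 have s: "s > 0" "s\<^sup>2 = de" using A.de by (auto simp: s_def)
 \<comment> \<open>The choice \<open>t = - sg * sqrt de\<close> balances the constant term, of order
   \<open>de\<close>, against the quadratic one.\<close>
 have fin: "sg * (e - h) <= s * ((1 + c\<^sup>2) * L0 + K / Z)" if sg: "sg = 1 | sg = -1" for sg
 proof -
  have s2: "(- sg * s)\<^sup>2 = de" using sg s(2) by auto
  have "2 * s * (Z * (sg * (e - h))) <= Z * (a - bb) + de * (Z * q + m\<^sup>2)" using key[of "- sg * s"] unfolding s2 by (simp add: algebra_simps)
  also have "... <= Z * (de * ((1 + c\<^sup>2) * L0)) + de * K" using Z A.de by (intro add_mono mult_left_mono ab qK) auto
  also have "... = s * (Z * (s * ((1 + c\<^sup>2) * L0 + K / Z)))" using Z by (simp add: s(2)[symmetric] power2_eq_square algebra_simps)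
  finally have "2 * (sg * (e - h)) <= s * ((1 + c\<^sup>2) * L0 + K / Z)" using s(1) Z by (simp add: mult.assoc mult.left_commute[of 2])
  moreover have "0 <= s * ((1 + c\<^sup>2) * L0 + K / Z)" using s Z LU_pos[where 'a='a] WG_nonneg[where 'a='a] by (simp add: L0_def K_def mv)
  moreover have "X <= Y" if "2 * X <= Y" "0 <= Y" for X Y :: real using that by simp
  ultimately show ?thesis by blast
 qed
 from fin[of 1] fin[of "-1"] show ?thesis unfolding abs_le_iff f_def[symmetric] using eh
  by (simp add: s_def[symmetric] L0_def[symmetric] Z_def[symmetric] K_def[symmetric])
qed

end

context cone_split
begin

text \<open>With \<open>xi\<close> a rescaled \<open>psi0\<close>, the Laplacian part of the test
  integral is a multiple of \<open>dmean\<close>, and the remaining part integrates to zero against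
  the 1-homogeneous \<open>w\<close>. Passing from \<open>V\<close> to \<open>u\<close> costs
  \<open>O(de)\<close>, and \<open>de <= sqrt de\<close>.\<close>

lemma dmean_u_bound:
 assumes bal: "LI (%x. A.V x * gauss x) = c * LI (%x. B.V x * gauss x)"
  and c: "0 <= c" "c <= k" and s: "0 < s1" "s1 <= s" "s <= S0" and z: "norm z <= 1"
  and S: "S = 1 + S0" and mv: "mv = measure lborel (cball (0::'a) S)"
 shows "abs (dmean (%x. A.u x - c * B.u x) z s) <= S0 / s1 ^ DIM('a) *
  (((1 + k\<^sup>2) * (LU TYPE('a) * (2 * real DIM('a) + 2) * WG TYPE('a)) + (ZG TYPE('a) * ((1 + S0 * S)\<^sup>2 * exp (S\<^sup>2 / 2) * mv) + (S0 * mv)\<^sup>2) / ZG TYPE('a))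
   + (1 + k) * (2 + S\<^sup>2) * ((6 + real DIM('a)) / s1 + (real DIM('a) + 1) * S0 + S) * mv) * sqrt de"
proof -
 define n where "n = DIM('a)"
 have s0: "s > 0" "S0 > 0" "S > 0" using s S by linarith+
 define xi where "xi x = s * psi0 ((x - z) /\<^sub>R s)" for x
 define gxi where "gxi x = - (bump 3 ((x - z) /\<^sub>R s) *R ((x - z) /\<^sub>R s))" for x
 define lxi where "lxi x = lap0 ((x - z) /\<^sub>R s) / s" for x
 have xi: "C2on UNIV xi gxi lxi" unfolding xi_def[abs_def] gxi_def[abs_def] lxi_def[abs_def] by (rule C2on_scale[OF C2on_psi0 s0(1)])
 note cx = C2on_continuous[OF xi]
 have zS: "xi x = 0 & gxi x = 0 & lxi x = 0" if x: "norm x > S" for x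
 proof -
  have "s <= dist x z" using x z s S norm_triangle_ineq2[of x z] by (simp add: dist_norm)
  from norm_scaled_ge[OF s0(1) this] have "norm ((x - z) /\<^sub>R s) >= 1" .
  then show ?thesis unfolding xi_def gxi_def lxi_def by (simp add: bump_zero lap0_zero psi0_def)
 qed
 have b1: "abs (xi x) <= S0" for x
 proof -
  have "s * psi0 ((x - z) /\<^sub>R s) <= S0 * 1" using s0 s by (intro mult_mono bump_times_bounds) (auto simp: psi0_nonneg)
  then show ?thesis using s0 by (simp add: xi_def abs_mult psi0_nonneg)
 qed
 have b2: "norm (gxi x) <= 1" for x unfolding gxi_def norm_minus_cancel by (rule bump_times_bounds)
 have b3: "abs (lxi x) <= (6 + real n) / s1" for x
 proof -
  have "abs (lap0 ((x - z) /\<^sub>R s)) / s <= (6 + real n) / s1" unfolding n_def using s by (intro frac_le bump_times_bounds) auto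
  then show ?thesis using s0 by (simp add: lxi_def)
 qed
 define T where "T x = lxi x + ((real n + 1) * xi x + x *. gxi x)" for x
 define Ml where "Ml = (6 + real n) / s1 + (real n + 1) * S0 + S"
 have Ml: "Ml >= 0" using s0 s by (simp add: Ml_def)
 have bT: "abs (T x) <= Ml" if "norm x <= S" for x
 proof -
  have "abs ((real n + 1) * xi x) <= (real n + 1) * S0" unfolding abs_mult using b1[of x] by (intro mult_mono) auto
  moreover have "abs (x *. gxi x) <= S * 1" using Cauchy_Schwarz_ineq2[of x "gxi x"] mult_mono[OF that b2[of x]] s0 by simp
  ultimately show ?thesis using b3[of x] unfolding T_def Ml_def by linarith
 qed
 have zT: "T x = 0" if "norm x > S" for x using zS[OF that] by (simp add: T_def)
 have cT: "continuous_on UNIV T" unfolding T_def by (intro continuous_intros cx)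
 define f where "f x = A.V x - c * B.V x" for x
 define w where "w x = A.u x - c * B.u x" for x
 have cf: "continuous_on UNIV f" unfolding f_def using compact_C1.cf[OF A.V_C1] compact_C1.cf[OF B.V_C1] by (intro continuous_intros)
 have cw: "continuous_on UNIV w" unfolding w_def by (intro continuous_intros A.u_continuous B.u_continuous)
 have hw: "w (t *R x) = t * w x" if "t > 0" for t x using that by (simp add: w_def A.u_hom B.u_hom algebra_simps)
 have i: "integrable lborel (%x. f x * T x)" "integrable lborel (%x. (w x - f x) * T x)" "integrable lborel (%x. w x * lxi x)"
  "integrable lborel (%x. w x * ((real n + 1) * xi x + x *. gxi x))"
  by (rule integrable_cts_supp[of _ S]; auto intro!: continuous_intros cf cw cT cx simp: zT zS)+
 define Q where "Q = (1 + k\<^sup>2) * (LU TYPE('a) * (2 * real n + 2) * WG TYPE('a)) + (ZG TYPE('a) * ((1 + S0 * S)\<^sup>2 * exp (S\<^sup>2 / 2) * mv) + (S0 * mv)\<^sup>2) / ZG TYPE('a)"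
 have L0: "0 <= LU TYPE('a) * (2 * real n + 2) * WG TYPE('a)" using LU_pos[where 'a='a] WG_nonneg[where 'a='a] by simp
 have sd: "sqrt de >= 0" "de <= sqrt de" using A.de by (auto intro!: real_le_rsqrt simp: power2_eq_square mult_left_le)
 have 1: "abs (LI (%x. f x * T x)) <= sqrt de * Q"
 proof -
  have "abs (LI (%x. f x * T x)) <= sqrt de * ((1 + c\<^sup>2) * (LU TYPE('a) * (2 * real n + 2) * WG TYPE('a)) + (ZG TYPE('a) * ((1 + S0 * S)\<^sup>2 * exp (S\<^sup>2 / 2) * mv) + (S0 * mv)\<^sup>2) / ZG TYPE('a))"
   unfolding f_def T_def n_def by (rule quadratic_form_bound[OF bal xi s0(3) zS b1 b2 _ mv]) (use s0 in auto)
  also have "... <= sqrt de * Q" unfolding Q_def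
   using c by (intro mult_left_mono sd add_mono mult_right_mono L0 power_mono order_refl) auto
  finally show ?thesis .
 qed
 have 2: "abs (LI (%x. (w x - f x) * T x)) <= ((1 + k) * (de * (2 + S\<^sup>2)) * Ml) * mv" unfolding mv
 proof (rule abs_integral_le_cball)
  fix x :: 'a assume x: "norm x <= S"
  have "x *. x <= S\<^sup>2" unfolding power2_norm_eq_inner[symmetric] using x by (intro power_mono) auto
  then have d: "de * (2 + x *. x) <= de * (2 + S\<^sup>2)" using A.de by (intro mult_left_mono) auto
  have a: "0 <= A.u x - A.V x" "A.u x - A.V x <= de * (2 + S\<^sup>2)" "0 <= B.u x - B.V x" "B.u x - B.V x <= de * (2 + S\<^sup>2)"
   using A.V_le_u[of x] A.u_le_V[of x] B.V_le_u[of x] B.u_le_V[of x] d by linarith+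
  have cb: "0 <= c * (B.u x - B.V x)" "c * (B.u x - B.V x) <= k * (de * (2 + S\<^sup>2))"
   using a c by (auto intro!: mult_mono)
  have "w x - f x = (A.u x - A.V x) - c * (B.u x - B.V x)" by (simp add: w_def f_def algebra_simps)
  moreover have "(1 + k) * (de * (2 + S\<^sup>2)) = de * (2 + S\<^sup>2) + k * (de * (2 + S\<^sup>2))" by (simp add: distrib_right)
  ultimately have "abs (w x - f x) <= (1 + k) * (de * (2 + S\<^sup>2))" using a cb by linarith
  then show "abs ((w x - f x) * T x) <= (1 + k) * (de * (2 + S\<^sup>2)) * Ml"
   unfolding abs_mult using bT[OF x] by (intro mult_mono) auto
 qed (use zT c A.de Ml in auto)
 have m: "mv >= 0" by (simp add: mv)
 have "((1 + k) * (de * (2 + S\<^sup>2)) * Ml) * mv = de * ((1 + k) * (2 + S\<^sup>2) * Ml * mv)" by (simp add: mult_ac)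
 also have "... <= sqrt de * ((1 + k) * (2 + S\<^sup>2) * Ml * mv)" using c Ml m by (intro mult_right_mono sd) auto
 finally have 3: "abs (LI (%x. (w x - f x) * T x)) <= sqrt de * ((1 + k) * (2 + S\<^sup>2) * Ml * mv)" using 2 by linarith
 have "LI (%x. w x * ((real n + 1) * xi x + x *. gxi x)) = 0"
  unfolding n_def by (rule homogeneous_dilation_identity[OF cw hw xi, of S]) (use zS s0 in auto)
 then have "LI (%x. w x * lxi x) = LI (%x. w x * lxi x + w x * ((real n + 1) * xi x + x *. gxi x))"
  using i by simp
 also have "... = LI (%x. f x * T x + (w x - f x) * T x)"
  by (rule arg_cong[where f = "LI"]) (simp add: T_def fun_eq_iff algebra_simps)
 also have "... = LI (%x. f x * T x) + LI (%x. (w x - f x) * T x)" using i by simp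
 finally have "abs (LI (%x. w x * lxi x)) <= sqrt de * Q + sqrt de * ((1 + k) * (2 + S\<^sup>2) * Ml * mv)" using 1 3 by linarith
 then have 4: "abs (LI (%x. w x * lxi x)) <= sqrt de * (Q + (1 + k) * (2 + S\<^sup>2) * Ml * mv)" by (simp add: distrib_left)
 have "dmean w z s = s * LI (%x. w x * lxi x) / s ^ n"
  unfolding mean_eq(2)[OF s0(1)] lxi_def n_def using s0 by simp
 then have "abs (dmean w z s) = (s / s ^ n) * abs (LI (%x. w x * lxi x))" using s0 by (simp add: abs_mult)
 also have "... <= (S0 / s1 ^ n) * (sqrt de * (Q + (1 + k) * (2 + S\<^sup>2) * Ml * mv))"
  using s s0 by (intro mult_mono 4 frac_le power_mono) auto
 finally show ?thesis unfolding w_def[abs_def] Q_def Ml_def n_def by (simp only: mult_ac)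
qed

end

lemma bump2_lipschitz: "abs (bump 2 a - bump 2 (b :: 'a::euclidean_space)) <= 4 * norm (a - b)"
proof -
 have "norm (bump 2 a - bump 2 b) <= 4 * norm (a - b)"
 proof (rule differentiable_bound[OF convex_UNIV])
  fix x :: 'a
  show "(bump 2 has_derivative (%h. - (2 * real 2 * bump (2 - 1) x) * (x *. h))) (at x within UNIV)" using bump_has_derivative[of 2 x] by simp
  show "onorm (%h. - (2 * real 2 * bump (2 - 1) x) * (x *. h)) <= 4"
  proof (rule onorm_le)
   fix h
   have "bump 1 x * norm x <= 1"
    by (cases "norm x <= 1") (use mult_mono[OF bump_le_one[of 1 x], of "norm x" 1] in "auto simp: bump_nonneg bump_zero")
   then have "bump 1 x * abs (x *. h) <= 1 * norm h"
    using mult_left_mono[OF Cauchy_Schwarz_ineq2[of x h] bump_nonneg[of 1 x]] mult_right_mono[of "bump 1 x * norm x" 1 "norm h"]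
    by (simp add: mult.assoc[symmetric])
   then show "norm (- (2 * real 2 * bump (2 - 1) x) * (x *. h)) <= 4 * norm h" by (simp add: abs_mult bump_nonneg)
  qed
 qed auto
 then show ?thesis by simp
qed

text \<open>Up to the factor 6, the gradient of \<open>bump 3\<close> is
  \<open>- (bump 2 y *R y)\<close>; this field changes by at most 9 times the displacement here, 1
  from the factor \<open>y\<close> and 4 * 2 from \<open>bump 2\<close>, and 6 * 9 = 54.\<close>

lemma bump3_taylor:
 fixes x w :: "'a::euclidean_space"
 assumes x: "norm x <= 2"
 shows "abs (bump 3 (x - w) - bump 3 x - 6 * bump 2 x * (x *. w)) <= 54 * (norm w)\<^sup>2"
proof -
 have d: "((%t. bump 3 (x - t *R w)) has_real_derivative 6 * bump 2 (x - t *R w) * ((x - t *R w) *. w)) (at t)" for t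
 proof -
  have 1: "((%t. x - t *R w) has_derivative (%h. - (h *R w))) (at t)" by (auto intro!: derivative_eq_intros)
  have 2: "(bump 3 has_derivative (%h. - (2 * real 3 * bump (3 - 1) y) * (y *. h))) (at y)" for y :: 'a by (rule bump_has_derivative) simp
  have "(%h. - (2 * real 3 * bump (3 - 1) (x - t *R w)) * ((x - t *R w) *. (- (h *R w)))) = (*) (6 * bump 2 (x - t *R w) * ((x - t *R w) *. w))"
   by (simp add: fun_eq_iff)
  then show ?thesis using has_derivative_compose[OF 1 2] unfolding has_field_derivative_def by (simp only:)
 qed
 have "EX t>0. t < 1 & bump 3 (x - 1 *R w) - bump 3 (x - 0 *R w) = (1 - 0) * (6 * bump 2 (x - t *R w) * ((x - t *R w) *. w))"
  by (rule MVT2) (use d in auto)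
 then obtain t where t: "0 < t" "t < 1" "bump 3 (x - w) - bump 3 x = 6 * bump 2 (x - t *R w) * ((x - t *R w) *. w)" by auto
 define y where "y = x - t *R w"
 have yx: "norm (y - x) <= norm w" using t by (simp add: y_def mult_left_le_one_le)
 have "bump 2 y *R y - bump 2 x *R x = bump 2 y *R (y - x) + (bump 2 y - bump 2 x) *R x" by (simp add: algebra_simps)
 then have "norm (bump 2 y *R y - bump 2 x *R x) <= bump 2 y * norm (y - x) + abs (bump 2 y - bump 2 x) * norm x"
  using norm_triangle_ineq[of "bump 2 y *R (y - x)" "(bump 2 y - bump 2 x) *R x"] by (simp add: bump_nonneg)
 also have "... <= 1 * norm w + (4 * norm w) * 2"
  using x yx bump2_lipschitz[of y x] by (intro add_mono mult_mono) (auto simp: bump_le_one)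
 finally have n: "norm (bump 2 y *R y - bump 2 x *R x) <= 9 * norm w" by simp
 have "bump 3 (x - w) - bump 3 x - 6 * bump 2 x * (x *. w) = 6 * ((bump 2 y *R y - bump 2 x *R x) *. w)"
  unfolding t(3) y_def[symmetric] by (simp add: inner_diff_left)
 also have "abs (...) <= 6 * (9 * norm w * norm w)"
  using Cauchy_Schwarz_ineq2[of "bump 2 y *R y - bump 2 x *R x" w] mult_right_mono[OF n, of "norm w"] by simp
 finally show ?thesis by (simp add: power2_eq_square)
qed

text \<open>An almost harmonic 1-homogeneous function is almost linear: its means over large balls are linear up to \<open>O(1/S)\<close>
 by homogeneity, and they differ little from those over small balls.\<close>

lemma homogeneous_almost_linear:
 fixes w :: "'a::euclidean_space => real"
 assumes cw: "continuous_on UNIV w" and hw: "!!t x. t > 0 ==> w (t *R x) = t * w x" and M: "!!x. abs (w x) <= M * norm x"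
  and s1: "0 < s1" "s1 <= 1" and dm: "!!z s. norm z <= 1 ==> s1 <= s ==> s <= 1 / s1 ==> abs (dmean w z s) <= om"
 shows "EX a. ALL z. norm z <= 1 --> abs (mean w z s1 - a *. z) <= 2 * (om / s1\<^sup>2) + 110 * M * measure lborel (cball (0::'a) 2) * s1"
proof -
 \<comment> \<open>The large radius: dilating to scale 1 moves the centre \<open>z\<close> to within
   \<open>s1\<close> of the origin, where the mean is expanded to first order.\<close>
 define S where "S = 1 / s1"
 define mv where "mv = measure lborel (cball (0::'a) 2)"
 have mv: "mv >= 0" by (simp add: mv_def)
 have S: "S >= 1" "s1 <= S" using s1 by (auto simp: S_def field_simps intro: mult_le_one order_trans)
 have M0: "M >= 0"
 proof -
  obtain b :: 'a where b: "b : Basis" using nonempty_Basis by blast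
  show ?thesis using M[of b] b by simp
 qed
 have om: "om >= 0" using dm[of 0 s1] S by (simp add: S_def)
 \<comment> \<open>The gradient at the origin of the map sending \<open>v\<close> to
   \<open>mean w v 1\<close>; it becomes the slope of the linear approximation.\<close>
 define a where "a = LI (%x. (6 * w x * bump 2 x) *R x)"
 have diff: "abs (mean w z S - mean w z s1) <= om / s1\<^sup>2" if z: "norm z <= 1" for z
 proof -
  have b: "- (om / s1) * s <= dmean w z s & dmean w z s <= (om / s1) * s" if s: "s1 < s" "s < S" for s
  proof -
   have "abs (dmean w z s) <= om" using dm[OF z, of s] s by (simp add: S_def)
   moreover have "om * 1 <= om * (s / s1)" using om s s1 by (intro mult_left_mono) auto
   ultimately show ?thesis using abs_le_D1[of "dmean w z s" om] abs_le_D2[of "dmean w z s" om] by simp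
  qed
  note B = mean_diff_bounds[OF cw less_imp_le[OF s1(1)] S(2), of "- (om / s1)" z "om / s1", OF b]
  have "om / s1 * (S - s1) <= om / s1 * S" using om s1 by (intro mult_left_mono) auto
  also have "... = om / s1\<^sup>2" by (simp add: S_def power2_eq_square)
  finally have 1: "om / s1 * (S - s1) <= om / s1\<^sup>2" .
  have 2: "- (om / s1) * (S - s1) = - (om / s1 * (S - s1))" by simp
  show ?thesis using B[unfolded 2] 1 by linarith
 qed
 have hom: "mean w z t = t * mean w (z /\<^sub>R t) 1" if "t > 0" for z t
 proof -
  have "w (z + t *R y) = t * w (z /\<^sub>R t + 1 *R y)" for y
   using hw[OF that, of "z /\<^sub>R t + y"] that by (simp add: scaleR_add_right)
  then show ?thesis unfolding mean_def by (simp add: mult.assoc)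
 qed
 have tay: "abs (mean w v 1 - mean w 0 1 - a *. v) <= (108 * M * mv) * (norm v)\<^sup>2" if v: "norm v <= 1" for v
 proof -
  have big: "bump 3 (x - v) = 0 & bump 3 x = 0 & bump 2 x = 0" if "norm x > 2" for x :: 'a
   using that v norm_triangle_ineq2[of x v] by (simp add: bump_zero)
  have cb: "continuous_on UNIV (%x::'a. bump 2 x)" by (intro continuous_intros)
  have i: "integrable lborel (%x. w x * bump 3 (x - v))" "integrable lborel (%x. w x * bump 3 x)" "integrable lborel (%x. (6 * w x * bump 2 x) *R x)"
   by (rule integrable_cts_supp[of _ 2]; auto intro!: continuous_intros cw simp: big)+
  have i3: "integrable lborel (%x. ((6 * w x * bump 2 x) *R x) *. v)" using integrable_inner_left[OF i(3)] by blast
  have "mean w v 1 - mean w 0 1 - a *. v = LI (%x. w x * bump 3 (x - v)) - LI (%x. w x * bump 3 x) - LI (%x. ((6 * w x * bump 2 x) *R x) *. v)"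
   unfolding a_def integral_inner_left[OF i(3), symmetric] by (simp add: mean_eq(1)[of 1])
  also have "... = LI (%x. w x * bump 3 (x - v) - w x * bump 3 x - ((6 * w x * bump 2 x) *R x) *. v)" using i i3 by simp
  also have "abs (...) <= (M * 2 * (54 * (norm v)\<^sup>2)) * mv" unfolding mv_def
  proof (rule abs_integral_le_cball)
   fix x :: 'a assume x: "norm x <= 2"
   have "w x * bump 3 (x - v) - w x * bump 3 x - ((6 * w x * bump 2 x) *R x) *. v = w x * (bump 3 (x - v) - bump 3 x - 6 * bump 2 x * (x *. v))"
    by (simp add: algebra_simps)
   moreover have "abs (w x) <= M * 2" using M[of x] mult_left_mono[OF x M0] by linarith
   ultimately show "abs (w x * bump 3 (x - v) - w x * bump 3 x - ((6 * w x * bump 2 x) *R x) *. v) <= M * 2 * (54 * (norm v)\<^sup>2)"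
    using mult_mono[OF _ bump3_taylor[OF x, of v], of "abs (w x)" "M * 2"] M0 by (simp only: abs_mult)
  qed (use big M0 in auto)
  finally show ?thesis by (simp add: mult_ac)
 qed
 have h0: "abs (mean w 0 1) <= 2 * M * mv"
 proof -
  have "abs (mean w 0 1) <= (M * 2) * mv" unfolding mean_def mv_def
  proof (rule abs_integral_le_cball)
   fix x :: 'a assume x: "norm x <= 2"
   have "abs (w x) * bump 3 x <= (M * 2) * 1"
    using M[of x] mult_left_mono[OF x M0] M0 by (intro mult_mono) (auto simp: bump_nonneg bump_le_one)
   then show "abs (w (0 + 1 *R x) * bump 3 x) <= M * 2" by (simp add: abs_mult bump_nonneg)
  qed (use M0 in "auto simp: bump_zero")
  then show ?thesis by (simp add: mult_ac)
 qed
 show ?thesis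
 proof (intro exI[of _ a] allI impI)
  fix z :: 'a assume z: "norm z <= 1"
  have zS: "norm (z /\<^sub>R S) <= s1" using z s1 by (simp add: S_def divide_inverse mult_left_le)
  then have zS1: "norm (z /\<^sub>R S) <= 1" using s1 by linarith
  have 1: "abs (mean w z S - S * mean w 0 1 - a *. z) <= 108 * M * mv * s1"
  proof -
   have "mean w z S - S * mean w 0 1 - a *. z = S * (mean w (z /\<^sub>R S) 1 - mean w 0 1 - a *. (z /\<^sub>R S))"
    using S hom[of S z] by (simp add: right_diff_distrib)
   also have "abs (...) <= S * ((108 * M * mv) * (norm (z /\<^sub>R S))\<^sup>2)" unfolding abs_mult using S tay[OF zS1] by (intro mult_mono) auto
   also have "... <= S * ((108 * M * mv) * s1\<^sup>2)" using zS S M0 mv by (intro mult_left_mono power_mono) auto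
   also have "... = 108 * M * mv * s1" using s1 by (simp add: S_def power2_eq_square)
   finally show ?thesis .
  qed
  \<comment> \<open>The constant term \<open>mean w 0 S = S * mean w 0 1\<close> is small as well,
    by comparison with \<open>mean w 0 s1\<close>, which is of order \<open>s1\<close>.\<close>
  have 2: "abs (S * mean w 0 1 - s1 * mean w 0 1) <= om / s1\<^sup>2" using diff[of 0] hom[of S 0] hom[of s1 0] S s1 by simp
  have 3: "abs (s1 * mean w 0 1) <= s1 * (2 * M * mv)" unfolding abs_mult using s1 h0 by (intro mult_mono) auto
  have 4: "110 * M * mv * s1 = 108 * M * mv * s1 + s1 * (2 * M * mv)" by simp
  show "abs (mean w z s1 - a *. z) <= 2 * (om / s1\<^sup>2) + 110 * M * measure lborel (cball (0::'a) 2) * s1"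
   using 1 2 3 diff[OF z] unfolding mv_def[symmetric] 4 by linarith
 qed
qed

text \<open>At the vertex means are linear in the radius, so a lower bound for the mean of
  \<open>U\<close> is one for \<open>dmean\<close>, the quantity that
  \<open>zero_set_density\<close> asks for.\<close>

lemma homogeneous_dmean:
 fixes w :: "'a::euclidean_space => real"
 assumes cw: "continuous_on UNIV w" and hw: "!!t x. t > 0 ==> w (t *R x) = t * w x"
 shows "dmean w 0 1 = mean w 0 1"
proof -
 have h: "mean w 0 s = s * mean w 0 1" if "s > 0" for s
  using hw[OF that] unfolding mean_def by (simp add: mult.assoc)
 have "(mean w 0 has_real_derivative dmean w 0 1 / 1) (at 1)" by (rule mean_has_derivative[OF cw]) simp
 then have "((%s. s * mean w 0 1) has_real_derivative dmean w 0 1 / 1) (at 1)"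
  unfolding has_field_derivative_def by (rule has_derivative_transform_within_open[of _ _ _ _ "{0<..}"]) (auto intro: h)
 moreover have "((%s. s * mean w 0 1) has_real_derivative mean w 0 1) (at 1)" by (auto intro!: derivative_eq_intros)
 ultimately show ?thesis using DERIV_unique by fastforce
qed

section \<open>Impossibility of two separate pieces\<close>

lemma ac_min_interior_lower:
 fixes U :: "'a::euclidean_space => real"
 assumes U: "ac_min U" and m: "m <= U p" "m > 0" and s: "s > 0" "4 * s * LU TYPE('a) <= m" and y: "dist p y <= s"
 shows "m / AH TYPE('a) <= U y"
proof -
 have pos: "U v > 0" if "dist p v < 4 * s" for v
 proof (rule ccontr)
  assume "~ ?thesis"
  then have "U v = 0" using U by (simp add: ac_min_def not_less antisym)
  from ac_min_growth[OF U this, of p] have "U p <= LU TYPE('a) * dist p v" .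
  also have "... < LU TYPE('a) * (4 * s)" using that LU_pos[where 'a='a] by simp
  finally show False using m s by (simp add: mult_ac)
 qed
 have "U p <= AH TYPE('a) * U y"
 proof (rule ac_min_harnack[OF U _ s(1)])
  show "U v > 0" if "dist y v < 3 * s" for v using pos[of v] dist_triangle[of p v y] that y by simp
 qed (use y in "simp add: dist_commute")
 then show ?thesis using m AH_pos[where 'a='a] by (simp add: divide_le_eq mult.commute)
qed

text \<open>On this ball \<open>U\<close> stays above \<open>de\<close> and |x| below 1, so the ball
  lies in the split set; being connected, it lies in one piece.\<close>

lemma cone_piece_ball:
 fixes U :: "'a::euclidean_space => real"
 assumes cp: "cone_piece U de C C'" and p: "p : C" "norm p <= 1/2" and s: "0 < s" "s <= 1/4"
  and low: "!!y. dist p y <= s ==> m2 <= U y" and d: "de < m2"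
 shows "ball p s \<subseteq> C" "!!y. y : ball p s ==> norm y <= 3/4"
proof -
 interpret cone_piece U de C C' by (rule cp)
 show n: "norm y <= 3/4" if "y : ball p s" for y using that p s norm_triangle_ineq2[of y p] by (simp add: dist_norm norm_minus_commute)
 have sub: "ball p s \<subseteq> C Un C'"
 proof
  fix y assume y: "y : ball p s"
  have "de * norm y <= de * 1" using n[OF y] de by (intro mult_left_mono) auto
  then have "de * norm y < U y" using low[of y] y d by simp
  then show "y : C Un C'" using cov by blast
 qed
 have "C Int ball p s = {} | C' Int ball p s = {}"
  by (rule connectedD[OF connected_ball oC oC' _ sub]) (use disj in blast)
 moreover have "p : C Int ball p s" using p s by simp
 ultimately show "ball p s \<subseteq> C" using sub by blast
qed

text \<open>The radius \<open>s1\<close> is fixed before \<open>de\<close>, which may depend on it.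
  The linear approximation of \<open>w\<close> has slope at least \<open>al\<close> because
  \<open>w\<close> is large near \<open>p\<close>, while at zeros of \<open>U\<close> it is
  \<open>O(s1)\<close>; this puts the zero set into a strip of width \<open>O(s1)\<close>, but its
  measure in the unit ball is at least \<open>dens\<close>.\<close>

theorem cone_split_impossible:
 fixes m :: real
 assumes m: "m > 0"
 shows "EX de>0. de <= 1 & de <= m & (ALL (U :: 'a::euclidean_space => real) C1 C2 p q. cone_split U de C1 C2 --> norm p <= 1/2 --> norm q <= 1/2 -->
  p : C1 --> q : C2 --> m <= U p --> m <= U q --> False)"
proof -
 define L where "L = LU TYPE('a)"
 have L: "L > 0" unfolding L_def by (rule LU_pos)
 define n where "n = DIM('a)"
 define sb where "sb = min (1/4) (m / (4 * L))"
 have "m / (4 * L) > 0" using m L by simp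
 then have sb: "0 < sb" "sb <= 1/4" "sb <= m / (4 * L)" unfolding sb_def by auto
 have sbL: "4 * sb * L <= m" using sb(3) L by (simp add: field_simps)
 define m2 where "m2 = m / AH TYPE('a)"
 have m2: "m2 > 0" using m AH_pos[where 'a='a] by (simp add: m2_def)
 define vb where "vb = measure lborel (ball (0::'a) sb)"
 have vb: "measure lborel (ball q sb) = vb" "vb > 0" for q :: 'a
  unfolding vb_def using content_ball[of sb q] content_ball[of sb "0::'a"] sb(1) by (simp_all add: unit_ball_vol_pos)
 \<comment> \<open>Lower bound for the Gaussian mean of the second truncation: it is at least
   \<open>m2 / 2\<close> on a ball of radius \<open>sb\<close> inside the unit ball, where the
   weight is at least \<open>exp (- 1 / 2)\<close>.\<close>
 define b0 where "b0 = m2 / 2 * exp (- 1 / 2) * vb"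
 have b0: "b0 > 0" using m2 vb by (simp add: b0_def)
 define W where "W = WG TYPE('a)"
 have W: "W >= 0" unfolding W_def by (rule WG_nonneg)
 \<comment> \<open>Upper bound for the balancing multiplier \<open>c\<close>, found from an upper
   bound for one Gaussian mean and the lower bound \<open>b0\<close> for the other.\<close>
 define k where "k = L * W / b0"
 have k: "k >= 0" using L W b0 by (simp add: k_def)
 define M where "M = (1 + k) * L"
 have M: "M >= 0" using k L by (simp add: M_def)
 define mv2 where "mv2 = measure lborel (cball (0::'a) 2)"
 have mv2: "mv2 >= 0" by (simp add: mv2_def)
 define J where "J = I3 TYPE('a)"
 have J: "J > 0" unfolding J_def by (rule I3_pos)
 define E1 where "E1 = 2 + 110 * M * mv2"
 have E1: "E1 > 0" using M mv2 by (simp add: E1_def add_pos_nonneg)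
 define E2 where "E2 = E1 + M * J"
 have E2: "E2 > 0" using E1 M J by (simp add: E2_def add_pos_nonneg)
 define al where "al = m2 * J / 4"
 have al: "al > 0" using m2 J by (simp add: al_def)
 \<comment> \<open>Lower bound for \<open>mean U 0 1\<close>, obtained from the ball around
   \<open>p\<close> on which \<open>U\<close> is harmonic.\<close>
 define c1 where "c1 = m * J * sb ^ n / A0"
 have A0: "A0 > 0" by (simp add: A0_def)
 have c1: "c1 > 0" using m J sb A0 by (simp add: c1_def)
 define dens where "dens = c1\<^sup>2 / (G0 TYPE('a) + 1)"
 have dens: "dens > 0" using c1 G0_nonneg[where 'a='a] by (simp add: dens_def add_nonneg_pos)
 define Y where "Y = 6 * (E2 / al) * measure lebesgue (cball (0::'a) 2)"
 have Y: "Y >= 0" using E2 al by (simp add: Y_def)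
 define s1 where "s1 = min (sb / 2) (min (al / E1) (dens / (2 * (Y + 1))))"
 have "al / E1 > 0" "dens / (2 * (Y + 1)) > 0" using al E1 dens Y by auto
 then have s1: "0 < s1" "s1 <= sb / 2" "s1 <= al / E1" "s1 <= dens / (2 * (Y + 1))" using sb unfolding s1_def by linarith+
 have s1': "s1 <= 1" "E1 * s1 <= al" using s1 sb E1 by (auto simp: field_simps)
 have s1Y: "Y * s1 < dens"
 proof -
  have "Y * s1 <= (Y + 1) * s1" using s1 by (intro mult_right_mono) auto
  also have "... <= dens / 2" using s1(4) Y by (simp add: field_simps)
  finally show ?thesis using dens by simp
 qed
 define S0 where "S0 = 1 / s1"
 define S where "S = 1 + S0"
 define mv where "mv = measure lborel (cball (0::'a) S)"
 define Kd where "Kd = S0 / s1 ^ DIM('a) *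
  (((1 + k\<^sup>2) * (LU TYPE('a) * (2 * real DIM('a) + 2) * WG TYPE('a)) + (ZG TYPE('a) * ((1 + S0 * S)\<^sup>2 * exp (S\<^sup>2 / 2) * mv) + (S0 * mv)\<^sup>2) / ZG TYPE('a))
   + (1 + k) * (2 + S\<^sup>2) * ((6 + real DIM('a)) / s1 + (real DIM('a) + 1) * S0 + S) * mv)"
 define ta where "ta = s1 ^ 3 / (abs (Kd) + 1)"
 have ta: "ta > 0" using s1 by (simp add: ta_def add_nonneg_pos)
 \<comment> \<open>\<open>m2 / 7\<close> keeps \<open>de * (2 + |y|^2) <= 3 * de\<close> below
   \<open>m2 / 2\<close> on the unit ball; \<open>ta^2\<close> makes \<open>Kd * sqrt de\<close> at
   most \<open>s1 ^ 3\<close>, so that division by \<open>s1^2\<close> still leaves an error of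
   order \<open>s1\<close>.\<close>
 define de where "de = min (min 1 m) (min (m2 / 7) (ta\<^sup>2))"
 have de: "0 < de" "de <= 1" "de <= m" "de <= m2 / 7" "de <= ta\<^sup>2" using m m2 ta by (auto simp: de_def)
 have Kd: "Kd * sqrt de <= s1 ^ 3"
 proof -
  have "sqrt de <= ta" using de(5) ta by (intro real_le_lsqrt) auto
  then have "(abs (Kd) + 1) * sqrt de <= (abs (Kd) + 1) * ta" by (intro mult_left_mono) auto
  also have "... = s1 ^ 3" by (simp add: ta_def)
  finally have "(abs (Kd) + 1) * sqrt de <= s1 ^ 3" .
  moreover have "Kd * sqrt de <= (abs (Kd) + 1) * sqrt de" using de by (intro mult_right_mono) auto
  ultimately show ?thesis by linarith
 qed
 show ?thesis
 proof (intro exI[of _ de] conjI allI impI)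
  fix U :: "'a => real" and C1 C2 p q
  assume cs: "cone_split U de C1 C2" and p: "norm p <= 1/2" "p : C1" "m <= U p" and q: "norm q <= 1/2" "q : C2" "m <= U q"
  interpret cone_split U de C1 C2 by (rule cs)
  have U: "ac_min U" by (rule A.U)
  have low: "m2 <= U y" if "m <= U x" "dist x y <= sb" for x y
   unfolding m2_def by (rule ac_min_interior_lower[OF U that(1) m sb(1) _ that(2)]) (use sbL in "simp add: L_def")
  have dem2: "de < m2" using de m2 by linarith
  have lp: "m2 <= U y" if "dist p y <= sb" for y using low[OF p(3) that] .
  have lq: "m2 <= U y" if "dist q y <= sb" for y using low[OF q(3) that] .
  have pb: "ball p sb \<subseteq> C1" "!!y. y : ball p sb ==> norm y <= 3/4"
   using cone_piece_ball[OF A.cone_piece_axioms p(2,1) sb(1,2) lp dem2] by blast+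
  have qb: "ball q sb \<subseteq> C2" "!!y. y : ball q sb ==> norm y <= 3/4"
   using cone_piece_ball[OF B.cone_piece_axioms q(2,1) sb(1,2) lq dem2] by blast+
  interpret VA: compact_C1 A.V A.gV "LU TYPE('a) / de + 1" by (rule A.V_C1)
  interpret VB: compact_C1 B.V B.gV "LU TYPE('a) / de + 1" by (rule B.V_C1)
  have iA: "integrable lborel (%x. A.V x * gauss x)"
   by (rule integrable_cts_supp[of _ "LU TYPE('a) / de + 1"]) (auto intro!: continuous_intros VA.cf simp: VA.zf)
  have iB: "integrable lborel (%x. B.V x * gauss x)"
   by (rule integrable_cts_supp[of _ "LU TYPE('a) / de + 1"]) (auto intro!: continuous_intros VB.cf simp: VB.zf)
  have IA: "LI (%x. A.V x * gauss x) <= L * W"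
  proof -
   have "LI (%x. A.V x * gauss x) <= LI (%x::'a. L * ((1 + x *. x)\<^sup>2 * gauss x))"
   proof (rule integral_mono[OF iA])
    show "integrable lborel (%x::'a. L * ((1 + x *. x)\<^sup>2 * gauss x))" by (intro integrable_mult_right gauss_moment_integrable)
    fix x :: 'a
    have "(1 + x *. x) * 1 <= (1 + x *. x) * (1 + x *. x)" by (intro mult_left_mono) auto
    then have "L * (1 + x *. x) <= L * (1 + x *. x)\<^sup>2" using L by (intro mult_left_mono) (auto simp: power2_eq_square)
    then have "A.V x <= L * (1 + x *. x)\<^sup>2" using A.V_le[of x] by (simp add: L_def)
    from mult_right_mono[OF this less_imp_le[OF gauss_pos[of x]]] show "A.V x * gauss x <= L * ((1 + x *. x)\<^sup>2 * gauss x)" by (simp add: mult.assoc)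
   qed
   then show ?thesis by (simp add: W_def WG_def)
  qed
  have IA0: "0 <= LI (%x. A.V x * gauss x)"
   by (intro bi_nonneg mult_nonneg_nonneg A.V_nonneg less_imp_le[OF gauss_pos])
  have IB: "b0 <= LI (%x. B.V x * gauss x)"
  proof -
   have "b0 = LI (%x. m2 / 2 * exp (- 1 / 2) * indicator (ball q sb) x)" by (simp add: b0_def vb)
   also have "... <= LI (%x. B.V x * gauss x)"
   proof (rule integral_mono[OF _ iB])
    show "integrable lborel (%x. m2 / 2 * exp (- 1 / 2) * indicator (ball q sb) x :: real)"
     by (intro integrable_mult_right integrable_real_indicator) (use emeasure_bounded_finite[of "ball q sb"] in auto)
    fix y :: 'a
    show "m2 / 2 * exp (- 1 / 2) * indicator (ball q sb) y <= B.V y * gauss y"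
    proof (cases "y : ball q sb")
     case True
     have yy: "y *. y <= 1" using qb(2)[OF True] by (simp add: power2_norm_eq_inner[symmetric] power_le_one)
     have "de * (2 + y *. y) <= m2 / 7 * 3" using de yy by (intro mult_mono) auto
     moreover have "U y - de * (2 + y *. y) <= B.V y" by (rule B.V_ge) (use qb True in auto)
     moreover have "m2 <= U y" using True by (intro low[OF q(3)]) simp
     ultimately have "m2 / 2 <= B.V y" using m2 by linarith
     moreover have "exp (- 1 / 2) <= gauss y" using yy by (simp add: gauss_def)
     ultimately have "m2 / 2 * exp (- 1 / 2) <= B.V y * gauss y" using m2 by (intro mult_mono) auto
     then show ?thesis using True by simp
    qed (simp add: B.V_nonneg less_imp_le gauss_pos)
   qed
   finally show ?thesis .
  qed
  define c where "c = LI (%x. A.V x * gauss x) / LI (%x. B.V x * gauss x)"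
  have c: "0 <= c" "c <= k" unfolding c_def k_def using IA IA0 IB b0 by (auto intro!: frac_le divide_nonneg_nonneg)
  have bal: "LI (%x. A.V x * gauss x) = c * LI (%x. B.V x * gauss x)" using IB b0 by (simp add: c_def)
  define w where "w x = A.u x - c * B.u x" for x
  have cw: "continuous_on UNIV w" unfolding w_def by (intro continuous_intros A.u_continuous B.u_continuous)
  have hw: "w (t *R x) = t * w x" if "t > 0" for t x using that by (simp add: w_def A.u_hom B.u_hom algebra_simps)
  have wU: "abs (w x) <= (1 + k) * U x" for x
  proof -
   have "0 <= c * B.u x" "c * B.u x <= k * U x" using c A.Unn[of x] B.u_nonneg[of x] B.u_le_U[of x] by (auto intro!: mult_mono)
   then show ?thesis using A.u_nonneg[of x] A.u_le_U[of x] by (simp add: w_def distrib_right)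
  qed
  have wM: "abs (w x) <= M * norm x" for x
   using wU[of x] mult_left_mono[OF A.growth[of x], of "1 + k"] k unfolding M_def L_def mult.assoc by linarith
  have dm: "abs (dmean w z s) <= s1 ^ 3" if "norm z <= 1" "s1 <= s" "s <= 1 / s1" for z s
  proof -
   have "abs (dmean w z s) <= Kd * sqrt de" unfolding w_def Kd_def
    by (rule dmean_u_bound[OF bal c s1(1) that(2) _ that(1) S_def mv_def]) (use that in "simp add: S0_def")
   then show ?thesis using Kd by linarith
  qed
  obtain a where a: "!!z. norm z <= 1 ==> abs (mean w z s1 - a *. z) <= 2 * (s1 ^ 3 / s1\<^sup>2) + 110 * M * mv2 * s1"
   using homogeneous_almost_linear[OF cw hw wM s1(1) s1'(1) dm] unfolding mv2_def by blast
  have "2 * (s1 ^ 3 / s1\<^sup>2) + 110 * M * mv2 * s1 = E1 * s1" using s1 by (simp add: E1_def power2_eq_square power3_eq_cube distrib_right)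
  then have a': "abs (mean w z s1 - a *. z) <= E1 * s1" if "norm z <= 1" for z using a[OF that] by simp
  have iw: "integrable lborel (%y. w (z + s1 *R y) * bump 3 y)" for z
   by (rule integrable_cts_supp[of _ 1]) (auto intro!: continuous_intros continuous_on_compose2[OF cw] simp: bump_zero)
  have "m2 / 2 * J <= mean w p s1"
  proof -
   have "LI (%y::'a. m2 / 2 * bump 3 y) <= LI (%y. w (p + s1 *R y) * bump 3 y)"
   proof (rule integral_mono[OF _ iw])
    show "integrable lborel (%y::'a. m2 / 2 * bump 3 y)" by (intro integrable_mult_right bump_integrable) simp
    fix y :: 'a
    show "m2 / 2 * bump 3 y <= w (p + s1 *R y) * bump 3 y"
    proof (cases "norm y <= 1")
     case True
     define v where "v = p + s1 *R y"
     have "dist p v <= s1" using True s1 by (simp add: v_def dist_norm mult_left_le)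
     then have v: "v : ball p sb" using s1 sb by simp
     have "de * norm v <= m2 / 7 * 1" using pb(2)[OF v] de by (intro mult_mono) auto
     moreover have "w v = U v - de * norm v" using pb(1) v A.disj by (auto simp: w_def A.u_def B.u_def)
     moreover have "m2 <= U v" using v by (intro low[OF p(3)]) simp
     ultimately have "m2 / 2 <= w v" using m2 by linarith
     then show ?thesis unfolding v_def by (intro mult_right_mono bump_nonneg)
    qed (simp add: bump_zero)
   qed
   then show ?thesis by (simp add: mean_def J_def I3_def)
  qed
  moreover have "abs (mean w p s1 - a *. p) <= al" using a'[of p] p s1' by simp
  ultimately have "al <= a *. p" unfolding al_def by linarith
  also have "a *. p <= norm a * norm p" by (rule norm_cauchy_schwarz)
  also have "... <= norm a * 1" using p by (intro mult_left_mono) auto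
  finally have na: "al <= norm a" by simp
  have strip: "abs (a *. x) <= E2 * s1" if x: "norm x <= 1" "U x = 0" for x
  proof -
   have "abs (mean w x s1) <= (M * s1) * J"
   proof -
    have ib: "integrable lborel (%y::'a. M * s1 * bump 3 y)" by (intro integrable_mult_right bump_integrable) simp
    have "abs (mean w x s1) <= LI (%y. abs (w (x + s1 *R y) * bump 3 y))" unfolding mean_def by (rule integral_abs_bound)
    also have "... <= LI (%y::'a. M * s1 * bump 3 y)"
    proof (rule integral_mono[OF integrable_abs[OF iw] ib])
     fix y :: 'a
     show "abs (w (x + s1 *R y) * bump 3 y) <= M * s1 * bump 3 y"
     proof (cases "norm y <= 1")
      case True
      have "U (x + s1 *R y) <= L * (s1 * norm y)" using ac_min_growth[OF U x(2), of "x + s1 *R y"] s1 by (simp add: L_def dist_norm)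
      also have "... <= L * (s1 * 1)" using True L s1 by (intro mult_left_mono) auto
      finally have "(1 + k) * U (x + s1 *R y) <= (1 + k) * (L * s1)" using k by (intro mult_left_mono) auto
      then have "abs (w (x + s1 *R y)) <= M * s1" using wU[of "x + s1 *R y"] by (simp add: M_def mult.assoc)
      then show ?thesis unfolding abs_mult abs_of_nonneg[OF bump_nonneg] by (intro mult_right_mono bump_nonneg)
     qed (simp add: bump_zero)
    qed
    finally show ?thesis by (simp add: J_def I3_def)
   qed
   moreover have "E2 * s1 = E1 * s1 + (M * s1) * J" by (simp add: E2_def algebra_simps)
   ultimately show ?thesis using a'[OF x(1)] by linarith
  qed
  define e where "e = a /\<^sub>R norm a"
  have "norm a ~= 0" using na al by linarith
  then have ne: "norm e = 1" by (simp add: e_def)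
  define Z where "Z = {x : ball 0 1. U x = 0}"
  define T where "T = {x : cball 0 1. abs (e *. x - 0) <= E2 * s1 / al}"
  have ZT: "Z \<subseteq> T"
  proof
   fix x assume x: "x : Z"
   then have "abs (a *. x) <= E2 * s1" by (intro strip) (auto simp: Z_def)
   then have "abs (a *. x) / norm a <= E2 * s1 / al" using na al E2 s1 by (intro frac_le) auto
   then show "x : T" using x by (simp add: T_def Z_def e_def divide_inverse mult.commute abs_mult)
  qed
  have "compact T"
  proof -
   have "T = cball 0 1 Int {x. abs (e *. x - 0) <= E2 * s1 / al}" by (auto simp: T_def)
   moreover have "closed {x. abs (e *. x - 0) <= E2 * s1 / al}" by (intro closed_Collect_le continuous_intros)
   ultimately show ?thesis by (simp add: compact_Int_closed)
  qed
  then have Tl: "T : lmeasurable" by (rule lmeasurable_compact)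
  have Zb: "Z : sets borel" unfolding Z_def by (rule zero_set_borel[OF U])
  have "measure lborel Z = measure lebesgue Z" using Zb by (simp add: measure_completion)
  also have "... <= measure lebesgue T" by (rule measure_mono_fmeasurable[OF ZT _ Tl]) (use Zb in simp)
  also have "... <= 6 * (E2 * s1 / al / 1) * measure lebesgue (cball (0::'a) (2 * 1))"
   unfolding T_def by (rule measure_strip_le[OF ne]) (use E2 s1 al in auto)
  also have "... = Y * s1" by (simp add: Y_def)
  finally have Zs: "measure lborel Z < dens" using s1Y by linarith
  have "c1 <= mean U 0 1"
  proof -
   have "mean U p sb = U p * I3 TYPE('a)"
   proof (rule ac_min_mean_harmonic[OF U])
    show "U x > 0" if "dist p x < sb" for x using low[OF p(3), of x] that m2 by simp
   qed (use sb in simp)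
   moreover have "mean U p sb <= A0 * (1 / sb) ^ DIM('a) * mean U 0 1"
    by (rule mean_kernel_le) (use sb p A.Unn in "auto intro: continuous_on_subset[OF A.cU]")
   moreover have "m * J <= U p * J" using p J by (intro mult_right_mono) auto
   ultimately have "m * J <= A0 * (1 / sb) ^ n * mean U 0 1" by (simp add: J_def n_def)
   then show ?thesis using A0 sb by (simp add: c1_def power_divide field_simps)
  qed
  then have "c1 * 1 <= dmean U 0 1" using homogeneous_dmean[OF A.cU A.hom] by simp
  from zero_set_density[OF U _ c1 this] have "dens <= measure lborel Z" by (simp add: dens_def Z_def)
  then show False using Zs by simp
 qed (use de in auto)
qed

section \<open>Application to Jacobi fields\<close>

lemma hess_bound:
 fixes U :: "'a::euclidean_space => real"
 assumes U: "ac_min U" and x: "U x > 0" and b: "onorm (hess U x) <= M" and n: "norm n = 1"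
 shows "abs (hess U x n *. n) <= M"
proof -
 obtain H where "(grad U has_derivative H) (at x)" using ac_min_harmonic_C2[OF U] x unfolding C2on_def by blast
 then have "bounded_linear (hess U x)" unfolding hess_def
  using frechet_derivative_at[of "grad U" H x] has_derivative_bounded_linear by metis
 from onorm[OF this, of n] have "norm (hess U x n) <= M" using b n by simp
 then show ?thesis using Cauchy_Schwarz_ineq2[of "hess U x n" n] n by simp
qed

text \<open>If the one-sided limit of the Hessian does not exist, \<open>Lim\<close> is the arbitrary constant \<open>THE l. False\<close>,
 so the mean curvature is bounded in any case.\<close>

lemma mean_curv_bound:
 fixes U :: "'a::euclidean_space => real"
 assumes U: "ac_min U" and p: "p : closure {x. U x > 0}" "U p = 0" and r: "r > 0"
  and b: "!!x. x : ball p r ==> U x > 0 ==> onorm (hess U x) <= M" and n: "norm (normal U p) = 1" and M: "M >= 0"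
 shows "abs (mean_curv U p) <= max M \<bar>THE l::real. False\<bar>"
proof -
 define F where "F = at p within {x. U x > 0}"
 have F: "F ~= bot" using p unfolding F_def by (auto simp: closure_def at_within_eq_bot_iff islimpt_def trivial_limit_within)
 define h where "h x = hess U x (normal U p) *. normal U p" for x
 have ev: "eventually (%x. abs (h x) <= M) F"
  unfolding F_def eventually_at h_def using r by (intro exI[of _ r]) (auto simp: dist_commute intro!: hess_bound[OF U _ b n])
 show ?thesis
 proof (cases "EX l. (h \<longlongrightarrow> l) F")
  case True
  then obtain l where l: "(h \<longlongrightarrow> l) F" by blast
  have "abs (l) <= M" by (rule tendsto_upperbound[OF tendsto_rabs[OF l] ev F])
  moreover have "mean_curv U p = - l" using tendsto_Lim[OF F l] by (simp add: mean_curv_def F_def h_def[abs_def])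
  ultimately show ?thesis by simp
 next
  case False
  then have "(%l. (h \<longlongrightarrow> l) F) = (%l. False)" by blast
  then have "Lim F h = (THE l. False)" unfolding t2_space_class.Lim_def by simp
  then have "mean_curv U p = - (THE l. False)" by (simp add: mean_curv_def F_def h_def[abs_def])
  then show ?thesis by simp
 qed
qed

lemma frontier_pos_zero:
 fixes U :: "'a::euclidean_space => real"
 assumes U: "ac_min U" and x: "x : frontier {x. U x > 0}"
 shows "U x = 0" "x : closure {x. U x > 0}"
proof -
 have o: "open {x. U x > 0}" by (rule open_pos_set[OF U])
 have "x ~: {x. U x > 0}" "x : closure {x. U x > 0}" using x o by (auto simp: frontier_def interior_open)
 then show "U x = 0" "x : closure {x. U x > 0}" using U by (auto simp: ac_min_def not_less intro: antisym)
qed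

lemma good_shift:
 assumes g: "good U z rh" and x: "U x = 0" "x : closure {x. U x > 0}" "dist z x <= rh / 2"
 shows "good U x (rh / 2)"
 unfolding good_def
proof (intro conjI ballI impI)
 have rh: "rh > 0" using g by (rule good_pos)
 show "rh / 2 > 0" using rh by simp
 fix y assume y: "y : ball x (rh / 2)" "U y > 0"
 have "y : ball z rh" using y x dist_triangle[of z y x] by simp
 then have "onorm (hess U y) <= 1 / rh" using g y by (simp add: good_def)
 also have "... <= 1 / (rh / 2)" using rh by (simp add: field_simps)
 finally show "onorm (hess U y) <= 1 / (rh / 2)" .
qed (use x in auto)

lemma normal_eq:
 fixes U :: "'a::euclidean_space => real"
 assumes r: "reg_pt c C U x rh e" and c: "c > 0" "C > 0" "rh > 0" and x: "x : closure {x. U x > 0}" "U x = 0"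
 shows "normal U x = e"
 unfolding normal_def
proof (rule tendsto_Lim)
 show "at x within {x. U x > 0} ~= bot" using x by (auto simp: closure_def trivial_limit_within)
 show "(grad U \<longlongrightarrow> e) (at x within {x. U x > 0})"
 proof (rule Lim_transform_bound[THEN iffD1[OF LIM_zero_iff]])
  show "eventually (%y. norm (grad U y - e) <= norm (C * dist x y / rh)) (at x within {x. U x > 0})"
   unfolding eventually_at using r c
   by (intro exI[of _ "c * rh"]) (auto simp: reg_pt_def dist_commute)
  have "((%y. C * dist x y / rh) \<longlongrightarrow> C * dist x x / rh) (at x within {x. U x > 0})" by (intro tendsto_intros) (use c in auto)
  then show "((%y. C * dist x y / rh) \<longlongrightarrow> 0) (at x within {x. U x > 0})" by simp
 qed
qed

text \<open>A quadratic error is below \<open>eps * s\<close> at small scales \<open>s\<close>,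
  whatever \<open>eps > 0\<close> is; \<open>norm e = 1\<close> matches the unit slope demanded by
  \<open>Reg\<close>.\<close>

lemma reg_pt_Reg:
 fixes U :: "'a::euclidean_space => real"
 assumes r: "reg_pt c C U x rh e" and c: "c > 0" "C > 0" "rh > 0" and x: "x : frontier {x. U x > 0}" and e: "norm e = 1" and eps: "eps > 0"
 shows "x : Reg eps U"
proof -
 define s where "s = min (c * rh) (eps * rh / (2 * C))"
 have "0 < c * rh" "0 < eps * rh / (2 * C)" using c eps by auto
 then have s: "0 < s" "s <= c * rh" "s <= eps * rh / (2 * C)" unfolding s_def by linarith+
 have "C * s / rh <= eps / 2" using s(3) c by (simp add: field_simps)
 have "abs (U y - max 0 ((y - x) *. e)) < eps * s" if y: "y : ball x s" for y
 proof -
  have "abs (U y - max 0 (e *. (y - x))) <= C * (dist x y)\<^sup>2 / rh" using r y s unfolding reg_pt_def by auto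
  also have "... <= C * s\<^sup>2 / rh" using y c by (intro divide_right_mono mult_left_mono power_mono) auto
  also have "... = (C * s / rh) * s" by (simp add: power2_eq_square)
  also have "... <= (eps / 2) * s" using \<open>C * s / rh <= eps / 2\<close> s by (intro mult_right_mono) auto
  also have "... < eps * s" using eps s by simp
  finally show ?thesis by (simp add: inner_commute)
 qed
 then show ?thesis unfolding Reg_def free_bdry_def using x s e by blast
qed

text \<open>At each frontier point near \<open>z\<close> the Hessian bound persists with
  \<open>rh / 2\<close>, so there is a unit normal, close to \<open>u\<close>. From positive points,
  vectors in the cone around \<open>u\<close> are captured because the gradient is within 1/32 of
  \<open>u\<close>.\<close>

lemma good_lip_dom:
 "EX k>0. k <= 1/64 & (ALL (U :: 'a::euclidean_space => real) z rh R. ac_min U --> good U z rh --> 0 < R --> R <= k * rh -->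
  (EX u. lip_dom {x. U x > 0} z R u (normal U)) & (ALL eps>0. frontier {x. U x > 0} Int ball z R \<subseteq> Reg eps U))"
proof -
 obtain c C where cC: "0 < c" "c <= 1/4" "C > 0" and N: "!!(U::'a => real) z rh. ac_min U ==> good U z rh ==> EX e. reg_pt c C U z rh e"
  using normal_exists by metis
 define k where "k = min (1/64) (min (c / 4) (1 / (32 * C)))"
 have "1 / (32 * C) > 0" using cC by simp
 then have k: "0 < k" "k <= 1/64" "k <= c / 4" "k <= 1 / (32 * C)" using cC unfolding k_def by linarith+
 show ?thesis
 proof (intro exI[of _ k] conjI allI impI)
  show "0 < k" "k <= 1/64" by (fact k)+
  fix U :: "'a => real" and z rh R
  assume U: "ac_min U" and g: "good U z rh" and R: "0 < R" "R <= k * rh"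
  define Om where "Om = {x. U x > 0}"
  have rh: "rh > 0" using g by (rule good_pos)
  have Rb: "R <= rh / 64" "2 * R <= c * (rh / 2)" "C * R / rh <= 1/32"
  proof -
   show "R <= rh / 64" using R mult_right_mono[OF k(2), of rh] rh by linarith
   have "k * rh <= c / 4 * rh" using k(3) rh by (intro mult_right_mono) auto
   then have "2 * R <= 2 * (c / 4 * rh)" using R by linarith
   then show "2 * R <= c * (rh / 2)" by (simp add: mult.commute)
   have "R <= 1 / (32 * C) * rh" using R mult_right_mono[OF k(4), of rh] rh by linarith
   then show "C * R / rh <= 1/32" using cC rh by (simp add: field_simps)
  qed
  obtain u where u: "reg_pt c C U z rh u" using N[OF U g] by blast
  have nu: "norm u = 1" by (rule normal_unit[OF U g u cC(1,3)])
  have gradu: "norm (grad U x - u) <= C * dist z x / rh" if "dist z x <= c * rh" "U x > 0" for x using u that unfolding reg_pt_def by blast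
  have "c * (rh / 2) <= c * rh" using cC rh by simp
  then have crh: "2 * R <= c * rh" using Rb(2) by linarith
  have o: "open Om" unfolding Om_def by (rule open_pos_set[OF U])
  have fr: "EX e. reg_pt c C U x (rh / 2) e & norm e = 1 & normal U x = e" if x: "x : frontier Om Int ball z R" for x
  proof -
   have x0: "U x = 0" "x : closure {x. U x > 0}" using frontier_pos_zero[OF U, of x] x by (auto simp: Om_def)
   have gx: "good U x (rh / 2)" by (rule good_shift[OF g x0]) (use x Rb rh in auto)
   obtain e where e: "reg_pt c C U x (rh / 2) e" using N[OF U gx] by blast
   have "norm e = 1" by (rule normal_unit[OF U gx e cC(1,3)])
   moreover have "normal U x = e" by (rule normal_eq[OF e cC(1,3) _ x0(2,1)]) (use rh in simp)
   ultimately show ?thesis using e by blast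
  qed
  have "lip_dom Om z R u (normal U)" unfolding lip_dom_def
  proof (intro conjI allI impI ballI)
   show "z : closure Om" using g by (simp add: good_def Om_def)
   fix x v assume x: "x : closure Om" "x : ball z R" and v: "x + v : ball z R" "v ~= 0" "norm v / 8 <= v *. u"
   have nv: "norm v > 0" using v by simp
   have v2: "norm v <= 2 * R" using dist_triangle[of x "x + v" z] x v by (simp add: dist_norm norm_minus_commute)
   \<comment> \<open>A quantitative lower bound instead of mere positivity, so that the conclusion
     survives the passage from \<open>Om\<close> to its closure.\<close>
   have low: "U (y + v) >= norm v / 16" if y: "y : Om" "dist z y < R" "dist z (y + v) < R" for y
   proof -
    have Uy: "U y > 0" using y by (simp add: Om_def)
    have "norm (grad U y - u) <= C * dist z y / rh" by (rule gradu[OF _ Uy]) (use y crh R in linarith)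
    also have "... <= C * R / rh" using y cC rh by (intro divide_right_mono mult_left_mono) auto
    finally have "norm (grad U y - u) <= 1/32" using Rb by linarith
    then have "abs ((grad U y - u) *. v) <= 1/32 * norm v" using Cauchy_Schwarz_ineq2[of "grad U y - u" v] mult_right_mono[of "norm (grad U y - u)" "1/32" "norm v"] by simp
    moreover have "(grad U y - u) *. v = grad U y *. v - v *. u" by (simp add: inner_diff_left inner_commute[of v])
    ultimately have gv: "grad U y *. v >= 3/32 * norm v" using v(3) by linarith
    have "norm v * norm v <= norm v * (rh / 32)" using v2 Rb by (intro mult_left_mono) auto
    then have q: "(norm v)\<^sup>2 / rh <= norm v / 32" using rh by (simp add: power2_eq_square field_simps)
    have inb: "y : ball z rh" "y + v : ball z rh" using y Rb rh by auto
    have "closed_segment y (y + v) \<subseteq> {x. U x > 0} Int ball z rh"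
    proof (rule capture[OF U g Uy inb])
     show "(norm (y + v - y))\<^sup>2 / rh < U y + grad U y *. (y + v - y)" unfolding add_diff_cancel_left' using gv q nv Uy by linarith
    qed
    from grad_lipschitz_segment(2)[OF U g this] have "abs (U (y + v) - U y - grad U y *. v) <= (norm v)\<^sup>2 / rh" by simp
    then show ?thesis using gv q Uy nv by linarith
   qed
   show "x + v : Om"
   proof (rule ccontr)
    assume "x + v ~: Om"
    then have "U (x + v) <= 0" by (simp add: Om_def)
    then have "U (x + v) < norm v / 16" using nv by linarith
    \<comment> \<open>An open neighbourhood of \<open>x\<close> made of points violating
      \<open>low\<close>; as \<open>x\<close> is in the closure of \<open>Om\<close>, it would meet
      \<open>Om\<close>.\<close>
    define T where "T = {y. U (y + v) < norm v / 16} Int ({y. dist z y < R} Int {y. dist z (y + v) < R})"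
    have "continuous_on UNIV (%y. U (y + v))"
     by (rule continuous_on_compose2[of UNIV U]) (use U in "auto simp: ac_min_def intro!: continuous_intros")
    then have "open T" unfolding T_def by (intro open_Int open_Collect_less continuous_intros)
    moreover have "x : T" using \<open>U (x + v) < norm v / 16\<close> x v by (simp add: T_def)
    moreover have "U (y + v) < norm v / 16 & dist z y < R & dist z (y + v) < R" if "y : T" for y using that by (simp add: T_def)
    ultimately have T: "open T" "x : T" "!!y. y : T ==> U (y + v) < norm v / 16 & dist z y < R & dist z (y + v) < R" by blast+
    obtain y where "y : T" "y : Om" using x(1) T(1,2) open_Int_closure_eq_empty[of T Om] by blast
    then show False using T(3)[of y] low[of y] by fastforce
   qed
  next
   fix x assume x: "x : frontier Om Int ball z R"
   obtain e where e: "reg_pt c C U x (rh / 2) e" "norm e = 1" "normal U x = e" using fr[OF x] by blast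
   show "norm (normal U x) = 1" using e by simp
   \<comment> \<open>The normals at \<open>x\<close> and at \<open>z\<close> are compared through
     the gradient at one positive point \<open>y\<close> near \<open>x\<close>.\<close>
   have "x : closure Om" using x by (auto simp: frontier_def)
   then obtain y where y: "y : Om" "dist y x < R" using R(1) closure_approachable by metis
   have Uy: "U y > 0" using y by (simp add: Om_def)
   have d: "dist x y <= R" "dist z y <= 2 * R" using y x dist_triangle[of z y x] by (auto simp: dist_commute)
   have "norm (grad U y - e) <= C * dist x y / (rh / 2)" using e(1) Uy d Rb R unfolding reg_pt_def by auto
   also have "... <= C * R / (rh / 2)" using d cC rh by (intro divide_right_mono mult_left_mono) auto
   also have "... = 2 * (C * R / rh)" by simp
   finally have 1: "norm (grad U y - e) <= 1/16" using Rb(3) by linarith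
   have "norm (grad U y - u) <= C * dist z y / rh" by (rule gradu[OF _ Uy]) (use d crh in linarith)
   also have "... <= C * (2 * R) / rh" using d cC rh by (intro divide_right_mono mult_left_mono) auto
   also have "... = 2 * (C * R / rh)" by simp
   finally have 2: "norm (grad U y - u) <= 1/16" using Rb(3) by linarith
   have "norm (e - u) <= norm (grad U y - u) + norm (grad U y - e)"
    using norm_triangle_ineq4[of "grad U y - u" "grad U y - e"] by simp
   then show "norm (normal U x - u) <= 1/8" using 1 2 e by simp
  qed (use o nu R in auto)
  then show "EX u. lip_dom {x. U x > 0} z R u (normal U)" unfolding Om_def by blast
  show "frontier {x. U x > 0} Int ball z R \<subseteq> Reg eps U" if "eps > 0" for eps
  proof
   fix x assume x: "x : frontier {x. U x > 0} Int ball z R"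
   obtain e where e: "reg_pt c C U x (rh / 2) e" "norm e = 1" using fr[of x] x unfolding Om_def by blast
   show "x : Reg eps U" by (rule reg_pt_Reg[OF e(1) cC(1,3) _ _ e(2) that]) (use rh x in auto)
  qed
 qed
qed

text \<open>The Robin coefficient is the mean curvature, which is bounded near a good point;
  shrinking \<open>R\<close> makes \<open>K * R\<close> as small as the barrier arguments require.
  The point \<open>y\<close> provided is the one at height \<open>R / 8\<close> above
  \<open>z\<close>.\<close>

lemma jacobi_boundary_harnack:
 fixes rh :: real
 assumes rh: "rh > 0"
 shows "EX R C. 0 < R & R <= rh & C > 0 & (ALL (U :: 'a::euclidean_space => real) ph eps z x. ac_min U --> eps > 0 --> pos_jacobi eps U ph --> good U z rh -->
  x : closure {x. U x > 0} --> dist z x <= R / 128 -->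
  (EX y. cball y (R / 16) \<subseteq> {x. U x > 0} & dist x y <= R & ph x <= C * ph y & ph y <= C * ph x))"
proof -
 obtain k where k: "k > 0" "k <= 1/64" and kL: "!!(U :: 'a => real) z rh R. ac_min U ==> good U z rh ==> 0 < R ==> R <= k * rh ==>
  (EX u. lip_dom {x. U x > 0} z R u (normal U)) & (ALL eps>0. frontier {x. U x > 0} Int ball z R \<subseteq> Reg eps U)"
  using good_lip_dom by metis
 obtain ka Cu where ka: "0 < ka" "ka <= 1" and Cu: "Cu > 0" and up: "!!Om z R u \<nu> K ph (g :: 'a => 'a) x. lip_dom Om z R u \<nu> ==> robin Om z R \<nu> K ph g ==> K >= 0 ==> K * R <= ka
  ==> x : closure Om ==> dist z x <= R / 128 ==> ph x <= Cu * ph (z + (R/8) *R u)"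
  using robin_upper[where 'a='a] by metis
 \<comment> \<open>The second entry covers the arbitrary value of \<open>Lim\<close> when no limit
   exists; it is a fixed real number, so \<open>K\<close> depends on \<open>rh\<close> only.\<close>
 define K where "K = max (1 / (rh / 2)) \<bar>THE l::real. False\<bar>"
 have K: "K > 0" using rh by (simp add: K_def less_max_iff_disj)
 define R where "R = min (k * rh) (ka / K)"
 have "0 < k * rh" "0 < ka / K" using k rh ka K by auto
 then have R: "0 < R" "R <= k * rh" "R <= ka / K" unfolding R_def by linarith+
 have KR: "K * R <= ka" using R(3) K by (simp add: field_simps)
 have Rrh: "R <= rh / 64" using R mult_right_mono[OF k(2), of rh] rh by linarith
 define C where "C = max Cu (AH TYPE('a) / cE TYPE('a))"
 have C: "C > 0" using Cu by (simp add: C_def)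
 show ?thesis
 proof (rule exI[of _ R], rule exI[of _ C], intro conjI allI impI)
  show "0 < R" "C > 0" "R <= rh" using R C Rrh rh by auto
  fix U :: "'a => real" and ph eps z x
  assume U: "ac_min U" and eps: "eps > 0" and J: "pos_jacobi eps U ph" and g: "good U z rh" and x: "x : closure {x. U x > 0}" "dist z x <= R / 128"
  define Om where "Om = {x. U x > 0}"
  define X where "X = closure Om - Sing eps U"
  have o: "open Om" unfolding Om_def by (rule open_pos_set[OF U])
  obtain u where L: "lip_dom Om z R u (normal U)" and Rg: "frontier Om Int ball z R \<subseteq> Reg eps U" using kL[OF U g R(1,2)] eps unfolding Om_def by blast
  have BX: "closure Om Int ball z R \<subseteq> X" using Rg by (auto simp: X_def Sing_def free_bdry_def Om_def)
  note J' = J[unfolded pos_jacobi_def Let_def, folded Om_def, folded X_def]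
  have pos: "ph x > 0" if "x : X" for x using conjunct1[OF J'] that by blast
  obtain gg Hs where A: "continuous_on X ph" "continuous_on X gg" "ALL b:Basis. continuous_on X (%x. Hs x b)"
   "ALL x:Om. (ph has_derivative (%h. gg x *. h)) (at x) & (gg has_derivative Hs x) (at x)" "ALL x:Om. (\<Sum>b\<in>Basis. Hs x b *. b) = 0"
   "ALL p:Reg eps U. gg p *. normal U p + mean_curv U p * ph p = 0"
   using conjunct2[OF J'] by (elim conjE exE) (rule that; assumption)
  have cont: "continuous_on X ph" "continuous_on X gg" "!!b. b : Basis ==> continuous_on X (%x. Hs x b)" using A(1-3) by auto
  have d: "(ph has_derivative (%h. gg x *. h)) (at x)" "(gg has_derivative Hs x) (at x)" "(\<Sum>b\<in>Basis. Hs x b *. b) = 0" if "x : Om" for x using A(4,5) that by auto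
  have bc: "gg p *. normal U p + mean_curv U p * ph p = 0" if "p : Reg eps U" for p using A(6) that by blast
  have B: "robin Om z R (normal U) K ph gg" unfolding robin_def
  proof (intro conjI ballI)
   show "continuous_on (closure Om Int ball z R) ph" "continuous_on (closure Om Int ball z R) gg"
    using cont BX by (auto intro: continuous_on_subset)
   have sub: "Om Int ball z R \<subseteq> X" using BX closure_subset[of Om] by blast
   show "C2on (Om Int ball z R) ph gg (%_. 0)"
    by (rule C2onI[of _ _ _ Hs]) (use d continuous_on_subset[OF cont(3) sub] in auto)
   show "ph x > 0" if "x : closure Om Int ball z R" for x using pos that BX by blast
   fix p assume p: "p : frontier Om Int ball z R"
   have p0: "U p = 0" "p : closure {x. U x > 0}" using frontier_pos_zero[OF U, of p] p by (auto simp: Om_def)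
   have "good U p (rh / 2)" by (rule good_shift[OF g p0]) (use p Rrh rh in auto)
   then have "abs (mean_curv U p) <= K" unfolding K_def
    by (intro mean_curv_bound[OF U p0(2,1), of "rh / 2"]) (use L p rh in "auto simp: good_def lip_dom_def")
   moreover have "ph p > 0" using pos p BX by (auto simp: frontier_def)
   moreover have "gg p *. normal U p = - (mean_curv U p * ph p)" using bc[of p] Rg p by auto
   ultimately show "abs (gg p *. normal U p) <= K * ph p" by (simp add: abs_mult)
  qed
  have nu: "norm u = 1" and z: "z : closure Om" using L by (auto simp: lip_dom_def)
  define y where "y = z + (R/8) *R u"
  have yx: "cball y (R / 16) \<subseteq> Om" using lip_dom_ball[OF L z, of "R/8"] R by (simp add: y_def)
  have py: "ph y > 0" using yx BX R nu pos[of y] closure_subset[of Om] by (auto simp: y_def dist_norm subset_iff)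
  have "ph x > 0" using x R pos[of x] BX by (auto simp: Om_def)
  have "ph x <= Cu * ph y" unfolding y_def by (rule up[OF L B _ KR]) (use K x in "auto simp: Om_def")
  also have "... <= C * ph y" using py by (intro mult_right_mono) (auto simp: C_def)
  finally have 1: "ph x <= C * ph y" .
  have "cE TYPE('a) * ph y <= AH TYPE('a) * ph x" unfolding y_def
   by (rule robin_lower[OF L B]) (use K KR ka x R in "auto simp: Om_def")
  then have "ph y <= AH TYPE('a) / cE TYPE('a) * ph x" using cE_pos[where 'a='a] by (simp add: field_simps)
  also have "... <= C * ph x" using \<open>ph x > 0\<close> by (intro mult_right_mono) (auto simp: C_def)
  finally have 2: "ph y <= C * ph x" .
  have "dist x y <= dist z x + dist z y" by (metis dist_commute dist_triangle)
  then have "dist x y <= R" using x R nu by (simp add: y_def dist_norm)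
  then show "EX y. cball y (R / 16) \<subseteq> {x. U x > 0} & dist x y <= R & ph x <= C * ph y & ph y <= C * ph x"
   using yx 1 2 unfolding Om_def by blast
 qed
qed

section \<open>Harnack inequality between interior points\<close>

lemma ray_connected_component:
 fixes D :: "'a::real_normed_vector set"
 assumes D: "!!x t. x : D ==> t > 0 ==> t *R x : D" and x: "connected_component D a x" and t: "t > 0"
 shows "connected_component D a (t *R x)"
proof -
 have xD: "x : D" using connected_component_in[OF x] by simp
 have "connected ((%s. s *R x) ` {0<..})" by (intro connected_continuous_image continuous_intros convex_connected) auto
 moreover have "(%s. s *R x) ` {0<..} \<subseteq> D" using D xD by auto
 moreover have "x : (%s. s *R x) ` {0<..}" by (rule image_eqI[of _ _ 1]) auto
 moreover have "t *R x : (%s. s *R x) ` {0<..}" using t by auto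
 ultimately have "connected_component D x (t *R x)" unfolding connected_component_def by blast
 with x show ?thesis by (rule connected_component_trans)
qed

text \<open>Otherwise the component of \<open>p\<close> and the rest of the set would form a
  \<open>cone_split\<close>: both are open, and invariant under dilations because rays stay inside
  the set.\<close>

lemma cone_connected:
 fixes m :: real
 assumes m: "m > 0"
 shows "EX de>0. ALL (U :: 'a::euclidean_space => real) p q. ac_min U --> (ALL t>0. ALL x. U (t *R x) = t * U x) --> norm p <= 1/2 --> norm q <= 1/2 -->
  m <= U p --> m <= U q --> connected_component {x. U x > de * norm x} p q"
proof -
 obtain de where de: "de > 0" "de <= 1" "de <= m" and imp: "!!(U :: 'a => real) C1 C2 p q. cone_split U de C1 C2 ==> norm p <= 1/2 ==> norm q <= 1/2 ==>
  p : C1 ==> q : C2 ==> m <= U p ==> m <= U q ==> False"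
  using cone_split_impossible[OF m, where 'a='a] by metis
 show ?thesis
 proof (intro exI[of _ de] conjI allI impI)
  fix U :: "'a => real" and p q
  assume U: "ac_min U" and hom: "ALL t>0. ALL x. U (t *R x) = t * U x" and p: "norm p <= 1/2" "m <= U p" and q: "norm q <= 1/2" "m <= U q"
  define D where "D = {x. U x > de * norm x}"
  have inD: "x : D" if "norm x <= 1/2" "m <= U x" for x
  proof -
   have "de * norm x <= de * (1/2)" using that(1) de by (intro mult_left_mono) auto
   then have "de * norm x < U x" using that(2) de by linarith
   then show ?thesis by (simp add: D_def)
  qed
  have Dc: "t *R x : D" if "x : D" "t > 0" for x t
   using that hom by (simp add: D_def mult.left_commute)
  have cU: "continuous_on UNIV U" using U by (simp add: ac_min_def)
  have oD: "open D" unfolding D_def by (intro open_Collect_less continuous_intros cU)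
  define C1 where "C1 = connected_component_set D p"
  define C2 where "C2 = D - C1"
  have o1: "open C1" unfolding C1_def by (rule open_connected_component[OF oD])
  have o2: "open C2"
  proof (rule openI)
   fix x assume x: "x : C2"
   have "connected_component_set D x \<subseteq> C2"
   proof
    fix y assume y: "y : connected_component_set D x"
    then have "y : D" using connected_component_in[of D x y] by simp
    moreover have "y ~: C1" using x y connected_component_sym[of D x y] connected_component_trans[of D p y x] by (auto simp: C1_def C2_def)
    ultimately show "y : C2" by (simp add: C2_def)
   qed
   moreover have "open (connected_component_set D x)" "x : connected_component_set D x" using open_connected_component[OF oD] x by (auto simp: C2_def)
   ultimately show "EX e>0. ball x e \<subseteq> C2" by (meson open_contains_ball subset_trans)
  qed
  have sub: "C1 \<subseteq> D" unfolding C1_def by (rule connected_component_subset)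
  have k1: "t *R x : C1" if "x : C1" "t > 0" for x t
   using ray_connected_component[of D p x t] Dc that by (simp add: C1_def)
  have k2: "t *R x : C2" if "x : C2" "t > 0" for x t
   using k1[of "t *R x" "1/t"] Dc[of x t] that by (auto simp: C2_def)
  have "cone_split U de C1 C2"
  proof (intro cone_split.intro cone_piece.intro)
   show "C1 Un C2 = {x. U x > de * norm x}" "C2 Un C1 = {x. U x > de * norm x}" using sub by (auto simp: C2_def D_def)
  qed (use U hom de o1 o2 k1 k2 in "auto simp: C2_def")
  then have "q ~: C2" using imp[of U C1 C2 p q] p q inD[of p] by (auto simp: C1_def)
  then show "connected_component {x. U x > de * norm x} p q" using inD[of q] q by (simp add: C2_def C1_def D_def)
 qed (use de in auto)
qed

text \<open>Pigeonhole instead of an explicit chain: on the connected set \<open>f\<close> takes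
  \<open>N + 1\<close> equally spaced values from \<open>f y\<close> to \<open>f x\<close>, and two
  of the corresponding points share one of the \<open>N\<close> covering balls. If
  \<open>f x - f y > N * l\<close>, their values differ by more than \<open>l\<close>, a
  contradiction.\<close>

lemma connected_oscillation_bound:
 fixes s R :: real
 assumes s: "s > 0"
 shows "EX N::nat. ALL (T :: 'a::euclidean_space set) f l x y. connected T --> T \<subseteq> cball 0 R --> continuous_on T f --> (0::real) <= l -->
  (ALL x:T. ALL y:T. dist x y < s --> f x <= f y + l) --> x : T --> y : T --> f x <= f y + real N * l"
proof -
 have "EX K. finite K & cball (0::'a) R \<subseteq> (\<Union>x\<in>K. ball x (s/2))"
  using compact_cball[of "0::'a" R] s unfolding compact_eq_totally_bounded by (auto dest!: spec[of _ "s/2"])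
 then obtain K where K: "finite K" "cball (0::'a) R \<subseteq> (\<Union>x\<in>K. ball x (s/2))" by blast
 define N where "N = card K"
 show ?thesis
 proof (intro exI[of _ N] allI impI)
  fix T :: "'a set" and f :: "'a => real" and l x y
  assume T: "connected T" "T \<subseteq> cball 0 R" and f: "continuous_on T f" and l: "0 <= l"
   and h: "ALL x:T. ALL y:T. dist x y < s --> f x <= f y + l" and x: "x : T" and y: "y : T"
  show "f x <= f y + real N * l"
  proof (rule ccontr)
   assume neg: "~ ?thesis"
   define L where "L = f x - f y"
   have L: "L > real N * l" using neg by (simp add: L_def)
   have "K ~= {}" using K(2) T(2) x by auto
   then have N: "N > 0" using K(1) by (simp add: N_def card_gt_0_iff)
   have L0: "L > 0" using L l N by (meson le_less_trans mult_nonneg_nonneg of_nat_0_le_iff)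
   have LN: "L / real N > l" using L N by (simp add: field_simps)
   have "EX v:T. f v = f y + real j * (L / real N)" if j: "j <= N" for j
   proof -
    have "connected (f ` T)" by (rule connected_continuous_image[OF f T(1)])
    then have "{f y..f x} \<subseteq> f ` T" by (rule connected_contains_Icc) (use x y in auto)
    moreover have "real j * (L / real N) <= real N * (L / real N)" using j L0 by (intro mult_right_mono) auto
    then have "f y + real j * (L / real N) : {f y..f x}" using L0 N by (simp add: L_def)
    ultimately show ?thesis by (metis (no_types, lifting) imageE subsetD)
   qed
   then obtain v where v: "!!j. j <= N ==> v j : T" "!!j. j <= N ==> f (v j) = f y + real j * (L / real N)" by metis
   have "EX k:K. v j : ball k (s/2)" if "j <= N" for j using v(1)[OF that] T(2) K(2) by blast
   then obtain k where k: "!!j. j <= N ==> k j : K" "!!j. j <= N ==> v j : ball (k j) (s/2)" by metis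
   have "~ inj_on k {0..N}"
   proof
    assume "inj_on k {0..N}"
    then have "card {0..N} <= card K" by (rule card_inj_on_le) (use k K in auto)
    then show False by (simp add: N_def)
   qed
   then obtain i j where ij: "i <= N" "j <= N" "i < j" "k i = k j"
    unfolding inj_on_def by (metis atLeastAtMost_iff linorder_neqE_nat)
   have "dist (v j) (v i) < s" using k(2)[OF ij(1)] k(2)[OF ij(2)] ij(4) dist_triangle[of "v j" "v i" "k i"] by (simp add: dist_commute)
   then have 1: "f (v j) <= f (v i) + l" using h v(1) ij by blast
   have "real i + 1 <= real j" using ij(3) by linarith
   then have "(real i + 1) * (L / real N) <= real j * (L / real N)" using L0 by (intro mult_right_mono) auto
   then have "f (v i) + L / real N <= f (v j)" unfolding v(2)[OF ij(1)] v(2)[OF ij(2)] distrib_right by linarith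
   then show False using 1 LN by linarith
  qed
 qed
qed

text \<open>\<open>connected_oscillation_bound\<close> for \<open>ln (ph x)\<close> on a connected
  part of the shell 3/4 <= |x| <= 5/4 where \<open>U\<close> is bounded below, so that the zero set
  is at a definite distance.\<close>

lemma interior_harnack:
 fixes r :: real
 assumes r: "r > 0"
 shows "EX C>0. ALL (U :: 'a::euclidean_space => real) ph g y y'. ac_min U --> (ALL t>0. ALL x. U (t *R x) = t * U x) --> C2on {x. U x > 0} ph g (%_. 0) -->
  (ALL x. U x > 0 --> ph x > 0) --> 3/4 <= norm y --> norm y <= 5/4 --> 3/4 <= norm y' --> norm y' <= 5/4 -->
  cball y r \<subseteq> {x. U x > 0} --> cball y' r \<subseteq> {x. U x > 0} --> ph y <= C * ph y'"
proof -
 obtain c where c: "c > 0" and nd: "!!(U :: 'a => real) x r. ac_min U ==> r > 0 ==> (!!y. dist x y < r ==> U y > 0) ==> c * r <= U x"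
  using ac_min_nondegenerate[where 'a='a] by metis
 define m where "m = c * r / 4"
 have m: "m > 0" using c r by (simp add: m_def)
 obtain de where de: "de > 0" and con: "!!(U :: 'a => real) p q. ac_min U ==> (ALL t>0. ALL x. U (t *R x) = t * U x) ==> norm p <= 1/2 ==> norm q <= 1/2 ==>
  m <= U p ==> m <= U q ==> connected_component {x. U x > de * norm x} p q"
  using cone_connected[OF m, where 'a='a] by (elim exE conjE) (rule that; blast)
 \<comment> \<open>On the part of the shell used below \<open>U > 3/4 * de\<close>; by linear
   growth, balls of radius \<open>3 * s\<close> contain no zero, as
   \<open>LU * (3 * s) = 3/8 * de\<close>.\<close>
 define s where "s = de / (8 * LU TYPE('a))"
 have LU: "LU TYPE('a) > 0" by (rule LU_pos)
 have s: "s > 0" using de LU by (simp add: s_def)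
 have sL: "LU TYPE('a) * (3 * s) = 3/8 * de" using LU by (simp add: s_def)
 obtain N where N: "!!(T :: 'a set) f l x y. connected T ==> T \<subseteq> cball 0 2 ==> continuous_on T f ==> (0::real) <= l ==>
  (ALL x:T. ALL y:T. dist x y < s --> f x <= f y + l) ==> x : T ==> y : T ==> f x <= f y + real N * l"
  using connected_oscillation_bound[OF s, where 'a='a and R = 2] by (elim exE conjE) (rule that; blast)
 define A where "A = AH TYPE('a)"
 have A: "A >= 1" unfolding A_def by (rule AH_ge_1)
 show ?thesis
 proof (intro exI[of _ "exp (real N * ln A)"] conjI allI impI)
  show "exp (real N * ln A) > 0" by simp
  fix U :: "'a => real" and ph g y y'
  assume U: "ac_min U" and hom: "ALL t>0. ALL x. U (t *R x) = t * U x" and ph: "C2on {x. U x > 0} ph g (%_. 0)" "ALL x. U x > 0 --> ph x > 0"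
   and y: "3/4 <= norm y" "norm y <= 5/4" and y': "3/4 <= norm y'" "norm y' <= 5/4"
   and b: "cball y r \<subseteq> {x. U x > 0}" "cball y' r \<subseteq> {x. U x > 0}"
  \<comment> \<open>Points are scaled by 1/4 because connectedness was shown for points of norm at
    most 1/2.\<close>
  have low: "m <= U ((1/4) *R v)" if "cball v r \<subseteq> {x. U x > 0}" for v
  proof -
   have "c * r <= U v"
   proof (rule nd[OF U r])
    show "U y > 0" if "dist v y < r" for y using subsetD[OF \<open>cball v r \<subseteq> {x. U x > 0}\<close>, of y] that by simp
   qed
   moreover have "U ((1/4) *R v) = 1/4 * U v" using hom[rule_format, of "1/4" v] by simp
   ultimately show ?thesis by (simp add: m_def)
  qed
  define D where "D = {x. U x > de * norm x}"
  have Dc: "t *R x : D" if "x : D" "t > 0" for x t using that hom by (simp add: D_def mult.left_commute)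
  have cc: "connected_component D ((1/4) *R y) ((1/4) *R y')" unfolding D_def
   by (rule con[OF U hom]) (use y y' low b in auto)
  define Q where "Q = connected_component_set D ((1/4) *R y)"
  have QD: "Q \<subseteq> D" unfolding Q_def by (rule connected_component_subset)
  have yQ: "(1/4) *R y : Q" "(1/4) *R y' : Q"
   using cc connected_component_in(1)[OF cc] by (simp_all add: Q_def)
  have Q0: "x ~= 0" if "x : Q" for x
  proof
   assume "x = 0"
   moreover have "U 0 = 0" using hom[rule_format, of 2 0] by simp
   ultimately show False using that QD by (auto simp: D_def)
  qed
  \<comment> \<open>Radial rescaling of the component to an interval of radii: the image is still
    connected and lies in a bounded shell, whereas the component is an unbounded cone.\<close>
  define F where "F p = (snd p / norm (fst p)) *R fst p" for p :: "'a \<times> real"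
  define T where "T = F ` (Q \<times> {3/4..5/4})"
  have cT: "connected T" unfolding T_def
  proof (rule connected_continuous_image)
   show "continuous_on (Q \<times> {3/4..5/4}) F" unfolding F_def using Q0 by (intro continuous_intros) auto
   show "connected (Q \<times> {3/4..5/4::real})" unfolding Q_def by (intro connected_Times connected_connected_component connected_Icc)
  qed
  have TD: "norm x <= 5/4" "U x > 3/4 * de" if "x : T" for x
  proof -
   obtain q t where q: "q : Q" "3/4 <= t" "t <= 5/4" "x = (t / norm q) *R q" using \<open>x : T\<close> by (auto simp: T_def F_def)
   have n: "norm x = t" using q Q0[OF q(1)] by simp
   have "x : D" unfolding q(4) using q QD Q0[OF q(1)] by (intro Dc) auto
   then have "de * t < U x" using n by (simp add: D_def)
   moreover have "de * (3/4) <= de * t" using q de by (intro mult_left_mono) auto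
   ultimately show "norm x <= 5/4" "U x > 3/4 * de" using q n by auto
  qed
  have inT: "v : T" if v: "(1/4) *R v : Q" "3/4 <= norm v" "norm v <= 5/4" for v
  proof -
   have "v = F ((1/4) *R v, norm v)" using v by (auto simp: F_def)
   then show ?thesis unfolding T_def using v by (intro image_eqI[of _ _ "((1/4) *R v, norm v)"]) auto
  qed
  have o: "open {x. U x > 0}" by (rule open_pos_set[OF U])
  have far: "cball x (3 * s) \<subseteq> {x. U x > 0}" if x: "x : T" for x
  proof
   fix v assume v: "v : cball x (3 * s)"
   show "v : {x. U x > 0}"
   proof (rule ccontr)
    assume "v ~: {x. U x > 0}"
    then have "U v = 0" using U by (auto simp: ac_min_def not_less intro: antisym)
    from ac_min_growth[OF U this, of x] have "U x <= LU TYPE('a) * dist x v" .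
    also have "... <= LU TYPE('a) * (3 * s)" using v LU by (intro mult_left_mono) auto
    finally show False using TD(2)[OF x] de unfolding sL by linarith
   qed
  qed
  have posT: "ph x > 0" if "x : T" for x
  proof -
   have "x : cball x (3 * s)" using s by simp
   then show ?thesis using far[OF that] ph(2) by blast
  qed
  have TO: "T \<subseteq> {x. U x > 0}" using TD(2) de by (force intro: less_trans)
  have "ln (ph y) <= ln (ph y') + real N * ln A"
  proof (rule N[OF cT])
   show "T \<subseteq> cball 0 2" using TD(1) by force
   show "continuous_on T (%x. ln (ph x))"
    using posT by (intro continuous_intros continuous_on_subset[OF C2on_continuous(1)[OF ph(1)] TO]) force
   show "0 <= ln A" using A by simp
   show "ALL x:T. ALL v:T. dist x v < s --> ln (ph x) <= ln (ph v) + ln A"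
   proof (intro ballI impI)
    fix x v assume x: "x : T" and v: "v : T" and d: "dist x v < s"
    have "ph x <= A * ph v" unfolding A_def
    proof (rule harmonic_harnack[OF ph(1) o far[OF v] _ s])
     show "0 <= ph p" if "p : cball v (3 * s)" for p using far[OF v] that ph(2) by (blast intro: less_imp_le)
    qed (use d in "simp add: dist_commute")
    then have "ln (ph x) <= ln (A * ph v)" using posT[OF x] by simp
    then show "ln (ph x) <= ln (ph v) + ln A" using A posT[OF v] by (simp add: ln_mult)
   qed
   show "y : T" "y' : T" using inT yQ y y' by auto
  qed
  then have "exp (ln (ph y)) <= exp (real N * ln A + ln (ph y'))" by simp
  moreover have "ph y > 0" "ph y' > 0" using ph(2) subsetD[OF b(1), of y] subsetD[OF b(2), of y'] r by auto
  ultimately show "ph y <= exp (real N * ln A) * ph y'" by (simp add: exp_add)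
 qed
qed

section \<open>Comparison on the regularity set\<close>

lemma R_set_hess_bound:
 assumes p: "p : R_set U rh" and rh: "rh > 0"
 shows "!!x. x : ball p rh ==> U x > 0 ==> onorm (hess U x) <= 1 / rh"
proof -
 fix x assume x: "x : ball p rh" "U x > 0"
 define S where "S = {r. r > 0 & (ALL x:ball p r Int {x. U x > 0}. onorm (hess U x) < 1 / r)}"
 have "(if S = {} then 0 else Sup (ereal ` S)) > ereal rh" using p unfolding R_set_def reg_scale_def S_def Let_def by blast
 then have "ereal rh < Sup (ereal ` S)" using rh by (auto split: if_splits)
 then obtain r where r: "r : S" "rh < r" unfolding less_Sup_iff by auto
 then have "onorm (hess U x) < 1 / r" using x by (auto simp: S_def)
 also have "... <= 1 / rh" using r rh by (simp add: frac_le)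
 finally show "onorm (hess U x) <= 1 / rh" by simp
qed

text \<open>If no zero lies within \<open>R / 256\<close> of \<open>p\<close>, the point itself
  serves; otherwise a zero nearest to \<open>p\<close> is a good point, to which the boundary
  estimate applies.\<close>

lemma jacobi_interior_point:
 fixes rh :: real
 assumes rh: "rh > 0"
 shows "EX r C. 0 < r & C > 0 & (ALL (U :: 'a::euclidean_space => real) ph eps p. ac_min U --> eps > 0 --> pos_jacobi eps U ph --> p : R_set U rh -->
  (EX y. cball y r \<subseteq> {x. U x > 0} & dist p y <= 1/4 & ph p <= C * ph y & ph y <= C * ph p))"
proof -
 \<comment> \<open>\<open>rh / 2\<close> keeps the ball around the zero inside the ball around
   \<open>p\<close>, where the Hessian is bounded; 1/4 keeps \<open>y\<close> away from the origin
   when \<open>p\<close> is on the unit sphere.\<close>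
 define rh0 where "rh0 = min (rh / 2) (1/4)"
 have rh0: "rh0 > 0" "rh0 <= rh / 2" "rh0 <= 1/4" using rh by (auto simp: rh0_def)
 obtain R C where R: "0 < R" "R <= rh0" and C: "C > 0" and B: "!!(U :: 'a => real) ph eps z x. ac_min U ==> eps > 0 ==> pos_jacobi eps U ph ==> good U z rh0 ==>
  x : closure {x. U x > 0} ==> dist z x <= R / 128 ==>
  (EX y. cball y (R / 16) \<subseteq> {x. U x > 0} & dist x y <= R & ph x <= C * ph y & ph y <= C * ph x)"
  using jacobi_boundary_harnack[OF rh0(1), where 'a='a] by (elim exE conjE) (rule that; blast)
 \<comment> \<open>At least 1, to cover the case \<open>y = p\<close>.\<close>
 define C' where "C' = max C 1"
 show ?thesis
 proof (rule exI[of _ "R / 256"], rule exI[of _ C'], intro conjI allI impI)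
  show "0 < R / 256" "C' > 0" using R by (auto simp: C'_def)
  fix U :: "'a => real" and ph eps p
  assume U: "ac_min U" and eps: "eps > 0" and J: "pos_jacobi eps U ph" and p: "p : R_set U rh"
  have pc: "p : closure {x. U x > 0}" using p by (simp add: R_set_def)
  have o: "open {x. U x > 0}" by (rule open_pos_set[OF U])
  have nn: "U v >= 0" for v using U by (simp add: ac_min_def)
  have pos: "ph v > 0" if "U v > 0" for v
  proof -
   have "v : closure {x. U x > 0} - Sing eps U" using that o closure_subset[of "{x. U x > 0}"]
    by (auto simp: Sing_def free_bdry_def frontier_def interior_open)
   then show ?thesis using J by (auto simp: pos_jacobi_def Let_def)
  qed
  show "EX y. cball y (R / 256) \<subseteq> {x. U x > 0} & dist p y <= 1/4 & ph p <= C' * ph y & ph y <= C' * ph p"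
  proof (cases "EX v. U v = 0 & dist p v <= R / 256")
   case False
   have inOm: "cball p (R / 256) \<subseteq> {x. U x > 0}" using False nn by (force simp: less_le)
   then have "ph p > 0" using subsetD[OF inOm, of p] R by (intro pos) auto
   then have "ph p <= C' * ph p" using mult_right_mono[of 1 C' "ph p"] by (simp add: C'_def)
   then show ?thesis using inOm by (intro exI[of _ p]) auto
  next
   case True
   then obtain v where v: "U v = 0" "dist p v <= R / 256" by blast
   have "EX z. U z = 0 & dist p z <= R / 256 & z : closure {x. U x > 0}"
   proof (cases "U p = 0")
    case True
    then show ?thesis using pc R by (intro exI[of _ p]) auto
   next
    case False
    then have Up: "U p > 0" using nn[of p] by simp
    obtain z where z: "U z = 0" "dist p z > 0" "!!y. dist p y < dist p z ==> U y > 0" "dist p z <= dist p v"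
     using ac_min_zero_set_nearest[OF U v(1) Up] by blast
    have "z : closure (ball p (dist p z))" using z(2) by simp
    moreover have "ball p (dist p z) \<subseteq> {x. U x > 0}" using z(3) by auto
    ultimately have "z : closure {x. U x > 0}" using closure_mono by blast
    then show ?thesis using z v by auto
   qed
   then obtain z where z: "U z = 0" "dist p z <= R / 256" "z : closure {x. U x > 0}" by blast
   have "good U z rh0" unfolding good_def
   proof (intro conjI ballI impI)
    fix x assume x: "x : ball z rh0" "U x > 0"
    have "x : ball p rh" using x z R rh0 dist_triangle[of p x z] by simp
    from R_set_hess_bound[OF p rh this x(2)] have "onorm (hess U x) <= 1 / rh" .
    also have "... <= 1 / rh0" using rh0 by (intro frac_le) auto
    finally show "onorm (hess U x) <= 1 / rh0" .
   qed (use rh0 z in auto)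
   from B[OF U eps J this pc] obtain y where y: "cball y (R / 16) \<subseteq> {x. U x > 0}" "dist p y <= R" "ph p <= C * ph y" "ph y <= C * ph p"
    using z R by (auto simp: dist_commute)
   have py: "ph y > 0" using subsetD[OF y(1), of y] R by (intro pos) auto
   then have "0 < C * ph p" using y(4) by linarith
   then have pp: "ph p > 0" using C by (simp add: zero_less_mult_iff)
   have "C * ph y <= C' * ph y" "C * ph p <= C' * ph p" using py pp by (auto simp: C'_def intro: mult_right_mono)
   moreover have "cball y (R / 256) \<subseteq> cball y (R / 16)" using R by (intro subset_cball) simp
   ultimately show ?thesis using y R rh0 by (intro exI[of _ y] conjI) auto
  qed
 qed
qed

theorem mainTheorem7:
  "\<exists>\<epsilon>0>0. \<forall>eps. 0 < eps \<and> eps \<le> \<epsilon>0 \<longrightarrow>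
     (\<forall>\<rho>>0. \<exists>C::real. \<forall>(U::'a::euclidean_space \<Rightarrow> real) \<phi>.
        U \<in> cone_minimizers \<and> pos_jacobi eps U \<phi> \<longrightarrow>
        (SUP p\<in>sphere 0 1 \<inter> R_set U \<rho>. ereal (\<phi> p))
          \<le> ereal C * (INF p\<in>sphere 0 1 \<inter> R_set U \<rho>. ereal (\<phi> p)))"
proof (rule exI[of _ 1], intro conjI allI impI)
 \<comment> \<open>The witness 1 for the threshold is an arbitrary choice: the free boundary points
   used are in \<open>Reg eps\<close> for every \<open>eps > 0\<close>.\<close>
 fix eps rh :: real assume eps: "0 < eps & eps <= 1" and rh: "rh > 0"
 obtain r C where r: "0 < r" and C: "C > 0" and I: "!!(U :: 'a => real) ph p. ac_min U ==> pos_jacobi eps U ph ==> p : R_set U rh ==>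
  (EX y. cball y r \<subseteq> {x. U x > 0} & dist p y <= 1/4 & ph p <= C * ph y & ph y <= C * ph p)"
  using jacobi_interior_point[OF rh, where 'a='a] conjunct1[OF eps] by (elim exE conjE) (rule that; blast)
 obtain C' where C': "C' > 0" and H: "!!(U :: 'a => real) ph g y y'. ac_min U ==> (ALL t>0. ALL x. U (t *R x) = t * U x) ==> C2on {x. U x > 0} ph g (%_. 0) ==>
  (ALL x. U x > 0 --> ph x > 0) ==> 3/4 <= norm y ==> norm y <= 5/4 ==> 3/4 <= norm y' ==> norm y' <= 5/4 ==>
  cball y r \<subseteq> {x. U x > 0} ==> cball y' r \<subseteq> {x. U x > 0} ==> ph y <= C' * ph y'"
  using interior_harnack[OF r, where 'a='a] by (elim exE conjE) (rule that; blast)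
 \<comment> \<open>Route p, y, y', q: a comparison with an interior point at each end, and the
   interior inequality between \<open>y\<close> and \<open>y'\<close>.\<close>
 define D where "D = C * (C' * C)"
 have D: "D > 0" using C C' by (simp add: D_def)
 show "EX C::real. ALL (U::'a => real) ph. U : cone_minimizers & pos_jacobi eps U ph -->
    (SUP p\<in>sphere 0 1 Int R_set U rh. ereal (ph p)) <= ereal C * (INF p\<in>sphere 0 1 Int R_set U rh. ereal (ph p))"
 proof (intro exI[of _ D] allI impI)
  fix U :: "'a => real" and ph
  assume A: "U : cone_minimizers & pos_jacobi eps U ph"
  have U: "ac_min U" using A by (auto simp: cone_minimizers_def intro: global_minimizer_imp_ac_min)
  have hom: "ALL t>0. ALL x. U (t *R x) = t * U x" using A by (auto simp: cone_minimizers_def)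
  define Om where "Om = {x. U x > 0}"
  define X where "X = closure Om - Sing eps U"
  have o: "open Om" unfolding Om_def by (rule open_pos_set[OF U])
  have sub: "Om \<subseteq> X" using o closure_subset[of Om] by (auto simp: X_def Sing_def free_bdry_def frontier_def interior_open Om_def)
  note J' = conjunct2[OF A, unfolded pos_jacobi_def Let_def, folded Om_def, folded X_def]
  have pos: "ALL x. U x > 0 --> ph x > 0" using conjunct1[OF J'] sub by (auto simp: Om_def)
  obtain g Hs where G: "ALL b:Basis. continuous_on X (%x. Hs x b)"
   "ALL x:Om. (ph has_derivative (%h. g x *. h)) (at x) & (g has_derivative Hs x) (at x)" "ALL x:Om. (\<Sum>b\<in>Basis. Hs x b *. b) = 0"
   using conjunct2[OF J'] by (elim conjE exE) (rule that; assumption)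
  have C2: "C2on {x. U x > 0} ph g (%_. 0)" unfolding Om_def[symmetric]
  proof (rule C2onI[of _ _ _ Hs])
   show "continuous_on Om (%x. Hs x b)" if "b : Basis" for b using G(1) that sub by (blast intro: continuous_on_subset)
  qed (use G in auto)
  have main: "ph p <= D * ph q" if p: "p : sphere 0 1 Int R_set U rh" and q: "q : sphere 0 1 Int R_set U rh" for p q
  proof -
   obtain y where y: "cball y r \<subseteq> {x. U x > 0}" "dist p y <= 1/4" "ph p <= C * ph y" using I[of U ph p] U A p by blast
   obtain y' where y': "cball y' r \<subseteq> {x. U x > 0}" "dist q y' <= 1/4" "ph y' <= C * ph q" using I[of U ph q] U A q by blast
   have n: "3/4 <= norm v" "norm v <= 5/4" if "w : sphere 0 1" "dist w v <= 1/4" for v w :: 'a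
    using that norm_triangle_ineq2[of w v] norm_triangle_ineq2[of v w] by (auto simp: dist_norm norm_minus_commute)
   have "ph y <= C' * ph y'" by (rule H[OF U hom C2 pos _ _ _ _ y(1) y'(1)]) (use n y(2) y'(2) p q in blast)+
   then have "C * ph y <= C * (C' * (C * ph q))" using y'(3) C C' by (meson less_imp_le mult_left_mono order_trans)
   then show ?thesis using y(3) by (simp add: D_def mult.assoc)
  qed
  show "(SUP p\<in>sphere 0 1 Int R_set U rh. ereal (ph p)) <= ereal D * (INF p\<in>sphere 0 1 Int R_set U rh. ereal (ph p))"
  proof (rule SUP_least)
   \<comment> \<open>Moving \<open>D\<close> to the left reduces the claim to inequalities between
     real values; over an empty set the supremum is minus infinity, and there is no such
     \<open>p\<close>.\<close>
   fix p assume p: "p : sphere 0 1 Int R_set U rh"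
   have "ereal (ph p / D) <= (INF q\<in>sphere 0 1 Int R_set U rh. ereal (ph q))"
   proof (rule INF_greatest)
    fix q assume "q : sphere 0 1 Int R_set U rh"
    from main[OF p this] show "ereal (ph p / D) <= ereal (ph q)" using D by (simp add: pos_divide_le_eq mult.commute)
   qed
   then have "ereal D * ereal (ph p / D) <= ereal D * (INF q\<in>sphere 0 1 Int R_set U rh. ereal (ph q))"
    using D by (intro ereal_mult_left_mono) auto
   then show "ereal (ph p) <= ereal D * (INF q\<in>sphere 0 1 Int R_set U rh. ereal (ph q))" using D by simp
  qed
 qed
qed simp

end
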